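(* Let $k$ be a field, let $A$ be a finite-dimensional $k$-algebra and let $J\subseteq A$ be a homological ideal which has finite projective dimension as an $A$-$A$-bimodule. Then $A$ and $A/J$ are singularly equivalent of Morita type with level.
   Context: Algebras are finite-dimensional associative unital $k$-algebras, $k$ acts centrally on bimodules, and modules are finitely generated left modules unless stated otherwise. A two-sided ideal $J\subseteq A$ is a homological ideal if the canonical map $A\to A/J$ is a homological epimorphism, i.e. the naturally induced functor $\mathcal{D}^b(\mathrm{mod}\,A/J)\to\mathcal{D}^b(\mathrm{mod}\,A)$ is fully faithful. Write $A^e=A\otimes_k A^{op}$, identify $A$-$A$-bimodules with left $A^e$-modules, let $\underline{\mathrm{mod}}\,A^e$ be the stable category of finitely generated $A^e$-modules modulo morphisms factoring through projectives, and let $\Omega_{A^e}$ be the syzygy functor on it. Two algebras $A$ and $B$ are singularly equivalent of Morita type with level if there exist an $A$-$B$-bimodule $M$, a $B$-$A$-bimodule $N$ and an integer $n\ge 0$ such that (1) the one-sided modules ${}_AM$, $M_B$, ${}_BN$, $N_A$ are all finitely generated projective; and (2) $M\otimes_B N\cong\Omega^n_{A^e}(A)$ in $\underline{\mathrm{mod}}\,A^e$ and $N\otimes_A M\cong\Omega^n_{B^e}(B)$ in $\underline{\mathrm{mod}}\,B^e$. *)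

theory Defs
  imports "HOL-Algebra.Free_Abelian_Groups" "HOL-Algebra.QuotRing" "HOL-Algebra.Module"
begin

section \<open>Algebras\<close>

text \<open>An algebra over \<open>K\<close> and a left module are both records of type
  \<^typ>\<open>('r, 'm) module\<close>: the fields \<open>mult\<close> and \<open>one\<close> are the ring structure of an algebra and are
  unused in a module. The library's locale \<^locale>\<open>algebra\<close> requires commutativity, hence the
  following variant. The zero algebra is allowed.\<close>

definition fin_gen :: "('r, 'x) ring_scheme \<Rightarrow> ('r, 'm, 'y) module_scheme \<Rightarrow> bool" where
  "fin_gen R M \<longleftrightarrow>
     (\<exists>S. finite S \<and> S \<subseteq> carrier M \<and> (\<forall>H. submodule H R M \<and> S \<subseteq> H \<longrightarrow> H = carrier M))"

locale fd_algebra = K?: field K + module K A + A?: ring A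
  for K :: "('k, 'z) ring_scheme" and A :: "('k, 'a) module" +
  assumes smult_mult_left:
      "\<lbrakk>c \<in> carrier K; x \<in> carrier A; y \<in> carrier A\<rbrakk>
        \<Longrightarrow> (c \<odot>\<^bsub>A\<^esub> x) \<otimes>\<^bsub>A\<^esub> y = c \<odot>\<^bsub>A\<^esub> (x \<otimes>\<^bsub>A\<^esub> y)"
    and smult_mult_right:
      "\<lbrakk>c \<in> carrier K; x \<in> carrier A; y \<in> carrier A\<rbrakk>
        \<Longrightarrow> x \<otimes>\<^bsub>A\<^esub> (c \<odot>\<^bsub>A\<^esub> y) = c \<odot>\<^bsub>A\<^esub> (x \<otimes>\<^bsub>A\<^esub> y)"
    and finite_dimensional: "fin_gen K A"

definition opposite :: "('k, 'a) module \<Rightarrow> ('k, 'a) module" where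
  "opposite A = A\<lparr>mult := \<lambda>x y. y \<otimes>\<^bsub>A\<^esub> x\<rparr>"

text \<open>The ring \<^term>\<open>A Quot J\<close> with its \<open>K\<close>-action; the union over representatives is the single
  coset of \<open>c \<odot> x\<close>.\<close>

definition quotient_algebra :: "('k, 'a) module \<Rightarrow> 'a set \<Rightarrow> ('k, 'a set) module" where
  "quotient_algebra A J = ring.extend (A Quot J)
     (module.fields (\<lambda>c X. \<Union>x\<in>X. J +>\<^bsub>A\<^esub> (c \<odot>\<^bsub>A\<^esub> x)))"


section \<open>Left modules\<close>

locale left_module = R?: ring R + M?: abelian_group M
  for R :: "('r, 'x) ring_scheme" and M :: "('r, 'm, 'y) module_scheme" +
  assumes smult_closed: "\<lbrakk>a \<in> carrier R; x \<in> carrier M\<rbrakk> \<Longrightarrow> a \<odot>\<^bsub>M\<^esub> x \<in> carrier M"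
    and smult_l_distr: "\<lbrakk>a \<in> carrier R; b \<in> carrier R; x \<in> carrier M\<rbrakk>
      \<Longrightarrow> (a \<oplus>\<^bsub>R\<^esub> b) \<odot>\<^bsub>M\<^esub> x = a \<odot>\<^bsub>M\<^esub> x \<oplus>\<^bsub>M\<^esub> b \<odot>\<^bsub>M\<^esub> x"
    and smult_r_distr: "\<lbrakk>a \<in> carrier R; x \<in> carrier M; y \<in> carrier M\<rbrakk>
      \<Longrightarrow> a \<odot>\<^bsub>M\<^esub> (x \<oplus>\<^bsub>M\<^esub> y) = a \<odot>\<^bsub>M\<^esub> x \<oplus>\<^bsub>M\<^esub> a \<odot>\<^bsub>M\<^esub> y"
    and smult_assoc1: "\<lbrakk>a \<in> carrier R; b \<in> carrier R; x \<in> carrier M\<rbrakk>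
      \<Longrightarrow> (a \<otimes>\<^bsub>R\<^esub> b) \<odot>\<^bsub>M\<^esub> x = a \<odot>\<^bsub>M\<^esub> (b \<odot>\<^bsub>M\<^esub> x)"
    and smult_one: "x \<in> carrier M \<Longrightarrow> \<one>\<^bsub>R\<^esub> \<odot>\<^bsub>M\<^esub> x = x"

definition fg_module :: "('r, 'x) ring_scheme \<Rightarrow> ('r, 'm, 'y) module_scheme \<Rightarrow> bool" where
  "fg_module R M \<longleftrightarrow> left_module R M \<and> fin_gen R M"

definition mod_hom ::
  "('r, 'x) ring_scheme \<Rightarrow> ('r, 'm, 'y) module_scheme \<Rightarrow> ('r, 'n, 'w) module_scheme \<Rightarrow> ('m \<Rightarrow> 'n) set"
where
  "mod_hom R M N = {f \<in> hom (add_monoid M) (add_monoid N).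
     \<forall>a\<in>carrier R. \<forall>x\<in>carrier M. f (a \<odot>\<^bsub>M\<^esub> x) = a \<odot>\<^bsub>N\<^esub> f x}"

text \<open>Every finitely generated module or bimodule over finite-dimensional \<open>K\<close>-algebras is
  isomorphic to one whose carrier is a set of functions of type \<^typ>\<open>nat \<Rightarrow> 'k\<close> (coordinate
  vectors), so quantification over such modules is expressed by quantification over modules with
  carrier in this type. Likewise a finitely generated \<open>P\<close> is projective iff it has the lifting
  property for all surjections between modules with carrier in this type, since these include,
  up to isomorphism, all surjections between finitely generated modules.\<close>

type_synonym 'k vec = "nat \<Rightarrow> 'k"

definition fg_projective :: "('k, 'a) module \<Rightarrow> ('a, 'm, 'y) module_scheme \<Rightarrow> bool" where
  "fg_projective A P \<longleftrightarrow> fg_module A P \<and>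
     (\<forall>(X :: ('a, 'k vec) module) (Y :: ('a, 'k vec) module) g h.
        left_module A X \<and> left_module A Y \<and>
        g \<in> mod_hom A X Y \<and> g ` carrier X = carrier Y \<and> h \<in> mod_hom A P Y
        \<longrightarrow> (\<exists>l\<in>mod_hom A P X. \<forall>p\<in>carrier P. g (l p) = h p))"


section \<open>The bounded derived category\<close>

text \<open>The objects of \<open>D\<^sup>b(mod A)\<close> are the bounded cochain complexes of finitely generated left
  modules; a morphism \<open>X \<rightarrow> Y\<close> is an equivalence class of roofs \<open>X \<leftarrow> Z \<rightarrow> Y\<close> whose left leg is a
  quasi-isomorphism, i.e. a morphism of the localization of \<open>K\<^sup>b(mod A)\<close> at the
  quasi-isomorphisms.\<close>

record ('a, 'm) cplx =
  ob :: "int \<Rightarrow> ('a, 'm) module"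
  df :: "int \<Rightarrow> 'm \<Rightarrow> 'm"

type_synonym 'm graded_map = "int \<Rightarrow> 'm \<Rightarrow> 'm"

definition bounded_complex :: "('k, 'a) module \<Rightarrow> ('a, 'm) cplx \<Rightarrow> bool" where
  "bounded_complex A X \<longleftrightarrow>
     (\<forall>i. fg_module A (ob X i)) \<and>
     (\<forall>i. df X i \<in> mod_hom A (ob X i) (ob X (i + 1))) \<and>
     (\<forall>i. \<forall>x\<in>carrier (ob X i). df X (i + 1) (df X i x) = \<zero>\<^bsub>ob X (i + 1 + 1)\<^esub>) \<and>
     finite {i. carrier (ob X i) \<noteq> {\<zero>\<^bsub>ob X i\<^esub>}}"

definition chain_map ::
  "('k, 'a) module \<Rightarrow> ('a, 'm) cplx \<Rightarrow> ('a, 'm) cplx \<Rightarrow> 'm graded_map \<Rightarrow> bool" where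
  "chain_map A X Y f \<longleftrightarrow>
     (\<forall>i. f i \<in> mod_hom A (ob X i) (ob Y i)) \<and>
     (\<forall>i. \<forall>x\<in>carrier (ob X i). f (i + 1) (df X i x) = df Y i (f i x))"

definition homotopic ::
  "('k, 'a) module \<Rightarrow> ('a, 'm) cplx \<Rightarrow> ('a, 'm) cplx \<Rightarrow> 'm graded_map \<Rightarrow> 'm graded_map \<Rightarrow> bool" where
  "homotopic A X Y f g \<longleftrightarrow>
     (\<exists>h. (\<forall>i. h i \<in> mod_hom A (ob X i) (ob Y (i - 1))) \<and>
          (\<forall>i. \<forall>x\<in>carrier (ob X i).
             f i x \<ominus>\<^bsub>ob Y i\<^esub> g i x = df Y (i - 1) (h i x) \<oplus>\<^bsub>ob Y i\<^esub> h (i + 1) (df X i x)))"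

definition cocycles :: "('a, 'm) cplx \<Rightarrow> int \<Rightarrow> 'm set" where
  "cocycles X i = a_kernel (ob X i) (ob X (i + 1)) (df X i)"

definition coboundaries :: "('a, 'm) cplx \<Rightarrow> int \<Rightarrow> 'm set" where
  "coboundaries X i = df X (i - 1) ` carrier (ob X (i - 1))"

definition cohomology :: "('a, 'm) cplx \<Rightarrow> int \<Rightarrow> 'm set set" where
  "cohomology X i = (\<lambda>z. coboundaries X i +>\<^bsub>ob X i\<^esub> z) ` cocycles X i"

text \<open>For a chain map \<open>f : X \<rightarrow> Y\<close>, a class \<open>[z]\<close> is sent to \<open>B\<^sup>i(Y) + f([z])\<close>, which is the
  class of \<open>f z\<close>.\<close>

definition cohomology_map :: "('a, 'm) cplx \<Rightarrow> 'm graded_map \<Rightarrow> int \<Rightarrow> 'm set \<Rightarrow> 'm set" where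
  "cohomology_map Y f i C = coboundaries Y i <+>\<^bsub>ob Y i\<^esub> f i ` C"

definition quasi_iso ::
  "('k, 'a) module \<Rightarrow> ('a, 'm) cplx \<Rightarrow> ('a, 'm) cplx \<Rightarrow> 'm graded_map \<Rightarrow> bool" where
  "quasi_iso A X Y f \<longleftrightarrow> chain_map A X Y f \<and>
     (\<forall>i. bij_betw (cohomology_map Y f i) (cohomology X i) (cohomology Y i))"

type_synonym ('a, 'm) roof = "('a, 'm) cplx \<times> 'm graded_map \<times> 'm graded_map"

definition roofs ::
  "('k, 'a) module \<Rightarrow> ('a, 'k vec) cplx \<Rightarrow> ('a, 'k vec) cplx \<Rightarrow> ('a, 'k vec) roof set" where
  "roofs A X Y = {(Z, s, f). bounded_complex A Z \<and> quasi_iso A Z X s \<and> chain_map A Z Y f}"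

definition roof_rel ::
  "('k, 'a) module \<Rightarrow> ('a, 'k vec) cplx \<Rightarrow> ('a, 'k vec) cplx
     \<Rightarrow> (('a, 'k vec) roof \<times> ('a, 'k vec) roof) set" where
  "roof_rel A X Y = {((Z, s, f), (Z', s', f')).
     (Z, s, f) \<in> roofs A X Y \<and> (Z', s', f') \<in> roofs A X Y \<and>
     (\<exists>W u v. bounded_complex A W \<and> quasi_iso A W Z u \<and> quasi_iso A W Z' v \<and>
        homotopic A W X (\<lambda>i. s i \<circ> u i) (\<lambda>i. s' i \<circ> v i) \<and>
        homotopic A W Y (\<lambda>i. f i \<circ> u i) (\<lambda>i. f' i \<circ> v i))}"

definition derived_hom ::
  "('k, 'a) module \<Rightarrow> ('a, 'k vec) cplx \<Rightarrow> ('a, 'k vec) cplx \<Rightarrow> ('a, 'k vec) roof set set" where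
  "derived_hom A X Y = roofs A X Y // roof_rel A X Y"


section \<open>Homological ideals\<close>

text \<open>Restriction of scalars along \<open>A \<rightarrow> A/J\<close> is exact, so it acts termwise on complexes and roofs
  and leaves the underlying maps unchanged.\<close>

definition restrict_module ::
  "('k, 'a) module \<Rightarrow> 'a set \<Rightarrow> ('a set, 'm) module \<Rightarrow> ('a, 'm) module" where
  "restrict_module A J M =
     \<lparr>carrier = carrier M, mult = mult M, one = one M, zero = zero M, add = add M,
      smult = \<lambda>a x. (J +>\<^bsub>A\<^esub> a) \<odot>\<^bsub>M\<^esub> x\<rparr>"

definition restrict_cplx ::
  "('k, 'a) module \<Rightarrow> 'a set \<Rightarrow> ('a set, 'm) cplx \<Rightarrow> ('a, 'm) cplx" where
  "restrict_cplx A J X = \<lparr>ob = \<lambda>i. restrict_module A J (ob X i), df = df X\<rparr>"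

definition restrict_derived_hom ::
  "('k, 'a) module \<Rightarrow> 'a set \<Rightarrow> ('a set, 'k vec) cplx \<Rightarrow> ('a set, 'k vec) cplx
     \<Rightarrow> ('a set, 'k vec) roof set \<Rightarrow> ('a, 'k vec) roof set" where
  "restrict_derived_hom A J X Y C =
     (\<Union>(Z, s, f)\<in>C. roof_rel A (restrict_cplx A J X) (restrict_cplx A J Y) ``
        {(restrict_cplx A J Z, s, f)})"

definition homological_ideal :: "('k, 'a) module \<Rightarrow> 'a set \<Rightarrow> bool" where
  "homological_ideal A J \<longleftrightarrow> ideal J A \<and>
     (\<forall>X Y. bounded_complex (quotient_algebra A J) X \<and> bounded_complex (quotient_algebra A J) Y
        \<longrightarrow> bij_betw (restrict_derived_hom A J X Y)
              (derived_hom (quotient_algebra A J) X Y)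
              (derived_hom A (restrict_cplx A J X) (restrict_cplx A J Y)))"


section \<open>Bimodules\<close>

text \<open>An \<open>A\<close>-\<open>B\<close>-bimodule record is in particular a left module record over \<open>A\<close>; its right
  structure is recorded as a left module over \<^term>\<open>opposite B\<close>. Bimodules on which \<open>K\<close> acts
  centrally, bimodule homomorphisms, and projectivity by lifting along surjective bimodule
  homomorphisms are the left modules over \<open>A \<otimes>\<^sub>K B\<^sup>o\<^sup>p\<close>, their homomorphisms, and their
  projectivity, under the usual identification.\<close>

record ('a, 'b, 'm) bimodule = "('a, 'm) module" +
  rsmult :: "'m \<Rightarrow> 'b \<Rightarrow> 'm"

definition right_module :: "('a, 'b, 'm) bimodule \<Rightarrow> ('b, 'm) module" where
  "right_module M =
     \<lparr>carrier = carrier M, mult = mult M, one = one M, zero = zero M, add = add M,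
      smult = \<lambda>b x. rsmult M x b\<rparr>"

definition bimodule ::
  "('k, 'z) ring_scheme \<Rightarrow> ('k, 'a) module \<Rightarrow> ('k, 'b) module \<Rightarrow> ('a, 'b, 'm) bimodule \<Rightarrow> bool" where
  "bimodule K A B M \<longleftrightarrow>
     left_module A M \<and> left_module (opposite B) (right_module M) \<and>
     (\<forall>a\<in>carrier A. \<forall>x\<in>carrier M. \<forall>b\<in>carrier B.
        rsmult M (a \<odot>\<^bsub>M\<^esub> x) b = a \<odot>\<^bsub>M\<^esub> rsmult M x b) \<and>
     (\<forall>c\<in>carrier K. \<forall>x\<in>carrier M.
        (c \<odot>\<^bsub>A\<^esub> \<one>\<^bsub>A\<^esub>) \<odot>\<^bsub>M\<^esub> x = rsmult M x (c \<odot>\<^bsub>B\<^esub> \<one>\<^bsub>B\<^esub>))"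

definition subbimodule ::
  "'m set \<Rightarrow> ('k, 'a) module \<Rightarrow> ('k, 'b) module \<Rightarrow> ('a, 'b, 'm) bimodule \<Rightarrow> bool" where
  "subbimodule H A B M \<longleftrightarrow> submodule H A M \<and> submodule H (opposite B) (right_module M)"

definition fg_bimodule ::
  "('k, 'z) ring_scheme \<Rightarrow> ('k, 'a) module \<Rightarrow> ('k, 'b) module \<Rightarrow> ('a, 'b, 'm) bimodule \<Rightarrow> bool" where
  "fg_bimodule K A B M \<longleftrightarrow> bimodule K A B M \<and>
     (\<exists>S. finite S \<and> S \<subseteq> carrier M \<and> (\<forall>H. subbimodule H A B M \<and> S \<subseteq> H \<longrightarrow> H = carrier M))"

definition bimod_hom ::
  "('k, 'a) module \<Rightarrow> ('k, 'b) module \<Rightarrow> ('a, 'b, 'm) bimodule \<Rightarrow> ('a, 'b, 'n) bimodule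
     \<Rightarrow> ('m \<Rightarrow> 'n) set" where
  "bimod_hom A B M N =
     mod_hom A M N \<inter> mod_hom (opposite B) (right_module M) (right_module N)"

definition bimod_iso ::
  "('k, 'a) module \<Rightarrow> ('k, 'b) module \<Rightarrow> ('a, 'b, 'm) bimodule \<Rightarrow> ('a, 'b, 'n) bimodule \<Rightarrow> bool" where
  "bimod_iso A B M N \<longleftrightarrow> (\<exists>f\<in>bimod_hom A B M N. bij_betw f (carrier M) (carrier N))"

definition fg_projective_bimodule ::
  "('k, 'z) ring_scheme \<Rightarrow> ('k, 'a) module \<Rightarrow> ('k, 'b) module \<Rightarrow> ('a, 'b, 'm) bimodule \<Rightarrow> bool" where
  "fg_projective_bimodule K A B P \<longleftrightarrow> fg_bimodule K A B P \<and>
     (\<forall>(X :: ('a, 'b, 'k vec) bimodule) (Y :: ('a, 'b, 'k vec) bimodule) g h.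
        bimodule K A B X \<and> bimodule K A B Y \<and>
        g \<in> bimod_hom A B X Y \<and> g ` carrier X = carrier Y \<and> h \<in> bimod_hom A B P Y
        \<longrightarrow> (\<exists>l\<in>bimod_hom A B P X. \<forall>p\<in>carrier P. g (l p) = h p))"

definition regular_bimodule :: "('k, 'a) module \<Rightarrow> ('a, 'a, 'a) bimodule" where
  "regular_bimodule A =
     \<lparr>carrier = carrier A, mult = mult A, one = one A, zero = zero A, add = add A,
      smult = mult A, rsmult = mult A\<rparr>"

definition ideal_bimodule :: "('k, 'a) module \<Rightarrow> 'a set \<Rightarrow> ('a, 'a, 'a) bimodule" where
  "ideal_bimodule A J = (regular_bimodule A)\<lparr>carrier := J\<rparr>"

text \<open>A finite projective resolution
  \<open>0 \<rightarrow> P\<^sub>n \<rightarrow> \<dots> \<rightarrow> P\<^sub>1 \<rightarrow> P\<^sub>0 \<rightarrow> X \<rightarrow> 0\<close>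
  by finitely generated bimodules, with augmentation \<open>e\<close> and \<open>d i : P (i + 1) \<rightarrow> P i\<close>.\<close>

definition finite_proj_dim_bimodule ::
  "('k, 'z) ring_scheme \<Rightarrow> ('k, 'a) module \<Rightarrow> ('k, 'b) module \<Rightarrow> ('a, 'b, 'm) bimodule \<Rightarrow> bool" where
  "finite_proj_dim_bimodule K A B X \<longleftrightarrow>
     (\<exists>n (P :: nat \<Rightarrow> ('a, 'b, 'k vec) bimodule) d e.
        (\<forall>i. fg_projective_bimodule K A B (P i)) \<and>
        (\<forall>i>n. carrier (P i) = {\<zero>\<^bsub>P i\<^esub>}) \<and>
        e \<in> bimod_hom A B (P 0) X \<and> e ` carrier (P 0) = carrier X \<and>
        (\<forall>i. d i \<in> bimod_hom A B (P (Suc i)) (P i)) \<and>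
        a_kernel (P 0) X e = d 0 ` carrier (P 1) \<and>
        (\<forall>i. a_kernel (P (Suc i)) (P i) (d i) = d (Suc i) ` carrier (P (Suc (Suc i)))))"


section \<open>Tensor products over an algebra\<close>

text \<open>\<open>M \<otimes>\<^sub>B N\<close> is the free abelian group on \<open>M \<times> N\<close> modulo the usual relations. An element of
  the quotient is a coset; the outer actions are induced by \<open>(x, y) \<mapsto> (a x, y)\<close> and
  \<open>(x, y) \<mapsto> (x, y c)\<close> on generators.\<close>

definition tensor_relations ::
  "('k, 'b) module \<Rightarrow> ('a, 'b, 'm) bimodule \<Rightarrow> ('b, 'c, 'n) bimodule \<Rightarrow> ('m \<times> 'n \<Rightarrow>\<^sub>0 int) set" where
  "tensor_relations B M N =
     {frag_of (x \<oplus>\<^bsub>M\<^esub> x', y) - frag_of (x, y) - frag_of (x', y) | x x' y.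
        x \<in> carrier M \<and> x' \<in> carrier M \<and> y \<in> carrier N} \<union>
     {frag_of (x, y \<oplus>\<^bsub>N\<^esub> y') - frag_of (x, y) - frag_of (x, y') | x y y'.
        x \<in> carrier M \<and> y \<in> carrier N \<and> y' \<in> carrier N} \<union>
     {frag_of (rsmult M x b, y) - frag_of (x, b \<odot>\<^bsub>N\<^esub> y) | x b y.
        x \<in> carrier M \<and> b \<in> carrier B \<and> y \<in> carrier N}"

definition tensor ::
  "('k, 'b) module \<Rightarrow> ('a, 'b, 'm) bimodule \<Rightarrow> ('b, 'c, 'n) bimodule
     \<Rightarrow> ('a, 'c, ('m \<times> 'n \<Rightarrow>\<^sub>0 int) set) bimodule" where
  "tensor B M N =
     (let F = free_Abelian_group (carrier M \<times> carrier N);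
          U = generate F (tensor_relations B M N);
          T = F Mod U
      in \<lparr>carrier = carrier T, mult = undefined, one = undefined,
          zero = one T, add = mult T,
          smult = (\<lambda>a t. \<Union>p\<in>t. U #>\<^bsub>F\<^esub> frag_extend (\<lambda>(x, y). frag_of (a \<odot>\<^bsub>M\<^esub> x, y)) p),
          rsmult = (\<lambda>t c. \<Union>p\<in>t. U #>\<^bsub>F\<^esub> frag_extend (\<lambda>(x, y). frag_of (x, rsmult N y c)) p)\<rparr>)"


section \<open>The stable category and syzygies\<close>

definition stably_equal ::
  "('k, 'z) ring_scheme \<Rightarrow> ('k, 'a) module \<Rightarrow> ('k, 'b) module
     \<Rightarrow> ('a, 'b, 'm) bimodule \<Rightarrow> ('a, 'b, 'n) bimodule \<Rightarrow> ('m \<Rightarrow> 'n) \<Rightarrow> ('m \<Rightarrow> 'n) \<Rightarrow> bool" where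
  "stably_equal K A B X Y f g \<longleftrightarrow>
     (\<exists>(P :: ('a, 'b, 'k vec) bimodule) u v. fg_projective_bimodule K A B P \<and>
        u \<in> bimod_hom A B X P \<and> v \<in> bimod_hom A B P Y \<and>
        (\<forall>x\<in>carrier X. f x \<ominus>\<^bsub>Y\<^esub> g x = v (u x)))"

definition stably_iso ::
  "('k, 'z) ring_scheme \<Rightarrow> ('k, 'a) module \<Rightarrow> ('k, 'b) module
     \<Rightarrow> ('a, 'b, 'm) bimodule \<Rightarrow> ('a, 'b, 'n) bimodule \<Rightarrow> bool" where
  "stably_iso K A B X Y \<longleftrightarrow> fg_bimodule K A B X \<and> fg_bimodule K A B Y \<and>
     (\<exists>f\<in>bimod_hom A B X Y. \<exists>g\<in>bimod_hom A B Y X.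
        stably_equal K A B X X (g \<circ> f) id \<and> stably_equal K A B Y Y (f \<circ> g) id)"

text \<open>\<open>is_syzygy K A B n X Y\<close>: the bimodule \<open>Y\<close> represents \<open>\<Omega>\<^sup>n X\<close>. A syzygy depends on the choice
  of projective presentation, but by Schanuel's lemma only up to isomorphism in the stable
  category, so being stably isomorphic to some \<open>n\<close>-th syzygy is the same as being stably
  isomorphic to \<open>\<Omega>\<^sup>n X\<close>.\<close>

primrec is_syzygy ::
  "('k, 'z) ring_scheme \<Rightarrow> ('k, 'a) module \<Rightarrow> ('k, 'b) module \<Rightarrow> nat
     \<Rightarrow> ('a, 'b, 'm) bimodule \<Rightarrow> ('a, 'b, 'k vec) bimodule \<Rightarrow> bool" where
  "is_syzygy K A B 0 X Y \<longleftrightarrow> fg_bimodule K A B Y \<and> bimod_iso A B X Y"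
| "is_syzygy K A B (Suc n) X Y \<longleftrightarrow> fg_bimodule K A B Y \<and>
     (\<exists>Z (P :: ('a, 'b, 'k vec) bimodule) f. is_syzygy K A B n X Z \<and>
        fg_projective_bimodule K A B P \<and>
        f \<in> bimod_hom A B P Z \<and> f ` carrier P = carrier Z \<and>
        bimod_iso A B (P\<lparr>carrier := a_kernel P Z f\<rparr>) Y)"

definition sing_equiv_morita_level ::
  "('k, 'z) ring_scheme \<Rightarrow> ('k, 'a) module \<Rightarrow> ('k, 'b) module \<Rightarrow> bool" where
  "sing_equiv_morita_level K A B \<longleftrightarrow>
     (\<exists>(M :: ('a, 'b, 'k vec) bimodule) (N :: ('b, 'a, 'k vec) bimodule) (n :: nat).
        bimodule K A B M \<and> bimodule K B A N \<and>
        fg_projective A M \<and> fg_projective (opposite B) (right_module M) \<and>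
        fg_projective B N \<and> fg_projective (opposite A) (right_module N) \<and>
        (\<exists>Y. is_syzygy K A A n (regular_bimodule A) Y \<and> stably_iso K A A (tensor B M N) Y) \<and>
        (\<exists>Y. is_syzygy K B B n (regular_bimodule B) Y \<and> stably_iso K B B (tensor A N M) Y))"

end

theory Submission imports Defs begin

text \<open>Let \<open>L\<^sub>i\<close> and \<open>L'\<^sub>i\<close> be the syzygies in projective resolutions of \<open>B = A/J\<close> as an \<open>A\<close>-\<open>B\<close>- and as a
  \<open>B\<close>-\<open>A\<close>-bimodule, and put \<open>M = L\<^sub>m\<close>, \<open>N = L'\<^sub>m\<close>, where \<open>m - 1\<close> bounds the projective dimension of \<open>J\<close>. By
  \<open>0 \<rightarrow> J \<rightarrow> A \<rightarrow> B \<rightarrow> 0\<close> the \<open>A\<close>-module \<open>B\<close> has projective dimension at most \<open>m\<close> on both sides, so \<open>M\<close> and \<open>N\<close>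
  are one-sided projective over \<open>A\<close>; over \<open>B\<close> they are because the resolutions split there.

  Tensoring \<open>M\<close> with the resolution of \<open>B\<close> gives \<open>M \<otimes>\<^sub>B N = \<Omega>\<^sup>m(M)\<close> over \<open>A\<^sup>e\<close>, and in the same way every
  projective \<open>A\<close>-\<open>B\<close>-bimodule has projective dimension at most \<open>m\<close> over \<open>A\<^sup>e\<close>. Hence \<open>\<Omega>\<^sup>m(M)\<close> is stably
  \<open>\<Omega>\<^sup>2\<^sup>m(B)\<close>, and this is \<open>\<Omega>\<^sup>2\<^sup>m(A)\<close> as \<open>J\<close> has finite projective dimension. On the other side
  \<open>N \<otimes>\<^sub>A M = \<Omega>\<^sup>m(B \<otimes>\<^sub>A M)\<close>, and \<open>B \<otimes>\<^sub>A M = \<Omega>\<^sup>m(B)\<close> because the positive \<open>Tor\<close> groups of \<open>B\<close> with itself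
  over \<open>A\<close> vanish. This vanishing is used in the form that homomorphisms from \<open>L\<^sub>i\<^sub>+\<^sub>1\<close> to a \<open>B\<close>-module
  extend to the projective containing \<open>L\<^sub>i\<^sub>+\<^sub>1\<close>, and it follows from fullness of the functor between
  the derived categories.\<close>

section \<open>Bimodules\<close>

lemma abelian_group_cong_imp:
  assumes "abelian_group M" "carrier M = carrier N" "zero M = zero N" "add M = add N"
  shows "abelian_group N"
  using abelian_groupE[OF assms(1)] assms(2-) by (intro abelian_groupI) auto

lemma abelian_group_cong:
  assumes "carrier M = carrier N" "zero M = zero N" "add M = add N"
  shows "abelian_group M \<longleftrightarrow> abelian_group N"
  using abelian_group_cong_imp[of M N] abelian_group_cong_imp[of N M] assms by metis

lemma (in abelian_group) diff_zero_iff: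
  "\<lbrakk>x \<in> carrier G; y \<in> carrier G\<rbrakk> \<Longrightarrow> x \<ominus> y = \<zero> \<longleftrightarrow> x = y"
  by (metis a_inv_closed minus_minus minus_eq minus_equality r_neg)

lemma (in abelian_group) diff_add_cancel [simp]:
  "\<lbrakk>x \<in> carrier G; y \<in> carrier G\<rbrakk> \<Longrightarrow> (x \<ominus> y) \<oplus> y = x"
  by (simp add: a_minus_def a_assoc l_neg)

lemma (in abelian_group) add_diff_cancel_left [simp]:
  "\<lbrakk>x \<in> carrier G; y \<in> carrier G\<rbrakk> \<Longrightarrow> y \<oplus> (x \<ominus> y) = x"
  by (subst a_comm) auto

lemma (in abelian_group) add_diff_cancel [simp]:
  "\<lbrakk>x \<in> carrier G; y \<in> carrier G\<rbrakk> \<Longrightarrow> (x \<oplus> y) \<ominus> y = x"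
  by (simp add: a_minus_def a_assoc r_neg)

lemma (in abelian_group) diff_zero [simp]: "x \<in> carrier G \<Longrightarrow> x \<ominus> \<zero> = x"
  by (simp add: a_minus_def)

lemma (in abelian_group) diff_self [simp]: "x \<in> carrier G \<Longrightarrow> x \<ominus> x = \<zero>"
  by (simp add: diff_zero_iff)

lemma (in abelian_group) add_diff_add_left:
  "\<lbrakk>x \<in> carrier G; y \<in> carrier G; z \<in> carrier G\<rbrakk> \<Longrightarrow> (z \<oplus> x) \<ominus> (z \<oplus> y) = x \<ominus> y"
proof -
  assume *: "x \<in> carrier G" "y \<in> carrier G" "z \<in> carrier G"
  then have "(z \<oplus> x) \<ominus> (z \<oplus> y) = (z \<oplus> \<ominus> z) \<oplus> (x \<oplus> \<ominus> y)"
    by (simp add: a_minus_def minus_add a_ac)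
  with * show ?thesis by (simp add: r_neg a_minus_def)
qed

lemma (in abelian_group) diff_add_diff:
  "\<lbrakk>x \<in> carrier G; y \<in> carrier G; u \<in> carrier G; v \<in> carrier G\<rbrakk>
    \<Longrightarrow> (x \<ominus> y) \<oplus> (u \<ominus> v) = (x \<oplus> u) \<ominus> (y \<oplus> v)"
  by (simp add: a_minus_def minus_add a_ac)

lemma (in abelian_group) diff_eq_iff:
  "\<lbrakk>x \<in> carrier G; y \<in> carrier G; z \<in> carrier G\<rbrakk> \<Longrightarrow> x \<ominus> y = z \<longleftrightarrow> x = z \<oplus> y"
  by auto

lemma a_inv_cong:
  assumes "carrier M = carrier N" "zero M = zero N" "add M = add N"
  shows "a_inv M x = a_inv N x"
  using assms by (simp add: a_inv_def m_inv_def)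

definition scal :: "('k, 'a) module \<Rightarrow> 'k \<Rightarrow> 'a" where "scal A c = c \<odot>\<^bsub>A\<^esub> \<one>\<^bsub>A\<^esub>"

context fd_algebra
begin

lemma scal_closed [simp, intro]: "c \<in> carrier K \<Longrightarrow> scal A c \<in> carrier A"
  by (simp add: scal_def)

lemma scal_one [simp]: "scal A \<one>\<^bsub>K\<^esub> = \<one>\<^bsub>A\<^esub>"
  by (simp add: scal_def)

lemma scal_add: "\<lbrakk>c \<in> carrier K; d \<in> carrier K\<rbrakk> \<Longrightarrow> scal A (c \<oplus>\<^bsub>K\<^esub> d) = scal A c \<oplus>\<^bsub>A\<^esub> scal A d"
  by (simp add: scal_def smult_l_distr)

lemma scal_mult_left: "\<lbrakk>c \<in> carrier K; x \<in> carrier A\<rbrakk> \<Longrightarrow> scal A c \<otimes>\<^bsub>A\<^esub> x = c \<odot>\<^bsub>A\<^esub> x"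
  by (simp add: scal_def smult_mult_left)

lemma scal_mult_right: "\<lbrakk>c \<in> carrier K; x \<in> carrier A\<rbrakk> \<Longrightarrow> x \<otimes>\<^bsub>A\<^esub> scal A c = c \<odot>\<^bsub>A\<^esub> x"
  by (simp add: scal_def smult_mult_right)

lemma scal_mult: "\<lbrakk>c \<in> carrier K; d \<in> carrier K\<rbrakk> \<Longrightarrow> scal A (c \<otimes>\<^bsub>K\<^esub> d) = scal A c \<otimes>\<^bsub>A\<^esub> scal A d"
  by (simp add: scal_mult_left) (simp add: scal_def smult_assoc1)

lemma field_K: "field K" by (rule K.field_axioms)
lemma ring_A: "ring A" by (rule A.ring_axioms)

lemma ring_opposite: "ring (opposite A)"
  unfolding opposite_def
  by (rule ringI, subst abelian_group_cong[of _ A])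
     (auto simp: A.is_abelian_group A.l_distr A.r_distr A.m_assoc intro!: monoidI)

lemma fd_algebra_opposite: "fd_algebra K (opposite A)"
proof -
  have m: "module K (opposite A)"
    by (rule moduleI, rule K.is_cring, subst abelian_group_cong[of _ A])
       (auto simp: opposite_def A.is_abelian_group smult_l_distr smult_r_distr smult_assoc1)
  have *: "submodule H K (opposite A) = submodule H K A" for H
    by (auto simp: submodule_def submodule_axioms_def opposite_def)
  have fin: "fin_gen K (opposite A)"
    using finite_dimensional unfolding fin_gen_def * by (simp add: opposite_def)
  show ?thesis
    unfolding fd_algebra_def fd_algebra_axioms_def using m ring_opposite fin field_K
    by (simp add: opposite_def smult_mult_left smult_mult_right)
qed

end

lemma opposite_opposite [simp]: "opposite (opposite A) = A"
  by (simp add: opposite_def)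

lemma opposite_simps [simp]:
  "carrier (opposite A) = carrier A" "one (opposite A) = one A" "zero (opposite A) = zero A"
  "add (opposite A) = add A" "smult (opposite A) = smult A"
  "mult (opposite A) x y = mult A y x"
  by (simp_all add: opposite_def)

locale bim = abelian_group X for X :: "('a, 'b, 'm) bimodule" +
  fixes K :: "('k, 'z) ring_scheme" and A :: "('k, 'a) module" and B :: "('k, 'b) module"
  assumes fdA: "fd_algebra K A" and fdB: "fd_algebra K B"
    and l_closed [simp, intro]: "\<lbrakk>a \<in> carrier A; x \<in> carrier X\<rbrakk> \<Longrightarrow> a \<odot>\<^bsub>X\<^esub> x \<in> carrier X"
    and l_add1: "\<lbrakk>a \<in> carrier A; a' \<in> carrier A; x \<in> carrier X\<rbrakk>
      \<Longrightarrow> (a \<oplus>\<^bsub>A\<^esub> a') \<odot>\<^bsub>X\<^esub> x = a \<odot>\<^bsub>X\<^esub> x \<oplus>\<^bsub>X\<^esub> a' \<odot>\<^bsub>X\<^esub> x"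
    and l_add2: "\<lbrakk>a \<in> carrier A; x \<in> carrier X; y \<in> carrier X\<rbrakk>
      \<Longrightarrow> a \<odot>\<^bsub>X\<^esub> (x \<oplus>\<^bsub>X\<^esub> y) = a \<odot>\<^bsub>X\<^esub> x \<oplus>\<^bsub>X\<^esub> a \<odot>\<^bsub>X\<^esub> y"
    and l_assoc: "\<lbrakk>a \<in> carrier A; a' \<in> carrier A; x \<in> carrier X\<rbrakk>
      \<Longrightarrow> (a \<otimes>\<^bsub>A\<^esub> a') \<odot>\<^bsub>X\<^esub> x = a \<odot>\<^bsub>X\<^esub> (a' \<odot>\<^bsub>X\<^esub> x)"
    and l_one [simp]: "x \<in> carrier X \<Longrightarrow> \<one>\<^bsub>A\<^esub> \<odot>\<^bsub>X\<^esub> x = x"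
    and r_closed [simp, intro]: "\<lbrakk>b \<in> carrier B; x \<in> carrier X\<rbrakk> \<Longrightarrow> rsmult X x b \<in> carrier X"
    and r_add1: "\<lbrakk>b \<in> carrier B; b' \<in> carrier B; x \<in> carrier X\<rbrakk>
      \<Longrightarrow> rsmult X x (b \<oplus>\<^bsub>B\<^esub> b') = rsmult X x b \<oplus>\<^bsub>X\<^esub> rsmult X x b'"
    and r_add2: "\<lbrakk>b \<in> carrier B; x \<in> carrier X; y \<in> carrier X\<rbrakk>
      \<Longrightarrow> rsmult X (x \<oplus>\<^bsub>X\<^esub> y) b = rsmult X x b \<oplus>\<^bsub>X\<^esub> rsmult X y b"
    and r_assoc: "\<lbrakk>b \<in> carrier B; b' \<in> carrier B; x \<in> carrier X\<rbrakk>
      \<Longrightarrow> rsmult X x (b \<otimes>\<^bsub>B\<^esub> b') = rsmult X (rsmult X x b) b'"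
    and r_one [simp]: "x \<in> carrier X \<Longrightarrow> rsmult X x \<one>\<^bsub>B\<^esub> = x"
    and lr_assoc: "\<lbrakk>a \<in> carrier A; b \<in> carrier B; x \<in> carrier X\<rbrakk>
      \<Longrightarrow> rsmult X (a \<odot>\<^bsub>X\<^esub> x) b = a \<odot>\<^bsub>X\<^esub> rsmult X x b"
    and central: "\<lbrakk>c \<in> carrier K; x \<in> carrier X\<rbrakk>
      \<Longrightarrow> scal A c \<odot>\<^bsub>X\<^esub> x = rsmult X x (scal B c)"

lemma right_module_simps [simp]:
  "carrier (right_module M) = carrier M" "zero (right_module M) = zero M"
  "add (right_module M) = add M" "smult (right_module M) b x = rsmult M x b"
  by (simp_all add: right_module_def)

lemma abelian_group_right_module [simp]: "abelian_group (right_module M) = abelian_group M"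
  by (rule abelian_group_cong) simp_all

lemma bim_iff: "bim X K A B \<longleftrightarrow> fd_algebra K A \<and> fd_algebra K B \<and> bimodule K A B X"
proof
  assume "bim X K A B"
  then interpret bim X K A B .
  have [simp]: "ring A" "ring (opposite B)"
    using fdA fdB by (auto intro: fd_algebra.ring_A fd_algebra.ring_opposite)
  have "bimodule K A B X"
    unfolding bimodule_def left_module_def left_module_axioms_def
    using scal_def[of A] scal_def[of B] central
    by (simp add: abelian_group_axioms l_add1 l_add2 l_assoc r_add1 r_add2 r_assoc lr_assoc)
  then show "fd_algebra K A \<and> fd_algebra K B \<and> bimodule K A B X"
    using fdA fdB by simp
next
  assume *: "fd_algebra K A \<and> fd_algebra K B \<and> bimodule K A B X"
  then show "bim X K A B"
    unfolding bimodule_def left_module_def left_module_axioms_def bim_def bim_axioms_def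
    by (simp add: scal_def)
qed

lemma bimod_hom_iff:
  "f \<in> bimod_hom A B X Y \<longleftrightarrow> f \<in> carrier X \<rightarrow> carrier Y \<and>
     (\<forall>x\<in>carrier X. \<forall>y\<in>carrier X. f (x \<oplus>\<^bsub>X\<^esub> y) = f x \<oplus>\<^bsub>Y\<^esub> f y) \<and>
     (\<forall>a\<in>carrier A. \<forall>x\<in>carrier X. f (a \<odot>\<^bsub>X\<^esub> x) = a \<odot>\<^bsub>Y\<^esub> f x) \<and>
     (\<forall>b\<in>carrier B. \<forall>x\<in>carrier X. f (rsmult X x b) = rsmult Y (f x) b)"
  by (auto simp: bimod_hom_def mod_hom_def hom_def)

locale bhom = X: bim X K A B + Y: bim Y K A B
  for K :: "('k, 'z) ring_scheme" and A :: "('k, 'a) module" and B :: "('k, 'b) module"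
    and X :: "('a, 'b, 'm) bimodule" and Y :: "('a, 'b, 'n) bimodule" +
  fixes f :: "'m \<Rightarrow> 'n"
  assumes hom: "f \<in> bimod_hom A B X Y"
begin

lemma closed [simp, intro]: "x \<in> carrier X \<Longrightarrow> f x \<in> carrier Y"
  using hom by (auto simp: bimod_hom_iff)
lemma add [simp]: "\<lbrakk>x \<in> carrier X; y \<in> carrier X\<rbrakk> \<Longrightarrow> f (x \<oplus>\<^bsub>X\<^esub> y) = f x \<oplus>\<^bsub>Y\<^esub> f y"
  using hom by (auto simp: bimod_hom_iff)
lemma left [simp]: "\<lbrakk>a \<in> carrier A; x \<in> carrier X\<rbrakk> \<Longrightarrow> f (a \<odot>\<^bsub>X\<^esub> x) = a \<odot>\<^bsub>Y\<^esub> f x"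
  using hom by (auto simp: bimod_hom_iff)
lemma right [simp]: "\<lbrakk>b \<in> carrier B; x \<in> carrier X\<rbrakk> \<Longrightarrow> f (rsmult X x b) = rsmult Y (f x) b"
  using hom by (auto simp: bimod_hom_iff)
lemma zero [simp]: "f \<zero>\<^bsub>X\<^esub> = \<zero>\<^bsub>Y\<^esub>"
  using add[of "\<zero>\<^bsub>X\<^esub>" "\<zero>\<^bsub>X\<^esub>"] Y.add.l_cancel_one[of "f \<zero>\<^bsub>X\<^esub>" "f \<zero>\<^bsub>X\<^esub>"] by simp
lemma neg [simp]: "x \<in> carrier X \<Longrightarrow> f (\<ominus>\<^bsub>X\<^esub> x) = \<ominus>\<^bsub>Y\<^esub> f x"
  using add[of "\<ominus>\<^bsub>X\<^esub> x" x] by (simp add: X.l_neg Y.minus_equality)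
lemma diff [simp]: "\<lbrakk>x \<in> carrier X; y \<in> carrier X\<rbrakk> \<Longrightarrow> f (x \<ominus>\<^bsub>X\<^esub> y) = f x \<ominus>\<^bsub>Y\<^esub> f y"
  by (simp add: a_minus_def)
lemma ker_iff: "x \<in> a_kernel X Y f \<longleftrightarrow> x \<in> carrier X \<and> f x = \<zero>\<^bsub>Y\<^esub>"
  by (simp add: a_kernel_def kernel_def)
lemma inj_iff: "inj_on f (carrier X) \<longleftrightarrow> (\<forall>x\<in>carrier X. f x = \<zero>\<^bsub>Y\<^esub> \<longrightarrow> x = \<zero>\<^bsub>X\<^esub>)"
proof
  show "inj_on f (carrier X) \<Longrightarrow> \<forall>x\<in>carrier X. f x = \<zero>\<^bsub>Y\<^esub> \<longrightarrow> x = \<zero>\<^bsub>X\<^esub>"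
    using zero by (metis X.zero_closed inj_onD)
  assume *: "\<forall>x\<in>carrier X. f x = \<zero>\<^bsub>Y\<^esub> \<longrightarrow> x = \<zero>\<^bsub>X\<^esub>"
  show "inj_on f (carrier X)"
  proof (rule inj_onI)
    fix x y assume "x \<in> carrier X" "y \<in> carrier X" "f x = f y"
    with *[rule_format, of "x \<ominus>\<^bsub>X\<^esub> y"] show "x = y" by (simp add: Y.diff_zero_iff X.diff_zero_iff)
  qed
qed
lemma surjE: assumes "f ` carrier X = carrier Y" "y \<in> carrier Y" obtains x where "x \<in> carrier X" "f x = y"
  using assms by (metis imageE)

end

lemma bhomI: "\<lbrakk>bim X K A B; bim Y K A B; f \<in> bimod_hom A B X Y\<rbrakk> \<Longrightarrow> bhom K A B X Y f"
  by (simp add: bhom_def bhom_axioms_def)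

lemma bimod_homI:
  assumes "\<And>x. x \<in> carrier X \<Longrightarrow> f x \<in> carrier Y"
    "\<And>x y. \<lbrakk>x \<in> carrier X; y \<in> carrier X\<rbrakk> \<Longrightarrow> f (x \<oplus>\<^bsub>X\<^esub> y) = f x \<oplus>\<^bsub>Y\<^esub> f y"
    "\<And>a x. \<lbrakk>a \<in> carrier A; x \<in> carrier X\<rbrakk> \<Longrightarrow> f (a \<odot>\<^bsub>X\<^esub> x) = a \<odot>\<^bsub>Y\<^esub> f x"
    "\<And>b x. \<lbrakk>b \<in> carrier B; x \<in> carrier X\<rbrakk> \<Longrightarrow> f (rsmult X x b) = rsmult Y (f x) b"
  shows "f \<in> bimod_hom A B X Y"
  using assms by (auto simp: bimod_hom_iff)

lemma bimod_hom_closed: "\<lbrakk>f \<in> bimod_hom A B X Y; x \<in> carrier X\<rbrakk> \<Longrightarrow> f x \<in> carrier Y"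
  by (auto simp: bimod_hom_iff)

lemma bimod_hom_comp:
  assumes "f \<in> bimod_hom A B X Y" "g \<in> bimod_hom A B Y Z" shows "g \<circ> f \<in> bimod_hom A B X Z"
  using assms by (auto simp: bimod_hom_iff Pi_iff)

lemma bimod_hom_id: "id \<in> bimod_hom A B X X" "(\<lambda>x. x) \<in> bimod_hom A B X X"
  by (auto simp: bimod_hom_iff)

context bim
begin

lemma l_zero_r [simp]: "a \<in> carrier A \<Longrightarrow> a \<odot>\<^bsub>X\<^esub> \<zero>\<^bsub>X\<^esub> = \<zero>\<^bsub>X\<^esub>"
  using l_add2[of a "\<zero>\<^bsub>X\<^esub>" "\<zero>\<^bsub>X\<^esub>"] add.l_cancel_one[of "a \<odot>\<^bsub>X\<^esub> \<zero>\<^bsub>X\<^esub>" "a \<odot>\<^bsub>X\<^esub> \<zero>\<^bsub>X\<^esub>"] by simp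
lemma r_zero_l [simp]: "b \<in> carrier B \<Longrightarrow> rsmult X \<zero>\<^bsub>X\<^esub> b = \<zero>\<^bsub>X\<^esub>"
  using r_add2[of b "\<zero>\<^bsub>X\<^esub>" "\<zero>\<^bsub>X\<^esub>"] add.l_cancel_one[of "rsmult X \<zero>\<^bsub>X\<^esub> b" "rsmult X \<zero>\<^bsub>X\<^esub> b"] by simp
lemma l_neg_r: "\<lbrakk>a \<in> carrier A; x \<in> carrier X\<rbrakk> \<Longrightarrow> a \<odot>\<^bsub>X\<^esub> (\<ominus>\<^bsub>X\<^esub> x) = \<ominus>\<^bsub>X\<^esub> (a \<odot>\<^bsub>X\<^esub> x)"
  using l_add2[of a "\<ominus>\<^bsub>X\<^esub> x" x] by (simp add: l_neg minus_equality)
lemma r_neg_l: "\<lbrakk>b \<in> carrier B; x \<in> carrier X\<rbrakk> \<Longrightarrow> rsmult X (\<ominus>\<^bsub>X\<^esub> x) b = \<ominus>\<^bsub>X\<^esub> (rsmult X x b)"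
  using r_add2[of b "\<ominus>\<^bsub>X\<^esub> x" x] by (simp add: l_neg minus_equality)
lemma A_simps [simp]: "\<one>\<^bsub>A\<^esub> \<in> carrier A" "\<zero>\<^bsub>A\<^esub> \<in> carrier A"
  "\<lbrakk>a \<in> carrier A; a' \<in> carrier A\<rbrakk> \<Longrightarrow> a \<otimes>\<^bsub>A\<^esub> a' \<in> carrier A"
  "\<lbrakk>a \<in> carrier A; a' \<in> carrier A\<rbrakk> \<Longrightarrow> a \<oplus>\<^bsub>A\<^esub> a' \<in> carrier A"
  "c \<in> carrier K \<Longrightarrow> scal A c \<in> carrier A"
proof -
  interpret A: fd_algebra K A by (rule fdA)
  show "\<one>\<^bsub>A\<^esub> \<in> carrier A" "\<zero>\<^bsub>A\<^esub> \<in> carrier A"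
  "\<lbrakk>a \<in> carrier A; a' \<in> carrier A\<rbrakk> \<Longrightarrow> a \<otimes>\<^bsub>A\<^esub> a' \<in> carrier A"
  "\<lbrakk>a \<in> carrier A; a' \<in> carrier A\<rbrakk> \<Longrightarrow> a \<oplus>\<^bsub>A\<^esub> a' \<in> carrier A"
  "c \<in> carrier K \<Longrightarrow> scal A c \<in> carrier A" by simp_all
qed

lemma B_simps [simp]: "\<one>\<^bsub>B\<^esub> \<in> carrier B" "\<zero>\<^bsub>B\<^esub> \<in> carrier B"
  "\<lbrakk>a \<in> carrier B; a' \<in> carrier B\<rbrakk> \<Longrightarrow> a \<otimes>\<^bsub>B\<^esub> a' \<in> carrier B"
  "\<lbrakk>a \<in> carrier B; a' \<in> carrier B\<rbrakk> \<Longrightarrow> a \<oplus>\<^bsub>B\<^esub> a' \<in> carrier B"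
  "c \<in> carrier K \<Longrightarrow> scal B c \<in> carrier B"
proof -
  interpret A: fd_algebra K B by (rule fdB)
  show "\<one>\<^bsub>B\<^esub> \<in> carrier B" "\<zero>\<^bsub>B\<^esub> \<in> carrier B"
  "\<lbrakk>a \<in> carrier B; a' \<in> carrier B\<rbrakk> \<Longrightarrow> a \<otimes>\<^bsub>B\<^esub> a' \<in> carrier B"
  "\<lbrakk>a \<in> carrier B; a' \<in> carrier B\<rbrakk> \<Longrightarrow> a \<oplus>\<^bsub>B\<^esub> a' \<in> carrier B"
  "c \<in> carrier K \<Longrightarrow> scal B c \<in> carrier B" by simp_all
qed

lemma neg_eq_smult: assumes "x \<in> carrier X" shows "\<exists>a\<in>carrier A. \<ominus>\<^bsub>X\<^esub> x = a \<odot>\<^bsub>X\<^esub> x"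
proof
  interpret A: fd_algebra K A by (rule fdA)
  show "\<ominus>\<^bsub>A\<^esub> \<one>\<^bsub>A\<^esub> \<in> carrier A" by simp
  have 0: "\<zero>\<^bsub>A\<^esub> \<odot>\<^bsub>X\<^esub> x = \<zero>\<^bsub>X\<^esub>"
    using l_add1[of "\<zero>\<^bsub>A\<^esub>" "\<zero>\<^bsub>A\<^esub>" x] assms add.l_cancel_one[of "\<zero>\<^bsub>A\<^esub> \<odot>\<^bsub>X\<^esub> x" "\<zero>\<^bsub>A\<^esub> \<odot>\<^bsub>X\<^esub> x"] by simp
  have "(\<ominus>\<^bsub>A\<^esub> \<one>\<^bsub>A\<^esub>) \<odot>\<^bsub>X\<^esub> x \<oplus>\<^bsub>X\<^esub> x = \<zero>\<^bsub>X\<^esub>"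
    using l_add1[of "\<ominus>\<^bsub>A\<^esub> \<one>\<^bsub>A\<^esub>" "\<one>\<^bsub>A\<^esub>" x] assms 0 by (simp add: A.l_neg)
  then show "\<ominus>\<^bsub>X\<^esub> x = (\<ominus>\<^bsub>A\<^esub> \<one>\<^bsub>A\<^esub>) \<odot>\<^bsub>X\<^esub> x"
    using assms by (simp add: minus_equality)
qed

definition stable_set :: "'m set \<Rightarrow> bool" where
  "stable_set H \<longleftrightarrow> H \<subseteq> carrier X \<and> \<zero>\<^bsub>X\<^esub> \<in> H \<and> (\<forall>x\<in>H. \<forall>y\<in>H. x \<oplus>\<^bsub>X\<^esub> y \<in> H) \<and>
     (\<forall>a\<in>carrier A. \<forall>x\<in>H. a \<odot>\<^bsub>X\<^esub> x \<in> H) \<and> (\<forall>b\<in>carrier B. \<forall>x\<in>H. rsmult X x b \<in> H)"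

lemma stable_set_neg: "\<lbrakk>stable_set H; x \<in> H\<rbrakk> \<Longrightarrow> \<ominus>\<^bsub>X\<^esub> x \<in> H"
  using neg_eq_smult[of x] by (auto simp: stable_set_def subset_iff)

lemma subbimodule_iff: "subbimodule H A B X \<longleftrightarrow> stable_set H"
proof
  assume "subbimodule H A B X"
  then show "stable_set H"
    unfolding subbimodule_def submodule_def submodule_axioms_def subgroup_def stable_set_def by auto
next
  assume H: "stable_set H"
  have *: "inv\<^bsub>add_monoid X\<^esub> x \<in> H" if "x \<in> H" for x
    using stable_set_neg[OF H that] by (simp add: a_inv_def)
  have "m_inv (add_monoid (right_module X)) x = m_inv (add_monoid X) x" for x
    using a_inv_cong[of "right_module X" X x] by (simp add: a_inv_def)
  with * have **: "inv\<^bsub>add_monoid (right_module X)\<^esub> x \<in> H" if "x \<in> H" for x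
    using that by metis
  have "subgroup H (add_monoid X)"
  proof (rule subgroup.intro)
    show "inv\<^bsub>add_monoid X\<^esub> x \<in> H" if "x \<in> H" for x by (rule *[OF that])
  qed (use H in \<open>auto simp: stable_set_def\<close>)
  moreover have "subgroup H (add_monoid (right_module X))"
  proof (rule subgroup.intro)
    show "inv\<^bsub>add_monoid (right_module X)\<^esub> x \<in> H" if "x \<in> H" for x by (rule **[OF that])
  qed (use H in \<open>auto simp: stable_set_def\<close>)
  ultimately show "subbimodule H A B X"
    using H unfolding subbimodule_def submodule_def submodule_axioms_def stable_set_def by auto
qed

lemma bim_sub:
  assumes H: "stable_set H" shows "bim (X\<lparr>carrier := H\<rparr>) K A B"
proof -
  have HX: "x \<in> carrier X" if "x \<in> H" for x using H that by (auto simp: stable_set_def)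
  have ag: "abelian_group (X\<lparr>carrier := H\<rparr>)"
    by (rule abelian_groupI)
       (use H stable_set_neg[OF H] in \<open>auto simp: stable_set_def a_ac HX l_neg r_neg intro!: bexI[of _ "\<ominus>\<^bsub>X\<^esub> _"]\<close>)
  show ?thesis
    unfolding bim_def bim_axioms_def using H ag
    by (auto simp: fdA fdB stable_set_def HX l_add1 l_add2 r_add1 r_add2 l_assoc r_assoc lr_assoc central)
qed

end

lemma (in bhom) stable_ker: "X.stable_set (a_kernel X Y f)"
  unfolding X.stable_set_def by (auto simp: ker_iff)

lemma (in bhom) stable_image: "X.stable_set H \<Longrightarrow> Y.stable_set (f ` H)"
proof -
  assume H: "X.stable_set H"
  then have HX: "x \<in> carrier X" if "x \<in> H" for x using that by (auto simp: X.stable_set_def)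
  show "Y.stable_set (f ` H)"
    unfolding Y.stable_set_def
  proof (intro conjI ballI)
    show "f ` H \<subseteq> carrier Y" using HX by auto
    show "\<zero>\<^bsub>Y\<^esub> \<in> f ` H" using H zero by (metis X.stable_set_def imageI)
  next
    fix u v assume "u \<in> f ` H" "v \<in> f ` H"
    then obtain x y where *: "u = f x" "v = f y" "x \<in> H" "y \<in> H" by auto
    then have "u \<oplus>\<^bsub>Y\<^esub> v = f (x \<oplus>\<^bsub>X\<^esub> y)" by (simp add: HX)
    with H * show "u \<oplus>\<^bsub>Y\<^esub> v \<in> f ` H" by (auto simp: X.stable_set_def)
  next
    fix a u assume a: "a \<in> carrier A" and "u \<in> f ` H"
    then obtain x where *: "u = f x" "x \<in> H" by auto
    then have "a \<odot>\<^bsub>Y\<^esub> u = f (a \<odot>\<^bsub>X\<^esub> x)" using a by (simp add: HX)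
    with H * a show "a \<odot>\<^bsub>Y\<^esub> u \<in> f ` H" by (auto simp: X.stable_set_def)
  next
    fix a u assume a: "a \<in> carrier B" and "u \<in> f ` H"
    then obtain x where *: "u = f x" "x \<in> H" by auto
    then have "rsmult Y u a = f (rsmult X x a)" using a by (simp add: HX)
    with H * a show "rsmult Y u a \<in> f ` H" by (auto simp: X.stable_set_def)
  qed
qed

lemma (in bhom) stable_vimage: "Y.stable_set H \<Longrightarrow> X.stable_set {x \<in> carrier X. f x \<in> H}"
  unfolding X.stable_set_def Y.stable_set_def by auto

lemma (in bhom) bim_ker: "bim (X\<lparr>carrier := a_kernel X Y f\<rparr>) K A B"
  by (rule X.bim_sub[OF stable_ker])

definition transport :: "('m \<Rightarrow> 'n) \<Rightarrow> ('a, 'b, 'm) bimodule \<Rightarrow> ('a, 'b, 'n) bimodule" where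
  "transport e X = (let i = the_inv_into (carrier X) e in
     \<lparr>carrier = e ` carrier X, mult = undefined, one = undefined, zero = e \<zero>\<^bsub>X\<^esub>,
      add = \<lambda>u v. e (i u \<oplus>\<^bsub>X\<^esub> i v), smult = \<lambda>a u. e (a \<odot>\<^bsub>X\<^esub> i u), rsmult = \<lambda>u b. e (rsmult X (i u) b)\<rparr>)"

context bim
begin

lemma transport_bim:
  assumes "inj_on e (carrier X)"
  shows "bim (transport e X) K A B"
proof -
  have i: "the_inv_into (carrier X) e (e x) = x" if "x \<in> carrier X" for x
    using assms that by (simp add: the_inv_into_f_f)
  have ag: "abelian_group (transport e X)"
  proof (rule abelian_groupI)
    fix x assume "x \<in> carrier (transport e X)"
    then obtain x' where "x = e x'" "x' \<in> carrier X" by (auto simp: transport_def Let_def)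
    then show "\<exists>y\<in>carrier (transport e X). y \<oplus>\<^bsub>transport e X\<^esub> x = \<zero>\<^bsub>transport e X\<^esub>"
      by (auto intro!: bexI[of _ "\<ominus>\<^bsub>X\<^esub> x'"] simp: transport_def Let_def i l_neg)
  qed (auto simp: transport_def Let_def i a_ac)
  show ?thesis
    unfolding bim_def bim_axioms_def using ag
    by (auto simp: transport_def Let_def fdA fdB i l_add1 l_add2 r_add1 r_add2 l_assoc r_assoc lr_assoc central)
qed

lemma transport_hom:
  assumes "inj_on e (carrier X)" shows "e \<in> bimod_hom A B X (transport e X)"
proof -
  have i: "the_inv_into (carrier X) e (e x) = x" if "x \<in> carrier X" for x
    using assms that by (simp add: the_inv_into_f_f)
  show ?thesis by (rule bimod_homI) (auto simp: transport_def Let_def i)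
qed

lemma transport_carrier: "carrier (transport e X) = e ` carrier X"
  by (simp add: transport_def Let_def)

end

lemma bimod_isoE:
  assumes "bimod_iso A B X Y" "bim X K A B"
  obtains f g where "f \<in> bimod_hom A B X Y" "g \<in> bimod_hom A B Y X"
    "\<And>x. x \<in> carrier X \<Longrightarrow> g (f x) = x" "\<And>y. y \<in> carrier Y \<Longrightarrow> f (g y) = y"
proof -
  interpret X: bim X K A B by fact
  obtain f where f: "f \<in> bimod_hom A B X Y" "bij_betw f (carrier X) (carrier Y)"
    using assms by (auto simp: bimod_iso_def)
  let ?g = "the_inv_into (carrier X) f"
  have gf: "?g (f x) = x" if "x \<in> carrier X" for x
    using f that by (simp add: the_inv_into_f_f bij_betw_def)
  have fg: "f (?g y) = y" if "y \<in> carrier Y" for y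
    using f that by (simp add: f_the_inv_into_f bij_betw_def)
  have gc: "?g y \<in> carrier X" if "y \<in> carrier Y" for y
    using f that by (metis bij_betw_def the_inv_into_into subset_refl)
  have "?g \<in> bimod_hom A B Y X"
  proof (rule bimod_homI)
    fix x y assume xy: "x \<in> carrier Y" "y \<in> carrier Y"
    have "f (?g x \<oplus>\<^bsub>X\<^esub> ?g y) = x \<oplus>\<^bsub>Y\<^esub> y"
      using f xy by (simp add: bimod_hom_iff gc fg)
    then show "?g (x \<oplus>\<^bsub>Y\<^esub> y) = ?g x \<oplus>\<^bsub>X\<^esub> ?g y" by (metis gf gc xy X.a_closed)
  next
    fix a x assume xy: "a \<in> carrier A" "x \<in> carrier Y"
    have "f (a \<odot>\<^bsub>X\<^esub> ?g x) = a \<odot>\<^bsub>Y\<^esub> x"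
      using f xy by (simp add: bimod_hom_iff gc fg)
    then show "?g (a \<odot>\<^bsub>Y\<^esub> x) = a \<odot>\<^bsub>X\<^esub> ?g x" by (metis gf gc xy X.l_closed)
  next
    fix a x assume xy: "a \<in> carrier B" "x \<in> carrier Y"
    have "f (rsmult X (?g x) a) = rsmult Y x a"
      using f xy by (simp add: bimod_hom_iff gc fg)
    then show "?g (rsmult Y x a) = rsmult X (?g x) a" by (metis gf gc xy X.r_closed)
  qed (use gc in auto)
  with f gf fg show ?thesis using that by blast
qed

lemma bimod_isoI:
  assumes "f \<in> bimod_hom A B X Y" "g \<in> carrier Y \<rightarrow> carrier X"
    "\<And>x. x \<in> carrier X \<Longrightarrow> g (f x) = x" "\<And>y. y \<in> carrier Y \<Longrightarrow> f (g y) = y"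
  shows "bimod_iso A B X Y"
  unfolding bimod_iso_def using assms
  by (intro bexI[of _ f] bij_betw_byWitness[of _ g]) (auto simp: bimod_hom_iff)

lemma bimod_iso_refl: "bimod_iso A B X X"
  by (rule bimod_isoI[of id _ _ _ _ id]) (auto simp: bimod_hom_id)

lemma bimod_iso_sym: "\<lbrakk>bimod_iso A B X Y; bim X K A B\<rbrakk> \<Longrightarrow> bimod_iso A B Y X"
  by (erule (1) bimod_isoE) (rule bimod_isoI, auto simp: bimod_hom_iff)

lemma bimod_iso_trans: "\<lbrakk>bimod_iso A B X Y; bimod_iso A B Y Z\<rbrakk> \<Longrightarrow> bimod_iso A B X Z"
  unfolding bimod_iso_def by (meson bimod_hom_comp bij_betw_trans)

lemma (in bim) transport_iso:
  "inj_on e (carrier X) \<Longrightarrow> bimod_iso A B X (transport e X)"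
  using transport_hom by (auto simp: bimod_iso_def bij_betw_def transport_carrier)


section \<open>Finite-dimensional vector spaces\<close>

locale vspace = abelian_group V for V :: "('k, 'm, 'y) module_scheme" +
  fixes K :: "('k, 'z) ring_scheme"
  assumes field_K: "field K"
    and s_closed [simp, intro]: "\<lbrakk>c \<in> carrier K; x \<in> carrier V\<rbrakk> \<Longrightarrow> c \<odot>\<^bsub>V\<^esub> x \<in> carrier V"
    and s_add1: "\<lbrakk>c \<in> carrier K; d \<in> carrier K; x \<in> carrier V\<rbrakk>
      \<Longrightarrow> (c \<oplus>\<^bsub>K\<^esub> d) \<odot>\<^bsub>V\<^esub> x = c \<odot>\<^bsub>V\<^esub> x \<oplus>\<^bsub>V\<^esub> d \<odot>\<^bsub>V\<^esub> x"
    and s_add2: "\<lbrakk>c \<in> carrier K; x \<in> carrier V; y \<in> carrier V\<rbrakk>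
      \<Longrightarrow> c \<odot>\<^bsub>V\<^esub> (x \<oplus>\<^bsub>V\<^esub> y) = c \<odot>\<^bsub>V\<^esub> x \<oplus>\<^bsub>V\<^esub> c \<odot>\<^bsub>V\<^esub> y"
    and s_assoc: "\<lbrakk>c \<in> carrier K; d \<in> carrier K; x \<in> carrier V\<rbrakk>
      \<Longrightarrow> (c \<otimes>\<^bsub>K\<^esub> d) \<odot>\<^bsub>V\<^esub> x = c \<odot>\<^bsub>V\<^esub> (d \<odot>\<^bsub>V\<^esub> x)"
    and s_one [simp]: "x \<in> carrier V \<Longrightarrow> \<one>\<^bsub>K\<^esub> \<odot>\<^bsub>V\<^esub> x = x"

primrec spn :: "('k, 'z) ring_scheme \<Rightarrow> ('k, 'm, 'y) module_scheme \<Rightarrow> 'm list \<Rightarrow> 'm set" where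
  "spn K V [] = {\<zero>\<^bsub>V\<^esub>}"
| "spn K V (s # ss) = {c \<odot>\<^bsub>V\<^esub> s \<oplus>\<^bsub>V\<^esub> y | c y. c \<in> carrier K \<and> y \<in> spn K V ss}"

definition fdim :: "('k, 'z) ring_scheme \<Rightarrow> ('k, 'm, 'y) module_scheme \<Rightarrow> bool" where
  "fdim K V \<longleftrightarrow> (\<exists>ss. set ss \<subseteq> carrier V \<and> spn K V ss = carrier V)"

definition vsub :: "('k, 'z) ring_scheme \<Rightarrow> ('k, 'm, 'y) module_scheme \<Rightarrow> 'm set \<Rightarrow> bool" where
  "vsub K V H \<longleftrightarrow> H \<subseteq> carrier V \<and> \<zero>\<^bsub>V\<^esub> \<in> H \<and> (\<forall>x\<in>H. \<forall>y\<in>H. x \<oplus>\<^bsub>V\<^esub> y \<in> H) \<and>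
     (\<forall>c\<in>carrier K. \<forall>x\<in>H. c \<odot>\<^bsub>V\<^esub> x \<in> H)"

definition linear_on ::
  "('k, 'z) ring_scheme \<Rightarrow> ('k, 'm, 'y) module_scheme \<Rightarrow> ('k, 'n, 'w) module_scheme \<Rightarrow> 'm set \<Rightarrow> ('m \<Rightarrow> 'n) \<Rightarrow> bool"
where
  "linear_on K V W H f \<longleftrightarrow> f \<in> H \<rightarrow> carrier W \<and>
     (\<forall>x\<in>H. \<forall>y\<in>H. f (x \<oplus>\<^bsub>V\<^esub> y) = f x \<oplus>\<^bsub>W\<^esub> f y) \<and> (\<forall>c\<in>carrier K. \<forall>x\<in>H. f (c \<odot>\<^bsub>V\<^esub> x) = c \<odot>\<^bsub>W\<^esub> f x)"

lemma spn_ConsI: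
  "\<lbrakk>c \<in> carrier K; y \<in> spn K V ss\<rbrakk> \<Longrightarrow> c \<odot>\<^bsub>V\<^esub> s \<oplus>\<^bsub>V\<^esub> y \<in> spn K V (s # ss)"
  by auto

context vspace
begin

lemma K_simps [simp]: "\<one>\<^bsub>K\<^esub> \<in> carrier K" "\<zero>\<^bsub>K\<^esub> \<in> carrier K"
  "\<lbrakk>c \<in> carrier K; d \<in> carrier K\<rbrakk> \<Longrightarrow> c \<oplus>\<^bsub>K\<^esub> d \<in> carrier K"
  "\<lbrakk>c \<in> carrier K; d \<in> carrier K\<rbrakk> \<Longrightarrow> c \<otimes>\<^bsub>K\<^esub> d \<in> carrier K"
  "c \<in> carrier K \<Longrightarrow> \<ominus>\<^bsub>K\<^esub> c \<in> carrier K"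
  using field_K by (auto simp: field_def domain_def cring_def ring_def
      intro: ring.ring_simprules cring.cring_simprules)

lemma s_zero1 [simp]: "x \<in> carrier V \<Longrightarrow> \<zero>\<^bsub>K\<^esub> \<odot>\<^bsub>V\<^esub> x = \<zero>\<^bsub>V\<^esub>"
proof -
  assume x: "x \<in> carrier V"
  interpret K: field K by (rule field_K)
  have "(\<zero>\<^bsub>K\<^esub> \<oplus>\<^bsub>K\<^esub> \<zero>\<^bsub>K\<^esub>) \<odot>\<^bsub>V\<^esub> x = \<zero>\<^bsub>K\<^esub> \<odot>\<^bsub>V\<^esub> x" by simp
  then show ?thesis using x s_add1[of "\<zero>\<^bsub>K\<^esub>" "\<zero>\<^bsub>K\<^esub>" x]
      add.l_cancel_one[of "\<zero>\<^bsub>K\<^esub> \<odot>\<^bsub>V\<^esub> x" "\<zero>\<^bsub>K\<^esub> \<odot>\<^bsub>V\<^esub> x"] by simp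
qed

lemma s_zero2 [simp]: "c \<in> carrier K \<Longrightarrow> c \<odot>\<^bsub>V\<^esub> \<zero>\<^bsub>V\<^esub> = \<zero>\<^bsub>V\<^esub>"
  using s_add2[of c "\<zero>\<^bsub>V\<^esub>" "\<zero>\<^bsub>V\<^esub>"] add.l_cancel_one[of "c \<odot>\<^bsub>V\<^esub> \<zero>\<^bsub>V\<^esub>" "c \<odot>\<^bsub>V\<^esub> \<zero>\<^bsub>V\<^esub>"] by simp

lemma s_neg: "\<lbrakk>c \<in> carrier K; x \<in> carrier V\<rbrakk> \<Longrightarrow> (\<ominus>\<^bsub>K\<^esub> c) \<odot>\<^bsub>V\<^esub> x = \<ominus>\<^bsub>V\<^esub> (c \<odot>\<^bsub>V\<^esub> x)"
proof -
  assume x: "c \<in> carrier K" "x \<in> carrier V"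
  interpret K: field K by (rule field_K)
  have "(\<ominus>\<^bsub>K\<^esub> c \<oplus>\<^bsub>K\<^esub> c) \<odot>\<^bsub>V\<^esub> x = \<zero>\<^bsub>V\<^esub>" using x by (simp add: K.l_neg)
  then show ?thesis using x s_add1[of "\<ominus>\<^bsub>K\<^esub> c" c x] by (simp add: minus_equality)
qed

lemma vsubD:
  assumes "vsub K V H"
  shows "H \<subseteq> carrier V" "x \<in> H \<Longrightarrow> x \<in> carrier V" "\<zero>\<^bsub>V\<^esub> \<in> H" "\<lbrakk>x \<in> H; y \<in> H\<rbrakk> \<Longrightarrow> x \<oplus>\<^bsub>V\<^esub> y \<in> H"
    "\<lbrakk>c \<in> carrier K; x \<in> H\<rbrakk> \<Longrightarrow> c \<odot>\<^bsub>V\<^esub> x \<in> H" "x \<in> H \<Longrightarrow> \<ominus>\<^bsub>V\<^esub> x \<in> H" "\<lbrakk>x \<in> H; y \<in> H\<rbrakk> \<Longrightarrow> x \<ominus>\<^bsub>V\<^esub> y \<in> H"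
proof -
  show 1: "H \<subseteq> carrier V" "x \<in> H \<Longrightarrow> x \<in> carrier V" "\<zero>\<^bsub>V\<^esub> \<in> H" and 2: "\<lbrakk>x \<in> H; y \<in> H\<rbrakk> \<Longrightarrow> x \<oplus>\<^bsub>V\<^esub> y \<in> H"
    and 3: "\<lbrakk>c \<in> carrier K; x \<in> H\<rbrakk> \<Longrightarrow> c \<odot>\<^bsub>V\<^esub> x \<in> H" for c x y using assms by (auto simp: vsub_def)
  show 4: "x \<in> H \<Longrightarrow> \<ominus>\<^bsub>V\<^esub> x \<in> H" for x
    using 3[of "\<ominus>\<^bsub>K\<^esub> \<one>\<^bsub>K\<^esub>" x] 1(1) s_neg[of "\<one>\<^bsub>K\<^esub>" x] by auto
  show "\<lbrakk>x \<in> H; y \<in> H\<rbrakk> \<Longrightarrow> x \<ominus>\<^bsub>V\<^esub> y \<in> H" using 2 4 by (simp add: a_minus_def)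
qed

lemma vsub_Int: "\<lbrakk>vsub K V G; vsub K V H\<rbrakk> \<Longrightarrow> vsub K V (G \<inter> H)"
  by (auto simp: vsub_def)

lemma vsub_spn: "set ss \<subseteq> carrier V \<Longrightarrow> vsub K V (spn K V ss)"
proof (induction ss)
  case Nil then show ?case by (auto simp: vsub_def)
next
  case (Cons s ss)
  then have H: "vsub K V (spn K V ss)" and s: "s \<in> carrier V" by auto
  note D = vsubD[OF H]
  show ?case unfolding vsub_def
  proof (intro conjI ballI)
    show "spn K V (s # ss) \<subseteq> carrier V" using D s by auto
    have "\<zero>\<^bsub>V\<^esub> = \<zero>\<^bsub>K\<^esub> \<odot>\<^bsub>V\<^esub> s \<oplus>\<^bsub>V\<^esub> \<zero>\<^bsub>V\<^esub>" using s by simp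
    then show "\<zero>\<^bsub>V\<^esub> \<in> spn K V (s # ss)" using D(3) K_simps(2) unfolding spn.simps by blast
  next
    fix x y assume "x \<in> spn K V (s # ss)" "y \<in> spn K V (s # ss)"
    then obtain c d u v where *: "x = c \<odot>\<^bsub>V\<^esub> s \<oplus>\<^bsub>V\<^esub> u" "y = d \<odot>\<^bsub>V\<^esub> s \<oplus>\<^bsub>V\<^esub> v" "c \<in> carrier K" "d \<in> carrier K"
      "u \<in> spn K V ss" "v \<in> spn K V ss" by auto
    then have "x \<oplus>\<^bsub>V\<^esub> y = (c \<oplus>\<^bsub>K\<^esub> d) \<odot>\<^bsub>V\<^esub> s \<oplus>\<^bsub>V\<^esub> (u \<oplus>\<^bsub>V\<^esub> v)" using D(2) s by (simp add: s_add1 a_ac)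
    with * D(4) show "x \<oplus>\<^bsub>V\<^esub> y \<in> spn K V (s # ss)" by (metis spn_ConsI K_simps(3))
  next
    fix d x assume d: "d \<in> carrier K" and "x \<in> spn K V (s # ss)"
    then obtain c u where *: "x = c \<odot>\<^bsub>V\<^esub> s \<oplus>\<^bsub>V\<^esub> u" "c \<in> carrier K" "u \<in> spn K V ss" by auto
    then have "d \<odot>\<^bsub>V\<^esub> x = (d \<otimes>\<^bsub>K\<^esub> c) \<odot>\<^bsub>V\<^esub> s \<oplus>\<^bsub>V\<^esub> (d \<odot>\<^bsub>V\<^esub> u)" using D(2) s d by (simp add: s_add2 s_assoc)
    with * D(5) d show "d \<odot>\<^bsub>V\<^esub> x \<in> spn K V (s # ss)" by (metis spn_ConsI K_simps(4))
  qed
qed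

lemma spn_Cons_sub: assumes "set (s # ss) \<subseteq> carrier V" shows "spn K V ss \<subseteq> spn K V (s # ss)"
proof
  fix x assume x: "x \<in> spn K V ss"
  then have "x = \<zero>\<^bsub>K\<^esub> \<odot>\<^bsub>V\<^esub> s \<oplus>\<^bsub>V\<^esub> x" using assms vsubD(2)[OF vsub_spn] by auto
  with x show "x \<in> spn K V (s # ss)" using K_simps(2) unfolding spn.simps by blast
qed

lemma spn_base: "set ss \<subseteq> carrier V \<Longrightarrow> set ss \<subseteq> spn K V ss"
proof (induction ss)
  case (Cons s ss)
  have "s = \<one>\<^bsub>K\<^esub> \<odot>\<^bsub>V\<^esub> s \<oplus>\<^bsub>V\<^esub> \<zero>\<^bsub>V\<^esub>" using Cons by simp
  then have "s \<in> spn K V (s # ss)" using vsubD(3)[OF vsub_spn, of ss] Cons.prems K_simps(1) by (metis spn_ConsI set_subset_Cons subset_trans)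
  then show ?case using Cons spn_Cons_sub[of s ss] by auto
qed auto

lemma spn_least: "\<lbrakk>vsub K V H; set ss \<subseteq> H\<rbrakk> \<Longrightarrow> spn K V ss \<subseteq> H"
  by (induction ss) (auto simp: vsubD)

lemma spn_of_vsub:
  "\<lbrakk>vsub K V H; H \<subseteq> spn K V ss; set ss \<subseteq> carrier V\<rbrakk> \<Longrightarrow> \<exists>ts. set ts \<subseteq> H \<and> spn K V ts = H"
proof (induction ss arbitrary: H)
  case Nil
  then have "H = {\<zero>\<^bsub>V\<^esub>}" by (auto simp: vsub_def)
  then show ?case by (intro exI[of _ "[]"]) auto
next
  case (Cons s ss)
  interpret K: field K by (rule field_K)
  note D = vsubD[OF Cons.prems(1)]
  have S: "vsub K V (spn K V ss)" and s: "s \<in> carrier V" using Cons vsub_spn by auto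
  obtain ts where ts: "set ts \<subseteq> H \<inter> spn K V ss" "spn K V ts = H \<inter> spn K V ss"
    using Cons.IH[OF vsub_Int[OF Cons.prems(1) S]] Cons.prems by auto
  show ?case
  proof (cases "H \<subseteq> spn K V ss")
    case True then show ?thesis using ts by auto
  next
    case False
    then obtain v where v: "v \<in> H" "v \<notin> spn K V ss" by auto
    with Cons.prems obtain c w where cw: "v = c \<odot>\<^bsub>V\<^esub> s \<oplus>\<^bsub>V\<^esub> w" "c \<in> carrier K" "w \<in> spn K V ss" by auto
    have w: "w \<in> carrier V" using cw vsubD[OF S] by auto
    have "c \<noteq> \<zero>\<^bsub>K\<^esub>" using v cw s w by auto
    then have c: "c \<in> Units K" using cw K.field_Units by auto
    have "H \<subseteq> spn K V (v # ts)"
    proof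
      fix x assume x: "x \<in> H"
      with Cons.prems obtain c' w' where cw': "x = c' \<odot>\<^bsub>V\<^esub> s \<oplus>\<^bsub>V\<^esub> w'" "c' \<in> carrier K" "w' \<in> spn K V ss" by auto
      have w': "w' \<in> carrier V" using cw' vsubD[OF S] by auto
      define d where "d = c' \<otimes>\<^bsub>K\<^esub> inv\<^bsub>K\<^esub> c"
      have d: "d \<in> carrier K" "d \<otimes>\<^bsub>K\<^esub> c = c'"
        using c cw' by (auto simp: d_def K.m_assoc K.Units_closed)
      have dv: "d \<odot>\<^bsub>V\<^esub> v = c' \<odot>\<^bsub>V\<^esub> s \<oplus>\<^bsub>V\<^esub> d \<odot>\<^bsub>V\<^esub> w"
        using d cw s w by (simp add: s_add2 s_assoc[symmetric])
      have dvH: "d \<odot>\<^bsub>V\<^esub> v \<in> H" using D v d by auto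
      have "x \<ominus>\<^bsub>V\<^esub> d \<odot>\<^bsub>V\<^esub> v = w' \<ominus>\<^bsub>V\<^esub> d \<odot>\<^bsub>V\<^esub> w"
        using cw' dv s w w' d
        by (simp add: add_diff_add_left)
      also have "\<dots> \<in> spn K V ss" using vsubD[OF S] cw' cw d by auto
      finally have "x \<ominus>\<^bsub>V\<^esub> d \<odot>\<^bsub>V\<^esub> v \<in> spn K V ts" using ts D x dvH by auto
      moreover have "x = d \<odot>\<^bsub>V\<^esub> v \<oplus>\<^bsub>V\<^esub> (x \<ominus>\<^bsub>V\<^esub> d \<odot>\<^bsub>V\<^esub> v)"
        using D(2) x dvH by simp
      ultimately show "x \<in> spn K V (v # ts)" using d by auto
    qed
    moreover have "spn K V (v # ts) \<subseteq> H" using spn_least[OF Cons.prems(1), of "v # ts"] v ts by auto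
    ultimately show ?thesis using v ts by (intro exI[of _ "v # ts"]) auto
  qed
qed

lemma spn_inj: "\<exists>e :: 'm \<Rightarrow> nat \<Rightarrow> 'k. inj_on e (spn K V ss)"
proof (induction ss)
  case (Cons s ss)
  then obtain e :: "'m \<Rightarrow> nat \<Rightarrow> 'k" where e: "inj_on e (spn K V ss)" by auto
  have "\<forall>x\<in>spn K V (s # ss). \<exists>p. x = fst p \<odot>\<^bsub>V\<^esub> s \<oplus>\<^bsub>V\<^esub> snd p \<and> snd p \<in> spn K V ss" by auto
  then obtain p where p: "\<And>x. x \<in> spn K V (s # ss) \<Longrightarrow> x = fst (p x) \<odot>\<^bsub>V\<^esub> s \<oplus>\<^bsub>V\<^esub> snd (p x) \<and> snd (p x) \<in> spn K V ss"
    by (metis bchoice)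
  have "inj_on (\<lambda>x. case_nat (fst (p x)) (e (snd (p x)))) (spn K V (s # ss))"
  proof (rule inj_onI)
    fix x y assume xy: "x \<in> spn K V (s # ss)" "y \<in> spn K V (s # ss)"
      and eq: "case_nat (fst (p x)) (e (snd (p x))) = case_nat (fst (p y)) (e (snd (p y)))"
    have "fst (p x) = fst (p y)" using fun_cong[OF eq, of 0] by simp
    moreover have "e (snd (p x)) = e (snd (p y))"
      using fun_cong[OF eq, of "Suc _"] by auto
    then have "snd (p x) = snd (p y)" using e p xy by (auto dest: inj_onD)
    ultimately show "x = y" using p xy by metis
  qed
  then show ?case by blast
qed auto

lemma linear_on_spn:
  assumes "linear_on K V W (carrier V) f" "vspace W K" "set ss \<subseteq> carrier V"
  shows "f ` spn K V ss = spn K W (map f ss)"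
  using assms(3)
proof (induction ss)
  case Nil
  interpret W: vspace W K by fact
  have "f \<zero>\<^bsub>V\<^esub> = f (\<zero>\<^bsub>K\<^esub> \<odot>\<^bsub>V\<^esub> \<zero>\<^bsub>V\<^esub>)" by simp
  also have "\<dots> = \<zero>\<^bsub>K\<^esub> \<odot>\<^bsub>W\<^esub> f \<zero>\<^bsub>V\<^esub>" using assms(1) K_simps(2) zero_closed unfolding linear_on_def by blast
  also have "\<dots> = \<zero>\<^bsub>W\<^esub>" using assms(1) zero_closed unfolding linear_on_def by (metis Pi_mem W.s_zero1)
  finally show ?case by simp
next
  case (Cons s ss)
  have D: "x \<in> carrier V" if "x \<in> spn K V ss" for x using that vsubD(2)[OF vsub_spn, of ss] Cons by auto
  have f: "f (c \<odot>\<^bsub>V\<^esub> s \<oplus>\<^bsub>V\<^esub> y) = c \<odot>\<^bsub>W\<^esub> f s \<oplus>\<^bsub>W\<^esub> f y" if "c \<in> carrier K" "y \<in> spn K V ss" for c y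
    using that assms(1) Cons.prems D by (auto simp: linear_on_def)
  have IH: "f ` spn K V ss = spn K W (map f ss)" using Cons by auto
  show ?case
  proof (intro equalityI subsetI)
    fix x assume "x \<in> f ` spn K V (s # ss)"
    then show "x \<in> spn K W (map f (s # ss))" using f IH by (auto simp del: D) blast
  next
    fix x assume "x \<in> spn K W (map f (s # ss))"
    then obtain c y where *: "x = c \<odot>\<^bsub>W\<^esub> f s \<oplus>\<^bsub>W\<^esub> y" "c \<in> carrier K" "y \<in> f ` spn K V ss" using IH by auto
    then obtain z where z: "y = f z" "z \<in> spn K V ss" by auto
    with * f have "x = f (c \<odot>\<^bsub>V\<^esub> s \<oplus>\<^bsub>V\<^esub> z)" by simp
    with * z show "x \<in> f ` spn K V (s # ss)" using spn_ConsI by (metis imageI)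
  qed
qed

lemma spn_lift:
  fixes X :: "('k, 'n, 'w) module_scheme" and Y :: "('k, 'o, 'v) module_scheme"
  assumes "vspace X K" "vspace Y K" "linear_on K X Y (carrier X) g" "g ` carrier X = carrier Y"
    "set ss \<subseteq> carrier V" "linear_on K V Y (spn K V ss) h"
  shows "\<exists>l. linear_on K V X (spn K V ss) l \<and> (\<forall>x\<in>spn K V ss. g (l x) = h x)"
  using assms(5,6)
proof (induction ss)
  case Nil
  interpret X: vspace X K by fact
  interpret Y: vspace Y K by fact
  interpret K: field K by (rule field_K)
  have "h \<zero>\<^bsub>V\<^esub> = h (\<zero>\<^bsub>K\<^esub> \<odot>\<^bsub>V\<^esub> \<zero>\<^bsub>V\<^esub>)" by simp
  also have "\<dots> = \<zero>\<^bsub>K\<^esub> \<odot>\<^bsub>Y\<^esub> h \<zero>\<^bsub>V\<^esub>" using Nil K_simps(2) unfolding linear_on_def by auto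
  also have "\<dots> = \<zero>\<^bsub>Y\<^esub>" using Nil by (auto simp: linear_on_def)
  finally have h: "h \<zero>\<^bsub>V\<^esub> = \<zero>\<^bsub>Y\<^esub>" .
  have "g \<zero>\<^bsub>X\<^esub> = g (\<zero>\<^bsub>K\<^esub> \<odot>\<^bsub>X\<^esub> \<zero>\<^bsub>X\<^esub>)" by simp
  also have "\<dots> = \<zero>\<^bsub>K\<^esub> \<odot>\<^bsub>Y\<^esub> g \<zero>\<^bsub>X\<^esub>" using assms(3) K_simps(2) X.zero_closed unfolding linear_on_def by blast
  also have "\<dots> = \<zero>\<^bsub>Y\<^esub>" using assms(3) X.zero_closed unfolding linear_on_def by (metis Pi_mem Y.s_zero1)
  finally show ?case using h by (intro exI[of _ "\<lambda>_. \<zero>\<^bsub>X\<^esub>"]) (auto simp: linear_on_def)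
next
  case (Cons s ss)
  interpret X: vspace X K by fact
  interpret Y: vspace Y K by fact
  interpret K: field K by (rule field_K)
  have s: "s \<in> carrier V" and ss: "set ss \<subseteq> carrier V" using Cons.prems by auto
  note S = vsub_spn[OF ss]
  note D = vsubD[OF S]
  have sub: "spn K V ss \<subseteq> spn K V (s # ss)" using spn_Cons_sub Cons.prems(1) .
  have hs: "linear_on K V Y (spn K V ss) h"
    using Cons.prems(2) sub unfolding linear_on_def by blast
  obtain l where l: "linear_on K V X (spn K V ss) l" "\<And>x. x \<in> spn K V ss \<Longrightarrow> g (l x) = h x"
    using Cons.IH[OF ss hs] by auto
  show ?case
  proof (cases "s \<in> spn K V ss")
    case True
    then have "spn K V (s # ss) \<subseteq> spn K V ss" using D by auto
    then have "spn K V (s # ss) = spn K V ss" using sub by auto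
    then show ?thesis using l by auto
  next
    case False
    have uniq: "c = c' \<and> y = y'"
      if "c \<odot>\<^bsub>V\<^esub> s \<oplus>\<^bsub>V\<^esub> y = c' \<odot>\<^bsub>V\<^esub> s \<oplus>\<^bsub>V\<^esub> y'" "c \<in> carrier K" "c' \<in> carrier K" "y \<in> spn K V ss" "y' \<in> spn K V ss" for c c' y y'
    proof -
      have yc: "y \<in> carrier V" "y' \<in> carrier V" using that D by auto
      have "c = c'"
      proof (rule ccontr)
        assume ne: "c \<noteq> c'"
        define d where "d = c \<oplus>\<^bsub>K\<^esub> \<ominus>\<^bsub>K\<^esub> c'"
        have d0: "d \<in> carrier K" "d \<noteq> \<zero>\<^bsub>K\<^esub>" using that ne K.diff_zero_iff[of c c'] by (auto simp: d_def a_minus_def)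
        then have d: "d \<in> Units K" using K.field_Units by auto
        have "(d \<oplus>\<^bsub>K\<^esub> c') \<odot>\<^bsub>V\<^esub> s \<oplus>\<^bsub>V\<^esub> y = c' \<odot>\<^bsub>V\<^esub> s \<oplus>\<^bsub>V\<^esub> y'"
          using that by (simp add: d_def K.a_assoc K.l_neg)
        then have "d \<odot>\<^bsub>V\<^esub> s \<oplus>\<^bsub>V\<^esub> y \<oplus>\<^bsub>V\<^esub> c' \<odot>\<^bsub>V\<^esub> s = y' \<oplus>\<^bsub>V\<^esub> c' \<odot>\<^bsub>V\<^esub> s"
          using that s yc d0 by (simp add: s_add1 a_ac)
        then have "d \<odot>\<^bsub>V\<^esub> s \<oplus>\<^bsub>V\<^esub> y = y'" using that s yc d0 by simp
        then have "d \<odot>\<^bsub>V\<^esub> s = y' \<ominus>\<^bsub>V\<^esub> y"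
          using s yc d0 by (auto simp: a_minus_def a_assoc r_neg)
        then have "d \<odot>\<^bsub>V\<^esub> s \<in> spn K V ss" using D(7)[of y' y] that by simp
        then have "inv\<^bsub>K\<^esub> d \<odot>\<^bsub>V\<^esub> (d \<odot>\<^bsub>V\<^esub> s) \<in> spn K V ss" using D(5) d by simp
        moreover have "inv\<^bsub>K\<^esub> d \<odot>\<^bsub>V\<^esub> (d \<odot>\<^bsub>V\<^esub> s) = s" using d d0 s by (simp add: s_assoc[symmetric])
        ultimately show False using False by simp
      qed
      with that s yc show ?thesis by simp
    qed
    obtain x0 where x0: "x0 \<in> carrier X" "g x0 = h s"
    proof -
      have "s \<in> spn K V (s # ss)" using spn_base[of "s # ss"] Cons.prems by auto
      then have "h s \<in> carrier Y" using Cons.prems(2) unfolding linear_on_def by blast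
      with assms(4) that show ?thesis by (metis imageE)
    qed
    define P where "P x = (THE p. fst p \<in> carrier K \<and> snd p \<in> spn K V ss \<and> x = fst p \<odot>\<^bsub>V\<^esub> s \<oplus>\<^bsub>V\<^esub> snd p)" for x
    have P: "P (c \<odot>\<^bsub>V\<^esub> s \<oplus>\<^bsub>V\<^esub> y) = (c, y)" if "c \<in> carrier K" "y \<in> spn K V ss" for c y
      unfolding P_def
    proof (rule the_equality)
      show "fst (c, y) \<in> carrier K \<and> snd (c, y) \<in> spn K V ss \<and> c \<odot>\<^bsub>V\<^esub> s \<oplus>\<^bsub>V\<^esub> y = fst (c, y) \<odot>\<^bsub>V\<^esub> s \<oplus>\<^bsub>V\<^esub> snd (c, y)"
        using that by simp
      show "p = (c, y)" if "fst p \<in> carrier K \<and> snd p \<in> spn K V ss \<and> c \<odot>\<^bsub>V\<^esub> s \<oplus>\<^bsub>V\<^esub> y = fst p \<odot>\<^bsub>V\<^esub> s \<oplus>\<^bsub>V\<^esub> snd p" for p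
        using uniq[of c y "fst p" "snd p"] that \<open>c \<in> carrier K\<close> \<open>y \<in> spn K V ss\<close> by (cases p) auto
    qed
    define L where "L x = fst (P x) \<odot>\<^bsub>X\<^esub> x0 \<oplus>\<^bsub>X\<^esub> l (snd (P x))" for x
    have L: "L (c \<odot>\<^bsub>V\<^esub> s \<oplus>\<^bsub>V\<^esub> y) = c \<odot>\<^bsub>X\<^esub> x0 \<oplus>\<^bsub>X\<^esub> l y" if "c \<in> carrier K" "y \<in> spn K V ss" for c y
      using P[OF that] by (simp add: L_def)
    have lc: "l y \<in> carrier X" if "y \<in> spn K V ss" for y using l(1) that by (auto simp: linear_on_def)
    have "linear_on K V X (spn K V (s # ss)) L"
      unfolding linear_on_def
    proof (intro conjI ballI)
      show "L \<in> spn K V (s # ss) \<rightarrow> carrier X" using L lc x0 by auto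
    next
      fix x y assume "x \<in> spn K V (s # ss)" "y \<in> spn K V (s # ss)"
      then obtain c d u v where *: "x = c \<odot>\<^bsub>V\<^esub> s \<oplus>\<^bsub>V\<^esub> u" "y = d \<odot>\<^bsub>V\<^esub> s \<oplus>\<^bsub>V\<^esub> v" "c \<in> carrier K" "d \<in> carrier K"
        "u \<in> spn K V ss" "v \<in> spn K V ss" by auto
      then have "x \<oplus>\<^bsub>V\<^esub> y = (c \<oplus>\<^bsub>K\<^esub> d) \<odot>\<^bsub>V\<^esub> s \<oplus>\<^bsub>V\<^esub> (u \<oplus>\<^bsub>V\<^esub> v)" using D(2) s by (simp add: s_add1 a_ac)
      moreover have "l (u \<oplus>\<^bsub>V\<^esub> v) = l u \<oplus>\<^bsub>X\<^esub> l v" using l(1) * by (auto simp: linear_on_def)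
      ultimately show "L (x \<oplus>\<^bsub>V\<^esub> y) = L x \<oplus>\<^bsub>X\<^esub> L y" using * L D(4) lc x0 by (simp add: X.s_add1 X.a_ac)
    next
      fix d x assume d: "d \<in> carrier K" and "x \<in> spn K V (s # ss)"
      then obtain c u where *: "x = c \<odot>\<^bsub>V\<^esub> s \<oplus>\<^bsub>V\<^esub> u" "c \<in> carrier K" "u \<in> spn K V ss" by auto
      then have "d \<odot>\<^bsub>V\<^esub> x = (d \<otimes>\<^bsub>K\<^esub> c) \<odot>\<^bsub>V\<^esub> s \<oplus>\<^bsub>V\<^esub> (d \<odot>\<^bsub>V\<^esub> u)" using D(2) s d by (simp add: s_add2 s_assoc)
      moreover have "l (d \<odot>\<^bsub>V\<^esub> u) = d \<odot>\<^bsub>X\<^esub> l u" using l(1) * d by (auto simp: linear_on_def)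
      ultimately show "L (d \<odot>\<^bsub>V\<^esub> x) = d \<odot>\<^bsub>X\<^esub> L x" using * L D(5) lc x0 d by (simp add: X.s_add2 X.s_assoc)
    qed
    moreover have "g (L x) = h x" if "x \<in> spn K V (s # ss)" for x
    proof -
      from that obtain c u where *: "x = c \<odot>\<^bsub>V\<^esub> s \<oplus>\<^bsub>V\<^esub> u" "c \<in> carrier K" "u \<in> spn K V ss" unfolding spn.simps by blast
      have g: "g (c \<odot>\<^bsub>X\<^esub> x0 \<oplus>\<^bsub>X\<^esub> l u) = c \<odot>\<^bsub>Y\<^esub> g x0 \<oplus>\<^bsub>Y\<^esub> g (l u)"
        using assms(3) * lc x0 by (simp add: linear_on_def)
      have "s \<in> spn K V (s # ss)" "u \<in> spn K V (s # ss)" "c \<odot>\<^bsub>V\<^esub> s \<in> spn K V (s # ss)"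
        using spn_base[of "s # ss"] Cons.prems * sub vsubD(5)[OF vsub_spn[of "s # ss"]] by auto
      then have "h x = c \<odot>\<^bsub>Y\<^esub> h s \<oplus>\<^bsub>Y\<^esub> h u"
        using Cons.prems(2) * unfolding linear_on_def by metis
      with g L * l x0 show ?thesis by simp
    qed
    ultimately show ?thesis by blast
  qed
qed

lemma fdim_iff: "fin_gen K V \<longleftrightarrow> fdim K V"
proof
  assume "fin_gen K V"
  then obtain S where S: "finite S" "S \<subseteq> carrier V" "\<And>H. \<lbrakk>submodule H K V; S \<subseteq> H\<rbrakk> \<Longrightarrow> H = carrier V"
    by (auto simp: fin_gen_def)
  obtain ss where ss: "set ss = S" using S(1) finite_list by auto
  then have H: "vsub K V (spn K V ss)" using S(2) vsub_spn by auto
  have "submodule (spn K V ss) K V"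
    unfolding submodule_def submodule_axioms_def
  proof (intro conjI allI impI)
    show "subgroup (spn K V ss) (add_monoid V)"
    proof (rule subgroup.intro)
      show "inv\<^bsub>add_monoid V\<^esub> x \<in> spn K V ss" if "x \<in> spn K V ss" for x
        using vsubD(6)[OF H that] by (simp add: a_inv_def)
    qed (use vsubD[OF H] in auto)
  qed (use vsubD[OF H] in auto)
  then have "spn K V ss = carrier V" using S(3) spn_base ss S(2) by auto
  then show "fdim K V" using ss S(2) by (auto simp: fdim_def)
next
  assume "fdim K V"
  then obtain ss where ss: "set ss \<subseteq> carrier V" "spn K V ss = carrier V" by (auto simp: fdim_def)
  have "H = carrier V" if "submodule H K V" "set ss \<subseteq> H" for H
  proof -
    have "vsub K V H" using that(1) unfolding submodule_def submodule_axioms_def subgroup_def vsub_def by auto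
    then show ?thesis using spn_least[OF _ that(2)] ss vsubD(1)[of H] by auto
  qed
  then show "fin_gen K V" using ss by (auto simp: fin_gen_def)
qed

lemma fdim_sub: "\<lbrakk>fdim K V; vsub K V H\<rbrakk> \<Longrightarrow> \<exists>ts. set ts \<subseteq> H \<and> spn K V ts = H"
  using spn_of_vsub[of H] vsubD(1)[of H] unfolding fdim_def by metis

lemma fdim_image:
  assumes "fdim K V" "linear_on K V W (carrier V) f" "vspace W K" "f ` carrier V = carrier W"
  shows "fdim K W"
proof -
  obtain ss where ss: "set ss \<subseteq> carrier V" "spn K V ss = carrier V" using assms(1) by (auto simp: fdim_def)
  then have "spn K W (map f ss) = carrier W" using linear_on_spn[OF assms(2,3), of ss] assms(4) by simp
  moreover have "set (map f ss) \<subseteq> carrier W" using ss assms(2) by (auto simp: linear_on_def)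
  ultimately show ?thesis unfolding fdim_def by blast
qed

end

lemma spn_cong: "\<lbrakk>zero V = zero W; add V = add W; smult V = smult W\<rbrakk> \<Longrightarrow> spn K V ss = spn K W ss"
  by (induction ss) auto


section \<open>Finite-dimensional bimodules\<close>

definition kspace :: "('k, 'a) module \<Rightarrow> ('a, 'b, 'm) bimodule \<Rightarrow> ('k, 'm) module" where
  "kspace A X = \<lparr>carrier = carrier X, mult = undefined, one = undefined, zero = zero X, add = add X,
     smult = \<lambda>c x. scal A c \<odot>\<^bsub>X\<^esub> x\<rparr>"

lemma kspace_simps [simp]:
  "carrier (kspace A X) = carrier X" "zero (kspace A X) = zero X" "add (kspace A X) = add X"
  "smult (kspace A X) c x = scal A c \<odot>\<^bsub>X\<^esub> x"
  by (simp_all add: kspace_def)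

locale fbim = bim X K A B for X :: "('a, 'b, 'm) bimodule" and K :: "('k, 'z) ring_scheme"
    and A :: "('k, 'a) module" and B :: "('k, 'b) module" +
  assumes fdim: "fdim K (kspace A X)"

lemma fbim_iff: "fbim X K A B \<longleftrightarrow> bim X K A B \<and> fdim K (kspace A X)"
  by (simp add: fbim_def fbim_axioms_def)

lemma (in fd_algebra) vspace_algebra: "vspace A K"
  unfolding vspace_def vspace_axioms_def
  by (simp add: A.is_abelian_group field_K smult_l_distr smult_r_distr smult_assoc1)

lemma (in fd_algebra) fdim_algebra: "fdim K A"
  using finite_dimensional vspace.fdim_iff[OF vspace_algebra] by simp

context bim
begin

lemma vspace_kspace: "vspace (kspace A X) K"
proof -
  interpret A: fd_algebra K A by (rule fdA)
  have "abelian_group (kspace A X)" by (subst abelian_group_cong[of _ X]) (auto simp: abelian_group_axioms)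
  then show ?thesis
    unfolding vspace_def vspace_axioms_def
    by (simp add: A.field_K A.scal_add A.scal_mult l_add1 l_add2 l_assoc)
qed

lemma scal_commute: "\<lbrakk>a \<in> carrier A; c \<in> carrier K; x \<in> carrier X\<rbrakk>
  \<Longrightarrow> a \<odot>\<^bsub>X\<^esub> (scal A c \<odot>\<^bsub>X\<^esub> x) = scal A c \<odot>\<^bsub>X\<^esub> (a \<odot>\<^bsub>X\<^esub> x)"
proof -
  interpret A: fd_algebra K A by (rule fdA)
  assume "a \<in> carrier A" "c \<in> carrier K" "x \<in> carrier X"
  then show ?thesis using A.scal_mult_left[of c a] A.scal_mult_right[of c a]
    by (simp add: l_assoc[symmetric])
qed

lemma linear_left: "a \<in> carrier A \<Longrightarrow> linear_on K (kspace A X) (kspace A X) (carrier X) (\<lambda>x. a \<odot>\<^bsub>X\<^esub> x)"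
  by (simp add: linear_on_def l_add2 scal_commute)

lemma linear_right: "b \<in> carrier B \<Longrightarrow> linear_on K (kspace A X) (kspace A X) (carrier X) (\<lambda>x. rsmult X x b)"
  by (simp add: linear_on_def r_add2 lr_assoc)

lemma linear_orbit_left: "x \<in> carrier X \<Longrightarrow> linear_on K A (kspace A X) (carrier A) (\<lambda>a. a \<odot>\<^bsub>X\<^esub> x)"
proof -
  interpret A: fd_algebra K A by (rule fdA)
  assume "x \<in> carrier X"
  then show ?thesis
    by (simp add: linear_on_def l_add1 A.scal_mult_left[symmetric] l_assoc)
qed

lemma linear_orbit_right: "x \<in> carrier X \<Longrightarrow> linear_on K B (kspace A X) (carrier B) (\<lambda>b. rsmult X x b)"
proof -
  interpret B: fd_algebra K B by (rule fdB)
  assume "x \<in> carrier X"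
  then show ?thesis
    by (simp add: linear_on_def r_add1 B.scal_mult_left[symmetric] r_assoc central[symmetric] lr_assoc)
qed

lemma stable_set_vsub: "stable_set H \<Longrightarrow> vsub K (kspace A X) H"
  by (auto simp: stable_set_def vsub_def)

lemma fg_bimodule_iff: "fg_bimodule K A B X \<longleftrightarrow> fdim K (kspace A X)"
proof
  interpret A: fd_algebra K A by (rule fdA)
  interpret B: fd_algebra K B by (rule fdB)
  interpret V: vspace "kspace A X" K by (rule vspace_kspace)
  assume "fg_bimodule K A B X"
  then obtain S where S: "finite S" "S \<subseteq> carrier X" "\<And>H. \<lbrakk>stable_set H; S \<subseteq> H\<rbrakk> \<Longrightarrow> H = carrier X"
    unfolding fg_bimodule_def subbimodule_iff by blast
  obtain ss where ss: "set ss = S" using S(1) finite_list by auto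
  obtain as where as: "set as \<subseteq> carrier A" "spn K A as = carrier A" using A.fdim_algebra by (auto simp: fdim_def)
  obtain bs where bs: "set bs \<subseteq> carrier B" "spn K B bs = carrier B" using B.fdim_algebra by (auto simp: fdim_def)
  define f where "f = (\<lambda>(a, s, b). a \<odot>\<^bsub>X\<^esub> rsmult X s b)"
  define T where "T = map f (List.product as (List.product ss bs))"
  have setT: "set T = f ` (set as \<times> set ss \<times> set bs)" by (simp add: T_def)
  have cT: "set T \<subseteq> carrier X" unfolding setT f_def using as bs S ss
    by (auto simp: subset_iff intro!: l_closed r_closed)
  define H where "H = spn K (kspace A X) T"
  have vH: "vsub K (kspace A X) H" unfolding H_def using V.vsub_spn[of T] cT by simp
  note D = V.vsubD[OF vH, simplified]
  have base: "set T \<subseteq> H" unfolding H_def using V.spn_base[of T] cT by simp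
  have orb_l: "a \<odot>\<^bsub>X\<^esub> rsmult X s b \<in> H" if "a \<in> carrier A" "s \<in> set ss" "b \<in> set bs" for a s b
  proof -
    have sb: "rsmult X s b \<in> carrier X" using that S ss bs by auto
    have "a \<odot>\<^bsub>X\<^esub> rsmult X s b \<in> (\<lambda>a. a \<odot>\<^bsub>X\<^esub> rsmult X s b) ` spn K A as" using as that by auto
    also have "\<dots> = spn K (kspace A X) (map (\<lambda>a. a \<odot>\<^bsub>X\<^esub> rsmult X s b) as)"
      using vspace.linear_on_spn[OF A.vspace_algebra linear_orbit_left[OF sb] vspace_kspace, of as] as by simp
    also have "\<dots> \<subseteq> H"
      by (rule V.spn_least[OF vH]) (use base setT that in \<open>force simp: f_def\<close>)
    finally show ?thesis .
  qed
  have orb: "a \<odot>\<^bsub>X\<^esub> rsmult X s b \<in> H" if "a \<in> carrier A" "s \<in> set ss" "b \<in> carrier B" for a s b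
  proof -
    have s: "s \<in> carrier X" using that S ss by auto
    then have as: "a \<odot>\<^bsub>X\<^esub> s \<in> carrier X" using that by simp
    have "a \<odot>\<^bsub>X\<^esub> rsmult X s b \<in> (\<lambda>b. rsmult X (a \<odot>\<^bsub>X\<^esub> s) b) ` spn K B bs" using bs that s by (auto simp: lr_assoc)
    also have "\<dots> = spn K (kspace A X) (map (\<lambda>b. rsmult X (a \<odot>\<^bsub>X\<^esub> s) b) bs)"
      using vspace.linear_on_spn[OF B.vspace_algebra linear_orbit_right[OF as] vspace_kspace, of bs] bs by simp
    also have "\<dots> \<subseteq> H"
      by (rule V.spn_least[OF vH]) (use orb_l that bs s in \<open>auto simp: lr_assoc subset_iff\<close>)
    finally show ?thesis .
  qed
  have lst: "f ` H \<subseteq> H" if "linear_on K (kspace A X) (kspace A X) (carrier X) f" "\<And>t. t \<in> set T \<Longrightarrow> f t \<in> H" for f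
  proof -
    have "f ` H = spn K (kspace A X) (map f T)"
      unfolding H_def using V.linear_on_spn[OF _ vspace_kspace, of f T] that(1) cT by simp
    also have "\<dots> \<subseteq> H" by (rule V.spn_least[OF vH]) (use that in auto)
    finally show ?thesis .
  qed
  have "stable_set H"
    unfolding stable_set_def
  proof (intro conjI ballI)
    fix a x assume a: "a \<in> carrier A" and x: "x \<in> H"
    have "a \<odot>\<^bsub>X\<^esub> t \<in> H" if t: "t \<in> set T" for t
    proof -
      obtain p where p: "p \<in> set as \<times> set ss \<times> set bs" "t = f p" using t unfolding setT by (rule imageE)
      obtain a' s b where *: "t = a' \<odot>\<^bsub>X\<^esub> rsmult X s b" "a' \<in> set as" "s \<in> set ss" "b \<in> set bs"
        using p by (cases p) (simp add: f_def)
      then have "a \<odot>\<^bsub>X\<^esub> t = (a \<otimes>\<^bsub>A\<^esub> a') \<odot>\<^bsub>X\<^esub> rsmult X s b" using a as bs S ss by (simp add: l_assoc subset_iff)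
      then show ?thesis using orb_l[of "a \<otimes>\<^bsub>A\<^esub> a'" s b] * a as by auto
    qed
    then show "a \<odot>\<^bsub>X\<^esub> x \<in> H" using lst[OF linear_left[OF a]] x by auto
  next
    fix b x assume b: "b \<in> carrier B" and x: "x \<in> H"
    have "rsmult X t b \<in> H" if t: "t \<in> set T" for t
    proof -
      obtain p where p: "p \<in> set as \<times> set ss \<times> set bs" "t = f p" using t unfolding setT by (rule imageE)
      obtain a' s b' where *: "t = a' \<odot>\<^bsub>X\<^esub> rsmult X s b'" "a' \<in> set as" "s \<in> set ss" "b' \<in> set bs"
        using p by (cases p) (simp add: f_def)
      then have "rsmult X t b = a' \<odot>\<^bsub>X\<^esub> rsmult X s (b' \<otimes>\<^bsub>B\<^esub> b)" using b as bs S ss by (simp add: r_assoc lr_assoc subset_iff)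
      then show ?thesis using orb[of a' s "b' \<otimes>\<^bsub>B\<^esub> b"] * b as bs by auto
    qed
    then show "rsmult X x b \<in> H" using lst[OF linear_right[OF b]] x by auto
  qed (use D in auto)
  moreover have "S \<subseteq> H"
  proof
    fix s assume "s \<in> S"
    then show "s \<in> H" using orb[of "\<one>\<^bsub>A\<^esub>" s "\<one>\<^bsub>B\<^esub>"] ss S by auto
  qed
  ultimately have "H = carrier X" by (rule S(3))
  then show "fdim K (kspace A X)" using cT unfolding H_def fdim_def by auto
next
  interpret V: vspace "kspace A X" K by (rule vspace_kspace)
  assume "fdim K (kspace A X)"
  then obtain ss where ss: "set ss \<subseteq> carrier X" "spn K (kspace A X) ss = carrier X" by (auto simp: fdim_def)
  have "bimodule K A B X" using bim_axioms bim_iff by auto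
  moreover have "H = carrier X" if "stable_set H" "set ss \<subseteq> H" for H
    using V.spn_least[OF stable_set_vsub[OF that(1)] that(2)] ss that by (auto simp: stable_set_def)
  ultimately show "fg_bimodule K A B X"
    unfolding fg_bimodule_def subbimodule_iff using ss(1) by blast
qed

end

lemma fbim_iff_fg:
  "fbim X K A B \<longleftrightarrow> fd_algebra K A \<and> fd_algebra K B \<and> fg_bimodule K A B X"
  by (metis bim.fg_bimodule_iff bim_iff fbim_iff fg_bimodule_def)

lemma (in bhom) linear_on_hom: "linear_on K (kspace A X) (kspace A Y) (carrier X) f"
  by (simp add: linear_on_def)

lemma (in fbim) fbim_sub: assumes "stable_set H" shows "fbim (X\<lparr>carrier := H\<rparr>) K A B"
proof -
  interpret V: vspace "kspace A X" K by (rule vspace_kspace)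
  obtain ts where ts: "set ts \<subseteq> H" "spn K (kspace A X) ts = H"
    using V.fdim_sub[OF fdim stable_set_vsub[OF assms]] by auto
  moreover have "spn K (kspace A X) ts = spn K (kspace A (X\<lparr>carrier := H\<rparr>)) ts"
    by (rule spn_cong) (simp_all add: kspace_def)
  ultimately have "fdim K (kspace A (X\<lparr>carrier := H\<rparr>))" by (auto simp: fdim_def)
  then show ?thesis using bim_sub[OF assms] by (simp add: fbim_iff)
qed

lemma fbim_image:
  assumes "fbim X K A B" "bim Y K A B" "f \<in> bimod_hom A B X Y" "f ` carrier X = carrier Y"
  shows "fbim Y K A B"
proof -
  interpret f: bhom K A B X Y f using assms by (auto simp: fbim_iff intro: bhomI)
  show ?thesis
    using assms vspace.fdim_image[OF f.X.vspace_kspace _ _ f.Y.vspace_kspace, of f] f.linear_on_hom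
    by (simp add: fbim_iff)
qed

lemma fbim_iso: "\<lbrakk>fbim X K A B; bim Y K A B; bimod_iso A B X Y\<rbrakk> \<Longrightarrow> fbim Y K A B"
  using fbim_image by (fastforce simp: bimod_iso_def bij_betw_def)

definition enc :: "('k, 'a) module \<Rightarrow> ('a, 'b, 'm) bimodule \<Rightarrow> ('a, 'b, 'k vec) bimodule" where
  "enc A X = transport (SOME e. inj_on e (carrier X)) X"

context fbim
begin

lemma enc_inj: "inj_on (SOME e :: 'm \<Rightarrow> 'k vec. inj_on e (carrier X)) (carrier X)"
proof -
  interpret V: vspace "kspace A X" K by (rule vspace_kspace)
  obtain ss where "spn K (kspace A X) ss = carrier X" using fdim by (auto simp: fdim_def)
  then have "\<exists>e :: 'm \<Rightarrow> 'k vec. inj_on e (carrier X)" using V.spn_inj[of ss] by simp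
  then show ?thesis by (rule someI_ex)
qed

lemma enc_iso: "bimod_iso A B X (enc A X)"
  unfolding enc_def by (rule transport_iso[OF enc_inj])

lemma enc_fbim: "fbim (enc A X) K A B"
  using fbim_iso[OF fbim_axioms _ enc_iso] transport_bim[OF enc_inj] by (simp add: enc_def)

lemma encE:
  obtains e i where "e \<in> bimod_hom A B X (enc A X)" "i \<in> bimod_hom A B (enc A X) X"
    "\<And>x. x \<in> carrier X \<Longrightarrow> i (e x) = x" "\<And>y. y \<in> carrier (enc A X) \<Longrightarrow> e (i y) = y"
  using bimod_isoE[OF enc_iso bim_axioms] by blast

end

lemma proj_iff:
  fixes P :: "('a, 'b, 'm) bimodule" and A :: "('k, 'a) module"
  assumes "fd_algebra K A" "fd_algebra K B"
  shows "fg_projective_bimodule K A B P \<longleftrightarrow> fbim P K A B \<and>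
     (\<forall>(X :: ('a, 'b, 'k vec) bimodule) (Y :: ('a, 'b, 'k vec) bimodule) g h.
        bim X K A B \<and> bim Y K A B \<and> g \<in> bimod_hom A B X Y \<and> g ` carrier X = carrier Y \<and> h \<in> bimod_hom A B P Y
        \<longrightarrow> (\<exists>l\<in>bimod_hom A B P X. \<forall>p\<in>carrier P. g (l p) = h p))"
  unfolding fg_projective_bimodule_def using assms by (simp add: fbim_iff_fg bim_iff)

locale pbim = fbim P K A B for P :: "('a, 'b, 'm) bimodule" and K :: "('k, 'z) ring_scheme" and A :: "('k, 'a) module"
    and B :: "('k, 'b) module" +
  assumes lift_vec: "\<And>(X :: ('a, 'b, 'k vec) bimodule) (Y :: ('a, 'b, 'k vec) bimodule) g h.
    \<lbrakk>bim X K A B; bim Y K A B; g \<in> bimod_hom A B X Y; g ` carrier X = carrier Y; h \<in> bimod_hom A B P Y\<rbrakk>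
    \<Longrightarrow> \<exists>l\<in>bimod_hom A B P X. \<forall>p\<in>carrier P. g (l p) = h p"

lemma pbim_iff: "pbim P K A B \<longleftrightarrow> fd_algebra K A \<and> fd_algebra K B \<and> fg_projective_bimodule K A B P"
proof (cases "fd_algebra K A \<and> fd_algebra K B")
  case True
  show ?thesis
    using True by (simp add: pbim_def pbim_axioms_def proj_iff imp_conjL)
next
  case False
  then show ?thesis by (auto simp: pbim_def fbim_iff_fg)
qed

lemma (in bim) stable_Inter:
  "\<lbrakk>\<forall>H\<in>F. stable_set H; F \<noteq> {}\<rbrakk> \<Longrightarrow> stable_set (\<Inter>F)"
  unfolding stable_set_def by (auto simp: subset_iff)

text \<open>A finitely generated module only sees finitely generated submodules of the targets, so the
  lifting property against coordinate vectors gives it against modules of any type.\<close>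

lemma (in pbim) lift:
  fixes X :: "('a, 'b, 'x) bimodule" and Y :: "('a, 'b, 'y) bimodule"
  assumes "bim X K A B" "bim Y K A B" "g \<in> bimod_hom A B X Y" "g ` carrier X = carrier Y" "h \<in> bimod_hom A B P Y"
  obtains l where "l \<in> bimod_hom A B P X" "\<And>p. p \<in> carrier P \<Longrightarrow> g (l p) = h p"
proof -
  interpret g: bhom K A B X Y g using assms by (intro bhomI)
  interpret h: bhom K A B P Y h using assms bim_axioms by (intro bhomI)
  obtain S where S: "finite S" "S \<subseteq> carrier P" "\<And>H. \<lbrakk>stable_set H; S \<subseteq> H\<rbrakk> \<Longrightarrow> H = carrier P"
  proof -
    have "fg_bimodule K A B P" using fdim fg_bimodule_iff by simp
    then have "\<exists>S. finite S \<and> S \<subseteq> carrier P \<and> (\<forall>H. stable_set H \<and> S \<subseteq> H \<longrightarrow> H = carrier P)"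
      unfolding fg_bimodule_def subbimodule_iff by simp
    then show ?thesis using that by auto
  qed
  have "\<forall>s\<in>S. \<exists>x. x \<in> carrier X \<and> g x = h s"
  proof
    fix s assume "s \<in> S"
    then have "h s \<in> carrier Y" using S(2) h.closed by auto
    then show "\<exists>x. x \<in> carrier X \<and> g x = h s" using g.surjE[OF assms(4)] by metis
  qed
  then have "\<exists>x. \<forall>s\<in>S. x s \<in> carrier X \<and> g (x s) = h s" by (rule bchoice)
  then obtain x where x: "\<And>s. s \<in> S \<Longrightarrow> x s \<in> carrier X \<and> g (x s) = h s" by auto
  define X0 where "X0 = \<Inter>{H. g.X.stable_set H \<and> x ` S \<subseteq> H}"
  have car: "g.X.stable_set (carrier X)" by (auto simp: g.X.stable_set_def)
  have X0: "g.X.stable_set X0"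
    unfolding X0_def by (rule g.X.stable_Inter) (use car x in auto)
  have xX0: "x ` S \<subseteq> X0" by (auto simp: X0_def)
  let ?X0 = "X\<lparr>carrier := X0\<rparr>" and ?Y0 = "Y\<lparr>carrier := g ` X0\<rparr>"
  interpret X0: bim ?X0 K A B by (rule g.X.bim_sub[OF X0])
  have "H = X0" if "X0.stable_set H" "x ` S \<subseteq> H" for H
  proof
    show "H \<subseteq> X0" using that by (auto simp: X0.stable_set_def)
    have "g.X.stable_set H" using that X0 unfolding X0.stable_set_def g.X.stable_set_def by auto
    then show "X0 \<subseteq> H" using that(2) by (auto simp: X0_def)
  qed
  then have "fg_bimodule K A B ?X0"
    unfolding fg_bimodule_def X0.subbimodule_iff using S(1) xX0 X0.bim_axioms bim_iff
    by (metis (no_types, lifting) finite_imageI partial_object.select_convs(1) partial_object.surjective partial_object.update_convs(1))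
  then interpret X0: fbim ?X0 K A B using fdA fdB by (simp add: fbim_iff_fg)
  have Y0: "g.Y.stable_set (g ` X0)" using g.stable_image X0 .
  have bY0: "bim ?Y0 K A B" using g.Y.bim_sub[OF Y0] .
  have XX: "u \<in> carrier X" if "u \<in> X0" for u using X0 that by (auto simp: g.X.stable_set_def)
  have gh: "g \<in> bimod_hom A B ?X0 ?Y0"
    by (rule bimod_homI) (auto simp: XX)
  then interpret Y0: fbim ?Y0 K A B
    by (intro fbim_image[OF X0.fbim_axioms bY0]) auto
  have "{p \<in> carrier P. h p \<in> g ` X0} = carrier P"
  proof (rule S(3)[OF h.stable_vimage[OF Y0]])
    show "S \<subseteq> {p \<in> carrier P. h p \<in> g ` X0}"
    proof
      fix s assume s: "s \<in> S"
      then have "h s = g (x s)" "x s \<in> X0" using x xX0 by auto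
      then show "s \<in> {p \<in> carrier P. h p \<in> g ` X0}" using s S(2) by auto
    qed
  qed
  then have hY0: "h \<in> bimod_hom A B P ?Y0"
    by (intro bimod_homI) auto
  obtain e i where e: "e \<in> bimod_hom A B ?X0 (enc A ?X0)" "i \<in> bimod_hom A B (enc A ?X0) ?X0"
    "\<And>x. x \<in> X0 \<Longrightarrow> i (e x) = x" "\<And>y. y \<in> carrier (enc A ?X0) \<Longrightarrow> e (i y) = y"
    using X0.encE by auto
  obtain e' i' where e': "e' \<in> bimod_hom A B ?Y0 (enc A ?Y0)" "i' \<in> bimod_hom A B (enc A ?Y0) ?Y0"
    "\<And>x. x \<in> g ` X0 \<Longrightarrow> i' (e' x) = x" "\<And>y. y \<in> carrier (enc A ?Y0) \<Longrightarrow> e' (i' y) = y"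
    using Y0.encE by auto
  have surj: "(e' \<circ> g \<circ> i) ` carrier (enc A ?X0) = carrier (enc A ?Y0)"
  proof (intro equalityI subsetI)
    fix y assume "y \<in> (e' \<circ> g \<circ> i) ` carrier (enc A ?X0)"
    then show "y \<in> carrier (enc A ?Y0)"
      using bimod_hom_closed[OF e(2)] bimod_hom_closed[OF e'(1)] by auto
  next
    fix y assume y: "y \<in> carrier (enc A ?Y0)"
    then have "i' y \<in> g ` X0" using e'(2) by (auto simp: bimod_hom_iff)
    then obtain u where u: "u \<in> X0" "i' y = g u" by auto
    then have "(e' \<circ> g \<circ> i) (e u) = y" using e e' y by simp (metis)
    moreover have "e u \<in> carrier (enc A ?X0)" using e(1) u by (auto simp: bimod_hom_iff)
    ultimately show "y \<in> (e' \<circ> g \<circ> i) ` carrier (enc A ?X0)" by (metis imageI)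
  qed
  have "\<exists>l\<in>bimod_hom A B P (enc A ?X0). \<forall>p\<in>carrier P. (e' \<circ> g \<circ> i) (l p) = (e' \<circ> h) p"
    by (rule lift_vec[OF _ _ _ surj])
      (use X0.enc_fbim Y0.enc_fbim fbim.axioms(1) bimod_hom_comp[OF bimod_hom_comp[OF e(2) gh] e'(1)]
           bimod_hom_comp[OF hY0 e'(1)] in \<open>auto simp: comp_def\<close>)
  then obtain l where l: "l \<in> bimod_hom A B P (enc A ?X0)" "\<And>p. p \<in> carrier P \<Longrightarrow> e' (g (i (l p))) = e' (h p)" by auto
  have il: "i (l p) \<in> X0" if "p \<in> carrier P" for p using l(1) e(2) that by (auto simp: bimod_hom_iff)
  have "i \<circ> l \<in> bimod_hom A B P ?X0" using bimod_hom_comp[OF l(1) e(2)] .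
  then have "i \<circ> l \<in> bimod_hom A B P X" using il XX by (auto simp: bimod_hom_iff)
  moreover have "g ((i \<circ> l) p) = h p" if "p \<in> carrier P" for p
  proof -
    have "h p \<in> g ` X0" using hY0 that by (auto simp: bimod_hom_iff)
    moreover have "g (i (l p)) \<in> g ` X0" using il that by auto
    ultimately show ?thesis using l(2)[OF that] e'(3) by (metis comp_apply)
  qed
  ultimately show ?thesis using that by blast
qed

lemma pbim_retract:
  fixes P :: "('a, 'b, 'p) bimodule" and X :: "('a, 'b, 'x) bimodule" and A :: "('k, 'a) module"
  assumes "pbim P K A B" "bim X K A B" "r \<in> bimod_hom A B P X" "s \<in> bimod_hom A B X P"
    "\<And>x. x \<in> carrier X \<Longrightarrow> r (s x) = x"
  shows "pbim X K A B"
proof -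
  interpret P: pbim P K A B by fact
  have "r ` carrier P = carrier X"
  proof (intro equalityI subsetI)
    fix x assume "x \<in> carrier X"
    then show "x \<in> r ` carrier P" using assms(5) bimod_hom_closed[OF assms(4)] by (metis imageI)
  qed (use bimod_hom_closed[OF assms(3)] in auto)
  then have "fbim X K A B" by (rule fbim_image[OF P.fbim_axioms assms(2,3)])
  moreover have "\<exists>l\<in>bimod_hom A B X Y. \<forall>p\<in>carrier X. g (l p) = h p"
    if *: "bim Y K A B" "bim Z K A B" "g \<in> bimod_hom A B Y Z" "g ` carrier Y = carrier Z" "h \<in> bimod_hom A B X Z"
    for Y Z :: "('a, 'b, 'k vec) bimodule" and g h
  proof -
    obtain l where l: "l \<in> bimod_hom A B P Y" "\<And>p. p \<in> carrier P \<Longrightarrow> g (l p) = (h \<circ> r) p"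
      using P.lift[OF *(1-4) bimod_hom_comp[OF assms(3) *(5)]] by blast
    have "s x \<in> carrier P" if "x \<in> carrier X" for x using assms(4) that by (auto simp: bimod_hom_iff)
    then show ?thesis
      using bimod_hom_comp[OF assms(4) l(1)] l(2) assms(5) by (intro bexI[of _ "l \<circ> s"]) auto
  qed
  ultimately show ?thesis unfolding pbim_def pbim_axioms_def by blast
qed

lemma pbim_iso: "\<lbrakk>pbim P K A B; bim X K A B; bimod_iso A B P X\<rbrakk> \<Longrightarrow> pbim X K A B"
  by (rule bimod_isoE[of A B P X K]) (auto intro: pbim_retract[of P K A B X] dest: pbim.axioms(1) fbim.axioms(1))

lemma pbim_iso': "\<lbrakk>pbim P K A B; bim X K A B; bimod_iso A B X P\<rbrakk> \<Longrightarrow> pbim X K A B"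
  using pbim_iso bimod_iso_sym by blast


section \<open>Direct sums, short exact sequences and syzygies\<close>

definition vpair :: "'k vec \<Rightarrow> 'k vec \<Rightarrow> 'k vec" where
  "vpair f g n = (if even n then f (n div 2) else g (n div 2))"
definition vfst :: "'k vec \<Rightarrow> 'k vec" where "vfst h n = h (2 * n)"
definition vsnd :: "'k vec \<Rightarrow> 'k vec" where "vsnd h n = h (2 * n + 1)"

lemma vpair_simps [simp]: "vfst (vpair f g) = f" "vsnd (vpair f g) = g" "vpair (vfst h) (vsnd h) = h"
  by (auto simp: vpair_def vfst_def vsnd_def fun_eq_iff elim!: evenE oddE)

lemma vpair_eq_iff: "vpair f g = vpair f' g' \<longleftrightarrow> f = f' \<and> g = g'"
  by (metis vpair_simps(1,2))

lemma vec_eqI: "\<lbrakk>vfst u = vfst v; vsnd u = vsnd v\<rbrakk> \<Longrightarrow> u = v"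
  by (metis vpair_simps(3))

definition dsum :: "('a, 'b, 'k vec) bimodule \<Rightarrow> ('a, 'b, 'k vec) bimodule \<Rightarrow> ('a, 'b, 'k vec) bimodule" where
  "dsum X Y = \<lparr>carrier = {u. vfst u \<in> carrier X \<and> vsnd u \<in> carrier Y}, mult = undefined, one = undefined,
     zero = vpair \<zero>\<^bsub>X\<^esub> \<zero>\<^bsub>Y\<^esub>, add = \<lambda>u v. vpair (vfst u \<oplus>\<^bsub>X\<^esub> vfst v) (vsnd u \<oplus>\<^bsub>Y\<^esub> vsnd v),
     smult = \<lambda>a u. vpair (a \<odot>\<^bsub>X\<^esub> vfst u) (a \<odot>\<^bsub>Y\<^esub> vsnd u),
     rsmult = \<lambda>u b. vpair (rsmult X (vfst u) b) (rsmult Y (vsnd u) b)\<rparr>"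

lemma dsum_simps [simp]:
  "u \<in> carrier (dsum X Y) \<longleftrightarrow> vfst u \<in> carrier X \<and> vsnd u \<in> carrier Y"
  "\<zero>\<^bsub>dsum X Y\<^esub> = vpair \<zero>\<^bsub>X\<^esub> \<zero>\<^bsub>Y\<^esub>"
  "u \<oplus>\<^bsub>dsum X Y\<^esub> v = vpair (vfst u \<oplus>\<^bsub>X\<^esub> vfst v) (vsnd u \<oplus>\<^bsub>Y\<^esub> vsnd v)"
  "a \<odot>\<^bsub>dsum X Y\<^esub> u = vpair (a \<odot>\<^bsub>X\<^esub> vfst u) (a \<odot>\<^bsub>Y\<^esub> vsnd u)"
  "rsmult (dsum X Y) u b = vpair (rsmult X (vfst u) b) (rsmult Y (vsnd u) b)"
  by (simp_all add: dsum_def)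

lemma bim_dsum:
  assumes "bim X K A B" "bim Y K A B" shows "bim (dsum X Y) K A B"
proof -
  interpret X: bim X K A B by fact
  interpret Y: bim Y K A B by fact
  have "abelian_group (dsum X Y)"
  proof (rule abelian_groupI)
    fix u assume "u \<in> carrier (dsum X Y)"
    then show "\<exists>v\<in>carrier (dsum X Y). v \<oplus>\<^bsub>dsum X Y\<^esub> u = \<zero>\<^bsub>dsum X Y\<^esub>"
      by (intro bexI[of _ "vpair (\<ominus>\<^bsub>X\<^esub> vfst u) (\<ominus>\<^bsub>Y\<^esub> vsnd u)"]) (auto simp: X.l_neg Y.l_neg)
  qed (auto simp: X.a_ac Y.a_ac)
  then show ?thesis
    unfolding bim_def bim_axioms_def
    by (simp add: X.fdA X.fdB X.l_add1 X.l_add2 X.r_add1 X.r_add2 X.l_assoc X.r_assoc X.lr_assoc X.central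
        Y.l_add1 Y.l_add2 Y.r_add1 Y.r_add2 Y.l_assoc Y.r_assoc Y.lr_assoc Y.central)
qed

lemma dsum_fst: "vfst \<in> bimod_hom A B (dsum X Y) X" and dsum_snd: "vsnd \<in> bimod_hom A B (dsum X Y) Y"
  by (auto simp: bimod_hom_iff)

lemma dsum_inl: "\<lbrakk>bim X K A B; bim Y K A B\<rbrakk> \<Longrightarrow> (\<lambda>x. vpair x \<zero>\<^bsub>Y\<^esub>) \<in> bimod_hom A B X (dsum X Y)"
  and dsum_inr: "\<lbrakk>bim X K A B; bim Y K A B\<rbrakk> \<Longrightarrow> (\<lambda>y. vpair \<zero>\<^bsub>X\<^esub> y) \<in> bimod_hom A B Y (dsum X Y)"
proof -
  assume "bim X K A B" "bim Y K A B"
  interpret X: bim X K A B by fact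
  interpret Y: bim Y K A B by fact
  show "(\<lambda>x. vpair x \<zero>\<^bsub>Y\<^esub>) \<in> bimod_hom A B X (dsum X Y)" "(\<lambda>y. vpair \<zero>\<^bsub>X\<^esub> y) \<in> bimod_hom A B Y (dsum X Y)"
    by (auto simp: bimod_hom_iff)
qed

lemma hom_plus:
  assumes "bim Z K A B" "f \<in> bimod_hom A B X Z" "g \<in> bimod_hom A B X Z"
  shows "(\<lambda>x. f x \<oplus>\<^bsub>Z\<^esub> g x) \<in> bimod_hom A B X Z"
proof -
  interpret Z: bim Z K A B by fact
  note c = bimod_hom_closed[OF assms(2)] bimod_hom_closed[OF assms(3)]
  show ?thesis using assms(2,3) by (auto simp: bimod_hom_iff c Z.a_ac Z.l_add2 Z.r_add2)
qed

lemma hom_uminus: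
  assumes "bim Z K A B" "f \<in> bimod_hom A B X Z" shows "(\<lambda>x. \<ominus>\<^bsub>Z\<^esub> f x) \<in> bimod_hom A B X Z"
proof -
  interpret Z: bim Z K A B by fact
  note c = bimod_hom_closed[OF assms(2)]
  show ?thesis using assms(2) by (auto simp: bimod_hom_iff c Z.minus_add Z.l_neg_r Z.r_neg_l Z.a_comm)
qed

lemma hom_diff:
  assumes "bim Z K A B" "f \<in> bimod_hom A B X Z" "g \<in> bimod_hom A B X Z"
  shows "(\<lambda>x. f x \<ominus>\<^bsub>Z\<^esub> g x) \<in> bimod_hom A B X Z"
  unfolding a_minus_def by (rule hom_plus[OF assms(1,2) hom_uminus[OF assms(1,3)]])

lemma hom_zero: "\<lbrakk>bim Z K A B\<rbrakk> \<Longrightarrow> (\<lambda>x. \<zero>\<^bsub>Z\<^esub>) \<in> bimod_hom A B X Z"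
proof -
  assume "bim Z K A B"
  interpret Z: bim Z K A B by fact
  show ?thesis by (auto simp: bimod_hom_iff)
qed

lemma dsum_copair:
  assumes "bim Z K A B" "f \<in> bimod_hom A B X Z" "g \<in> bimod_hom A B Y Z"
  shows "(\<lambda>u. f (vfst u) \<oplus>\<^bsub>Z\<^esub> g (vsnd u)) \<in> bimod_hom A B (dsum X Y) Z"
  using hom_plus[OF assms(1) bimod_hom_comp[OF dsum_fst assms(2)] bimod_hom_comp[OF dsum_snd assms(3)]] by simp

lemma dsum_pair:
  assumes "f \<in> bimod_hom A B Z X" "g \<in> bimod_hom A B Z Y"
  shows "(\<lambda>z. vpair (f z) (g z)) \<in> bimod_hom A B Z (dsum X Y)"
  using assms by (auto simp: bimod_hom_iff)

lemma (in fbim) generators: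
  obtains S where "finite S" "S \<subseteq> carrier X" "\<forall>H. stable_set H \<and> S \<subseteq> H \<longrightarrow> H = carrier X"
proof -
  have "fg_bimodule K A B X" using fdim fg_bimodule_iff by simp
  then have "\<exists>S. finite S \<and> S \<subseteq> carrier X \<and> (\<forall>H. stable_set H \<and> S \<subseteq> H \<longrightarrow> H = carrier X)"
    unfolding fg_bimodule_def subbimodule_iff by simp
  then show ?thesis using that by blast
qed

lemma fbim_dsum:
  assumes "fbim X K A B" "fbim Y K A B" shows "fbim (dsum X Y) K A B"
proof -
  interpret X: fbim X K A B by fact
  interpret Y: fbim Y K A B by fact
  interpret D: bim "dsum X Y" K A B by (rule bim_dsum) unfold_locales
  have l: "bhom K A B X (dsum X Y) (\<lambda>x. vpair x \<zero>\<^bsub>Y\<^esub>)"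
    by (intro bhomI dsum_inl) unfold_locales
  have r: "bhom K A B Y (dsum X Y) (\<lambda>y. vpair \<zero>\<^bsub>X\<^esub> y)"
    by (intro bhomI dsum_inr) unfold_locales
  obtain S where S: "finite S" "S \<subseteq> carrier X" "\<forall>H. X.stable_set H \<and> S \<subseteq> H \<longrightarrow> H = carrier X"
    by (rule X.generators)
  obtain T where T: "finite T" "T \<subseteq> carrier Y" "\<forall>H. Y.stable_set H \<and> T \<subseteq> H \<longrightarrow> H = carrier Y"
    by (rule Y.generators)
  let ?G = "(\<lambda>x. vpair x \<zero>\<^bsub>Y\<^esub>) ` S \<union> (\<lambda>y. vpair \<zero>\<^bsub>X\<^esub> y) ` T"
  have "H = carrier (dsum X Y)" if H: "D.stable_set H" "?G \<subseteq> H" for H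
  proof
    show "H \<subseteq> carrier (dsum X Y)" using H by (auto simp: D.stable_set_def)
    have 1: "{x \<in> carrier X. vpair x \<zero>\<^bsub>Y\<^esub> \<in> H} = carrier X"
      by (rule S(3)[rule_format, OF conjI[OF bhom.stable_vimage[OF l H(1)]]]) (use S(2) H(2) in auto)
    have 2: "{y \<in> carrier Y. vpair \<zero>\<^bsub>X\<^esub> y \<in> H} = carrier Y"
      by (rule T(3)[rule_format, OF conjI[OF bhom.stable_vimage[OF r H(1)]]]) (use T(2) H(2) in auto)
    show "carrier (dsum X Y) \<subseteq> H"
    proof
      fix u assume u: "u \<in> carrier (dsum X Y)"
      then have "vpair (vfst u) \<zero>\<^bsub>Y\<^esub> \<in> H" "vpair \<zero>\<^bsub>X\<^esub> (vsnd u) \<in> H" using 1 2 by auto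
      then have "vpair (vfst u) \<zero>\<^bsub>Y\<^esub> \<oplus>\<^bsub>dsum X Y\<^esub> vpair \<zero>\<^bsub>X\<^esub> (vsnd u) \<in> H" using H(1) unfolding D.stable_set_def by blast
      then show "u \<in> H" using u by simp
    qed
  qed
  moreover have "finite ?G" "?G \<subseteq> carrier (dsum X Y)" using S T by auto
  ultimately have "fg_bimodule K A B (dsum X Y)"
    unfolding fg_bimodule_def D.subbimodule_iff using D.bim_axioms bim_iff by metis
  then show ?thesis using X.fdA X.fdB by (simp add: fbim_iff_fg)
qed

lemma pbim_dsum:
  assumes "pbim P K A B" "pbim Q K A B" shows "pbim (dsum P Q) K A B"
proof -
  interpret P: pbim P K A B by fact
  interpret Q: pbim Q K A B by fact
  have "\<exists>l\<in>bimod_hom A B (dsum P Q) Y. \<forall>p\<in>carrier (dsum P Q). g (l p) = h p"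
    if *: "bim Y K A B" "bim Z K A B" "g \<in> bimod_hom A B Y Z" "g ` carrier Y = carrier Z" "h \<in> bimod_hom A B (dsum P Q) Z"
    for Y Z g h
  proof -
    interpret g: bhom K A B Y Z g using * by (intro bhomI)
    have D: "bim (dsum P Q) K A B" by (rule bim_dsum) unfold_locales
    interpret h: bhom K A B "dsum P Q" Z h using * D by (intro bhomI)
    obtain l where l: "l \<in> bimod_hom A B P Y" "\<And>p. p \<in> carrier P \<Longrightarrow> g (l p) = (h \<circ> (\<lambda>x. vpair x \<zero>\<^bsub>Q\<^esub>)) p"
      using P.lift[OF *(1-4) bimod_hom_comp[OF dsum_inl[OF P.bim_axioms Q.bim_axioms] *(5)]] by blast
    obtain m where m: "m \<in> bimod_hom A B Q Y" "\<And>p. p \<in> carrier Q \<Longrightarrow> g (m p) = (h \<circ> (\<lambda>x. vpair \<zero>\<^bsub>P\<^esub> x)) p"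
      using Q.lift[OF *(1-4) bimod_hom_comp[OF dsum_inr[OF P.bim_axioms Q.bim_axioms] *(5)]] by blast
    show ?thesis
    proof (intro bexI[OF _ dsum_copair[OF *(1) l(1) m(1)]] ballI)
      fix u assume u: "u \<in> carrier (dsum P Q)"
      have "u = vpair (vfst u) \<zero>\<^bsub>Q\<^esub> \<oplus>\<^bsub>dsum P Q\<^esub> vpair \<zero>\<^bsub>P\<^esub> (vsnd u)" using u by simp
      then have "h u = h (vpair (vfst u) \<zero>\<^bsub>Q\<^esub>) \<oplus>\<^bsub>Z\<^esub> h (vpair \<zero>\<^bsub>P\<^esub> (vsnd u))"
        using h.add[of "vpair (vfst u) \<zero>\<^bsub>Q\<^esub>" "vpair \<zero>\<^bsub>P\<^esub> (vsnd u)"] u by simp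
      then show "g (l (vfst u) \<oplus>\<^bsub>Y\<^esub> m (vsnd u)) = h u"
        using u l m bimod_hom_closed[OF l(1)] bimod_hom_closed[OF m(1)] by simp
    qed
  qed
  moreover have "fbim (dsum P Q) K A B" by (rule fbim_dsum) unfold_locales
  ultimately show ?thesis unfolding pbim_def pbim_axioms_def by blast
qed

lemma pbim_summand:
  assumes "pbim (dsum P Q) K A B" "bim P K A B" "bim Q K A B" shows "pbim P K A B"
  by (rule pbim_retract[OF assms(1,2) dsum_fst dsum_inl[OF assms(2,3)]]) simp

lemma iso_dsum_cong:
  assumes "bim X K A B" "bim Y K A B" "bimod_iso A B X X'" "bimod_iso A B Y Y'"
  shows "bimod_iso A B (dsum X Y) (dsum X' Y')"
proof -
  obtain f g where f: "f \<in> bimod_hom A B X X'" "g \<in> bimod_hom A B X' X"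
    "\<And>x. x \<in> carrier X \<Longrightarrow> g (f x) = x" "\<And>y. y \<in> carrier X' \<Longrightarrow> f (g y) = y"
    using bimod_isoE[OF assms(3,1)] by blast
  obtain f' g' where f': "f' \<in> bimod_hom A B Y Y'" "g' \<in> bimod_hom A B Y' Y"
    "\<And>x. x \<in> carrier Y \<Longrightarrow> g' (f' x) = x" "\<And>y. y \<in> carrier Y' \<Longrightarrow> f' (g' y) = y"
    using bimod_isoE[OF assms(4,2)] by blast
  show ?thesis
  proof (rule bimod_isoI)
    show "(\<lambda>u. vpair (f (vfst u)) (f' (vsnd u))) \<in> bimod_hom A B (dsum X Y) (dsum X' Y')"
      using dsum_pair[OF bimod_hom_comp[OF dsum_fst f(1)] bimod_hom_comp[OF dsum_snd f'(1)]] by simp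
  next
    show "(\<lambda>u. vpair (g (vfst u)) (g' (vsnd u))) \<in> carrier (dsum X' Y') \<rightarrow> carrier (dsum X Y)"
      using f(2) f'(2) by (auto simp: bimod_hom_closed)
  qed (simp_all add: f f')
qed

lemma iso_dsum_assoc: "bimod_iso A B (dsum (dsum X Y) Z) (dsum X (dsum Y Z))"
  by (rule bimod_isoI[of "\<lambda>u. vpair (vfst (vfst u)) (vpair (vsnd (vfst u)) (vsnd u))" _ _ _ _
        "\<lambda>u. vpair (vpair (vfst u) (vfst (vsnd u))) (vsnd (vsnd u))"])
     (auto simp: bimod_hom_iff)

lemma iso_dsum_swap: "bimod_iso A B (dsum (dsum X Y) Z) (dsum (dsum X Z) Y)"
  by (rule bimod_isoI[of "\<lambda>u. vpair (vpair (vfst (vfst u)) (vsnd u)) (vsnd (vfst u))" _ _ _ _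
        "\<lambda>u. vpair (vpair (vfst (vfst u)) (vsnd u)) (vsnd (vfst u))"])
     (auto simp: bimod_hom_iff)

definition zbim :: "('a, 'b, 'k vec) bimodule" where
  "zbim = \<lparr>carrier = {\<lambda>_. undefined}, mult = undefined, one = undefined, zero = \<lambda>_. undefined,
     add = \<lambda>x y. \<lambda>_. undefined, smult = \<lambda>a x. \<lambda>_. undefined, rsmult = \<lambda>x b. \<lambda>_. undefined\<rparr>"

lemma pbim_zbim:
  fixes A :: "('k, 'a) module" and B :: "('k, 'b) module"
  assumes "fd_algebra K A" "fd_algebra K B" shows "pbim (zbim :: ('a, 'b, 'k vec) bimodule) K A B" (is "pbim ?z K A B")
proof -
  have "abelian_group ?z" by (rule abelian_groupI) (auto simp: zbim_def)
  then interpret Z: bim ?z K A B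
    unfolding bim_def bim_axioms_def by (simp add: assms) (simp add: zbim_def)
  have "fdim K (kspace A ?z)" by (auto simp: fdim_def zbim_def kspace_def intro!: exI[of _ "[]"])
  then interpret Z: fbim ?z K A B by unfold_locales
  have "\<exists>l\<in>bimod_hom A B ?z Y. \<forall>p\<in>carrier ?z. g (l p) = h p"
    if *: "bim Y K A B" "bim Z K A B" "g \<in> bimod_hom A B Y Z" "h \<in> bimod_hom A B ?z Z" for Y Z :: "('a, 'b, 'k vec) bimodule" and g h
  proof -
    interpret g: bhom K A B Y Z g using * by (intro bhomI)
    interpret h: bhom K A B ?z Z h using * Z.bim_axioms by (intro bhomI)
    have "h p = \<zero>\<^bsub>Z\<^esub>" if "p \<in> carrier ?z" for p using h.zero that by (simp add: zbim_def)
    then show ?thesis by (intro bexI[OF _ hom_zero[OF *(1)]]) auto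
  qed
  then show ?thesis unfolding pbim_def pbim_axioms_def using Z.fbim_axioms by blast
qed

lemma fbim_bim: "fbim X K A B \<Longrightarrow> bim X K A B" by (rule fbim.axioms(1))
lemma pbim_fbim: "pbim X K A B \<Longrightarrow> fbim X K A B" by (rule pbim.axioms(1))
lemma pbim_bim: "pbim X K A B \<Longrightarrow> bim X K A B" by (rule fbim_bim[OF pbim_fbim])

definition ses ::
  "('k, 'a) module \<Rightarrow> ('k, 'b) module \<Rightarrow> ('a, 'b, 'm) bimodule \<Rightarrow> ('m \<Rightarrow> 'n) \<Rightarrow> ('a, 'b, 'n) bimodule
     \<Rightarrow> ('n \<Rightarrow> 'o) \<Rightarrow> ('a, 'b, 'o) bimodule \<Rightarrow> bool" where
  "ses A B U i V p W \<longleftrightarrow> i \<in> bimod_hom A B U V \<and> p \<in> bimod_hom A B V W \<and> inj_on i (carrier U) \<and>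
     p ` carrier V = carrier W \<and> i ` carrier U = a_kernel V W p"

lemma sesD:
  assumes "ses A B U i V p W" "bim U K A B" "bim V K A B" "bim W K A B"
  shows "bhom K A B U V i" "bhom K A B V W p"
    "\<And>x. \<lbrakk>x \<in> carrier U; i x = \<zero>\<^bsub>V\<^esub>\<rbrakk> \<Longrightarrow> x = \<zero>\<^bsub>U\<^esub>" "\<And>x. x \<in> carrier U \<Longrightarrow> p (i x) = \<zero>\<^bsub>W\<^esub>"
    "\<And>w. w \<in> carrier W \<Longrightarrow> \<exists>v\<in>carrier V. p v = w"
    "\<And>v. \<lbrakk>v \<in> carrier V; p v = \<zero>\<^bsub>W\<^esub>\<rbrakk> \<Longrightarrow> \<exists>u\<in>carrier U. i u = v"
proof -
  interpret i: bhom K A B U V i using assms by (auto simp: ses_def intro: bhomI)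
  interpret p: bhom K A B V W p using assms by (auto simp: ses_def intro: bhomI)
    show "bhom K A B U V i" "bhom K A B V W p" by unfold_locales
    show "\<And>x. \<lbrakk>x \<in> carrier U; i x = \<zero>\<^bsub>V\<^esub>\<rbrakk> \<Longrightarrow> x = \<zero>\<^bsub>U\<^esub>" using assms(1) i.inj_iff by (auto simp: ses_def)
    show "p (i x) = \<zero>\<^bsub>W\<^esub>" if "x \<in> carrier U" for x
    proof -
      have "i x \<in> a_kernel V W p" using that assms(1) unfolding ses_def by (metis imageI)
      then show ?thesis by (simp add: p.ker_iff)
    qed
    show "\<exists>v\<in>carrier V. p v = w" if "w \<in> carrier W" for w
      using that assms(1) unfolding ses_def by (metis imageE)
    show "\<exists>u\<in>carrier U. i u = v" if "v \<in> carrier V" "p v = \<zero>\<^bsub>W\<^esub>" for v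
    proof -
      have "v \<in> i ` carrier U" using that assms(1) p.ker_iff unfolding ses_def by simp
      then show ?thesis by auto
    qed
qed

lemma sesI:
  assumes "bhom K A B U V i" "bhom K A B V W p"
    "\<And>x. \<lbrakk>x \<in> carrier U; i x = \<zero>\<^bsub>V\<^esub>\<rbrakk> \<Longrightarrow> x = \<zero>\<^bsub>U\<^esub>" "\<And>x. x \<in> carrier U \<Longrightarrow> p (i x) = \<zero>\<^bsub>W\<^esub>"
    "\<And>w. w \<in> carrier W \<Longrightarrow> \<exists>v\<in>carrier V. p v = w"
    "\<And>v. \<lbrakk>v \<in> carrier V; p v = \<zero>\<^bsub>W\<^esub>\<rbrakk> \<Longrightarrow> \<exists>u\<in>carrier U. i u = v"
  shows "ses A B U i V p W"
proof -
  interpret i: bhom K A B U V i by fact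
  interpret p: bhom K A B V W p by fact
  show ?thesis unfolding ses_def
  proof (intro conjI)
    show "inj_on i (carrier U)" using assms(3) i.inj_iff by auto
    show "p ` carrier V = carrier W" using assms(5) by (auto simp: image_iff)
    show "i ` carrier U = a_kernel V W p"
    proof (intro equalityI subsetI)
      fix v assume "v \<in> a_kernel V W p"
      then show "v \<in> i ` carrier U" using assms(6)[of v] by (auto simp: p.ker_iff)
    qed (auto simp: p.ker_iff assms(4))
    show "i \<in> bimod_hom A B U V" by (rule i.hom)
    show "p \<in> bimod_hom A B V W" by (rule p.hom)
  qed
qed

lemma ses_factor:
  assumes "ses A B U i V p W" "bim U K A B" "bim V K A B" "bim W K A B" "bim Z K A B" "h \<in> bimod_hom A B Z V"
    "\<And>z. z \<in> carrier Z \<Longrightarrow> p (h z) = \<zero>\<^bsub>W\<^esub>"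
  obtains j where "j \<in> bimod_hom A B Z U" "\<And>z. z \<in> carrier Z \<Longrightarrow> i (j z) = h z"
proof -
  note D = sesD[OF assms(1-4)]
  note ex = D(6)
  interpret i: bhom K A B U V i by (rule D)
  have inj: "inj_on i (carrier U)" using assms(1) by (simp add: ses_def)
  have "\<forall>z\<in>carrier Z. \<exists>u. u \<in> carrier U \<and> i u = h z"
    using ex assms(7) bimod_hom_closed[OF assms(6)] by (metis)
  then have "\<exists>j. \<forall>z\<in>carrier Z. j z \<in> carrier U \<and> i (j z) = h z" by (rule bchoice)
  then obtain j where j: "\<And>z. z \<in> carrier Z \<Longrightarrow> j z \<in> carrier U" "\<And>z. z \<in> carrier Z \<Longrightarrow> i (j z) = h z" by auto
  have "j \<in> bimod_hom A B Z U"
  proof -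
    interpret h: bhom K A B Z V h using assms by (intro bhomI)
    show ?thesis
    proof (rule bimod_homI)
      show "j z \<in> carrier U" if "z \<in> carrier Z" for z by (rule j(1)[OF that])
      show "j (x \<oplus>\<^bsub>Z\<^esub> y) = j x \<oplus>\<^bsub>U\<^esub> j y" if "x \<in> carrier Z" "y \<in> carrier Z" for x y
        by (rule inj_onD[OF inj]) (use that j in simp_all)
      show "j (a \<odot>\<^bsub>Z\<^esub> x) = a \<odot>\<^bsub>U\<^esub> j x" if "a \<in> carrier A" "x \<in> carrier Z" for a x
        by (rule inj_onD[OF inj]) (use that j in simp_all)
      show "j (rsmult Z x a) = rsmult U (j x) a" if "a \<in> carrier B" "x \<in> carrier Z" for a x
        by (rule inj_onD[OF inj]) (use that j in simp_all)
    qed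
  qed
  with j show ?thesis using that by blast
qed


definition sesx ::
  "('k, 'a) module \<Rightarrow> ('k, 'b) module \<Rightarrow> ('a, 'b, 'm) bimodule \<Rightarrow> ('a, 'b, 'n) bimodule \<Rightarrow> ('a, 'b, 'o) bimodule \<Rightarrow> bool" where
  "sesx A B U V W \<longleftrightarrow> (\<exists>i p. ses A B U i V p W)"

lemma sesx_iso:
  assumes "sesx A B U V W" "bim U K A B" "bim V K A B" "bim W K A B" "bim U' K A B" "bim W' K A B"
    "bimod_iso A B U U'" "bimod_iso A B W W'"
  shows "sesx A B U' V W'"
proof -
  obtain i p where s: "ses A B U i V p W" using assms by (auto simp: sesx_def)
  note D = sesD[OF s assms(2-4)]
  note 1 = D(3)
  note 2 = D(4)
  note 3 = D(5)
  note 4 = D(6)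
  interpret i: bhom K A B U V i by (rule D)
  interpret p: bhom K A B V W p by (rule D)
  obtain f g where f: "f \<in> bimod_hom A B U U'" "g \<in> bimod_hom A B U' U"
    "\<And>x. x \<in> carrier U \<Longrightarrow> g (f x) = x" "\<And>y. y \<in> carrier U' \<Longrightarrow> f (g y) = y"
    using bimod_isoE[OF assms(7,2)] by blast
  obtain f' g' where f': "f' \<in> bimod_hom A B W W'" "g' \<in> bimod_hom A B W' W"
    "\<And>x. x \<in> carrier W \<Longrightarrow> g' (f' x) = x" "\<And>y. y \<in> carrier W' \<Longrightarrow> f' (g' y) = y"
    using bimod_isoE[OF assms(8,4)] by blast
  interpret g: bhom K A B U' U g using f assms by (intro bhomI)
  interpret f: bhom K A B U U' f using f assms by (intro bhomI)
  interpret f': bhom K A B W W' f' using f' assms by (intro bhomI)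
  interpret g': bhom K A B W' W g' using f' assms by (intro bhomI)
  have "ses A B U' (i \<circ> g) V (f' \<circ> p) W'"
  proof (rule sesI)
    show "bhom K A B U' V (i \<circ> g)" "bhom K A B V W' (f' \<circ> p)"
      using bimod_hom_comp[OF g.hom i.hom] bimod_hom_comp[OF p.hom f'.hom] assms by (auto intro: bhomI)
  next
    show "x = \<zero>\<^bsub>U'\<^esub>" if "x \<in> carrier U'" "(i \<circ> g) x = \<zero>\<^bsub>V\<^esub>" for x
      using 1[of "g x"] that f(4)[of x] f.zero by simp
  next
    show "(f' \<circ> p) ((i \<circ> g) x) = \<zero>\<^bsub>W'\<^esub>" if "x \<in> carrier U'" for x using 2[of "g x"] that by simp
  next
    show "\<exists>v\<in>carrier V. (f' \<circ> p) v = w" if w: "w \<in> carrier W'" for w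
    proof -
      obtain v where "v \<in> carrier V" "p v = g' w" using 3[of "g' w"] w by auto
      then show ?thesis using w f'(4)[of w] by (intro bexI[of _ v]) auto
    qed
  next
    fix v assume v: "v \<in> carrier V" "(f' \<circ> p) v = \<zero>\<^bsub>W'\<^esub>"
    then have "g' (f' (p v)) = \<zero>\<^bsub>W\<^esub>" by simp
    then have "p v = \<zero>\<^bsub>W\<^esub>" using f'(3)[of "p v"] v by simp
    then obtain u where "u \<in> carrier U" "i u = v" using 4 v by auto
    then show "\<exists>u\<in>carrier U'. (i \<circ> g) u = v" using f(3) by (intro bexI[of _ "f u"]) auto
  qed
  then show ?thesis by (auto simp: sesx_def)
qed

lemma ses_split:
  assumes "sesx A B U V E" "bim U K A B" "bim V K A B" "pbim E K A B"
  shows "bimod_iso A B V (dsum U E)"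
proof -
  obtain i p where s: "ses A B U i V p E" using assms by (auto simp: sesx_def)
  note E = pbim_bim[OF assms(4)]
  note D = sesD[OF s assms(2,3) E]
  note 1 = D(3)
  note 2 = D(4)
  note 4 = D(6)
  interpret i: bhom K A B U V i by (rule D)
  interpret p: bhom K A B V E p by (rule D)
  obtain t where t: "t \<in> bimod_hom A B E V" "\<And>e. e \<in> carrier E \<Longrightarrow> p (t e) = id e"
    using pbim.lift[OF assms(4,3) E p.hom _ bimod_hom_id(1)] s by (auto simp: ses_def)
  interpret t: bhom K A B E V t using t assms E by (intro bhomI)
  have h: "(\<lambda>v. v \<ominus>\<^bsub>V\<^esub> t (p v)) \<in> bimod_hom A B V V"
    using hom_diff[OF assms(3) bimod_hom_id(2) bimod_hom_comp[OF p.hom t.hom]] by simp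
  obtain r where r: "r \<in> bimod_hom A B V U" "\<And>v. v \<in> carrier V \<Longrightarrow> i (r v) = v \<ominus>\<^bsub>V\<^esub> t (p v)"
    by (rule ses_factor[OF s assms(2,3) E assms(3) h]) (use t in auto)
  interpret r: bhom K A B V U r using r assms by (intro bhomI)
  have inj: "u = u'" if "i u = i u'" "u \<in> carrier U" "u' \<in> carrier U" for u u'
    using s that unfolding ses_def inj_on_def by blast
  show ?thesis
  proof (rule bimod_isoI)
    show "(\<lambda>v. vpair (r v) (p v)) \<in> bimod_hom A B V (dsum U E)" by (rule dsum_pair[OF r.hom p.hom])
    show "(\<lambda>w. i (vfst w) \<oplus>\<^bsub>V\<^esub> t (vsnd w)) \<in> carrier (dsum U E) \<rightarrow> carrier V" by auto
    show "i (vfst (vpair (r v) (p v))) \<oplus>\<^bsub>V\<^esub> t (vsnd (vpair (r v) (p v))) = v" if "v \<in> carrier V" for v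
      using that r by simp
    show "vpair (r (i (vfst w) \<oplus>\<^bsub>V\<^esub> t (vsnd w))) (p (i (vfst w) \<oplus>\<^bsub>V\<^esub> t (vsnd w))) = w" if "w \<in> carrier (dsum U E)" for w
    proof (rule vec_eqI)
      have w: "vfst w \<in> carrier U" "vsnd w \<in> carrier E" using that by auto
      then have pw: "p (i (vfst w) \<oplus>\<^bsub>V\<^esub> t (vsnd w)) = vsnd w" using 2 t by simp
      then show "vsnd (vpair (r (i (vfst w) \<oplus>\<^bsub>V\<^esub> t (vsnd w))) (p (i (vfst w) \<oplus>\<^bsub>V\<^esub> t (vsnd w)))) = vsnd w" by simp
      have "i (vfst w) \<oplus>\<^bsub>V\<^esub> t (vsnd w) \<in> carrier V" using w by simp
      from r(2)[OF this, unfolded pw] have "i (r (i (vfst w) \<oplus>\<^bsub>V\<^esub> t (vsnd w))) = i (vfst w)"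
        using w by (simp del: r.add i.add)
      then have "r (i (vfst w) \<oplus>\<^bsub>V\<^esub> t (vsnd w)) = vfst w" using inj w by simp
      then show "vfst (vpair (r (i (vfst w) \<oplus>\<^bsub>V\<^esub> t (vsnd w))) (p (i (vfst w) \<oplus>\<^bsub>V\<^esub> t (vsnd w)))) = vfst w" by simp
    qed
  qed
qed

lemma ses_rotate:
  assumes "sesx A B U V W" "sesx A B N Q W" "bim U K A B" "bim V K A B" "bim W K A B" "bim N K A B" "pbim Q K A B"
  shows "sesx A B N (dsum U Q) V"
proof -
  note Q = pbim_bim[OF assms(7)]
  obtain i p where s: "ses A B U i V p W" using assms by (auto simp: sesx_def)
  note D = sesD[OF s assms(3-5)]
  note 1 = D(3)
  note 2 = D(4)
  note 3 = D(5)
  note 4 = D(6)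
  interpret i: bhom K A B U V i by (rule D)
  interpret p: bhom K A B V W p by (rule D)
  obtain k q where s': "ses A B N k Q q W" using assms by (auto simp: sesx_def)
  note Dk = sesD[OF s' assms(6) Q assms(5)]
  note k1 = Dk(3)
  note k2 = Dk(4)
  note k3 = Dk(5)
  note k4 = Dk(6)
  interpret k: bhom K A B N Q k by (rule Dk)
  interpret q: bhom K A B Q W q by (rule Dk)
  obtain a where a: "a \<in> bimod_hom A B Q V" "\<And>x. x \<in> carrier Q \<Longrightarrow> p (a x) = q x"
    using pbim.lift[OF assms(7,4,5) p.hom _ q.hom] s by (auto simp: ses_def)
  interpret a: bhom K A B Q V a using a assms Q by (intro bhomI)
  have h: "(\<lambda>n. \<ominus>\<^bsub>V\<^esub> a (k n)) \<in> bimod_hom A B N V"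
    using hom_uminus[OF assms(4) bimod_hom_comp[OF k.hom a.hom]] by simp
  obtain j where j: "j \<in> bimod_hom A B N U" "\<And>n. n \<in> carrier N \<Longrightarrow> i (j n) = \<ominus>\<^bsub>V\<^esub> a (k n)"
    by (rule ses_factor[OF s assms(3-5,6) h]) (use a k2 in auto)
  interpret j: bhom K A B N U j using j assms by (intro bhomI)
  have D: "bim (dsum U Q) K A B" by (rule bim_dsum[OF assms(3) Q])
  have "ses A B N (\<lambda>n. vpair (j n) (k n)) (dsum U Q) (\<lambda>w. i (vfst w) \<oplus>\<^bsub>V\<^esub> a (vsnd w)) V"
  proof (rule sesI)
    show "bhom K A B N (dsum U Q) (\<lambda>n. vpair (j n) (k n))"
      using dsum_pair[OF j.hom k.hom] assms D by (intro bhomI)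
    show "bhom K A B (dsum U Q) V (\<lambda>w. i (vfst w) \<oplus>\<^bsub>V\<^esub> a (vsnd w))"
      using dsum_copair[OF assms(4) i.hom a.hom] assms D by (intro bhomI)
    show "x = \<zero>\<^bsub>N\<^esub>" if "x \<in> carrier N" "vpair (j x) (k x) = \<zero>\<^bsub>dsum U Q\<^esub>" for x
      using that k1 by (simp add: vpair_eq_iff)
    show "i (vfst (vpair (j x) (k x))) \<oplus>\<^bsub>V\<^esub> a (vsnd (vpair (j x) (k x))) = \<zero>\<^bsub>V\<^esub>" if "x \<in> carrier N" for x
      using that j by (simp add: i.Y.l_neg)
  next
    fix v assume v: "v \<in> carrier V"
    then obtain x where x: "x \<in> carrier Q" "q x = p v" using k3[of "p v"] by auto
    then have "p (v \<ominus>\<^bsub>V\<^esub> a x) = \<zero>\<^bsub>W\<^esub>" using a v by simp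
    then obtain u where "u \<in> carrier U" "i u = v \<ominus>\<^bsub>V\<^esub> a x" using 4[of "v \<ominus>\<^bsub>V\<^esub> a x"] v x by auto
    then show "\<exists>w\<in>carrier (dsum U Q). i (vfst w) \<oplus>\<^bsub>V\<^esub> a (vsnd w) = v"
      using v x by (intro bexI[of _ "vpair u x"]) auto
  next
    fix w assume w: "w \<in> carrier (dsum U Q)" "i (vfst w) \<oplus>\<^bsub>V\<^esub> a (vsnd w) = \<zero>\<^bsub>V\<^esub>"
    have "p (i (vfst w) \<oplus>\<^bsub>V\<^esub> a (vsnd w)) = q (vsnd w)" using w(1) 2 a by simp
    then have "q (vsnd w) = \<zero>\<^bsub>W\<^esub>" using w(2) by simp
    then obtain n where n: "n \<in> carrier N" "k n = vsnd w" using k4[of "vsnd w"] w(1) by auto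
    have "i (vfst w) = \<ominus>\<^bsub>V\<^esub> a (vsnd w)" using w i.Y.minus_equality[of "i (vfst w)" "a (vsnd w)"] by simp
    then have "i (j n) = i (vfst w)" using j n by simp
    then have "j n = vfst w" using s n w(1) unfolding ses_def inj_on_def by (metis j.closed dsum_simps(1))
    then have "vpair (j n) (k n) = w" using n by simp
    then show "\<exists>n\<in>carrier N. vpair (j n) (k n) = w" using n(1) by (rule bexI)
  qed
  then show ?thesis by (auto simp: sesx_def)
qed

definition stab :: "('k, 'z) ring_scheme \<Rightarrow> ('k, 'a) module \<Rightarrow> ('k, 'b) module \<Rightarrow>
    ('a, 'b, 'k vec) bimodule \<Rightarrow> ('a, 'b, 'k vec) bimodule \<Rightarrow> bool" where
  "stab K A B X Y \<longleftrightarrow> (\<exists>P Q. pbim P K A B \<and> pbim Q K A B \<and> bimod_iso A B (dsum X P) (dsum Y Q))"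

lemma stab_iso:
  fixes A :: "('k, 'a) module" and B :: "('k, 'b) module"
  assumes "bim X K A B" "bim Y K A B" "bimod_iso A B X Y" shows "stab K A B X Y"
proof -
  have Z: "pbim (zbim :: ('a, 'b, 'k vec) bimodule) K A B" by (intro pbim_zbim) (use assms(1) in \<open>auto simp: bim_iff\<close>)
  show ?thesis unfolding stab_def
    using iso_dsum_cong[OF assms(1) pbim_bim[OF Z] assms(3) bimod_iso_refl] Z by blast
qed

lemma stab_sym: "\<lbrakk>stab K A B X Y; bim X K A B\<rbrakk> \<Longrightarrow> stab K A B Y X"
  unfolding stab_def by (meson bim_dsum bimod_iso_sym pbim_bim)

lemma stab_trans:
  assumes "stab K A B X Y" "stab K A B Y Z" "bim X K A B" "bim Y K A B" "bim Z K A B"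
  shows "stab K A B X Z"
proof -
  obtain P Q where 1: "pbim P K A B" "pbim Q K A B" "bimod_iso A B (dsum X P) (dsum Y Q)" using assms(1) by (auto simp: stab_def)
  obtain P' Q' where 2: "pbim P' K A B" "pbim Q' K A B" "bimod_iso A B (dsum Y P') (dsum Z Q')" using assms(2) by (auto simp: stab_def)
  note b = 1(1,2)[THEN pbim_bim] 2(1,2)[THEN pbim_bim] assms(3-5)
  have "bimod_iso A B (dsum X (dsum P P')) (dsum (dsum X P) P')"
    using bimod_iso_sym[OF iso_dsum_assoc] b by (meson bim_dsum)
  moreover have "bimod_iso A B (dsum (dsum X P) P') (dsum (dsum Y Q) P')"
    by (rule iso_dsum_cong[OF _ _ 1(3) bimod_iso_refl]) (use b bim_dsum in blast)+
  moreover have "bimod_iso A B (dsum (dsum Y Q) P') (dsum (dsum Y P') Q)" by (rule iso_dsum_swap)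
  moreover have "bimod_iso A B (dsum (dsum Y P') Q) (dsum (dsum Z Q') Q)"
    by (rule iso_dsum_cong[OF _ _ 2(3) bimod_iso_refl]) (use b bim_dsum in blast)+
  moreover have "bimod_iso A B (dsum (dsum Z Q') Q) (dsum Z (dsum Q' Q))" by (rule iso_dsum_assoc)
  ultimately have "bimod_iso A B (dsum X (dsum P P')) (dsum Z (dsum Q' Q))" by (metis bimod_iso_trans)
  then show ?thesis unfolding stab_def using pbim_dsum 1(1,2) 2(1,2) by blast
qed

lemma stab_dsum:
  fixes A :: "('k, 'a) module" and B :: "('k, 'b) module"
  assumes "bim X K A B" "pbim P K A B" shows "stab K A B X (dsum X P)"
proof -
  have Z: "pbim (zbim :: ('a, 'b, 'k vec) bimodule) K A B" by (intro pbim_zbim) (use assms(1) in \<open>auto simp: bim_iff\<close>)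
  have "bimod_iso A B (dsum X (dsum P zbim)) (dsum (dsum X P) zbim)"
    by (rule bimod_iso_sym[OF iso_dsum_assoc]) (use assms Z pbim_bim bim_dsum in blast)
  then show ?thesis unfolding stab_def using pbim_dsum[OF assms(2) Z] Z by blast
qed

lemma stab_proj:
  assumes "stab K A B X Y" "pbim X K A B" "bim Y K A B" shows "pbim Y K A B"
proof -
  obtain P Q where 1: "pbim P K A B" "pbim Q K A B" "bimod_iso A B (dsum X P) (dsum Y Q)" using assms(1) by (auto simp: stab_def)
  then have "pbim (dsum Y Q) K A B"
    using pbim_iso[OF pbim_dsum[OF assms(2) 1(1)] bim_dsum[OF assms(3)]] pbim_bim by blast
  then show ?thesis using pbim_summand assms(3) 1(2) pbim_bim by blast
qed

lemma stab_stably_iso: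
  fixes X :: "('a, 'b, 'm) bimodule" and A :: "('k, 'a) module" and B :: "('k, 'b) module"
  assumes "stab K A B X' Y" "bimod_iso A B X X'" "fbim X K A B" "fbim X' K A B" "fbim Y K A B"
  shows "stably_iso K A B X Y"
proof -
  obtain P Q where PQ: "pbim P K A B" "pbim Q K A B" "bimod_iso A B (dsum X' P) (dsum Y Q)" using assms(1) by (auto simp: stab_def)
  obtain e i where e: "e \<in> bimod_hom A B X X'" "i \<in> bimod_hom A B X' X"
    "\<And>x. x \<in> carrier X \<Longrightarrow> i (e x) = x" "\<And>y. y \<in> carrier X' \<Longrightarrow> e (i y) = y"
    using bimod_isoE[OF assms(2) fbim_bim[OF assms(3)]] by blast
  note b = PQ(1,2)[THEN pbim_bim] assms(3-5)[THEN fbim_bim]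
  obtain u v where u: "u \<in> bimod_hom A B (dsum X' P) (dsum Y Q)" "v \<in> bimod_hom A B (dsum Y Q) (dsum X' P)"
    "\<And>x. x \<in> carrier (dsum X' P) \<Longrightarrow> v (u x) = x" "\<And>y. y \<in> carrier (dsum Y Q) \<Longrightarrow> u (v y) = y"
    using bimod_isoE[OF PQ(3) bim_dsum[OF b(4) b(1)]] by blast
  interpret u: bhom K A B "dsum X' P" "dsum Y Q" u using u b bim_dsum by (intro bhomI)
  interpret v: bhom K A B "dsum Y Q" "dsum X' P" v using u b bim_dsum by (intro bhomI)
  interpret X: bim X K A B by (rule b)
  interpret X': bim X' K A B by (rule b)
  interpret Y: bim Y K A B by (rule b)
  interpret P: bim P K A B by (rule b)
  interpret Q: bim Q K A B by (rule b)
  interpret e: bhom K A B X X' e using e b by (intro bhomI)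
  interpret i: bhom K A B X' X i using e b by (intro bhomI)
  have half: "\<exists>f g c d. f \<in> bimod_hom A B S T \<and> g \<in> bimod_hom A B T S \<and> c \<in> bimod_hom A B S L \<and> d \<in> bimod_hom A B L S \<and>
      f = (\<lambda>x. vfst (w (vpair x \<zero>\<^bsub>M\<^esub>))) \<and> g = (\<lambda>x. vfst (w' (vpair x \<zero>\<^bsub>L\<^esub>))) \<and>
      (\<forall>x\<in>carrier S. g (f x) \<ominus>\<^bsub>S\<^esub> x = d (c x))"
    if "w \<in> bimod_hom A B (dsum S M) (dsum T L)" "w' \<in> bimod_hom A B (dsum T L) (dsum S M)"
      "\<And>x. x \<in> carrier (dsum S M) \<Longrightarrow> w' (w x) = x" "bim S K A B" "bim M K A B" "bim T K A B" "bim L K A B"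
    for S T M L :: "('a, 'b, 'k vec) bimodule" and w w'
  proof -
    interpret S: bim S K A B by fact
    interpret T: bim T K A B by fact
    interpret M: bim M K A B by fact
    interpret L: bim L K A B by fact
    interpret w: bhom K A B "dsum S M" "dsum T L" w using that bim_dsum by (intro bhomI)
    interpret w': bhom K A B "dsum T L" "dsum S M" w' using that bim_dsum by (intro bhomI)
    let ?f = "\<lambda>x. vfst (w (vpair x \<zero>\<^bsub>M\<^esub>))" and ?g = "\<lambda>x. vfst (w' (vpair x \<zero>\<^bsub>L\<^esub>))"
      and ?c = "\<lambda>x. vsnd (w (vpair x \<zero>\<^bsub>M\<^esub>))" and ?d0 = "\<lambda>x. vfst (w' (vpair \<zero>\<^bsub>T\<^esub> x))"
    have h: "?f \<in> bimod_hom A B S T" "?g \<in> bimod_hom A B T S" "?c \<in> bimod_hom A B S L" "?d0 \<in> bimod_hom A B L S"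
      using bimod_hom_comp[OF bimod_hom_comp[OF dsum_inl[OF that(4,5)] w.hom] dsum_fst]
        bimod_hom_comp[OF bimod_hom_comp[OF dsum_inl[OF that(6,7)] w'.hom] dsum_fst]
        bimod_hom_comp[OF bimod_hom_comp[OF dsum_inl[OF that(4,5)] w.hom] dsum_snd]
        bimod_hom_comp[OF bimod_hom_comp[OF dsum_inr[OF that(6,7)] w'.hom] dsum_fst] by (simp_all add: comp_def)
    have "?g (?f x) \<ominus>\<^bsub>S\<^esub> x = \<ominus>\<^bsub>S\<^esub> ?d0 (?c x)" if x: "x \<in> carrier S" for x
    proof -
      let ?z = "w (vpair x \<zero>\<^bsub>M\<^esub>)"
      have z: "?z \<in> carrier (dsum T L)" by (rule w.closed) (use x in simp)
      have "?z = vpair (vfst ?z) \<zero>\<^bsub>L\<^esub> \<oplus>\<^bsub>dsum T L\<^esub> vpair \<zero>\<^bsub>T\<^esub> (vsnd ?z)" using z by simp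
      then have "w' ?z = w' (vpair (vfst ?z) \<zero>\<^bsub>L\<^esub>) \<oplus>\<^bsub>dsum S M\<^esub> w' (vpair \<zero>\<^bsub>T\<^esub> (vsnd ?z))"
        using w'.add[of "vpair (vfst ?z) \<zero>\<^bsub>L\<^esub>" "vpair \<zero>\<^bsub>T\<^esub> (vsnd ?z)"] z by simp
      then have "x = ?g (?f x) \<oplus>\<^bsub>S\<^esub> ?d0 (?c x)" using \<open>\<And>x. x \<in> carrier (dsum S M) \<Longrightarrow> w' (w x) = x\<close>[of "vpair x \<zero>\<^bsub>M\<^esub>"] x
        by (metis M.zero_closed dsum_simps(1,3) vpair_simps(1,2))
      moreover have cl: "?g (?f x) \<in> carrier S" "?d0 (?c x) \<in> carrier S"
        using bimod_hom_closed[OF h(2) bimod_hom_closed[OF h(1) x]] bimod_hom_closed[OF h(4) bimod_hom_closed[OF h(3) x]] by simp_all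
      ultimately show ?thesis
        using S.diff_eq_iff[of "?g (?f x)" x "\<ominus>\<^bsub>S\<^esub> ?d0 (?c x)"] x
        by (metis S.a_inv_closed S.a_comm S.r_neg1 S.a_lcomm S.l_neg S.r_zero S.a_assoc)
    qed
    then show ?thesis
      using h hom_uminus[OF that(4) h(4)] by (intro exI[of _ ?f] exI[of _ ?g] exI[of _ ?c] exI[of _ "\<lambda>x. \<ominus>\<^bsub>S\<^esub> ?d0 x"]) simp
  qed
  obtain c d where cd: "c \<in> bimod_hom A B X' Q" "d \<in> bimod_hom A B Q X'"
    "\<And>x. x \<in> carrier X' \<Longrightarrow> vfst (v (vpair (vfst (u (vpair x \<zero>\<^bsub>P\<^esub>))) \<zero>\<^bsub>Q\<^esub>)) \<ominus>\<^bsub>X'\<^esub> x = d (c x)"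
    and fg: "(\<lambda>x. vfst (u (vpair x \<zero>\<^bsub>P\<^esub>))) \<in> bimod_hom A B X' Y" "(\<lambda>x. vfst (v (vpair x \<zero>\<^bsub>Q\<^esub>))) \<in> bimod_hom A B Y X'"
    using half[OF u(1,2,3)] b by auto
  obtain c' d' where cd': "c' \<in> bimod_hom A B Y P" "d' \<in> bimod_hom A B P Y"
    "\<And>x. x \<in> carrier Y \<Longrightarrow> vfst (u (vpair (vfst (v (vpair x \<zero>\<^bsub>Q\<^esub>))) \<zero>\<^bsub>P\<^esub>)) \<ominus>\<^bsub>Y\<^esub> x = d' (c' x)"
    using half[OF u(2,1,4)] b by auto
  let ?f = "\<lambda>x. vfst (u (vpair x \<zero>\<^bsub>P\<^esub>))" and ?g = "\<lambda>x. vfst (v (vpair x \<zero>\<^bsub>Q\<^esub>))"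
  have 1: "stably_equal K A B X X ((i \<circ> ?g) \<circ> (?f \<circ> e)) id"
    unfolding stably_equal_def
  proof (intro exI[of _ Q] exI[of _ "c \<circ> e"] exI[of _ "i \<circ> d"] conjI ballI)
    fix x assume x: "x \<in> carrier X"
    have "?g (?f (e x)) \<in> carrier X'"
      using bimod_hom_closed[OF fg(2) bimod_hom_closed[OF fg(1) e.closed[OF x]]] by simp
    then show "((i \<circ> ?g) \<circ> (?f \<circ> e)) x \<ominus>\<^bsub>X\<^esub> id x = (i \<circ> d) ((c \<circ> e) x)"
      using x i.diff[of "?g (?f (e x))" "e x"] cd(3)[of "e x"] e(3) by simp
  qed (use PQ(2) pbim_iff bimod_hom_comp[OF e.hom cd(1)] bimod_hom_comp[OF cd(2) i.hom] in auto)
  have 2: "stably_equal K A B Y Y ((?f \<circ> e) \<circ> (i \<circ> ?g)) id"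
    unfolding stably_equal_def
  proof (rule exI[of _ P], rule exI[of _ "c'"], rule exI[of _ "d'"], intro conjI ballI)
    fix x assume x: "x \<in> carrier Y"
    have "?g x \<in> carrier X'" using bimod_hom_closed[OF fg(2) x] by simp
    then show "((?f \<circ> e) \<circ> (i \<circ> ?g)) x \<ominus>\<^bsub>Y\<^esub> id x = d' (c' x)"
      using x cd'(3)[of x] e(4) by simp
  qed (use PQ(1) pbim_iff cd' in auto)
  show ?thesis unfolding stably_iso_def
    using 1 2 bimod_hom_comp[OF e.hom fg(1)] bimod_hom_comp[OF fg(2) i.hom] assms(3-5) by (auto simp: fbim_iff_fg)
qed

definition omega :: "('k, 'z) ring_scheme \<Rightarrow> ('k, 'a) module \<Rightarrow> ('k, 'b) module \<Rightarrow>
    ('a, 'b, 'm) bimodule \<Rightarrow> ('a, 'b, 'k vec) bimodule \<Rightarrow> bool" where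
  "omega K A B X Y \<longleftrightarrow> (\<exists>P :: ('a, 'b, 'k vec) bimodule. pbim P K A B \<and> sesx A B Y P X)"

lemma omegaE:
  fixes A :: "('k, 'a) module" and B :: "('k, 'b) module"
  assumes "omega K A B X Y"
  obtains P :: "('a, 'b, 'k vec) bimodule" where "pbim P K A B" "sesx A B Y P X"
  using assms by (auto simp: omega_def)

lemma is_syzygy_fbim:
  "\<lbrakk>is_syzygy K A B n X Y; fd_algebra K A; fd_algebra K B\<rbrakk> \<Longrightarrow> fbim Y K A B"
  by (cases n) (auto simp: fbim_iff_fg)

lemma is_syzygy_Suc:
  assumes "fd_algebra K A" "fd_algebra K B"
  shows "is_syzygy K A B (Suc n) X Y \<longleftrightarrow> fbim Y K A B \<and> (\<exists>Z. is_syzygy K A B n X Z \<and> omega K A B Z Y)"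
proof -
  have *: "(\<exists>f. f \<in> bimod_hom A B P Z \<and> f ` carrier P = carrier Z \<and> bimod_iso A B (P\<lparr>carrier := a_kernel P Z f\<rparr>) Y)
      \<longleftrightarrow> sesx A B Y P Z" if "fbim Z K A B" "pbim P K A B" "fbim Y K A B" for Z P
  proof
    assume "\<exists>f. f \<in> bimod_hom A B P Z \<and> f ` carrier P = carrier Z \<and> bimod_iso A B (P\<lparr>carrier := a_kernel P Z f\<rparr>) Y"
    then obtain f where f: "f \<in> bimod_hom A B P Z" "f ` carrier P = carrier Z" "bimod_iso A B (P\<lparr>carrier := a_kernel P Z f\<rparr>) Y" by auto
    interpret f: bhom K A B P Z f by (rule bhomI[OF pbim_bim[OF that(2)] fbim_bim[OF that(1)] f(1)])
    have "ses A B (P\<lparr>carrier := a_kernel P Z f\<rparr>) id P f Z"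
      unfolding ses_def using f by (auto simp: bimod_hom_iff f.ker_iff)
    then have "sesx A B (P\<lparr>carrier := a_kernel P Z f\<rparr>) P Z" by (auto simp: sesx_def)
    then show "sesx A B Y P Z"
      using sesx_iso[OF _ f.bim_ker f.X.bim_axioms f.Y.bim_axioms fbim_bim[OF that(3)] f.Y.bim_axioms f(3) bimod_iso_refl] by blast
  next
    assume "sesx A B Y P Z"
    then obtain i f where s: "ses A B Y i P f Z" by (auto simp: sesx_def)
    interpret f: bhom K A B P Z f
      by (rule bhomI[OF pbim_bim[OF that(2)] fbim_bim[OF that(1)]]) (use s in \<open>simp add: ses_def\<close>)
    have "bimod_iso A B Y (P\<lparr>carrier := a_kernel P Z f\<rparr>)"
      unfolding bimod_iso_def using s by (intro bexI[of _ i]) (auto simp: bij_betw_def ses_def bimod_hom_iff)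
    then show "\<exists>f. f \<in> bimod_hom A B P Z \<and> f ` carrier P = carrier Z \<and> bimod_iso A B (P\<lparr>carrier := a_kernel P Z f\<rparr>) Y"
      using bimod_iso_sym[OF _ fbim_bim[OF that(3)]] s unfolding ses_def by blast
  qed
  show ?thesis
  proof
    assume "is_syzygy K A B (Suc n) X Y"
    then show "fbim Y K A B \<and> (\<exists>Z. is_syzygy K A B n X Z \<and> omega K A B Z Y)"
      using * is_syzygy_fbim[OF _ assms] assms unfolding is_syzygy.simps omega_def pbim_iff fbim_iff_fg by metis
  next
    assume "fbim Y K A B \<and> (\<exists>Z. is_syzygy K A B n X Z \<and> omega K A B Z Y)"
    then show "is_syzygy K A B (Suc n) X Y"
      using * is_syzygy_fbim[OF _ assms] assms unfolding is_syzygy.simps omega_def pbim_iff fbim_iff_fg by metis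
  qed
qed


lemma sesx_dsum:
  assumes "sesx A B U V W" "bim U K A B" "bim V K A B" "bim W K A B" "bim P K A B"
  shows "sesx A B U (dsum V P) (dsum W P)"
proof -
  obtain i p where s: "ses A B U i V p W" using assms by (auto simp: sesx_def)
  note D = sesD[OF s assms(2-4)]
  interpret i: bhom K A B U V i by (rule D)
  interpret p: bhom K A B V W p by (rule D)
  interpret P: bim P K A B by fact
  have "ses A B U (\<lambda>u. vpair (i u) \<zero>\<^bsub>P\<^esub>) (dsum V P) (\<lambda>v. vpair (p (vfst v)) (vsnd v)) (dsum W P)"
  proof (rule sesI)
    show "bhom K A B U (dsum V P) (\<lambda>u. vpair (i u) \<zero>\<^bsub>P\<^esub>)"
      using bimod_hom_comp[OF i.hom dsum_inl[OF assms(3,5)]] bim_dsum[OF assms(3,5)] assms by (intro bhomI) (auto simp: comp_def)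
    show "bhom K A B (dsum V P) (dsum W P) (\<lambda>v. vpair (p (vfst v)) (vsnd v))"
      using dsum_pair[OF bimod_hom_comp[OF dsum_fst p.hom] dsum_snd] bim_dsum assms by (intro bhomI) (auto simp: comp_def)
    show "x = \<zero>\<^bsub>U\<^esub>" if "x \<in> carrier U" "vpair (i x) \<zero>\<^bsub>P\<^esub> = \<zero>\<^bsub>dsum V P\<^esub>" for x
      using that D(3) by (simp add: vpair_eq_iff)
    show "vpair (p (vfst (vpair (i x) \<zero>\<^bsub>P\<^esub>))) (vsnd (vpair (i x) \<zero>\<^bsub>P\<^esub>)) = \<zero>\<^bsub>dsum W P\<^esub>" if "x \<in> carrier U" for x
      using that D(4) by simp
  next
    fix w assume w: "w \<in> carrier (dsum W P)"
    then obtain v where "v \<in> carrier V" "p v = vfst w" using D(5)[of "vfst w"] by auto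
    then show "\<exists>v\<in>carrier (dsum V P). vpair (p (vfst v)) (vsnd v) = w"
      using w by (intro bexI[of _ "vpair v (vsnd w)"]) auto
  next
    fix v assume v: "v \<in> carrier (dsum V P)" "vpair (p (vfst v)) (vsnd v) = \<zero>\<^bsub>dsum W P\<^esub>"
    then have "p (vfst v) = \<zero>\<^bsub>W\<^esub>" "vsnd v = \<zero>\<^bsub>P\<^esub>" by (auto simp: vpair_eq_iff)
    then obtain u where u: "u \<in> carrier U" "i u = vfst v" using D(6)[of "vfst v"] v by auto
    have "vpair (i u) \<zero>\<^bsub>P\<^esub> = v" by (rule vec_eqI) (use u \<open>vsnd v = _\<close> in simp_all)
    then show "\<exists>u\<in>carrier U. vpair (i u) \<zero>\<^bsub>P\<^esub> = v" using u(1) by (rule bexI)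
  qed
  then show ?thesis by (auto simp: sesx_def)
qed

context
  fixes K :: "('k, 'z) ring_scheme" and A :: "('k, 'a) module" and B :: "('k, 'b) module"
  assumes fdA: "fd_algebra K A" and fdB: "fd_algebra K B"
begin

lemma omega_iso:
  fixes Y Y' :: "('a, 'b, 'k vec) bimodule"
  assumes "omega K A B X Y" "bimod_iso A B X X'" "bimod_iso A B Y Y'" "bim X K A B" "bim Y K A B" "bim X' K A B" "bim Y' K A B"
  shows "omega K A B X' Y'"
  using assms(1) sesx_iso[OF _ assms(5) _ assms(4) assms(7,6,3,2)] unfolding omega_def using pbim_bim by blast

lemma is_syzygy_iso_source:
  "\<lbrakk>bimod_iso A B X' X; is_syzygy K A B n X Y\<rbrakk> \<Longrightarrow> is_syzygy K A B n X' Y"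
proof (induction n arbitrary: Y)
  case 0 then show ?case by (auto intro: bimod_iso_trans)
next
  case (Suc n) then show ?case unfolding is_syzygy_Suc[OF fdA fdB] by blast
qed

lemma is_syzygy_iso_target:
  assumes "bimod_iso A B Y Y'" "is_syzygy K A B n X Y" "bim Y' K A B" shows "is_syzygy K A B n X Y'"
proof -
  have Y: "fbim Y K A B" using is_syzygy_fbim[OF assms(2) fdA fdB] .
  have Y': "fbim Y' K A B" by (rule fbim_iso[OF Y assms(3,1)])
  show ?thesis
  proof (cases n)
    case 0 then show ?thesis using assms Y' bimod_iso_trans by (auto simp: fbim_iff_fg)
  next
    case (Suc m)
    obtain Z where Z: "is_syzygy K A B m X Z" "omega K A B Z Y" using assms(2) Suc is_syzygy_Suc[OF fdA fdB] by blast
    have "bim Z K A B" using is_syzygy_fbim[OF Z(1) fdA fdB] fbim_bim by blast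
    then have "omega K A B Z Y'" using omega_iso[OF Z(2) bimod_iso_refl assms(1)] fbim_bim Y Y' by blast
    then show ?thesis using Z Y' is_syzygy_Suc[OF fdA fdB] Suc by blast
  qed
qed

lemma is_syzygy_SucI:
  "\<lbrakk>is_syzygy K A B n X Z; omega K A B Z Y; fbim Y K A B\<rbrakk> \<Longrightarrow> is_syzygy K A B (Suc n) X Y"
  using is_syzygy_Suc[OF fdA fdB] by blast

lemma is_syzygy_0:
  fixes X :: "('a, 'b, 'k vec) bimodule"
  shows "fbim X K A B \<Longrightarrow> is_syzygy K A B 0 X X"
  by (simp add: fbim_iff_fg bimod_iso_refl)

lemma is_syzygy_trans:
  fixes Y :: "('a, 'b, 'k vec) bimodule"
  assumes "is_syzygy K A B m X Y" "is_syzygy K A B n Y Z" shows "is_syzygy K A B (m + n) X Z"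
  using assms(2)
proof (induction n arbitrary: Z)
  case 0
  have "bimod_iso A B Y Z" "bim Z K A B"
    using 0 is_syzygy_fbim[OF 0 fdA fdB] fbim_bim by auto
  then show ?case using is_syzygy_iso_target[OF _ assms(1)] by simp
next
  case (Suc n)
  then obtain W where "is_syzygy K A B n Y W" "omega K A B W Z" "fbim Z K A B" using is_syzygy_Suc[OF fdA fdB] by blast
  then show ?case unfolding add_Suc_right using Suc.IH is_syzygy_SucI by blast
qed

lemma is_syzygy_Suc_left:
  fixes X Z :: "('a, 'b, 'k vec) bimodule"
  assumes "omega K A B X Z" "fbim X K A B" "fbim Z K A B" "is_syzygy K A B n Z Y"
  shows "is_syzygy K A B (Suc n) X Y"
  using is_syzygy_trans[OF is_syzygy_SucI[OF is_syzygy_0[OF assms(2)] assms(1,3)] assms(4)] by (simp only: add_Suc add_0)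

lemma is_syzygy_split:
  fixes X :: "('a, 'b, 'k vec) bimodule"
  assumes "is_syzygy K A B (Suc n) X Y" "fbim X K A B"
  obtains Z where "omega K A B X Z" "fbim Z K A B" "is_syzygy K A B n Z Y"
proof -
  have "\<exists>Z. omega K A B X Z \<and> fbim Z K A B \<and> is_syzygy K A B n Z Y"
    using assms(1)
  proof (induction n arbitrary: Y)
    case 0
    then obtain Z where Z: "is_syzygy K A B 0 X Z" "omega K A B Z Y" "fbim Y K A B" using is_syzygy_Suc[OF fdA fdB] by blast
    then have ZX: "bimod_iso A B Z X" "fbim Z K A B"
      using bimod_iso_sym[OF _ fbim_bim[OF assms(2)]] is_syzygy_fbim[OF Z(1) fdA fdB] by auto
    then have "omega K A B X Y" using omega_iso[OF Z(2) _ bimod_iso_refl, of X] assms(2) Z(3) fbim_bim by blast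
    then show ?case using Z(3) is_syzygy_0[OF Z(3)] by blast
  next
    case (Suc n)
    then obtain Z where Z: "is_syzygy K A B (Suc n) X Z" "omega K A B Z Y" "fbim Y K A B" using is_syzygy_Suc[OF fdA fdB] by blast
    then show ?case using Suc.IH[OF Z(1)] is_syzygy_SucI by blast
  qed
  with that show ?thesis by blast
qed

lemma stab_refl: "bim X K A B \<Longrightarrow> stab K A B X X"
  by (rule stab_iso) (auto simp: bimod_iso_refl)

lemma schanuel:
  fixes X Y X1 Y1 :: "('a, 'b, 'k vec) bimodule"
  assumes "omega K A B X X1" "omega K A B Y Y1" "stab K A B X Y" "bim X K A B" "bim Y K A B" "bim X1 K A B" "bim Y1 K A B"
  shows "stab K A B X1 Y1"
proof -
  obtain P :: "('a, 'b, 'k vec) bimodule" where P: "pbim P K A B" "sesx A B X1 P X" by (rule omegaE[OF assms(1)])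
  obtain Q :: "('a, 'b, 'k vec) bimodule" where Q: "pbim Q K A B" "sesx A B Y1 Q Y" by (rule omegaE[OF assms(2)])
  obtain P' Q' where PQ: "pbim P' K A B" "pbim Q' K A B" "bimod_iso A B (dsum X P') (dsum Y Q')" using assms(3) by (auto simp: stab_def)
  note b = assms(4-7) P(1)[THEN pbim_bim] Q(1)[THEN pbim_bim] PQ(1)[THEN pbim_bim] PQ(2)[THEN pbim_bim]
  have "sesx A B X1 (dsum P P') (dsum X P')" using sesx_dsum P(2) b by blast
  then have 1: "sesx A B X1 (dsum P P') (dsum Y Q')"
    using sesx_iso[OF _ _ _ _ _ _ bimod_iso_refl PQ(3)] b bim_dsum by blast
  have 2: "sesx A B Y1 (dsum Q Q') (dsum Y Q')" using sesx_dsum Q(2) b by blast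
  have Q2: "pbim (dsum Q Q') K A B" "pbim (dsum P P') K A B" using pbim_dsum P Q PQ by blast+
  have "sesx A B Y1 (dsum X1 (dsum Q Q')) (dsum P P')"
    by (rule ses_rotate[OF 1 2]) (use b bim_dsum Q2 in blast)+
  then have "bimod_iso A B (dsum X1 (dsum Q Q')) (dsum Y1 (dsum P P'))"
    by (rule ses_split) (use b bim_dsum Q2 in blast)+
  then show ?thesis using Q2 by (auto simp: stab_def)
qed

lemma is_syzygy_stab:
  fixes X Y :: "('a, 'b, 'k vec) bimodule"
  shows "\<lbrakk>is_syzygy K A B n X X'; is_syzygy K A B n Y Y'; stab K A B X Y; fbim X K A B; fbim Y K A B\<rbrakk> \<Longrightarrow> stab K A B X' Y'"
proof (induction n arbitrary: X' Y')
  case 0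
  have b: "bim X' K A B" "bim Y' K A B" "bim X K A B" "bim Y K A B"
    using 0(1,2)[THEN is_syzygy_fbim, OF fdA fdB] 0(4,5) fbim_bim by blast+
  have "bimod_iso A B X X'" "bimod_iso A B Y Y'" using 0 by auto
  then have "stab K A B X X'" "stab K A B Y Y'" using stab_iso b by blast+
  then show ?case using 0(3) b stab_trans stab_sym by metis
next
  case (Suc n)
  obtain X1 where X: "is_syzygy K A B n X X1" "omega K A B X1 X'" "fbim X' K A B" using Suc.prems(1) is_syzygy_Suc[OF fdA fdB] by blast
  obtain Y1 where Y: "is_syzygy K A B n Y Y1" "omega K A B Y1 Y'" "fbim Y' K A B" using Suc.prems(2) is_syzygy_Suc[OF fdA fdB] by blast
  have "stab K A B X1 Y1" using Suc X Y by blast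
  then show ?case using schanuel[OF X(2) Y(2)] X Y is_syzygy_fbim[OF X(1) fdA fdB] is_syzygy_fbim[OF Y(1) fdA fdB] fbim_bim by blast
qed

lemma is_syzygy_proj:
  fixes X :: "('a, 'b, 'k vec) bimodule"
  assumes "is_syzygy K A B n X Y" "pbim Y K A B" "is_syzygy K A B n X Y'" "fbim X K A B" shows "pbim Y' K A B"
  using stab_proj[OF is_syzygy_stab[OF assms(1,3) stab_refl[OF fbim_bim[OF assms(4)]] assms(4,4)] assms(2)]
    is_syzygy_fbim[OF assms(3) fdA fdB] assms(4) fbim_bim by blast

lemma is_syzygy_dsum:
  fixes X P :: "('a, 'b, 'k vec) bimodule"
  assumes "is_syzygy K A B n X Y" "pbim P K A B" "fbim X K A B"
  obtains Y' where "is_syzygy K A B n (dsum X P) Y'" "stab K A B Y Y'"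
proof (cases n)
  case 0
  have b: "bim X K A B" "bim P K A B" "fbim Y K A B" "bim Y K A B"
    using assms is_syzygy_fbim[OF assms(1) fdA fdB] fbim_bim pbim_bim by blast+
  have "bimod_iso A B X Y" using assms 0 by simp
  then have "bimod_iso A B (dsum X P) (dsum Y P)" using iso_dsum_cong b bimod_iso_refl by blast
  then have "is_syzygy K A B 0 (dsum X P) (dsum Y P)"
    using fbim_dsum[OF b(3) pbim_fbim[OF assms(2)]] by (simp add: fbim_iff_fg)
  then show ?thesis using that 0 stab_dsum[OF b(4) assms(2)] by simp
next
  case (Suc m)
  then obtain Z where Z: "omega K A B X Z" "fbim Z K A B" "is_syzygy K A B m Z Y"
    using is_syzygy_split assms by metis
  then obtain Q :: "('a, 'b, 'k vec) bimodule" where Q: "pbim Q K A B" "sesx A B Z Q X" by (auto simp: omega_def)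
  have "sesx A B Z (dsum Q P) (dsum X P)"
    by (rule sesx_dsum[OF Q(2) fbim_bim[OF Z(2)] pbim_bim[OF Q(1)] fbim_bim[OF assms(3)] pbim_bim[OF assms(2)]])
  then have "omega K A B (dsum X P) Z" using pbim_dsum[OF Q(1) assms(2)] by (auto simp: omega_def)
  then have "is_syzygy K A B n (dsum X P) Y"
    using is_syzygy_Suc_left fbim_dsum[OF assms(3) pbim_fbim[OF assms(2)]] Z Suc by blast
  then show ?thesis using that stab_refl is_syzygy_fbim[OF assms(1) fdA fdB] fbim_bim by blast
qed

lemma ses_syzygy_stab:
  fixes U V E E' :: "('a, 'b, 'k vec) bimodule"
  shows "\<lbrakk>sesx A B U V E; fbim U K A B; fbim V K A B; fbim E K A B; is_syzygy K A B q E E'; pbim E' K A B;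
    is_syzygy K A B q U U'; is_syzygy K A B q V V'\<rbrakk> \<Longrightarrow> stab K A B U' V'"
proof (induction q arbitrary: U V E U' V' E')
  case 0
  note b = 0(2-4)[THEN fbim_bim]
  have b': "bim U' K A B" "bim V' K A B" using 0(7,8)[THEN is_syzygy_fbim, OF fdA fdB] fbim_bim by blast+
  have i: "bimod_iso A B E E'" "bimod_iso A B U U'" "bimod_iso A B V V'" using 0 by auto
  have E: "pbim E K A B" by (rule pbim_iso'[OF 0(6) b(3) i(1)])
  have "stab K A B V (dsum U E)" using stab_iso[OF b(2) bim_dsum[OF b(1,3)] ses_split[OF 0(1) b(1,2) E]] .
  then have "stab K A B U V"
    using stab_dsum[OF b(1) E] b bim_dsum by (meson stab_sym stab_trans)
  then show ?case using stab_iso[OF b(1) b'(1) i(2)] stab_iso[OF b(2) b'(2) i(3)] b b' by (meson stab_sym stab_trans)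
next
  case (Suc q)
  obtain E1 where E1: "omega K A B E E1" "fbim E1 K A B" "is_syzygy K A B q E1 E'" using is_syzygy_split[OF Suc.prems(5,4)] by blast
  obtain U1 where U1: "omega K A B U U1" "fbim U1 K A B" "is_syzygy K A B q U1 U'" using is_syzygy_split[OF Suc.prems(7,2)] by blast
  obtain V1 where V1: "omega K A B V V1" "fbim V1 K A B" "is_syzygy K A B q V1 V'" using is_syzygy_split[OF Suc.prems(8,3)] by blast
  obtain PE :: "('a, 'b, 'k vec) bimodule" where PE: "pbim PE K A B" "sesx A B E1 PE E" by (rule omegaE[OF E1(1)])
  obtain PU :: "('a, 'b, 'k vec) bimodule" where PU: "pbim PU K A B" "sesx A B U1 PU U" by (rule omegaE[OF U1(1)])
  obtain PV :: "('a, 'b, 'k vec) bimodule" where PV: "pbim PV K A B" "sesx A B V1 PV V" by (rule omegaE[OF V1(1)])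
  note p = PE(1) PU(1) PV(1)
  note f = Suc.prems(2-4) E1(2) U1(2) V1(2) p[THEN pbim_fbim]
  note b = f[THEN fbim_bim]
  have 1: "sesx A B E1 (dsum U PE) V"
    by (rule ses_rotate[OF Suc.prems(1) PE(2) _ _ _ _ p(1)]) (rule b)+
  have 2: "sesx A B V1 (dsum E1 PV) (dsum U PE)"
    by (rule ses_rotate[OF 1 PV(2) b(4) bim_dsum[OF b(1,7)] b(2,6) p(3)])
  have 3: "sesx A B U1 (dsum PU PE) (dsum U PE)" by (rule sesx_dsum[OF PU(2) b(5,8,1,7)])
  have 4: "sesx A B U1 (dsum V1 (dsum PU PE)) (dsum E1 PV)"
    by (rule ses_rotate[OF 2 3 b(6) bim_dsum[OF b(4,9)] bim_dsum[OF b(1,7)] b(5) pbim_dsum[OF p(2,1)]])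
  obtain E'' where E'': "is_syzygy K A B q (dsum E1 PV) E''" "stab K A B E' E''" by (rule is_syzygy_dsum[OF E1(3) p(3) f(4)])
  obtain V'' where V'': "is_syzygy K A B q (dsum V1 (dsum PU PE)) V''" "stab K A B V' V''"
    by (rule is_syzygy_dsum[OF V1(3) pbim_dsum[OF p(2,1)] f(6)])
  have "bim E'' K A B" using is_syzygy_fbim[OF E''(1) fdA fdB] fbim_bim by blast
  then have pE: "pbim E'' K A B" using stab_proj[OF E''(2) Suc.prems(6)] by simp
  have "stab K A B U' V''"
    by (rule Suc.IH[OF 4 f(5) fbim_dsum[OF f(6) fbim_dsum[OF f(8,7)]] fbim_dsum[OF f(4,9)] E''(1) pE U1(3) V''(1)])
  then show ?case using V''(2) is_syzygy_fbim[OF V''(1) fdA fdB] is_syzygy_fbim[OF U1(3) fdA fdB] is_syzygy_fbim[OF V1(3) fdA fdB]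
      fbim_bim by (meson stab_sym stab_trans)
qed

lemma ses_syzygy_shift:
  fixes U E V E' :: "('a, 'b, 'k vec) bimodule"
  assumes "sesx A B U E V" "fbim U K A B" "fbim V K A B" "fbim E K A B" "is_syzygy K A B q E E'" "pbim E' K A B"
    "is_syzygy K A B q U U'" "is_syzygy K A B (Suc q) V V'"
  shows "stab K A B U' V'"
proof -
  obtain V1 where V1: "omega K A B V V1" "fbim V1 K A B" "is_syzygy K A B q V1 V'" using is_syzygy_split[OF assms(8,3)] by blast
  obtain P :: "('a, 'b, 'k vec) bimodule" where P: "pbim P K A B" "sesx A B V1 P V" by (rule omegaE[OF V1(1)])
  note f = assms(2-4) V1(2) P(1)[THEN pbim_fbim]
  note b = f[THEN fbim_bim]
  have 1: "sesx A B V1 (dsum U P) E" by (rule ses_rotate[OF assms(1) P(2) b(1,3,2,4) P(1)])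
  obtain U'' where U'': "is_syzygy K A B q (dsum U P) U''" "stab K A B U' U''" by (rule is_syzygy_dsum[OF assms(7) P(1) f(1)])
  have "stab K A B V' U''"
    by (rule ses_syzygy_stab[OF 1 f(4) fbim_dsum[OF f(1,5)] f(3) assms(5,6) V1(3) U''(1)])
  then show ?thesis using U''(2) is_syzygy_fbim[OF U''(1) fdA fdB] is_syzygy_fbim[OF assms(7) fdA fdB] is_syzygy_fbim[OF V1(3) fdA fdB]
      fbim_bim by (meson stab_sym stab_trans)
qed

lemma ses_syzygy_quotient:
  fixes U E V E' :: "('a, 'b, 'k vec) bimodule"
  assumes "sesx A B E U V" "fbim U K A B" "fbim V K A B" "fbim E K A B" "is_syzygy K A B q E E'" "pbim E' K A B"
    "is_syzygy K A B (Suc q) U U'" "is_syzygy K A B (Suc q) V V'"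
  shows "stab K A B U' V'"
proof -
  obtain U1 where U1: "omega K A B U U1" "fbim U1 K A B" "is_syzygy K A B q U1 U'" using is_syzygy_split[OF assms(7,2)] by blast
  obtain V1 where V1: "omega K A B V V1" "fbim V1 K A B" "is_syzygy K A B q V1 V'" using is_syzygy_split[OF assms(8,3)] by blast
  obtain P :: "('a, 'b, 'k vec) bimodule" where P: "pbim P K A B" "sesx A B V1 P V" by (rule omegaE[OF V1(1)])
  obtain Q :: "('a, 'b, 'k vec) bimodule" where Q: "pbim Q K A B" "sesx A B U1 Q U" by (rule omegaE[OF U1(1)])
  note f = assms(2-4) U1(2) V1(2) P(1)[THEN pbim_fbim] Q(1)[THEN pbim_fbim]
  note b = f[THEN fbim_bim]
  have 1: "sesx A B V1 (dsum E P) U" by (rule ses_rotate[OF assms(1) P(2) b(3,1,2,5) P(1)])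
  have 2: "sesx A B U1 (dsum V1 Q) (dsum E P)"
    by (rule ses_rotate[OF 1 Q(2) b(5) bim_dsum[OF b(3,6)] b(1,4) Q(1)])
  obtain E'' where E'': "is_syzygy K A B q (dsum E P) E''" "stab K A B E' E''" by (rule is_syzygy_dsum[OF assms(5) P(1) f(3)])
  obtain V'' where V'': "is_syzygy K A B q (dsum V1 Q) V''" "stab K A B V' V''" by (rule is_syzygy_dsum[OF V1(3) Q(1) f(5)])
  have "bim E'' K A B" using is_syzygy_fbim[OF E''(1) fdA fdB] fbim_bim by blast
  then have pE: "pbim E'' K A B" using stab_proj[OF E''(2) assms(6)] by simp
  have "stab K A B U' V''"
    by (rule ses_syzygy_stab[OF 2 f(4) fbim_dsum[OF f(5,7)] fbim_dsum[OF f(3,6)] E''(1) pE U1(3) V''(1)])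
  then show ?thesis using V''(2) is_syzygy_fbim[OF V''(1) fdA fdB] is_syzygy_fbim[OF U1(3) fdA fdB] is_syzygy_fbim[OF V1(3) fdA fdB]
      fbim_bim by (meson stab_sym stab_trans)
qed

lemma sesx_kernel_proj:
  fixes U V E :: "('a, 'b, 'k vec) bimodule"
  assumes "sesx A B U V E" "pbim V K A B" "pbim E K A B" "bim U K A B" shows "pbim U K A B"
  using ses_split[OF assms(1,4) pbim_bim[OF assms(2)] assms(3)] pbim_iso[OF assms(2) bim_dsum[OF assms(4) pbim_bim[OF assms(3)]]]
    pbim_summand assms(3,4) pbim_bim by blast

end


section \<open>Tensor products\<close>

locale tensor_pair = M: bim M K S R + N: bim N K R T
  for K :: "('k, 'z) ring_scheme" and S :: "('k, 'a) module" and R :: "('k, 'b) module" and T :: "('k, 'c) module"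
    and M :: "('a, 'b, 'm) bimodule" and N :: "('b, 'c, 'n) bimodule"
begin

definition F where "F = free_Abelian_group (carrier M \<times> carrier N)"
definition U where "U = generate F (tensor_relations R M N)"
definition cls where "cls p = U #>\<^bsub>F\<^esub> p"
definition tens where "tens x y = cls (frag_of (x, y))"
abbreviation "MN \<equiv> tensor R M N"

lemma F_simps [simp]: "carrier F = {p. Poly_Mapping.keys p \<subseteq> carrier M \<times> carrier N}" "\<one>\<^bsub>F\<^esub> = 0" "p \<otimes>\<^bsub>F\<^esub> q = p + q"
  by (auto simp: F_def)

lemma comm_group_F: "comm_group F" by (simp add: F_def abelian_free_Abelian_group)

lemma keys_sum_sub: "\<lbrakk>Poly_Mapping.keys p \<subseteq> X; Poly_Mapping.keys q \<subseteq> X\<rbrakk> \<Longrightarrow> Poly_Mapping.keys (p + q) \<subseteq> X"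
  "\<lbrakk>Poly_Mapping.keys p \<subseteq> X; Poly_Mapping.keys q \<subseteq> X\<rbrakk> \<Longrightarrow> Poly_Mapping.keys (p - q) \<subseteq> X"
  using keys_add[of p q] keys_diff[of p q] by blast+

lemma rel_carrier: "tensor_relations R M N \<subseteq> carrier F"
  unfolding tensor_relations_def F_simps
  by (intro Un_least subsetI; elim CollectE exE conjE; simp only: mem_Collect_eq; intro keys_sum_sub; simp)

lemma subgroup_U: "subgroup U F"
  unfolding U_def by (rule group.generate_is_subgroup[OF comm_group.axioms(2)[OF comm_group_F] rel_carrier])

lemma U_facts: "0 \<in> U" "\<lbrakk>p \<in> U; q \<in> U\<rbrakk> \<Longrightarrow> p + q \<in> U" "p \<in> U \<Longrightarrow> - p \<in> U" "\<lbrakk>p \<in> U; q \<in> U\<rbrakk> \<Longrightarrow> p - q \<in> U"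
  "p \<in> U \<Longrightarrow> Poly_Mapping.keys p \<subseteq> carrier M \<times> carrier N"
proof -
  show 0: "0 \<in> U" "\<lbrakk>p \<in> U; q \<in> U\<rbrakk> \<Longrightarrow> p + q \<in> U" "p \<in> U \<Longrightarrow> Poly_Mapping.keys p \<subseteq> carrier M \<times> carrier N" for p q
    using subgroup.one_closed[OF subgroup_U] subgroup.m_closed[OF subgroup_U] subgroup.subset[OF subgroup_U] by auto
  show m: "p \<in> U \<Longrightarrow> - p \<in> U" for p
    using subgroup.m_inv_closed[OF subgroup_U, of p] 0(3)[of p] by (simp add: F_def)
  show "\<lbrakk>p \<in> U; q \<in> U\<rbrakk> \<Longrightarrow> p - q \<in> U" using 0(2)[of p "- q"] m[of q] by simp
qed

lemma rel_U: "r \<in> tensor_relations R M N \<Longrightarrow> r \<in> U"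
  unfolding U_def by (rule generate.incl)

lemma rel_add1: "\<lbrakk>x \<in> carrier M; x' \<in> carrier M; y \<in> carrier N\<rbrakk>
   \<Longrightarrow> frag_of (x \<oplus>\<^bsub>M\<^esub> x', y) - frag_of (x, y) - frag_of (x', y) \<in> U"
  and rel_add2: "\<lbrakk>x \<in> carrier M; y \<in> carrier N; y' \<in> carrier N\<rbrakk>
   \<Longrightarrow> frag_of (x, y \<oplus>\<^bsub>N\<^esub> y') - frag_of (x, y) - frag_of (x, y') \<in> U"
  and rel_bal: "\<lbrakk>x \<in> carrier M; b \<in> carrier R; y \<in> carrier N\<rbrakk>
   \<Longrightarrow> frag_of (rsmult M x b, y) - frag_of (x, b \<odot>\<^bsub>N\<^esub> y) \<in> U"
  by (rule rel_U, unfold tensor_relations_def, blast)+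

lemma cls_def': "cls p = {u + p | u. u \<in> U}"
  by (auto simp: cls_def r_coset_def)

lemma cls_self: "p \<in> cls p" using U_facts(1) by (force simp: cls_def')

lemma cls_eq_iff: "cls p = cls q \<longleftrightarrow> p - q \<in> U"
proof
  assume "cls p = cls q"
  then have "p \<in> cls q" using cls_self by metis
  then show "p - q \<in> U" by (auto simp: cls_def')
next
  assume pq: "p - q \<in> U"
  have "u + p = (u + (p - q)) + q" "u + q = (u - (p - q)) + p" for u by (simp_all add: algebra_simps)
  then show "cls p = cls q" unfolding cls_def' using pq U_facts(2,4) by blast
qed

lemma additive_U:
  assumes "\<And>p q. f (p - q) = f p - f q" "\<And>x y. \<lbrakk>x \<in> carrier M; y \<in> carrier N\<rbrakk> \<Longrightarrow> f (frag_of (x, y)) \<in> U"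
    "Poly_Mapping.keys p \<subseteq> carrier M \<times> carrier N"
  shows "f p \<in> U"
  using assms(3)
proof (induction p rule: frag_induction)
  case zero
  have "f 0 = 0" using assms(1)[of 0 0] by simp
  then show ?case using U_facts by simp
next
  case (one x) then show ?case using assms(2) by auto
next
  case (diff a b) then show ?case using assms(1) U_facts by simp
qed

lemma additive_U_U:
  assumes "\<And>p q. f (p - q) = f p - f q" "\<And>r. r \<in> tensor_relations R M N \<Longrightarrow> f r \<in> U" "p \<in> U"
  shows "f p \<in> U"
proof -
  have f0: "f 0 = 0" using assms(1)[of 0 0] by simp
  then have fm: "f (- p) = - f p" for p using assms(1)[of 0 p] by simp
  then have fp: "f (p + q) = f p + f q" for p q using assms(1)[of p "- q"] by simp
  show ?thesis using assms(3) unfolding U_def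
  proof (induction rule: generate.induct)
    case one then show ?case using f0 U_facts(1) by (simp add: U_def)
  next
    case (incl h) then show ?case using assms(2) by (simp add: U_def)
  next
    case (inv h)
    then have "inv\<^bsub>F\<^esub> h = - h" using rel_carrier by (auto simp: F_def)
    then show ?case using assms(2)[OF inv] fm U_facts(3) by (simp add: U_def)
  next
    case (eng h1 h2) then show ?case using fp U_facts(2) by (simp add: U_def)
  qed
qed

definition lact where "lact a = frag_extend (\<lambda>(x, y). frag_of (a \<odot>\<^bsub>M\<^esub> x, y))"
definition ract where "ract b = frag_extend (\<lambda>(x, y). frag_of (x, rsmult N y b))"

lemma act_simps [simp]:
  "lact a (frag_of (x, y)) = frag_of (a \<odot>\<^bsub>M\<^esub> x, y)" "ract b (frag_of (x, y)) = frag_of (x, rsmult N y b)"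
  "lact a (p - q) = lact a p - lact a q" "ract b (p - q) = ract b p - ract b q"
  "lact a (p + q) = lact a p + lact a q" "ract b (p + q) = ract b p + ract b q"
  by (simp_all add: lact_def ract_def frag_extend_diff frag_extend_add)

lemma lact_keys: "\<lbrakk>Poly_Mapping.keys p \<subseteq> carrier M \<times> carrier N; a \<in> carrier S\<rbrakk> \<Longrightarrow> Poly_Mapping.keys (lact a p) \<subseteq> carrier M \<times> carrier N"
  unfolding lact_def by (rule order_trans[OF keys_frag_extend]) auto
lemma ract_keys: "\<lbrakk>Poly_Mapping.keys p \<subseteq> carrier M \<times> carrier N; b \<in> carrier T\<rbrakk> \<Longrightarrow> Poly_Mapping.keys (ract b p) \<subseteq> carrier M \<times> carrier N"
  unfolding ract_def by (rule order_trans[OF keys_frag_extend]) auto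

lemma lact_U: "\<lbrakk>a \<in> carrier S; p \<in> U\<rbrakk> \<Longrightarrow> lact a p \<in> U"
  by (rule additive_U_U) (auto simp: tensor_relations_def M.l_add2 M.lr_assoc[symmetric] intro!: rel_add1 rel_add2 rel_bal)
lemma ract_U: "\<lbrakk>b \<in> carrier T; p \<in> U\<rbrakk> \<Longrightarrow> ract b p \<in> U"
  by (rule additive_U_U) (auto simp: tensor_relations_def N.r_add2 N.lr_assoc intro!: rel_add1 rel_add2 rel_bal)

lemma UN_cls:
  assumes "\<And>p q. f (p - q) = f p - f q" "\<And>p. p \<in> U \<Longrightarrow> f p \<in> U"
  shows "(\<Union>q\<in>cls p. U #>\<^bsub>F\<^esub> f q) = cls (f p)"
proof -
  have "U #>\<^bsub>F\<^esub> f q = cls (f p)" if "q \<in> cls p" for q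
  proof -
    have "q - p \<in> U" using that by (auto simp: cls_def')
    then have "f q - f p \<in> U" using assms by metis
    then show ?thesis using cls_eq_iff cls_def by metis
  qed
  then show ?thesis using cls_self by auto
qed

lemma tensor_carrier: "carrier MN = cls ` carrier F"
  by (simp add: tensor_def Let_def F_def[symmetric] U_def[symmetric] carrier_FactGroup cls_def[abs_def] del: F_simps)

lemma tensor_zero: "\<zero>\<^bsub>MN\<^esub> = cls 0"
proof -
  have "cls 0 = U" by (auto simp: cls_def')
  then show ?thesis by (simp add: tensor_def Let_def F_def[symmetric] U_def[symmetric])
qed

lemma tensor_add: "cls p \<oplus>\<^bsub>MN\<^esub> cls q = cls (p + q)"
proof -
  have "cls p \<oplus>\<^bsub>MN\<^esub> cls q = set_mult F (cls p) (cls q)"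
    by (simp add: tensor_def Let_def F_def[symmetric] U_def[symmetric])
  also have "\<dots> = cls (p + q)"
  proof (intro equalityI subsetI)
    fix z assume "z \<in> set_mult F (cls p) (cls q)"
    then obtain u v where "u \<in> U" "v \<in> U" "z = (u + p) + (v + q)" by (auto simp: set_mult_def cls_def')
    then have "u + v \<in> U" "z = (u + v) + (p + q)" using U_facts by (auto simp: algebra_simps)
    then show "z \<in> cls (p + q)" unfolding cls_def' by blast
  next
    fix z assume "z \<in> cls (p + q)"
    then obtain u where "u \<in> U" "z = (u + p) + (0 + q)" by (auto simp: cls_def' algebra_simps)
    then show "z \<in> set_mult F (cls p) (cls q)" using U_facts(1) by (auto simp: set_mult_def cls_def')
  qed
  finally show ?thesis .
qed

lemma tensor_left: "a \<in> carrier S \<Longrightarrow> a \<odot>\<^bsub>MN\<^esub> cls p = cls (lact a p)"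
  using UN_cls[of "lact a" p] lact_U
  by (simp add: tensor_def Let_def F_def[symmetric] U_def[symmetric] lact_def[symmetric])

lemma tensor_right: "b \<in> carrier T \<Longrightarrow> rsmult MN (cls p) b = cls (ract b p)"
  using UN_cls[of "ract b" p] ract_U
  by (simp add: tensor_def Let_def F_def[symmetric] U_def[symmetric] ract_def[symmetric])

lemma tensorE: assumes "t \<in> carrier MN" obtains p where "t = cls p" "Poly_Mapping.keys p \<subseteq> carrier M \<times> carrier N"
  using assms by (auto simp: tensor_carrier)

lemma cls_carrier: "Poly_Mapping.keys p \<subseteq> carrier M \<times> carrier N \<Longrightarrow> cls p \<in> carrier MN"
  by (auto simp: tensor_carrier)

lemma cls_eqI:
  assumes "\<And>p q. f (p - q) = f p - f q" "\<And>p q. g (p - q) = g p - g q"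
    "\<And>x y. \<lbrakk>x \<in> carrier M; y \<in> carrier N\<rbrakk> \<Longrightarrow> f (frag_of (x, y)) - g (frag_of (x, y)) \<in> U"
    "Poly_Mapping.keys p \<subseteq> carrier M \<times> carrier N"
  shows "cls (f p) = cls (g p)"
  unfolding cls_eq_iff by (rule additive_U[of "\<lambda>p. f p - g p"]) (use assms in \<open>auto simp: algebra_simps\<close>)

lemma bim_tensor: "bim MN K S T"
proof -
  have ag: "abelian_group MN"
  proof (rule abelian_groupI)
    fix x y assume "x \<in> carrier MN" "y \<in> carrier MN"
    then obtain p q where "x = cls p" "y = cls q" "Poly_Mapping.keys p \<subseteq> carrier M \<times> carrier N" "Poly_Mapping.keys q \<subseteq> carrier M \<times> carrier N"
      by (metis tensorE)
    then show "x \<oplus>\<^bsub>MN\<^esub> y \<in> carrier MN" by (simp only: tensor_add cls_carrier[OF keys_sum_sub(1)])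
  next
    fix x assume "x \<in> carrier MN"
    then obtain p where p: "x = cls p" "Poly_Mapping.keys p \<subseteq> carrier M \<times> carrier N" by (rule tensorE)
    show "\<exists>y\<in>carrier MN. y \<oplus>\<^bsub>MN\<^esub> x = \<zero>\<^bsub>MN\<^esub>"
      by (rule bexI[of _ "cls (- p)"]) (use p in \<open>auto simp: tensor_add tensor_zero intro!: cls_carrier\<close>)
  qed (auto simp: tensor_add tensor_zero add_ac elim!: tensorE intro!: cls_carrier keys_sum_sub)
  show ?thesis
    unfolding bim_def bim_axioms_def
  proof (intro conjI allI impI)
    fix a a' x assume a: "a \<in> carrier S" "a' \<in> carrier S" and "x \<in> carrier MN"
    then obtain p where p: "x = cls p" "Poly_Mapping.keys p \<subseteq> carrier M \<times> carrier N" by (blast elim: tensorE)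
    have "cls (lact (a \<oplus>\<^bsub>S\<^esub> a') p) = cls (lact a p + lact a' p)"
    proof (rule cls_eqI[OF _ _ _ p(2)])
      show "lact (a \<oplus>\<^bsub>S\<^esub> a') (frag_of (x, y)) - (lact a (frag_of (x, y)) + lact a' (frag_of (x, y))) \<in> U"
        if "x \<in> carrier M" "y \<in> carrier N" for x y using that a by (simp add: M.l_add1 rel_add1[unfolded diff_diff_eq])
    qed (simp_all add: algebra_simps)
    then show "(a \<oplus>\<^bsub>S\<^esub> a') \<odot>\<^bsub>MN\<^esub> x = a \<odot>\<^bsub>MN\<^esub> x \<oplus>\<^bsub>MN\<^esub> a' \<odot>\<^bsub>MN\<^esub> x" using a p by (simp add: tensor_left tensor_add)
    have "cls (lact (a \<otimes>\<^bsub>S\<^esub> a') p) = cls (lact a (lact a' p))"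
      by (rule cls_eqI[OF _ _ _ p(2)]) (use a in \<open>auto simp: M.l_assoc U_facts(1)\<close>)
    then show "(a \<otimes>\<^bsub>S\<^esub> a') \<odot>\<^bsub>MN\<^esub> x = a \<odot>\<^bsub>MN\<^esub> (a' \<odot>\<^bsub>MN\<^esub> x)" using a p by (simp add: tensor_left)
  next
    fix a a' x assume a: "a \<in> carrier T" "a' \<in> carrier T" and "x \<in> carrier MN"
    then obtain p where p: "x = cls p" "Poly_Mapping.keys p \<subseteq> carrier M \<times> carrier N" by (blast elim: tensorE)
    have "cls (ract (a \<oplus>\<^bsub>T\<^esub> a') p) = cls (ract a p + ract a' p)"
    proof (rule cls_eqI[OF _ _ _ p(2)])
      show "ract (a \<oplus>\<^bsub>T\<^esub> a') (frag_of (x, y)) - (ract a (frag_of (x, y)) + ract a' (frag_of (x, y))) \<in> U"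
        if "x \<in> carrier M" "y \<in> carrier N" for x y using that a by (simp add: N.r_add1 rel_add2[unfolded diff_diff_eq])
    qed (simp_all add: algebra_simps)
    then show "rsmult MN x (a \<oplus>\<^bsub>T\<^esub> a') = rsmult MN x a \<oplus>\<^bsub>MN\<^esub> rsmult MN x a'" using a p by (simp add: tensor_right tensor_add)
    have "cls (ract (a \<otimes>\<^bsub>T\<^esub> a') p) = cls (ract a' (ract a p))"
      by (rule cls_eqI[OF _ _ _ p(2)]) (use a in \<open>auto simp: N.r_assoc U_facts(1)\<close>)
    then show "rsmult MN x (a \<otimes>\<^bsub>T\<^esub> a') = rsmult MN (rsmult MN x a) a'" using a p by (simp add: tensor_right)
  next
    fix x assume "x \<in> carrier MN"
    then obtain p where p: "x = cls p" "Poly_Mapping.keys p \<subseteq> carrier M \<times> carrier N" by (blast elim: tensorE)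
    have "cls (lact \<one>\<^bsub>S\<^esub> p) = cls p"
      by (rule cls_eqI[of "lact \<one>\<^bsub>S\<^esub>" "\<lambda>p. p", OF _ _ _ p(2)]) (auto simp: U_facts(1))
    moreover have "cls (ract \<one>\<^bsub>T\<^esub> p) = cls p"
      by (rule cls_eqI[of "ract \<one>\<^bsub>T\<^esub>" "\<lambda>p. p", OF _ _ _ p(2)]) (auto simp: U_facts(1))
    ultimately show "\<one>\<^bsub>S\<^esub> \<odot>\<^bsub>MN\<^esub> x = x" "rsmult MN x \<one>\<^bsub>T\<^esub> = x" using p by (simp_all add: tensor_left tensor_right)
  next
    fix a b x assume a: "a \<in> carrier S" "b \<in> carrier T" and "x \<in> carrier MN"
    then obtain p where p: "x = cls p" "Poly_Mapping.keys p \<subseteq> carrier M \<times> carrier N" by (blast elim: tensorE)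
    have "cls (ract b (lact a p)) = cls (lact a (ract b p))"
      by (rule cls_eqI[OF _ _ _ p(2)]) (use a in \<open>auto simp: U_facts(1)\<close>)
    then show "rsmult MN (a \<odot>\<^bsub>MN\<^esub> x) b = a \<odot>\<^bsub>MN\<^esub> rsmult MN x b" using a p by (simp add: tensor_right tensor_left)
  next
    fix c x assume c: "c \<in> carrier K" and "x \<in> carrier MN"
    then obtain p where p: "x = cls p" "Poly_Mapping.keys p \<subseteq> carrier M \<times> carrier N" by (blast elim: tensorE)
    have "cls (lact (scal S c) p) = cls (ract (scal T c) p)"
      by (rule cls_eqI[OF _ _ _ p(2)]) (use c in \<open>auto simp: M.central N.central[symmetric] intro!: rel_bal\<close>)
    then show "scal S c \<odot>\<^bsub>MN\<^esub> x = rsmult MN x (scal T c)" using c p by (simp add: tensor_right tensor_left)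
  next
    fix a x assume a: "a \<in> carrier S" and "x \<in> carrier MN"
    then obtain p where "x = cls p" "Poly_Mapping.keys p \<subseteq> carrier M \<times> carrier N" by (blast elim: tensorE)
    then show "a \<odot>\<^bsub>MN\<^esub> x \<in> carrier MN" using cls_carrier[OF lact_keys[OF _ a]] a by (simp only: tensor_left)
  next
    fix a x assume a: "a \<in> carrier T" and "x \<in> carrier MN"
    then obtain p where "x = cls p" "Poly_Mapping.keys p \<subseteq> carrier M \<times> carrier N" by (blast elim: tensorE)
    then show "rsmult MN x a \<in> carrier MN" using cls_carrier[OF ract_keys[OF _ a]] a by (simp only: tensor_right)
  qed (auto simp: ag M.fdA N.fdB tensor_left tensor_right tensor_add elim!: tensorE)
qed

sublocale MN: bim MN K S T by (rule bim_tensor)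

lemma tens_closed [simp, intro]: "\<lbrakk>x \<in> carrier M; y \<in> carrier N\<rbrakk> \<Longrightarrow> tens x y \<in> carrier MN"
  unfolding tens_def by (rule cls_carrier) simp
lemma tens_add1: "\<lbrakk>x \<in> carrier M; x' \<in> carrier M; y \<in> carrier N\<rbrakk> \<Longrightarrow> tens (x \<oplus>\<^bsub>M\<^esub> x') y = tens x y \<oplus>\<^bsub>MN\<^esub> tens x' y"
  unfolding tens_def tensor_add cls_eq_iff using rel_add1 by (simp add: algebra_simps)
lemma tens_add2: "\<lbrakk>x \<in> carrier M; y \<in> carrier N; y' \<in> carrier N\<rbrakk> \<Longrightarrow> tens x (y \<oplus>\<^bsub>N\<^esub> y') = tens x y \<oplus>\<^bsub>MN\<^esub> tens x y'"
  unfolding tens_def tensor_add cls_eq_iff using rel_add2 by (simp add: algebra_simps)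
lemma tens_bal: "\<lbrakk>x \<in> carrier M; b \<in> carrier R; y \<in> carrier N\<rbrakk> \<Longrightarrow> tens (rsmult M x b) y = tens x (b \<odot>\<^bsub>N\<^esub> y)"
  unfolding tens_def cls_eq_iff by (rule rel_bal)
lemma tens_left: "a \<in> carrier S \<Longrightarrow> a \<odot>\<^bsub>MN\<^esub> tens x y = tens (a \<odot>\<^bsub>M\<^esub> x) y"
  unfolding tens_def by (simp add: tensor_left)
lemma tens_right: "b \<in> carrier T \<Longrightarrow> rsmult MN (tens x y) b = tens x (rsmult N y b)"
  unfolding tens_def by (simp add: tensor_right)
lemma tens_zero1 [simp]: "y \<in> carrier N \<Longrightarrow> tens \<zero>\<^bsub>M\<^esub> y = \<zero>\<^bsub>MN\<^esub>"
  using tens_add1[of "\<zero>\<^bsub>M\<^esub>" "\<zero>\<^bsub>M\<^esub>" y] MN.add.l_cancel_one[of "tens \<zero>\<^bsub>M\<^esub> y" "tens \<zero>\<^bsub>M\<^esub> y"] by simp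
lemma tens_zero2 [simp]: "x \<in> carrier M \<Longrightarrow> tens x \<zero>\<^bsub>N\<^esub> = \<zero>\<^bsub>MN\<^esub>"
  using tens_add2[of x "\<zero>\<^bsub>N\<^esub>" "\<zero>\<^bsub>N\<^esub>"] MN.add.l_cancel_one[of "tens x \<zero>\<^bsub>N\<^esub>" "tens x \<zero>\<^bsub>N\<^esub>"] by simp
lemma tens_neg: "\<lbrakk>x \<in> carrier M; y \<in> carrier N\<rbrakk> \<Longrightarrow> \<ominus>\<^bsub>MN\<^esub> tens x y = tens (\<ominus>\<^bsub>M\<^esub> x) y"
  using tens_add1[of "\<ominus>\<^bsub>M\<^esub> x" x y] by (simp add: M.l_neg MN.minus_equality)

lemma tensor_induct [consumes 1, case_names zero tens add]:
  assumes "t \<in> carrier MN" "P \<zero>\<^bsub>MN\<^esub>" "\<And>x y. \<lbrakk>x \<in> carrier M; y \<in> carrier N\<rbrakk> \<Longrightarrow> P (tens x y)"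
    "\<And>s t. \<lbrakk>s \<in> carrier MN; t \<in> carrier MN; P s; P t\<rbrakk> \<Longrightarrow> P (s \<oplus>\<^bsub>MN\<^esub> t)"
  shows "P t"
proof -
  have "P (cls p) \<and> P (cls (- p)) \<and> Poly_Mapping.keys p \<subseteq> carrier M \<times> carrier N" if "Poly_Mapping.keys p \<subseteq> carrier M \<times> carrier N" for p
    using that
  proof (induction p rule: frag_induction)
    case zero then show ?case using assms(2) by (simp add: tensor_zero)
  next
    case (one z)
    obtain x y where z: "z = (x, y)" by (cases z)
    have "cls (- frag_of z) \<oplus>\<^bsub>MN\<^esub> tens x y = \<zero>\<^bsub>MN\<^esub>" by (simp add: tens_def tensor_add z tensor_zero)
    moreover have "cls (- frag_of z) \<in> carrier MN" using one by (intro cls_carrier) simp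
    ultimately have "\<ominus>\<^bsub>MN\<^esub> tens x y = cls (- frag_of z)" using one z by (intro MN.minus_equality) auto
    then have "cls (- frag_of z) = tens (\<ominus>\<^bsub>M\<^esub> x) y" using tens_neg one z by simp
    then show ?case using assms(3) one z by (auto simp: tens_def[symmetric])
  next
    case (diff a b)
    have "cls (a - b) = cls a \<oplus>\<^bsub>MN\<^esub> cls (- b)" "cls (- (a - b)) = cls (- a) \<oplus>\<^bsub>MN\<^esub> cls b"
      by (simp_all add: tensor_add)
    moreover have "Poly_Mapping.keys (a - b) \<subseteq> carrier M \<times> carrier N" by (intro keys_sum_sub(2)) (use diff in auto)
    ultimately show ?case using diff assms(4) cls_carrier by simp
  qed
  then show ?thesis using assms(1) by (metis tensorE)
qed

lemma tensor_universal:
  assumes "comm_group G" "\<And>x y. \<lbrakk>x \<in> carrier M; y \<in> carrier N\<rbrakk> \<Longrightarrow> \<beta> x y \<in> carrier G"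
    "\<And>x x' y. \<lbrakk>x \<in> carrier M; x' \<in> carrier M; y \<in> carrier N\<rbrakk> \<Longrightarrow> \<beta> (x \<oplus>\<^bsub>M\<^esub> x') y = \<beta> x y \<otimes>\<^bsub>G\<^esub> \<beta> x' y"
    "\<And>x y y'. \<lbrakk>x \<in> carrier M; y \<in> carrier N; y' \<in> carrier N\<rbrakk> \<Longrightarrow> \<beta> x (y \<oplus>\<^bsub>N\<^esub> y') = \<beta> x y \<otimes>\<^bsub>G\<^esub> \<beta> x y'"
    "\<And>x b y. \<lbrakk>x \<in> carrier M; b \<in> carrier R; y \<in> carrier N\<rbrakk> \<Longrightarrow> \<beta> (rsmult M x b) y = \<beta> x (b \<odot>\<^bsub>N\<^esub> y)"
  shows "\<exists>h. (\<forall>t\<in>carrier MN. h t \<in> carrier G) \<and>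
    (\<forall>s\<in>carrier MN. \<forall>t\<in>carrier MN. h (s \<oplus>\<^bsub>MN\<^esub> t) = h s \<otimes>\<^bsub>G\<^esub> h t) \<and>
    (\<forall>x\<in>carrier M. \<forall>y\<in>carrier N. h (tens x y) = \<beta> x y)"
proof -
  interpret G: comm_group G by fact
  obtain k where k: "k \<in> hom F G" "\<And>z. z \<in> carrier M \<times> carrier N \<Longrightarrow> k (frag_of z) = (\<lambda>(x, y). \<beta> x y) z"
    using G.free_Abelian_group_universal[of "\<lambda>(x, y). \<beta> x y" "carrier M \<times> carrier N"] assms(2) unfolding F_def
    by (metis (no_types, lifting) case_prod_conv image_subsetI mem_Sigma_iff surj_pair)
  interpret k: group_hom F G k
    using k comm_group.axioms(2)[OF comm_group_F] by (simp add: group_hom_def group_hom_axioms_def G.group_axioms)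
  have kc: "k p \<in> carrier G" if "Poly_Mapping.keys p \<subseteq> carrier M \<times> carrier N" for p using k.hom_closed that by simp
  have kd: "k (p - q) = k p \<otimes>\<^bsub>G\<^esub> inv\<^bsub>G\<^esub> k q"
    if "Poly_Mapping.keys p \<subseteq> carrier M \<times> carrier N" "Poly_Mapping.keys q \<subseteq> carrier M \<times> carrier N" for p q
  proof -
    have "inv\<^bsub>F\<^esub> q = - q" using that by (simp add: F_def)
    then show ?thesis using k.hom_mult[of p "- q"] k.hom_inv[of q] that by simp
  qed
  have can: "a \<otimes>\<^bsub>G\<^esub> b \<otimes>\<^bsub>G\<^esub> inv\<^bsub>G\<^esub> a \<otimes>\<^bsub>G\<^esub> inv\<^bsub>G\<^esub> b = \<one>\<^bsub>G\<^esub>" if "a \<in> carrier G" "b \<in> carrier G" for a b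
  proof -
    have "a \<otimes>\<^bsub>G\<^esub> b \<otimes>\<^bsub>G\<^esub> inv\<^bsub>G\<^esub> a = b" using that by (simp add: G.m_comm[of a b] G.m_assoc)
    then show ?thesis using that by simp
  qed
  have kr: "k r = \<one>\<^bsub>G\<^esub>" if "r \<in> tensor_relations R M N" for r
    using that unfolding tensor_relations_def
    by (auto simp: kd keys_sum_sub k(2) assms(2-5) can)
  have kU: "k u = \<one>\<^bsub>G\<^esub>" if "u \<in> U" for u
    using that unfolding U_def
  proof (induction rule: generate.induct)
    case one then show ?case using k.hom_one by simp
  next
    case (incl h) then show ?case by (rule kr)
  next
    case (inv h) then show ?case using kr[OF inv] rel_carrier by (subst k.hom_inv) auto
  next
    case (eng h1 h2)
    then have "h1 \<in> carrier F" "h2 \<in> carrier F" using U_facts(5) U_def by auto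
    then show ?case using eng by (simp only: k.hom_mult) simp
  qed
  have keq: "k p = k q" if "cls p = cls q" "Poly_Mapping.keys p \<subseteq> carrier M \<times> carrier N" "Poly_Mapping.keys q \<subseteq> carrier M \<times> carrier N" for p q
  proof -
    have "k p \<otimes>\<^bsub>G\<^esub> inv\<^bsub>G\<^esub> k q = \<one>\<^bsub>G\<^esub>" using kU[of "p - q"] that cls_eq_iff kd by simp
    then have "k p \<otimes>\<^bsub>G\<^esub> inv\<^bsub>G\<^esub> k q \<otimes>\<^bsub>G\<^esub> k q = k q" using kc that by simp
    then show ?thesis using kc that by (simp add: G.m_assoc)
  qed
  define h where "h t = k (SOME p. t = cls p \<and> Poly_Mapping.keys p \<subseteq> carrier M \<times> carrier N)" for t
  have h: "h (cls p) = k p" if "Poly_Mapping.keys p \<subseteq> carrier M \<times> carrier N" for p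
  proof -
    let ?q = "SOME q. cls p = cls q \<and> Poly_Mapping.keys q \<subseteq> carrier M \<times> carrier N"
    have "cls p = cls ?q \<and> Poly_Mapping.keys ?q \<subseteq> carrier M \<times> carrier N"
      by (rule someI[of _ p]) (use that in auto)
    then have "k ?q = k p" using keq[of ?q p] that by auto
    then show ?thesis by (simp add: h_def)
  qed
  show ?thesis
  proof (intro exI[of _ h] conjI ballI)
    show "h t \<in> carrier G" if "t \<in> carrier MN" for t using that h kc by (auto elim!: tensorE)
    show "h (s \<oplus>\<^bsub>MN\<^esub> t) = h s \<otimes>\<^bsub>G\<^esub> h t" if "s \<in> carrier MN" "t \<in> carrier MN" for s t
      using that h k.hom_mult by (auto elim!: tensorE simp: tensor_add keys_sum_sub)
    show "h (tens x y) = \<beta> x y" if "x \<in> carrier M" "y \<in> carrier N" for x y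
      using h[of "frag_of (x, y)"] that k(2)[of "(x, y)"] by (simp add: tens_def)
  qed
qed

lemma tensor_hom:
  assumes "bim Y K S T" "\<And>x y. \<lbrakk>x \<in> carrier M; y \<in> carrier N\<rbrakk> \<Longrightarrow> \<beta> x y \<in> carrier Y"
    "\<And>x x' y. \<lbrakk>x \<in> carrier M; x' \<in> carrier M; y \<in> carrier N\<rbrakk> \<Longrightarrow> \<beta> (x \<oplus>\<^bsub>M\<^esub> x') y = \<beta> x y \<oplus>\<^bsub>Y\<^esub> \<beta> x' y"
    "\<And>x y y'. \<lbrakk>x \<in> carrier M; y \<in> carrier N; y' \<in> carrier N\<rbrakk> \<Longrightarrow> \<beta> x (y \<oplus>\<^bsub>N\<^esub> y') = \<beta> x y \<oplus>\<^bsub>Y\<^esub> \<beta> x y'"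
    "\<And>x b y. \<lbrakk>x \<in> carrier M; b \<in> carrier R; y \<in> carrier N\<rbrakk> \<Longrightarrow> \<beta> (rsmult M x b) y = \<beta> x (b \<odot>\<^bsub>N\<^esub> y)"
    "\<And>a x y. \<lbrakk>a \<in> carrier S; x \<in> carrier M; y \<in> carrier N\<rbrakk> \<Longrightarrow> \<beta> (a \<odot>\<^bsub>M\<^esub> x) y = a \<odot>\<^bsub>Y\<^esub> \<beta> x y"
    "\<And>x y b. \<lbrakk>x \<in> carrier M; y \<in> carrier N; b \<in> carrier T\<rbrakk> \<Longrightarrow> \<beta> x (rsmult N y b) = rsmult Y (\<beta> x y) b"
  obtains h where "h \<in> bimod_hom S T MN Y" "\<And>x y. \<lbrakk>x \<in> carrier M; y \<in> carrier N\<rbrakk> \<Longrightarrow> h (tens x y) = \<beta> x y"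
proof -
  interpret Y: bim Y K S T by fact
  have "\<exists>h. (\<forall>t\<in>carrier MN. h t \<in> carrier Y) \<and>
    (\<forall>s\<in>carrier MN. \<forall>t\<in>carrier MN. h (s \<oplus>\<^bsub>MN\<^esub> t) = h s \<oplus>\<^bsub>Y\<^esub> h t) \<and>
    (\<forall>x\<in>carrier M. \<forall>y\<in>carrier N. h (tens x y) = \<beta> x y)"
    using tensor_universal[of "add_monoid Y" \<beta>, OF Y.a_comm_group] assms(2-5) by simp
  then obtain h where h: "\<And>t. t \<in> carrier MN \<Longrightarrow> h t \<in> carrier Y"
    "\<And>s t. \<lbrakk>s \<in> carrier MN; t \<in> carrier MN\<rbrakk> \<Longrightarrow> h (s \<oplus>\<^bsub>MN\<^esub> t) = h s \<oplus>\<^bsub>Y\<^esub> h t"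
    "\<And>x y. \<lbrakk>x \<in> carrier M; y \<in> carrier N\<rbrakk> \<Longrightarrow> h (tens x y) = \<beta> x y"
    by blast
  have h0: "h \<zero>\<^bsub>MN\<^esub> = \<zero>\<^bsub>Y\<^esub>"
    using h(2)[of "\<zero>\<^bsub>MN\<^esub>" "\<zero>\<^bsub>MN\<^esub>"] h(1)[of "\<zero>\<^bsub>MN\<^esub>"] Y.add.l_cancel_one[of "h \<zero>\<^bsub>MN\<^esub>" "h \<zero>\<^bsub>MN\<^esub>"] by simp
  have "h \<in> bimod_hom S T MN Y"
  proof (rule bimod_homI)
    fix a t assume a: "a \<in> carrier S" and "t \<in> carrier MN"
    from this(2) show "h (a \<odot>\<^bsub>MN\<^esub> t) = a \<odot>\<^bsub>Y\<^esub> h t"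
    proof (induction t rule: tensor_induct)
      case zero then show ?case using a h0 by simp
    next
      case (tens x y) then show ?case using a by (simp add: tens_left h(3) assms(6))
    next
      case (add s t) then show ?case using a by (simp add: MN.l_add2 Y.l_add2 h(1,2))
    qed
  next
    fix b t assume b: "b \<in> carrier T" and "t \<in> carrier MN"
    from this(2) show "h (rsmult MN t b) = rsmult Y (h t) b"
    proof (induction t rule: tensor_induct)
      case zero then show ?case using b h0 by simp
    next
      case (tens x y) then show ?case using b by (simp add: tens_right h(3) assms(7))
    next
      case (add s t) then show ?case using b by (simp add: MN.r_add2 Y.r_add2 h(1,2))
    qed
  qed (use h in auto)
  then show ?thesis using that h(3) by blast
qed

lemma tensor_hom_ex:
  assumes "bim Y K S T" "\<And>x y. \<lbrakk>x \<in> carrier M; y \<in> carrier N\<rbrakk> \<Longrightarrow> \<beta> x y \<in> carrier Y"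
    "\<And>x x' y. \<lbrakk>x \<in> carrier M; x' \<in> carrier M; y \<in> carrier N\<rbrakk> \<Longrightarrow> \<beta> (x \<oplus>\<^bsub>M\<^esub> x') y = \<beta> x y \<oplus>\<^bsub>Y\<^esub> \<beta> x' y"
    "\<And>x y y'. \<lbrakk>x \<in> carrier M; y \<in> carrier N; y' \<in> carrier N\<rbrakk> \<Longrightarrow> \<beta> x (y \<oplus>\<^bsub>N\<^esub> y') = \<beta> x y \<oplus>\<^bsub>Y\<^esub> \<beta> x y'"
    "\<And>x b y. \<lbrakk>x \<in> carrier M; b \<in> carrier R; y \<in> carrier N\<rbrakk> \<Longrightarrow> \<beta> (rsmult M x b) y = \<beta> x (b \<odot>\<^bsub>N\<^esub> y)"
    "\<And>a x y. \<lbrakk>a \<in> carrier S; x \<in> carrier M; y \<in> carrier N\<rbrakk> \<Longrightarrow> \<beta> (a \<odot>\<^bsub>M\<^esub> x) y = a \<odot>\<^bsub>Y\<^esub> \<beta> x y"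
    "\<And>x y b. \<lbrakk>x \<in> carrier M; y \<in> carrier N; b \<in> carrier T\<rbrakk> \<Longrightarrow> \<beta> x (rsmult N y b) = rsmult Y (\<beta> x y) b"
  shows "\<exists>h\<in>bimod_hom S T MN Y. \<forall>x\<in>carrier M. \<forall>y\<in>carrier N. h (tens x y) = \<beta> x y"
  by (rule tensor_hom[of Y \<beta>, OF assms]) auto

lemma tensor_hom_eq:
  assumes "bim Y K S T" "f \<in> bimod_hom S T MN Y" "g \<in> bimod_hom S T MN Y"
    "\<And>x y. \<lbrakk>x \<in> carrier M; y \<in> carrier N\<rbrakk> \<Longrightarrow> f (tens x y) = g (tens x y)" "t \<in> carrier MN"
  shows "f t = g t"
proof -
  interpret f: bhom K S T MN Y f using assms MN.bim_axioms by (intro bhomI)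
  interpret g: bhom K S T MN Y g using assms MN.bim_axioms by (intro bhomI)
  from assms(5) show ?thesis
  proof (induction t rule: tensor_induct)
    case zero show ?case by (simp only: f.zero g.zero)
  next
    case (tens x y) then show ?case by (rule assms(4))
  next
    case (add s t) then show ?case by (simp only: f.add g.add)
  qed
qed

end


abbreviation tens :: "('k, 'b) module \<Rightarrow> ('a, 'b, 'm) bimodule \<Rightarrow> ('b, 'c, 'n) bimodule \<Rightarrow> 'm \<Rightarrow> 'n
    \<Rightarrow> ('m \<times> 'n \<Rightarrow>\<^sub>0 int) set" where
  "tens R M N \<equiv> tensor_pair.tens R M N"

lemma tensor_pairI: "\<lbrakk>bim M K S R; bim N K R T\<rbrakk> \<Longrightarrow> tensor_pair K S R T M N"
  by (simp add: tensor_pair_def)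

lemma fbim_tensor:
  assumes "fbim M K S R" "fbim N K R T" shows "fbim (tensor R M N) K S T"
proof -
  interpret M: fbim M K S R by fact
  interpret N: fbim N K R T by fact
  interpret Z: tensor_pair K S R T M N by unfold_locales
  interpret VM: vspace "kspace S M" K by (rule M.vspace_kspace)
  interpret VN: vspace "kspace R N" K by (rule N.vspace_kspace)
  obtain ms where ms: "set ms \<subseteq> carrier M" "spn K (kspace S M) ms = carrier M" using M.fdim by (auto simp: fdim_def)
  obtain ns where ns: "set ns \<subseteq> carrier N" "spn K (kspace R N) ns = carrier N" using N.fdim by (auto simp: fdim_def)
  let ?G = "(\<lambda>(x, y). tens R M N x y) ` (set ms \<times> set ns)"
  have "H = carrier Z.MN" if H: "Z.MN.stable_set H" and G: "?G \<subseteq> H" for H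
  proof -
    have Hadd: "s \<oplus>\<^bsub>Z.MN\<^esub> t \<in> H" if "s \<in> H" "t \<in> H" for s t using H that by (auto simp: Z.MN.stable_set_def)
    have H0: "\<zero>\<^bsub>Z.MN\<^esub> \<in> H" using H by (auto simp: Z.MN.stable_set_def)
    have Hs: "a \<odot>\<^bsub>Z.MN\<^esub> t \<in> H" if "a \<in> carrier S" "t \<in> H" for a t using H that by (auto simp: Z.MN.stable_set_def)
    have 1: "tens R M N x y \<in> H" if y: "y \<in> set ns" and x: "x \<in> carrier M" for x y
    proof -
      have yN: "y \<in> carrier N" using y ns by auto
      have "vsub K (kspace S M) {x \<in> carrier M. tens R M N x y \<in> H}"
        using yN H0 by (auto simp: vsub_def Z.tens_add1 Hadd Z.tens_left[symmetric] Hs)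
      moreover have "set ms \<subseteq> {x \<in> carrier M. tens R M N x y \<in> H}" using ms G y by auto
      ultimately show ?thesis using VM.spn_least[of _ ms] ms x by auto
    qed
    have 2: "tens R M N x y \<in> H" if y: "y \<in> carrier N" and x: "x \<in> carrier M" for x y
    proof -
      have s: "tens R M N x (scal R c \<odot>\<^bsub>N\<^esub> z) = scal S c \<odot>\<^bsub>Z.MN\<^esub> tens R M N x z" if "c \<in> carrier K" "z \<in> carrier N" for c z
        using that x by (simp add: Z.tens_bal[symmetric] M.central[symmetric] Z.tens_left)
      have "vsub K (kspace R N) {y \<in> carrier N. tens R M N x y \<in> H}"
        using x H0 by (auto simp: vsub_def Z.tens_add2 Hadd s Hs)
      moreover have "set ns \<subseteq> {y \<in> carrier N. tens R M N x y \<in> H}" using ns 1 x by auto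
      ultimately show ?thesis using VN.spn_least[of _ ns] ns y by auto
    qed
    have "t \<in> H" if "t \<in> carrier Z.MN" for t
      using that by (induction t rule: Z.tensor_induct) (auto intro: H0 2 Hadd)
    then show ?thesis using H by (auto simp: Z.MN.stable_set_def)
  qed
  moreover have "finite ?G" "?G \<subseteq> carrier Z.MN" using ms ns by auto
  ultimately have "fg_bimodule K S T Z.MN"
    unfolding fg_bimodule_def Z.MN.subbimodule_iff using Z.MN.bim_axioms bim_iff by metis
  then show ?thesis using M.fdA N.fdB by (simp add: fbim_iff_fg)
qed

lemma tensor_map:
  assumes "bim M K S R" "bim N K R T" "bim N' K R T" "f \<in> bimod_hom R T N N'"
  obtains h where "h \<in> bimod_hom S T (tensor R M N) (tensor R M N')"
    "\<And>x y. \<lbrakk>x \<in> carrier M; y \<in> carrier N\<rbrakk> \<Longrightarrow> h (tens R M N x y) = tens R M N' x (f y)"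
proof -
  interpret N: tensor_pair K S R T M N using assms by (intro tensor_pairI)
  interpret N': tensor_pair K S R T M N' using assms by (intro tensor_pairI)
  interpret f: bhom K R T N N' f using assms by (intro bhomI)
  show ?thesis
    by (rule N.tensor_hom[of N'.MN "\<lambda>x y. N'.tens x (f y)"])
       (auto simp: N'.tens_add1 N'.tens_add2 N'.tens_bal N'.tens_left N'.tens_right N'.MN.bim_axioms intro: that)
qed

lemma tensor_right_exact:
  assumes s: "ses R T X' i X p X''" and M: "bim M K S R" and X: "bim X' K R T" "bim X K R T" "bim X'' K R T"
    and hi: "hi \<in> bimod_hom S T (tensor R M X') (tensor R M X)"
      "\<And>x y. \<lbrakk>x \<in> carrier M; y \<in> carrier X'\<rbrakk> \<Longrightarrow> hi (tens R M X' x y) = tens R M X x (i y)"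
    and hp: "hp \<in> bimod_hom S T (tensor R M X) (tensor R M X'')"
      "\<And>x y. \<lbrakk>x \<in> carrier M; y \<in> carrier X\<rbrakk> \<Longrightarrow> hp (tens R M X x y) = tens R M X'' x (p y)"
    and t: "t \<in> carrier (tensor R M X)" "hp t = \<zero>\<^bsub>tensor R M X''\<^esub>"
  shows "t \<in> hi ` carrier (tensor R M X')"
proof -
  note D = sesD[OF s X]
  interpret i: bhom K R T X' X i by (rule D)
  interpret p: bhom K R T X X'' p by (rule D)
  interpret X': tensor_pair K S R T M X' using assms by (intro tensor_pairI)
  interpret X: tensor_pair K S R T M X using assms by (intro tensor_pairI)
  interpret X'': tensor_pair K S R T M X'' using assms by (intro tensor_pairI)
  interpret hi: bhom K S T X'.MN X.MN hi using hi by (intro bhomI) unfold_locales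
  interpret hp: bhom K S T X.MN X''.MN hp using hp by (intro bhomI) unfold_locales
  define I where "I = hi ` carrier X'.MN"
  have "X'.MN.stable_set (carrier X'.MN)" by (auto simp: X'.MN.stable_set_def)
  then have I: "X.MN.stable_set I" unfolding I_def by (rule hi.stable_image)
  have Ic: "u \<in> carrier X.MN" if "u \<in> I" for u using I that by (auto simp: X.MN.stable_set_def)
  have Ia: "u \<oplus>\<^bsub>X.MN\<^esub> v \<in> I" if "u \<in> I" "v \<in> I" for u v using I that by (auto simp: X.MN.stable_set_def)
  have I0: "\<zero>\<^bsub>X.MN\<^esub> \<in> I" using I by (auto simp: X.MN.stable_set_def)
  have In: "\<ominus>\<^bsub>X.MN\<^esub> u \<in> I" if "u \<in> I" for u using X.MN.stable_set_neg[OF I that] .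
  let ?A = "add_monoid X.MN"
  have sub: "subgroup I ?A"
  proof (rule subgroup.intro)
    show "inv\<^bsub>?A\<^esub> u \<in> I" if "u \<in> I" for u using In[OF that] by (simp add: a_inv_def)
  qed (use Ic Ia I0 in auto)
  define C where "C u = I #>\<^bsub>?A\<^esub> u" for u
  have Cadd: "set_mult ?A (C u) (C v) = C (u \<oplus>\<^bsub>X.MN\<^esub> v)" if "u \<in> carrier X.MN" "v \<in> carrier X.MN" for u v
    using normal.rcos_sum[OF X.MN.add.subgroup_imp_normal[OF sub], of u v] that by (simp add: C_def)
  have CI: "C (u \<oplus>\<^bsub>X.MN\<^esub> v) = C u" if "u \<in> carrier X.MN" "v \<in> I" for u v
  proof -
    have "C v = I" unfolding C_def by (rule X.MN.add.coset_join2) (use that Ic sub in auto)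
    moreover have "C \<zero>\<^bsub>X.MN\<^esub> = I" unfolding C_def by (rule X.MN.add.coset_join2) (use I0 sub in auto)
    ultimately show ?thesis using Cadd[of u v] Cadd[of u "\<zero>\<^bsub>X.MN\<^esub>"] that Ic by simp
  qed
  have G: "comm_group (?A Mod I)" by (rule X.MN.add.abelian_FactGroup[OF sub])
  have Cc: "C u \<in> carrier (?A Mod I)" if "u \<in> carrier X.MN" for u using that by (auto simp: C_def carrier_FactGroup)
  have "\<forall>z\<in>carrier X''. \<exists>y. y \<in> carrier X \<and> p y = z" using D(5) by blast
  then have "\<exists>q. \<forall>z\<in>carrier X''. q z \<in> carrier X \<and> p (q z) = z" by (rule bchoice)
  then obtain q where q: "\<And>z. z \<in> carrier X'' \<Longrightarrow> q z \<in> carrier X" "\<And>z. z \<in> carrier X'' \<Longrightarrow> p (q z) = z" by blast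
  have wd: "C (X.tens x y) = C (X.tens x z)" if w: "x \<in> carrier M" "y \<in> carrier X" "z \<in> carrier X" "p y = p z" for x y z
  proof -
    obtain u where u: "u \<in> carrier X'" "i u = y \<ominus>\<^bsub>X\<^esub> z" using D(6)[of "y \<ominus>\<^bsub>X\<^esub> z"] w by auto
    note that = w
    have "y = z \<oplus>\<^bsub>X\<^esub> i u" using u that by simp
    then have "X.tens x y = X.tens x z \<oplus>\<^bsub>X.MN\<^esub> X.tens x (i u)" using that u X.tens_add2[of x z "i u"] by simp
    moreover have "X.tens x (i u) \<in> I" unfolding I_def using hi(2)[of x u] that u X'.tens_closed by (metis imageI)
    ultimately show ?thesis using CI that by simp
  qed
  have "\<exists>g. (\<forall>t\<in>carrier X''.MN. g t \<in> carrier (?A Mod I)) \<and>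
    (\<forall>s\<in>carrier X''.MN. \<forall>t\<in>carrier X''.MN. g (s \<oplus>\<^bsub>X''.MN\<^esub> t) = g s \<otimes>\<^bsub>?A Mod I\<^esub> g t) \<and>
    (\<forall>x\<in>carrier M. \<forall>y\<in>carrier X''. g (X''.tens x y) = C (X.tens x (q y)))"
  proof (rule X''.tensor_universal[OF G])
    show "C (X.tens x (q y)) \<in> carrier (?A Mod I)" if "x \<in> carrier M" "y \<in> carrier X''" for x y
      using that q Cc by simp
    show "C (X.tens (x \<oplus>\<^bsub>M\<^esub> x') (q y)) = C (X.tens x (q y)) \<otimes>\<^bsub>?A Mod I\<^esub> C (X.tens x' (q y))"
      if "x \<in> carrier M" "x' \<in> carrier M" "y \<in> carrier X''" for x x' y
      using that q by (simp add: Cadd X.tens_add1)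
    show "C (X.tens x (q (y \<oplus>\<^bsub>X''\<^esub> y'))) = C (X.tens x (q y)) \<otimes>\<^bsub>?A Mod I\<^esub> C (X.tens x (q y'))"
      if "x \<in> carrier M" "y \<in> carrier X''" "y' \<in> carrier X''" for x y y'
    proof -
      have "C (X.tens x (q (y \<oplus>\<^bsub>X''\<^esub> y'))) = C (X.tens x (q y \<oplus>\<^bsub>X\<^esub> q y'))"
        by (rule wd) (use that q in auto)
      then show ?thesis using that q by (simp add: Cadd X.tens_add2)
    qed
    show "C (X.tens (rsmult M x b) (q y)) = C (X.tens x (q (b \<odot>\<^bsub>X''\<^esub> y)))"
      if "x \<in> carrier M" "b \<in> carrier R" "y \<in> carrier X''" for x b y
    proof -
      have "C (X.tens x (q (b \<odot>\<^bsub>X''\<^esub> y))) = C (X.tens x (b \<odot>\<^bsub>X\<^esub> q y))"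
        by (rule wd) (use that q in auto)
      then show ?thesis using that q by (simp add: X.tens_bal)
    qed
  qed
  then obtain g where g0: "\<forall>s\<in>carrier X''.MN. \<forall>t\<in>carrier X''.MN. g (s \<oplus>\<^bsub>X''.MN\<^esub> t) = set_mult ?A (g s) (g t)"
    and g1: "\<forall>x\<in>carrier M. \<forall>y\<in>carrier X''. g (X''.tens x y) = C (X.tens x (q y))"
    unfolding mult_FactGroup by (elim exE conjE)
  have g: "\<lbrakk>s \<in> carrier X''.MN; t \<in> carrier X''.MN\<rbrakk> \<Longrightarrow> g (s \<oplus>\<^bsub>X''.MN\<^esub> t) = set_mult ?A (g s) (g t)"
    "\<lbrakk>x \<in> carrier M; y \<in> carrier X''\<rbrakk> \<Longrightarrow> g (X''.tens x y) = C (X.tens x (q y))" for s t x y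
    using g0 g1 by auto
  have gz: "g (X''.tens x (p y)) = C (X.tens x y)" if "x \<in> carrier M" "y \<in> carrier X" for x y
    using g(2)[of x "p y"] wd[of x "q (p y)" y] that q by simp
  have gt: "g (hp t) = C t" if "t \<in> carrier X.MN" for t
    using that
  proof (induction t rule: X.tensor_induct)
    case zero
    have "hp \<zero>\<^bsub>X.MN\<^esub> = X''.tens \<zero>\<^bsub>M\<^esub> (p \<zero>\<^bsub>X\<^esub>)" using hp.zero by simp
    then show ?case using gz[of "\<zero>\<^bsub>M\<^esub>" "\<zero>\<^bsub>X\<^esub>"] by simp
  next
    case (tens x y) then show ?case using hp(2) gz by simp
  next
    case (add s t)
    then have "g (hp (s \<oplus>\<^bsub>X.MN\<^esub> t)) = set_mult ?A (C s) (C t)" using g(1)[of "hp s" "hp t"] by simp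
    then show ?case using add Cadd by simp
  qed
  have "C t = C \<zero>\<^bsub>X.MN\<^esub>" using gt[OF t(1)] gt[of "\<zero>\<^bsub>X.MN\<^esub>"] t(2) hp.zero by simp
  also have "\<dots> = I" unfolding C_def by (rule X.MN.add.coset_join2) (use I0 sub in auto)
  finally have "C t = I" .
  moreover have "t \<in> C t" unfolding C_def using X.MN.add.rcos_self[OF _ sub] t(1) by simp
  ultimately show ?thesis by (simp add: I_def)
qed

lemma tensor_sesx:
  assumes s: "ses R T X' i X p X''" and M: "bim M K S R" and X: "bim X' K R T" "bim X K R T" "bim X'' K R T"
    and inj: "\<And>h t. \<lbrakk>h \<in> bimod_hom S T (tensor R M X') (tensor R M X);
        \<And>x y. \<lbrakk>x \<in> carrier M; y \<in> carrier X'\<rbrakk> \<Longrightarrow> h (tens R M X' x y) = tens R M X x (i y);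
        t \<in> carrier (tensor R M X'); h t = \<zero>\<^bsub>tensor R M X\<^esub>\<rbrakk> \<Longrightarrow> t = \<zero>\<^bsub>tensor R M X'\<^esub>"
  shows "sesx S T (tensor R M X') (tensor R M X) (tensor R M X'')"
proof -
  note D = sesD[OF s X]
  interpret i: bhom K R T X' X i by (rule D)
  interpret p: bhom K R T X X'' p by (rule D)
  interpret X': tensor_pair K S R T M X' using assms by (intro tensor_pairI)
  interpret X: tensor_pair K S R T M X using assms by (intro tensor_pairI)
  interpret X'': tensor_pair K S R T M X'' using assms by (intro tensor_pairI)
  obtain hi where hi: "hi \<in> bimod_hom S T X'.MN X.MN"
      "\<And>x y. \<lbrakk>x \<in> carrier M; y \<in> carrier X'\<rbrakk> \<Longrightarrow> hi (X'.tens x y) = X.tens x (i y)"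
    using tensor_map[OF M X(1,2) i.hom] by blast
  obtain hp where hp: "hp \<in> bimod_hom S T X.MN X''.MN"
      "\<And>x y. \<lbrakk>x \<in> carrier M; y \<in> carrier X\<rbrakk> \<Longrightarrow> hp (X.tens x y) = X''.tens x (p y)"
    using tensor_map[OF M X(2,3) p.hom] by blast
  interpret hi: bhom K S T X'.MN X.MN hi using hi by (intro bhomI) unfold_locales
  interpret hp: bhom K S T X.MN X''.MN hp using hp by (intro bhomI) unfold_locales
  have "ses S T X'.MN hi X.MN hp X''.MN"
  proof (rule sesI)
    show "bhom K S T X'.MN X.MN hi" "bhom K S T X.MN X''.MN hp" by unfold_locales
    show "t = \<zero>\<^bsub>X'.MN\<^esub>" if "t \<in> carrier X'.MN" "hi t = \<zero>\<^bsub>X.MN\<^esub>" for t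
      using inj[OF hi] that by blast
    show "hp (hi t) = \<zero>\<^bsub>X''.MN\<^esub>" if "t \<in> carrier X'.MN" for t
      using that
    proof (induction t rule: X'.tensor_induct)
      case zero show ?case by (simp only: hi.zero hp.zero)
    next
      case (tens x y) then show ?case using hi(2) hp(2) D(4) by simp
    next
      case (add s t) then show ?case by simp
    qed
    show "\<exists>v\<in>carrier X.MN. hp v = w" if "w \<in> carrier X''.MN" for w
      using that
    proof (induction w rule: X''.tensor_induct)
      case zero show ?case using hp.zero by blast
    next
      case (tens x y)
      then obtain z where "z \<in> carrier X" "p z = y" using D(5) by blast
      then show ?case using hp(2)[of x z] tens by (intro bexI[of _ "X.tens x z"]) auto
    next
      case (add s t)
      then obtain u v where "u \<in> carrier X.MN" "hp u = s" "v \<in> carrier X.MN" "hp v = t" by blast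
      then show ?case by (intro bexI[of _ "u \<oplus>\<^bsub>X.MN\<^esub> v"]) auto
    qed
    show "\<exists>u\<in>carrier X'.MN. hi u = v" if "v \<in> carrier X.MN" "hp v = \<zero>\<^bsub>X''.MN\<^esub>" for v
      using tensor_right_exact[OF s M X hi hp that] by auto
  qed
  then show ?thesis by (auto simp: sesx_def)
qed

definition right_functional :: "('k, 'b) module \<Rightarrow> ('a, 'b, 'm) bimodule \<Rightarrow> ('m \<Rightarrow> 'b) \<Rightarrow> bool" where
  "right_functional R W f \<longleftrightarrow> f \<in> carrier W \<rightarrow> carrier R \<and>
     (\<forall>x\<in>carrier W. \<forall>y\<in>carrier W. f (x \<oplus>\<^bsub>W\<^esub> y) = f x \<oplus>\<^bsub>R\<^esub> f y) \<and>
     (\<forall>x\<in>carrier W. \<forall>r\<in>carrier R. f (rsmult W x r) = f x \<otimes>\<^bsub>R\<^esub> r)"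

primrec expand :: "('a, 'b, 'm) bimodule \<Rightarrow> ('m \<times> ('m \<Rightarrow> 'b)) list \<Rightarrow> 'm \<Rightarrow> 'm" where
  "expand W [] x = \<zero>\<^bsub>W\<^esub>"
| "expand W (p # ps) x = rsmult W (fst p) (snd p x) \<oplus>\<^bsub>W\<^esub> expand W ps x"

definition dual_basis :: "('k, 'b) module \<Rightarrow> ('a, 'b, 'm) bimodule \<Rightarrow> ('m \<times> ('m \<Rightarrow> 'b)) list \<Rightarrow> bool" where
  "dual_basis R W ps \<longleftrightarrow> (\<forall>p\<in>set ps. fst p \<in> carrier W \<and> right_functional R W (snd p)) \<and>
     (\<forall>x\<in>carrier W. expand W ps x = x)"

lemma functional_tensor:
  assumes "bim W K S R" "bim X K R T" "right_functional R W f"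
  shows "\<exists>g. (\<forall>t\<in>carrier (tensor R W X). g t \<in> carrier X) \<and>
    (\<forall>s\<in>carrier (tensor R W X). \<forall>t\<in>carrier (tensor R W X). g (s \<oplus>\<^bsub>tensor R W X\<^esub> t) = g s \<oplus>\<^bsub>X\<^esub> g t) \<and>
    (\<forall>x\<in>carrier W. \<forall>y\<in>carrier X. g (tens R W X x y) = f x \<odot>\<^bsub>X\<^esub> y)"
proof -
  interpret X: tensor_pair K S R T W X using assms by (intro tensor_pairI)
  have f: "\<And>x. x \<in> carrier W \<Longrightarrow> f x \<in> carrier R"
    "\<And>x y. x \<in> carrier W \<Longrightarrow> y \<in> carrier W \<Longrightarrow> f (x \<oplus>\<^bsub>W\<^esub> y) = f x \<oplus>\<^bsub>R\<^esub> f y"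
    "\<And>x r. x \<in> carrier W \<Longrightarrow> r \<in> carrier R \<Longrightarrow> f (rsmult W x r) = f x \<otimes>\<^bsub>R\<^esub> r"
    using assms(3) by (auto simp: right_functional_def)
  show ?thesis
    using X.tensor_universal[of "add_monoid X" "\<lambda>x y. f x \<odot>\<^bsub>X\<^esub> y", OF X.N.a_comm_group]
    by (simp add: f X.N.l_add1 X.N.l_add2 X.N.l_assoc)
qed

lemma dual_basis_flat:
  assumes "bim W K S R" "bim X' K R T" "bim X K R T" "i \<in> bimod_hom R T X' X" "inj_on i (carrier X')" "dual_basis R W ps"
    "h \<in> bimod_hom S T (tensor R W X') (tensor R W X)"
    "\<And>x y. \<lbrakk>x \<in> carrier W; y \<in> carrier X'\<rbrakk> \<Longrightarrow> h (tens R W X' x y) = tens R W X x (i y)"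
    "t \<in> carrier (tensor R W X')" "h t = \<zero>\<^bsub>tensor R W X\<^esub>"
  shows "t = \<zero>\<^bsub>tensor R W X'\<^esub>"
proof -
  interpret X': tensor_pair K S R T W X' using assms by (intro tensor_pairI)
  interpret X: tensor_pair K S R T W X using assms by (intro tensor_pairI)
  interpret i: bhom K R T X' X i using assms by (intro bhomI)
  interpret h: bhom K S T X'.MN X.MN h using assms by (intro bhomI) unfold_locales
  have ps: "\<And>p. p \<in> set ps \<Longrightarrow> fst p \<in> carrier W" "\<And>p. p \<in> set ps \<Longrightarrow> right_functional R W (snd p)"
    "\<And>x. x \<in> carrier W \<Longrightarrow> expand W ps x = x"
    using assms(6) by (auto simp: dual_basis_def)
  have "\<forall>f\<in>{f. right_functional R W f}. \<exists>g. (\<forall>t\<in>carrier X'.MN. g t \<in> carrier X') \<and>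
    (\<forall>s\<in>carrier X'.MN. \<forall>t\<in>carrier X'.MN. g (s \<oplus>\<^bsub>X'.MN\<^esub> t) = g s \<oplus>\<^bsub>X'\<^esub> g t) \<and>
    (\<forall>x\<in>carrier W. \<forall>y\<in>carrier X'. g (X'.tens x y) = f x \<odot>\<^bsub>X'\<^esub> y)"
    using functional_tensor[OF assms(1,2)] by blast
  from bchoice[OF this] obtain \<Phi> where \<Phi>': "\<forall>f\<in>{f. right_functional R W f}. (\<forall>t\<in>carrier X'.MN. \<Phi> f t \<in> carrier X') \<and>
    (\<forall>s\<in>carrier X'.MN. \<forall>t\<in>carrier X'.MN. \<Phi> f (s \<oplus>\<^bsub>X'.MN\<^esub> t) = \<Phi> f s \<oplus>\<^bsub>X'\<^esub> \<Phi> f t) \<and>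
    (\<forall>x\<in>carrier W. \<forall>y\<in>carrier X'. \<Phi> f (X'.tens x y) = f x \<odot>\<^bsub>X'\<^esub> y)" by (elim exE)
  have \<Phi>: "right_functional R W f \<Longrightarrow> t \<in> carrier X'.MN \<Longrightarrow> \<Phi> f t \<in> carrier X'"
      "right_functional R W f \<Longrightarrow> s \<in> carrier X'.MN \<Longrightarrow> t \<in> carrier X'.MN \<Longrightarrow> \<Phi> f (s \<oplus>\<^bsub>X'.MN\<^esub> t) = \<Phi> f s \<oplus>\<^bsub>X'\<^esub> \<Phi> f t"
      "right_functional R W f \<Longrightarrow> x \<in> carrier W \<Longrightarrow> y \<in> carrier X' \<Longrightarrow> \<Phi> f (X'.tens x y) = f x \<odot>\<^bsub>X'\<^esub> y" for f s t x y
    using \<Phi>' by blast+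
  have zero: "\<Phi> f t = \<zero>\<^bsub>X'\<^esub>" if f: "right_functional R W f" for f
  proof -
    obtain g where g: "\<And>s t. s \<in> carrier X.MN \<Longrightarrow> g s \<in> carrier X"
      "\<And>s t. s \<in> carrier X.MN \<Longrightarrow> t \<in> carrier X.MN \<Longrightarrow> g (s \<oplus>\<^bsub>X.MN\<^esub> t) = g s \<oplus>\<^bsub>X\<^esub> g t"
      "\<And>x y. x \<in> carrier W \<Longrightarrow> y \<in> carrier X \<Longrightarrow> g (X.tens x y) = f x \<odot>\<^bsub>X\<^esub> y"
      using functional_tensor[OF assms(1,3) f] by blast
    have fc: "f x \<in> carrier R" if "x \<in> carrier W" for x using f that by (auto simp: right_functional_def)
    have g0: "g \<zero>\<^bsub>X.MN\<^esub> = \<zero>\<^bsub>X\<^esub>"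
      using g(2)[of "\<zero>\<^bsub>X.MN\<^esub>" "\<zero>\<^bsub>X.MN\<^esub>"] g(1)[of "\<zero>\<^bsub>X.MN\<^esub>"] X.N.add.l_cancel_one[of "g \<zero>\<^bsub>X.MN\<^esub>" "g \<zero>\<^bsub>X.MN\<^esub>"] by simp
    have \<Phi>0: "\<Phi> f \<zero>\<^bsub>X'.MN\<^esub> = \<zero>\<^bsub>X'\<^esub>"
      using \<Phi>(2)[OF f, of "\<zero>\<^bsub>X'.MN\<^esub>" "\<zero>\<^bsub>X'.MN\<^esub>"] \<Phi>(1)[OF f, of "\<zero>\<^bsub>X'.MN\<^esub>"]
        X'.N.add.l_cancel_one[of "\<Phi> f \<zero>\<^bsub>X'.MN\<^esub>" "\<Phi> f \<zero>\<^bsub>X'.MN\<^esub>"] by simp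
    have "i (\<Phi> f t) = g (h t)" if "t \<in> carrier X'.MN" for t
      using that
    proof (induction t rule: X'.tensor_induct)
      case zero show ?case by (simp only: h.zero g0 \<Phi>0 i.zero)
    next
      case (tens x y) then show ?case using assms(8) \<Phi>(3)[OF f] g(3) fc by simp
    next
      case (add s t) then show ?case using \<Phi>(1,2)[OF f] g(2) by simp
    qed
    then have "i (\<Phi> f t) = \<zero>\<^bsub>X\<^esub>" using assms(9,10) g0 by simp
    then show ?thesis using assms(5) i.inj_iff \<Phi>(1)[OF f assms(9)] by blast
  qed
  define G where "G ps t = foldr (\<lambda>p s. X'.tens (fst p) (\<Phi> (snd p) t) \<oplus>\<^bsub>X'.MN\<^esub> s) ps \<zero>\<^bsub>X'.MN\<^esub>" for ps t
  have Gs: "G [] t = \<zero>\<^bsub>X'.MN\<^esub>" "G (p # qs) t = X'.tens (fst p) (\<Phi> (snd p) t) \<oplus>\<^bsub>X'.MN\<^esub> G qs t" for p qs t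
    by (simp_all add: G_def)
  have Gc: "G qs t \<in> carrier X'.MN" if "set qs \<subseteq> set ps" "t \<in> carrier X'.MN" for qs t
    using that(1) by (induction qs) (auto simp: Gs ps \<Phi> that(2))
  have Gadd: "G qs (s \<oplus>\<^bsub>X'.MN\<^esub> t) = G qs s \<oplus>\<^bsub>X'.MN\<^esub> G qs t" if "set qs \<subseteq> set ps" "s \<in> carrier X'.MN" "t \<in> carrier X'.MN" for qs s t
    using that(1)
  proof (induction qs)
    case Nil then show ?case by (simp add: Gs)
  next
    case (Cons p qs)
    then have p: "fst p \<in> carrier W" "right_functional R W (snd p)" using ps by auto
    have "X'.tens (fst p) (\<Phi> (snd p) (s \<oplus>\<^bsub>X'.MN\<^esub> t)) = X'.tens (fst p) (\<Phi> (snd p) s) \<oplus>\<^bsub>X'.MN\<^esub> X'.tens (fst p) (\<Phi> (snd p) t)"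
      using p \<Phi>(1,2)[OF p(2)] that by (simp add: X'.tens_add2)
    then show ?case using Cons p \<Phi>(1)[OF p(2)] that Gc by (simp add: Gs X'.MN.a_ac)
  qed
  have Gt: "G qs (X'.tens x y) = X'.tens (expand W qs x) y \<and> expand W qs x \<in> carrier W"
    if "set qs \<subseteq> set ps" "x \<in> carrier W" "y \<in> carrier X'" for qs x y
    using that(1)
  proof (induction qs)
    case Nil then show ?case using that by (simp add: Gs)
  next
    case (Cons p qs)
    then have p: "fst p \<in> carrier W" "right_functional R W (snd p)" using ps by auto
    have c: "snd p x \<in> carrier R" using p that by (auto simp: right_functional_def)
    then show ?case using Cons p \<Phi>(3)[OF p(2)] that by (simp add: Gs X'.tens_add1 X'.tens_bal)
  qed
  have "G ps t = t" using assms(9)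
  proof (induction t rule: X'.tensor_induct)
    case zero
    have "\<zero>\<^bsub>X'.MN\<^esub> = X'.tens \<zero>\<^bsub>W\<^esub> \<zero>\<^bsub>X'\<^esub>" by simp
    then show ?case using Gt[of ps "\<zero>\<^bsub>W\<^esub>" "\<zero>\<^bsub>X'\<^esub>"] ps(3)[of "\<zero>\<^bsub>W\<^esub>"] by simp
  next
    case (tens x y) then show ?case using Gt ps(3) by simp
  next
    case (add s t) then show ?case using Gadd by simp
  qed
  moreover have "G qs t = \<zero>\<^bsub>X'.MN\<^esub>" if "set qs \<subseteq> set ps" for qs
    using that by (induction qs) (auto simp: Gs ps zero)
  ultimately show ?thesis by auto
qed


section \<open>Change of rings and projectivity of tensor products\<close>

definition hom_bimodule :: "('k, 'a) module \<Rightarrow> ('a, 'b, 'm) bimodule \<Rightarrow> ('a, 'c, 'n) bimodule \<Rightarrow> ('b, 'c, 'm \<Rightarrow> 'n) bimodule" where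
  "hom_bimodule S M X =
    \<lparr>carrier = {f \<in> extensional (carrier M). f \<in> carrier M \<rightarrow> carrier X \<and>
       (\<forall>x\<in>carrier M. \<forall>y\<in>carrier M. f (x \<oplus>\<^bsub>M\<^esub> y) = f x \<oplus>\<^bsub>X\<^esub> f y) \<and>
       (\<forall>a\<in>carrier S. \<forall>x\<in>carrier M. f (a \<odot>\<^bsub>M\<^esub> x) = a \<odot>\<^bsub>X\<^esub> f x)},
     mult = undefined, one = undefined, zero = \<lambda>x\<in>carrier M. \<zero>\<^bsub>X\<^esub>,
     add = \<lambda>f g. \<lambda>x\<in>carrier M. f x \<oplus>\<^bsub>X\<^esub> g x,
     smult = \<lambda>b f. \<lambda>x\<in>carrier M. f (rsmult M x b),
     rsmult = \<lambda>f c. \<lambda>x\<in>carrier M. rsmult X (f x) c\<rparr>"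

lemma hom_bimodule_simps:
  "f \<in> carrier (hom_bimodule S M X) \<longleftrightarrow> f \<in> extensional (carrier M) \<and> f \<in> carrier M \<rightarrow> carrier X \<and>
       (\<forall>x\<in>carrier M. \<forall>y\<in>carrier M. f (x \<oplus>\<^bsub>M\<^esub> y) = f x \<oplus>\<^bsub>X\<^esub> f y) \<and>
       (\<forall>a\<in>carrier S. \<forall>x\<in>carrier M. f (a \<odot>\<^bsub>M\<^esub> x) = a \<odot>\<^bsub>X\<^esub> f x)"
  "\<zero>\<^bsub>hom_bimodule S M X\<^esub> = (\<lambda>x\<in>carrier M. \<zero>\<^bsub>X\<^esub>)"
  "f \<oplus>\<^bsub>hom_bimodule S M X\<^esub> g = (\<lambda>x\<in>carrier M. f x \<oplus>\<^bsub>X\<^esub> g x)"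
  "b \<odot>\<^bsub>hom_bimodule S M X\<^esub> f = (\<lambda>x\<in>carrier M. f (rsmult M x b))"
  "rsmult (hom_bimodule S M X) f c = (\<lambda>x\<in>carrier M. rsmult X (f x) c)"
  by (simp_all add: hom_bimodule_def)

lemma bim_hom_bimodule:
  assumes "bim M K S R" "bim X K S T" shows "bim (hom_bimodule S M X) K R T"
proof -
  interpret M: bim M K S R by fact
  interpret X: bim X K S T by fact
  let ?H = "hom_bimodule S M X"
  note H = hom_bimodule_simps
  have ext: "f = g" if "f \<in> extensional (carrier M)" "g \<in> extensional (carrier M)" "\<And>x. x \<in> carrier M \<Longrightarrow> f x = g x" for f g
    using that by (rule extensionalityI)
  have ag: "abelian_group ?H"
  proof (rule abelian_groupI)
    fix f g assume "f \<in> carrier ?H" "g \<in> carrier ?H"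
    then show "f \<oplus>\<^bsub>?H\<^esub> g \<in> carrier ?H" by (auto simp: H X.a_ac X.l_add2 Pi_iff)
  next
    show "\<zero>\<^bsub>?H\<^esub> \<in> carrier ?H" by (auto simp: H)
  next
    fix f g h assume "f \<in> carrier ?H" "g \<in> carrier ?H" "h \<in> carrier ?H"
    then show "f \<oplus>\<^bsub>?H\<^esub> g \<oplus>\<^bsub>?H\<^esub> h = f \<oplus>\<^bsub>?H\<^esub> (g \<oplus>\<^bsub>?H\<^esub> h)"
      by (intro ext) (auto simp: H X.a_ac Pi_iff)
  next
    fix f g assume "f \<in> carrier ?H" "g \<in> carrier ?H"
    then show "f \<oplus>\<^bsub>?H\<^esub> g = g \<oplus>\<^bsub>?H\<^esub> f" by (intro ext) (auto simp: H X.a_ac Pi_iff)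
  next
    fix f assume f: "f \<in> carrier ?H"
    then show "\<zero>\<^bsub>?H\<^esub> \<oplus>\<^bsub>?H\<^esub> f = f" by (intro ext) (auto simp: H X.a_ac Pi_iff)
    let ?g = "\<lambda>x\<in>carrier M. \<ominus>\<^bsub>X\<^esub> f x"
    have "?g \<in> carrier ?H" using f by (auto simp: H X.minus_add X.a_comm X.l_neg_r Pi_iff)
    moreover have "?g \<oplus>\<^bsub>?H\<^esub> f = \<zero>\<^bsub>?H\<^esub>" using f by (intro ext) (auto simp: H X.l_neg Pi_iff)
    ultimately show "\<exists>g\<in>carrier ?H. g \<oplus>\<^bsub>?H\<^esub> f = \<zero>\<^bsub>?H\<^esub>" by blast
  qed
  show ?thesis
    unfolding bim_def bim_axioms_def
  proof (intro conjI allI impI)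
    fix b f assume "b \<in> carrier R" "f \<in> carrier ?H"
    then show "b \<odot>\<^bsub>?H\<^esub> f \<in> carrier ?H" by (auto simp: H M.r_add2 M.lr_assoc Pi_iff)
  next
    fix c f assume "c \<in> carrier T" "f \<in> carrier ?H"
    then show "rsmult ?H f c \<in> carrier ?H" by (auto simp: H X.r_add2 X.lr_assoc Pi_iff)
  next
    fix c f assume c: "c \<in> carrier K" and f: "f \<in> carrier ?H"
    show "scal R c \<odot>\<^bsub>?H\<^esub> f = rsmult ?H f (scal T c)"
    proof (intro ext)
      show "(scal R c \<odot>\<^bsub>?H\<^esub> f) x = (rsmult ?H f (scal T c)) x" if "x \<in> carrier M" for x
        using that f c M.central[of c x, symmetric] X.central[of c "f x"] by (auto simp: H Pi_iff)
    qed (auto simp: H)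
  qed (use ag M.fdB X.fdB in \<open>auto intro!: ext simp: H M.r_add1 M.r_assoc X.r_add1 X.r_add2 X.r_assoc Pi_iff\<close>)
qed

definition rst :: "('a' \<Rightarrow> 'a) \<Rightarrow> ('b' \<Rightarrow> 'b) \<Rightarrow> ('a, 'b, 'm) bimodule \<Rightarrow> ('a', 'b', 'm) bimodule" where
  "rst \<alpha> \<beta> X = \<lparr>carrier = carrier X, mult = mult X, one = one X, zero = zero X, add = add X,
     smult = \<lambda>a x. \<alpha> a \<odot>\<^bsub>X\<^esub> x, rsmult = \<lambda>x b. rsmult X x (\<beta> b)\<rparr>"

lemma rst_simps [simp]:
  "carrier (rst \<alpha> \<beta> X) = carrier X" "zero (rst \<alpha> \<beta> X) = zero X" "add (rst \<alpha> \<beta> X) = add X"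
  "smult (rst \<alpha> \<beta> X) a x = \<alpha> a \<odot>\<^bsub>X\<^esub> x" "rsmult (rst \<alpha> \<beta> X) x b = rsmult X x (\<beta> b)"
  by (simp_all add: rst_def)

definition alg_hom :: "('k, 'z) ring_scheme \<Rightarrow> ('k, 'a) module \<Rightarrow> ('k, 'b) module \<Rightarrow> ('a \<Rightarrow> 'b) \<Rightarrow> bool" where
  "alg_hom K A B f \<longleftrightarrow> f \<in> ring_hom A B \<and> (\<forall>c\<in>carrier K. f (scal A c) = scal B c)"

lemma alg_homD:
  assumes "alg_hom K A B f"
  shows "x \<in> carrier A \<Longrightarrow> f x \<in> carrier B" "\<lbrakk>x \<in> carrier A; y \<in> carrier A\<rbrakk> \<Longrightarrow> f (x \<oplus>\<^bsub>A\<^esub> y) = f x \<oplus>\<^bsub>B\<^esub> f y"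
    "\<lbrakk>x \<in> carrier A; y \<in> carrier A\<rbrakk> \<Longrightarrow> f (x \<otimes>\<^bsub>A\<^esub> y) = f x \<otimes>\<^bsub>B\<^esub> f y" "f \<one>\<^bsub>A\<^esub> = \<one>\<^bsub>B\<^esub>"
    "c \<in> carrier K \<Longrightarrow> f (scal A c) = scal B c"
  using assms by (auto simp: alg_hom_def ring_hom_def)

lemma alg_hom_id: "alg_hom K A A id" by (auto simp: alg_hom_def ring_hom_def)

lemma abelian_group_rst [simp]: "abelian_group (rst \<alpha> \<beta> X) = abelian_group X"
  by (rule abelian_group_cong) simp_all

lemma bim_rst:
  assumes "bim X K A B" "alg_hom K A' A \<alpha>" "alg_hom K B' B \<beta>" "fd_algebra K A'" "fd_algebra K B'"
  shows "bim (rst \<alpha> \<beta> X) K A' B'"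
proof -
  interpret X: bim X K A B by fact
  show ?thesis
    unfolding bim_def bim_axioms_def using alg_homD[OF assms(2)] alg_homD[OF assms(3)] assms(4,5)
    by (simp add: X.abelian_group_axioms X.l_add1 X.l_add2 X.l_assoc X.r_add1 X.r_add2 X.r_assoc X.lr_assoc X.central)
qed

lemma spn_cong': "\<lbrakk>zero V = zero W; add V = add W; \<And>c x. \<lbrakk>c \<in> carrier K; x \<in> set ss\<rbrakk> \<Longrightarrow> smult V c x = smult W c x\<rbrakk> \<Longrightarrow> spn K V ss = spn K W ss"
proof (induction ss)
  case (Cons s ss)
  have 1: "c \<odot>\<^bsub>V\<^esub> s \<oplus>\<^bsub>V\<^esub> y = c \<odot>\<^bsub>W\<^esub> s \<oplus>\<^bsub>W\<^esub> y" if "c \<in> carrier K" for c y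
    using Cons.prems that by simp
  have 2: "spn K V ss = spn K W ss" using Cons by simp
  show ?case
  proof (intro equalityI subsetI)
    fix x assume "x \<in> spn K V (s # ss)"
    then obtain c y where "x = c \<odot>\<^bsub>V\<^esub> s \<oplus>\<^bsub>V\<^esub> y" "c \<in> carrier K" "y \<in> spn K V ss" by auto
    then show "x \<in> spn K W (s # ss)" using 2 by (simp only: 1 spn_ConsI)
  next
    fix x assume "x \<in> spn K W (s # ss)"
    then obtain c y where "x = c \<odot>\<^bsub>W\<^esub> s \<oplus>\<^bsub>W\<^esub> y" "c \<in> carrier K" "y \<in> spn K W ss" by auto
    then show "x \<in> spn K V (s # ss)" using 2 by (simp only: 1[symmetric] spn_ConsI)
  qed
qed simp

lemma fbim_rst:
  assumes "fbim X K A B" "alg_hom K A' A \<alpha>" "alg_hom K B' B \<beta>" "fd_algebra K A'" "fd_algebra K B'"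
  shows "fbim (rst \<alpha> \<beta> X) K A' B'"
proof -
  have "spn K (kspace A' (rst \<alpha> \<beta> X)) ss = spn K (kspace A X) ss" for ss
    by (rule spn_cong') (use assms(2) in \<open>auto simp: alg_homD\<close>)
  then show ?thesis using assms bim_rst by (auto simp: fbim_iff fdim_def)
qed

lemma hom_rst: "\<lbrakk>f \<in> bimod_hom A B X Y; alg_hom K A' A \<alpha>; alg_hom K B' B \<beta>\<rbrakk>
    \<Longrightarrow> f \<in> bimod_hom A' B' (rst \<alpha> \<beta> X) (rst \<alpha> \<beta> Y)"
  by (auto simp: bimod_hom_iff alg_homD)

lemma iso_rst: "\<lbrakk>bimod_iso A B X Y; alg_hom K A' A \<alpha>; alg_hom K B' B \<beta>\<rbrakk>
    \<Longrightarrow> bimod_iso A' B' (rst \<alpha> \<beta> X) (rst \<alpha> \<beta> Y)"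
  unfolding bimod_iso_def using hom_rst by fastforce

lemma sesx_rst: "\<lbrakk>sesx A B X Y Z; alg_hom K A' A \<alpha>; alg_hom K B' B \<beta>\<rbrakk>
    \<Longrightarrow> sesx A' B' (rst \<alpha> \<beta> X) (rst \<alpha> \<beta> Y) (rst \<alpha> \<beta> Z)"
  unfolding sesx_def ses_def by (elim exE conjE, intro exI conjI, (rule hom_rst, assumption+)+)
    (simp_all add: a_kernel_def kernel_def)

text \<open>The operations are \<open>undefined\<close> off the carrier, where commutativity may fail, so that this
  algebra equals its opposite as a record.\<close>

definition base_algebra :: "('k, 'z) ring_scheme \<Rightarrow> ('k, 'k) module" where
  "base_algebra K = \<lparr>carrier = carrier K,
     mult = \<lambda>x y. if x \<in> carrier K \<and> y \<in> carrier K then x \<otimes>\<^bsub>K\<^esub> y else undefined, one = one K, zero = zero K,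
     add = add K, smult = \<lambda>x y. if x \<in> carrier K \<and> y \<in> carrier K then x \<otimes>\<^bsub>K\<^esub> y else undefined\<rparr>"

lemma base_algebra_simps [simp]:
  "carrier (base_algebra K) = carrier K" "one (base_algebra K) = one K" "zero (base_algebra K) = zero K" "add (base_algebra K) = add K"
  "\<lbrakk>x \<in> carrier K; y \<in> carrier K\<rbrakk> \<Longrightarrow> x \<otimes>\<^bsub>base_algebra K\<^esub> y = x \<otimes>\<^bsub>K\<^esub> y"
  "\<lbrakk>x \<in> carrier K; y \<in> carrier K\<rbrakk> \<Longrightarrow> x \<odot>\<^bsub>base_algebra K\<^esub> y = x \<otimes>\<^bsub>K\<^esub> y"
  by (simp_all add: base_algebra_def)

lemma fd_base: assumes "field K" shows "fd_algebra K (base_algebra K)"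
proof -
  interpret K: field K by fact
  have ag: "abelian_group (base_algebra K)" by (subst abelian_group_cong[of _ K]) (auto simp: K.is_abelian_group)
  have m: "module K (base_algebra K)"
    by (rule moduleI) (auto simp: K.is_cring ag K.l_distr K.r_distr K.m_assoc)
  have r: "ring (base_algebra K)"
    by (rule ringI) (auto simp: ag K.l_distr K.r_distr K.m_assoc intro!: monoidI)
  have v: "vspace (base_algebra K) K"
    unfolding vspace_def vspace_axioms_def using assms ag by (simp add: K.l_distr K.r_distr K.m_assoc)
  have "spn K (base_algebra K) [\<one>\<^bsub>K\<^esub>] = carrier K" by (auto intro!: exI[of _ "_"])
  then have "fdim K (base_algebra K)" unfolding fdim_def by (intro exI[of _ "[\<one>\<^bsub>K\<^esub>]"]) auto
  then have "fin_gen K (base_algebra K)" using vspace.fdim_iff[OF v] by simp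
  then show ?thesis
    unfolding fd_algebra_def fd_algebra_axioms_def using assms m r by (simp add: K.m_assoc K.m_lcomm)
qed

lemma opposite_base [simp]: assumes "field K" shows "opposite (base_algebra K) = base_algebra K"
proof -
  interpret K: field K by fact
  show ?thesis by (auto simp: opposite_def base_algebra_def fun_eq_iff K.m_comm)
qed

lemma scal_base [simp]: assumes "field K" "c \<in> carrier K" shows "scal (base_algebra K) c = c"
proof -
  interpret K: field K by fact
  show ?thesis using assms by (simp add: scal_def)
qed

lemma alg_hom_scal: assumes "fd_algebra K A" shows "alg_hom K (base_algebra K) A (scal A)"
proof -
  interpret A: fd_algebra K A by fact
  show ?thesis by (auto simp: alg_hom_def ring_hom_def A.scal_add A.scal_mult A.field_K)
qed

abbreviation left_restrict :: "('k, 'b) module \<Rightarrow> ('a, 'b, 'm) bimodule \<Rightarrow> ('a, 'k, 'm) bimodule" where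
  "left_restrict B X \<equiv> rst id (scal B) X"
abbreviation right_restrict :: "('k, 'a) module \<Rightarrow> ('a, 'b, 'm) bimodule \<Rightarrow> ('k, 'b, 'm) bimodule" where
  "right_restrict A X \<equiv> rst (scal A) id X"

lemma (in bim) bim_left_restrict: "bim (left_restrict B X) K A (base_algebra K)"
  using bim_rst[OF bim_axioms alg_hom_id alg_hom_scal[OF fdB] fdA] fd_base fdA fd_algebra.field_K by blast

lemma (in bim) bim_right_restrict: "bim (right_restrict A X) K (base_algebra K) B"
  using bim_rst[OF bim_axioms alg_hom_scal[OF fdA] alg_hom_id _ fdB] fd_base fdA fd_algebra.field_K by blast

text \<open>By the adjunction between tensor product and \<open>Hom\<close>, lifting along \<open>X \<rightarrow> Y\<close> for the tensor
  product is lifting along \<open>Hom(M, X) \<rightarrow> Hom(M, Y)\<close>, which is surjective.\<close>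

lemma pbim_tensor:
  fixes M :: "('a, 'b, 'm) bimodule" and Q :: "('b, 'c, 'n) bimodule" and S :: "('k, 'a) module"
  assumes "fbim M K S R" "pbim (left_restrict R M) K S (base_algebra K)" "pbim Q K R T"
  shows "pbim (tensor R M Q) K S T"
proof -
  interpret M: fbim M K S R by fact
  interpret Q: pbim Q K R T by fact
  interpret Z: tensor_pair K S R T M Q by unfold_locales
  have "\<exists>l\<in>bimod_hom S T Z.MN X. \<forall>t\<in>carrier Z.MN. g (l t) = h t"
    if *: "bim X K S T" "bim Y K S T" "g \<in> bimod_hom S T X Y" "g ` carrier X = carrier Y" "h \<in> bimod_hom S T Z.MN Y"
    for X Y :: "('a, 'c, 'k vec) bimodule" and g h
  proof -
    interpret X: bim X K S T by fact
    interpret Y: bim Y K S T by fact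
    interpret g: bhom K S T X Y g using * by (intro bhomI)
    interpret h: bhom K S T Z.MN Y h using * by (intro bhomI) unfold_locales
    let ?HX = "hom_bimodule S M X" and ?HY = "hom_bimodule S M Y"
    have HX: "bim ?HX K R T" and HY: "bim ?HY K R T" by (rule bim_hom_bimodule; unfold_locales)+
    note H = hom_bimodule_simps
    define G where "G f = (\<lambda>x\<in>carrier M. g (f x))" for f
    have G: "G \<in> bimod_hom R T ?HX ?HY"
      by (rule bimod_homI) (auto simp: H G_def Pi_iff intro!: restrict_ext)
    have surj: "G ` carrier ?HX = carrier ?HY"
    proof (intro equalityI subsetI)
      fix f assume f: "f \<in> carrier ?HY"
      have fh: "f \<in> bimod_hom S (base_algebra K) (left_restrict R M) (left_restrict T Y)"
      proof (rule bimod_homI)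
        fix c x assume "c \<in> carrier (base_algebra K)" "x \<in> carrier (left_restrict R M)"
        then show "f (rsmult (left_restrict R M) x c) = rsmult (left_restrict T Y) (f x) c"
          using f M.central[of c x, symmetric] Y.central[of c "f x", symmetric] by (auto simp: H Pi_iff)
      qed (use f in \<open>auto simp: H Pi_iff\<close>)
      obtain l where l: "l \<in> bimod_hom S (base_algebra K) (left_restrict R M) (left_restrict T X)"
        "\<And>x. x \<in> carrier (left_restrict R M) \<Longrightarrow> g (l x) = f x"
        by (rule pbim.lift[OF assms(2) X.bim_left_restrict Y.bim_left_restrict hom_rst[OF g.hom alg_hom_id alg_hom_scal[OF Q.fdB]] _ fh])
          (use *(4) in auto)
      let ?l = "\<lambda>x\<in>carrier M. l x"
      have "?l \<in> carrier ?HX" using l(1) by (auto simp: H bimod_hom_iff)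
      moreover have "G ?l = f" using l(2) f by (intro extensionalityI[of _ "carrier M"]) (auto simp: H G_def)
      ultimately show "f \<in> G ` carrier ?HX" by blast
    qed (use bimod_hom_closed[OF G] in auto)
    define k where "k q = (\<lambda>x\<in>carrier M. h (Z.tens x q))" for q
    have k: "k \<in> bimod_hom R T Q ?HY"
    proof (rule bimod_homI)
      show "k q \<in> carrier ?HY" if "q \<in> carrier Q" for q
        using that by (auto simp: H k_def Z.tens_add1 Z.tens_left[symmetric])
    qed (auto simp: H k_def Z.tens_add2 Z.tens_bal Z.tens_right[symmetric] intro!: restrict_ext)
    obtain l where l: "l \<in> bimod_hom R T Q ?HX" "\<And>q. q \<in> carrier Q \<Longrightarrow> G (l q) = k q"
      using Q.lift[OF HX HY G surj k] by blast
    have lH: "l q \<in> carrier ?HX" if "q \<in> carrier Q" for q using bimod_hom_closed[OF l(1) that] .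
    obtain L where L: "L \<in> bimod_hom S T Z.MN X" "\<And>x q. \<lbrakk>x \<in> carrier M; q \<in> carrier Q\<rbrakk> \<Longrightarrow> L (Z.tens x q) = l q x"
    proof (rule Z.tensor_hom[OF *(1), of "\<lambda>x q. l q x"])
      show "l q x \<in> carrier X" if "x \<in> carrier M" "q \<in> carrier Q" for x q using lH[OF that(2)] that by (auto simp: H)
      show "l q (x \<oplus>\<^bsub>M\<^esub> x') = l q x \<oplus>\<^bsub>X\<^esub> l q x'" if "x \<in> carrier M" "x' \<in> carrier M" "q \<in> carrier Q" for x x' q
        using lH[OF that(3)] that by (auto simp: H)
      show "l q (a \<odot>\<^bsub>M\<^esub> x) = a \<odot>\<^bsub>X\<^esub> l q x" if "a \<in> carrier S" "x \<in> carrier M" "q \<in> carrier Q" for a x q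
        using lH[OF that(3)] that by (auto simp: H)
      show "l (q \<oplus>\<^bsub>Q\<^esub> q') x = l q x \<oplus>\<^bsub>X\<^esub> l q' x" if "x \<in> carrier M" "q \<in> carrier Q" "q' \<in> carrier Q" for x q q'
        using l(1) that by (simp add: bimod_hom_iff H)
      show "l q (rsmult M x b) = l (b \<odot>\<^bsub>Q\<^esub> q) x" if "x \<in> carrier M" "b \<in> carrier R" "q \<in> carrier Q" for x b q
        using l(1) that by (simp add: bimod_hom_iff H)
      show "l (rsmult Q q c) x = rsmult X (l q x) c" if "x \<in> carrier M" "q \<in> carrier Q" "c \<in> carrier T" for x q c
        using l(1) that by (simp add: bimod_hom_iff H)
    qed blast
    have "(g \<circ> L) t = h t" if "t \<in> carrier Z.MN" for t
    proof (rule Z.tensor_hom_eq[OF *(2) bimod_hom_comp[OF L(1) g.hom] h.hom _ that])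
      fix x q assume xq: "x \<in> carrier M" "q \<in> carrier Q"
      have "G (l q) x = k q x" using l(2)[OF xq(2)] by simp
      then show "(g \<circ> L) (Z.tens x q) = h (Z.tens x q)" using xq L(2) by (simp add: G_def k_def)
    qed
    then show ?thesis using L(1) by auto
  qed
  moreover have "fbim Z.MN K S T" by (rule fbim_tensor) unfold_locales
  ultimately show ?thesis unfolding pbim_def pbim_axioms_def by blast
qed


lemma sesx_iso_middle:
  assumes "sesx A B U V W" "bim U K A B" "bim V K A B" "bim W K A B" "bim V' K A B" "bimod_iso A B V V'"
  shows "sesx A B U V' W"
proof -
  obtain i p where s: "ses A B U i V p W" using assms by (auto simp: sesx_def)
  note D = sesD[OF s assms(2-4)]
  interpret i: bhom K A B U V i by (rule D)
  interpret p: bhom K A B V W p by (rule D)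
  obtain f g where f: "f \<in> bimod_hom A B V V'" "g \<in> bimod_hom A B V' V"
    "\<And>x. x \<in> carrier V \<Longrightarrow> g (f x) = x" "\<And>y. y \<in> carrier V' \<Longrightarrow> f (g y) = y"
    using bimod_isoE[OF assms(6,3)] by blast
  interpret f: bhom K A B V V' f using f assms by (intro bhomI)
  interpret g: bhom K A B V' V g using f assms by (intro bhomI)
  have "ses A B U (f \<circ> i) V' (p \<circ> g) W"
  proof (rule sesI)
    show "bhom K A B U V' (f \<circ> i)" "bhom K A B V' W (p \<circ> g)"
      using bimod_hom_comp[OF i.hom f.hom] bimod_hom_comp[OF g.hom p.hom] assms by (auto intro: bhomI)
    show "x = \<zero>\<^bsub>U\<^esub>" if x: "x \<in> carrier U" "(f \<circ> i) x = \<zero>\<^bsub>V'\<^esub>" for x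
    proof -
      have "g (f (i x)) = \<zero>\<^bsub>V\<^esub>" using x by simp
      then show ?thesis using D(3) f(3) x by simp
    qed
    show "(p \<circ> g) ((f \<circ> i) x) = \<zero>\<^bsub>W\<^esub>" if "x \<in> carrier U" for x using that D(4) f(3) by simp
    show "\<exists>v\<in>carrier V'. (p \<circ> g) v = w" if w: "w \<in> carrier W" for w
    proof -
      obtain v where "v \<in> carrier V" "p v = w" using D(5) w by blast
      then show ?thesis using f(3) by (intro bexI[of _ "f v"]) auto
    qed
    show "\<exists>u\<in>carrier U. (f \<circ> i) u = v" if v: "v \<in> carrier V'" "(p \<circ> g) v = \<zero>\<^bsub>W\<^esub>" for v
    proof -
      obtain u where "u \<in> carrier U" "i u = g v" using D(6)[of "g v"] v by auto
      then show ?thesis using f(4) v by (intro bexI[of _ u]) auto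
    qed
  qed
  then show ?thesis by (auto simp: sesx_def)
qed

lemma sesx_iso3:
  assumes "sesx A B U V W" "bim U K A B" "bim V K A B" "bim W K A B" "bim U' K A B" "bim V' K A B" "bim W' K A B"
    "bimod_iso A B U U'" "bimod_iso A B V V'" "bimod_iso A B W W'"
  shows "sesx A B U' V' W'"
  using sesx_iso[OF sesx_iso_middle[OF assms(1-4,6,9)] assms(2,6,4,5,7,8,10)] .

lemma generated_cover:
  fixes E :: "('a, 'b, 'k vec) bimodule" and X :: "('a, 'b, 'm) bimodule"
  assumes X: "bim X K A B" and zb: "Q zbim" and ds: "\<And>F. Q F \<Longrightarrow> Q (dsum E F)" and Qb: "\<And>F. Q F \<Longrightarrow> bim F K A B"
    and E: "bim E K A B" and ev: "\<And>w. w \<in> carrier X \<Longrightarrow> \<exists>f\<in>bimod_hom A B E X. w \<in> f ` carrier E"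
    and "set ws \<subseteq> carrier X"
  shows "\<exists>F f. Q F \<and> f \<in> bimod_hom A B F X \<and> set ws \<subseteq> f ` carrier F"
  using assms(7)
proof (induction ws)
  case Nil
  show ?case using zb hom_zero[OF X] by auto
next
  case (Cons w ws)
  then obtain F f where F: "Q F" "f \<in> bimod_hom A B F X" "set ws \<subseteq> f ` carrier F" by auto
  obtain e x where e: "e \<in> bimod_hom A B E X" "x \<in> carrier E" "e x = w" using ev[of w] Cons.prems by auto
  interpret f: bhom K A B F X f by (rule bhomI[OF Qb[OF F(1)] X F(2)])
  interpret e: bhom K A B E X e by (rule bhomI[OF E X e(1)])
  let ?g = "\<lambda>u. e (vfst u) \<oplus>\<^bsub>X\<^esub> f (vsnd u)"
  have "w \<in> ?g ` carrier (dsum E F)"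
    using e by (intro image_eqI[of _ _ "vpair x \<zero>\<^bsub>F\<^esub>"]) auto
  moreover have "v \<in> ?g ` carrier (dsum E F)" if "v \<in> set ws" for v
  proof -
    have "v \<in> f ` carrier F" using F(3) that by auto
    then obtain y where "y \<in> carrier F" "v = f y" by (auto simp only: image_iff)
    then show ?thesis by (intro image_eqI[of _ _ "vpair \<zero>\<^bsub>E\<^esub> y"]) auto
  qed
  ultimately have "set (w # ws) \<subseteq> ?g ` carrier (dsum E F)" by auto
  with ds[OF F(1)] dsum_copair[OF X e.hom f.hom] show ?case by (intro exI[of _ "dsum E F"] exI[of _ ?g] conjI)
qed

lemma generated_cover_surj:
  fixes E :: "('a, 'b, 'k vec) bimodule" and X :: "('a, 'b, 'm) bimodule"
  assumes X: "fbim X K A B" and "Q zbim" "\<And>F. Q F \<Longrightarrow> Q (dsum E F)" and Qb: "\<And>F. Q F \<Longrightarrow> bim F K A B"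
    "bim E K A B" "\<And>w. w \<in> carrier X \<Longrightarrow> \<exists>f\<in>bimod_hom A B E X. w \<in> f ` carrier E"
  shows "\<exists>F f. Q F \<and> f \<in> bimod_hom A B F X \<and> f ` carrier F = carrier X"
proof -
  interpret X: fbim X K A B by fact
  obtain S where S: "finite S" "S \<subseteq> carrier X" "\<forall>H. X.stable_set H \<and> S \<subseteq> H \<longrightarrow> H = carrier X" by (rule X.generators)
  obtain ws where ws: "set ws = S" using S(1) finite_list by auto
  have "\<exists>F f. Q F \<and> f \<in> bimod_hom A B F X \<and> set ws \<subseteq> f ` carrier F"
    by (rule generated_cover[OF X.bim_axioms assms(2-6)]) (use ws S in auto)
  then obtain F f where F: "Q F" "f \<in> bimod_hom A B F X" "set ws \<subseteq> f ` carrier F" by blast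
  interpret f: bhom K A B F X f by (rule bhomI[OF Qb(1)[OF F(1)] X.bim_axioms F(2)])
  have "f.X.stable_set (carrier F)" by (auto simp: f.X.stable_set_def)
  then have "f ` carrier F = carrier X" using S(3) f.stable_image F(3) ws by blast
  then show ?thesis using F by blast
qed

lemma (in fd_algebra) bim_regular: "bim (regular_bimodule A) K A A"
proof -
  have ag: "abelian_group (regular_bimodule A)"
    by (subst abelian_group_cong[of _ A]) (auto simp: regular_bimodule_def A.is_abelian_group)
  show ?thesis unfolding bim_def bim_axioms_def using ag fd_algebra_axioms
    by (simp add: regular_bimodule_def A.l_distr A.r_distr A.m_assoc scal_mult_left scal_mult_right)
qed

lemma regular_simps [simp]: "carrier (regular_bimodule A) = carrier A" "zero (regular_bimodule A) = zero A"
  "add (regular_bimodule A) = add A" "smult (regular_bimodule A) = mult A" "rsmult (regular_bimodule A) = mult A"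
  by (simp_all add: regular_bimodule_def)

lemma (in fd_algebra) fbim_regular: "fbim (regular_bimodule A) K A A"
proof -
  have "spn K (kspace A (regular_bimodule A)) ss = spn K A ss" if "set ss \<subseteq> carrier A" for ss
    by (rule spn_cong') (use that in \<open>auto simp: scal_mult_left subset_iff\<close>)
  then show ?thesis using bim_regular fdim_algebra unfolding fbim_iff fdim_def by auto
qed

lemma left_restrict_base_iso: "bim X K A (base_algebra K) \<Longrightarrow> bimod_iso A (base_algebra K) (left_restrict (base_algebra K) X) X"
proof -
  assume X: "bim X K A (base_algebra K)"
  have "field K" using bim.fdB[OF X] fd_algebra.field_K by blast
  then show ?thesis by (intro bimod_isoI[of id _ _ _ _ id]) (auto simp: bimod_hom_iff)
qed

lemma pbim_regular_left:
  fixes A :: "('k, 'a) module"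
  assumes "fd_algebra K A" shows "pbim (left_restrict A (regular_bimodule A)) K A (base_algebra K)"
proof -
  interpret A: fd_algebra K A by fact
  let ?P = "left_restrict A (regular_bimodule A)" and ?k = "base_algebra K"
  have k: "fd_algebra K ?k" by (rule fd_base[OF A.field_K])
  have f: "fbim ?P K A ?k" by (rule fbim_rst[OF A.fbim_regular alg_hom_id alg_hom_scal[OF assms] assms k])
  have "\<exists>l\<in>bimod_hom A ?k ?P X. \<forall>p\<in>carrier ?P. g (l p) = h p"
    if *: "bim X K A ?k" "bim Y K A ?k" "g \<in> bimod_hom A ?k X Y" "g ` carrier X = carrier Y" "h \<in> bimod_hom A ?k ?P Y"
    for X Y :: "('a, 'k, 'k vec) bimodule" and g h
  proof -
    interpret g: bhom K A ?k X Y g using * by (intro bhomI)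
    interpret h: bhom K A ?k ?P Y h using * f fbim_bim by (intro bhomI) auto
    obtain x where x: "x \<in> carrier X" "g x = h \<one>\<^bsub>A\<^esub>" using g.surjE[OF *(4), of "h \<one>\<^bsub>A\<^esub>"] h.closed[of "\<one>\<^bsub>A\<^esub>"] by auto
    have "(\<lambda>a. a \<odot>\<^bsub>X\<^esub> x) \<in> bimod_hom A ?k ?P X"
    proof (rule bimod_homI)
      fix c a assume "c \<in> carrier ?k" "a \<in> carrier ?P"
      then show "rsmult ?P a c \<odot>\<^bsub>X\<^esub> x = rsmult X (a \<odot>\<^bsub>X\<^esub> x) c"
        using g.X.central[of c x] x by (simp add: g.X.l_assoc g.X.lr_assoc A.field_K)
    qed (use x in \<open>auto simp: g.X.l_add1 g.X.l_assoc\<close>)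
    moreover have "g (a \<odot>\<^bsub>X\<^esub> x) = h a" if "a \<in> carrier A" for a
      using h.left[of a "\<one>\<^bsub>A\<^esub>"] that x by simp
    ultimately show ?thesis by (intro bexI) simp_all
  qed
  then show ?thesis unfolding pbim_def pbim_axioms_def using f by blast
qed

lemma pbim_regular_right:
  fixes A :: "('k, 'a) module"
  assumes "fd_algebra K A" shows "pbim (right_restrict A (regular_bimodule A)) K (base_algebra K) A"
proof -
  interpret A: fd_algebra K A by fact
  let ?P = "right_restrict A (regular_bimodule A)" and ?k = "base_algebra K"
  have k: "fd_algebra K ?k" by (rule fd_base[OF A.field_K])
  have f: "fbim ?P K ?k A" by (rule fbim_rst[OF A.fbim_regular alg_hom_scal[OF assms] alg_hom_id k assms])
  have "\<exists>l\<in>bimod_hom ?k A ?P X. \<forall>p\<in>carrier ?P. g (l p) = h p"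
    if *: "bim X K ?k A" "bim Y K ?k A" "g \<in> bimod_hom ?k A X Y" "g ` carrier X = carrier Y" "h \<in> bimod_hom ?k A ?P Y"
    for X Y :: "('k, 'a, 'k vec) bimodule" and g h
  proof -
    interpret g: bhom K ?k A X Y g using * by (intro bhomI)
    interpret h: bhom K ?k A ?P Y h using * f fbim_bim by (intro bhomI) auto
    obtain x where x: "x \<in> carrier X" "g x = h \<one>\<^bsub>A\<^esub>" using g.surjE[OF *(4), of "h \<one>\<^bsub>A\<^esub>"] h.closed[of "\<one>\<^bsub>A\<^esub>"] by auto
    have "(\<lambda>a. rsmult X x a) \<in> bimod_hom ?k A ?P X"
    proof (rule bimod_homI)
      fix c a assume "c \<in> carrier ?k" "a \<in> carrier ?P"
      then show "rsmult X x (c \<odot>\<^bsub>?P\<^esub> a) = c \<odot>\<^bsub>X\<^esub> rsmult X x a"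
        using g.X.central[of c x, symmetric] x g.X.lr_assoc[of c a x] by (simp add: g.X.r_assoc A.field_K)
    qed (use x in \<open>auto simp: g.X.r_add1 g.X.r_assoc\<close>)
    moreover have "g (rsmult X x a) = h a" if "a \<in> carrier A" for a
      using h.right[of a "\<one>\<^bsub>A\<^esub>"] that x by simp
    ultimately show ?thesis by (intro bexI) simp_all
  qed
  then show ?thesis unfolding pbim_def pbim_axioms_def using f by blast
qed

lemma pbim_base:
  fixes X :: "('k, 'k, 'm) bimodule"
  assumes "fbim X K (base_algebra K) (base_algebra K)" shows "pbim X K (base_algebra K) (base_algebra K)"
proof -
  let ?k = "base_algebra K"
  interpret X: fbim X K ?k ?k by fact
  have fK: "field K" using X.fdA fd_algebra.field_K by blast
  interpret VX: vspace "kspace ?k X" K by (rule X.vspace_kspace)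
  obtain ss where ss: "set ss \<subseteq> carrier X" "spn K (kspace ?k X) ss = carrier X" using X.fdim by (auto simp: fdim_def)
  have "\<exists>l\<in>bimod_hom ?k ?k X Y. \<forall>p\<in>carrier X. g (l p) = h p"
    if *: "bim Y K ?k ?k" "bim Z K ?k ?k" "g \<in> bimod_hom ?k ?k Y Z" "g ` carrier Y = carrier Z" "h \<in> bimod_hom ?k ?k X Z"
    for Y Z :: "('k, 'k, 'k vec) bimodule" and g h
  proof -
    interpret g: bhom K ?k ?k Y Z g using * by (intro bhomI)
    interpret h: bhom K ?k ?k X Z h using * X.bim_axioms by (intro bhomI)
    obtain l where l: "linear_on K (kspace ?k X) (kspace ?k Y) (carrier X) l" "\<And>x. x \<in> carrier X \<Longrightarrow> g (l x) = h x"
      using VX.spn_lift[OF g.X.vspace_kspace g.Y.vspace_kspace, of g ss h] g.linear_on_hom h.linear_on_hom *(4) ss by auto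
    have "l \<in> bimod_hom ?k ?k X Y"
    proof (rule bimod_homI)
      fix c x assume cx: "c \<in> carrier ?k" "x \<in> carrier X"
      then have 1: "l (c \<odot>\<^bsub>X\<^esub> x) = c \<odot>\<^bsub>Y\<^esub> l x" using l(1) by (auto simp: linear_on_def fK)
      then show "l (c \<odot>\<^bsub>X\<^esub> x) = c \<odot>\<^bsub>Y\<^esub> l x" .
      have "l x \<in> carrier Y" using l(1) cx by (auto simp: linear_on_def)
      then show "l (rsmult X x c) = rsmult Y (l x) c" using X.central[of c x] g.X.central[of c "l x"] cx 1 by (simp add: fK)
    qed (use l(1) in \<open>auto simp: linear_on_def\<close>)
    then show ?thesis using l(2) by blast
  qed
  then show ?thesis unfolding pbim_def pbim_axioms_def using X.fbim_axioms by blast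
qed

lemma tensor_unit_left:
  assumes "bim P K A B" "alg_hom K A' A \<alpha>" "fd_algebra K A'"
  shows "bimod_iso A' B (tensor A (rst \<alpha> id (regular_bimodule A)) P) (rst \<alpha> id P)"
proof -
  interpret P: bim P K A B by fact
  interpret A: fd_algebra K A by (rule P.fdA)
  note h = alg_homD[OF assms(2)]
  have R: "bim (rst \<alpha> id (regular_bimodule A)) K A' A" by (rule bim_rst[OF A.bim_regular assms(2) alg_hom_id assms(3) P.fdA])
  have P': "bim (rst \<alpha> id P) K A' B" by (rule bim_rst[OF assms(1,2) alg_hom_id assms(3) P.fdB])
  interpret Z: tensor_pair K A' A B "rst \<alpha> id (regular_bimodule A)" P by (rule tensor_pairI[OF R assms(1)])
  have "\<exists>f\<in>bimod_hom A' B Z.MN (rst \<alpha> id P). \<forall>a\<in>carrier (rst \<alpha> id (regular_bimodule A)). \<forall>p\<in>carrier P. f (Z.tens a p) = a \<odot>\<^bsub>P\<^esub> p"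
    by (rule Z.tensor_hom_ex[OF P', of "\<lambda>a p. a \<odot>\<^bsub>P\<^esub> p"])
       (auto simp: P.l_add1 P.l_add2 P.l_assoc P.lr_assoc h)
  then obtain f where f: "f \<in> bimod_hom A' B Z.MN (rst \<alpha> id P)" "\<And>a p. \<lbrakk>a \<in> carrier A; p \<in> carrier P\<rbrakk> \<Longrightarrow> f (Z.tens a p) = a \<odot>\<^bsub>P\<^esub> p"
    by auto
  interpret f: bhom K A' B Z.MN "rst \<alpha> id P" f by (rule bhomI[OF Z.MN.bim_axioms P' f(1)])
  have "Z.tens \<one>\<^bsub>A\<^esub> (f t) = t" if "t \<in> carrier Z.MN" for t
    using that
  proof (induction t rule: Z.tensor_induct)
    case zero
    have f0: "f \<zero>\<^bsub>Z.MN\<^esub> = \<zero>\<^bsub>P\<^esub>" using f.zero by simp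
    show ?case unfolding f0 by (rule Z.tens_zero2) simp
  next
    case (tens a p)
    then have ap: "a \<in> carrier A" "p \<in> carrier P" by auto
    have r: "rsmult (rst \<alpha> id (regular_bimodule A)) \<one>\<^bsub>A\<^esub> a = a" using ap by simp
    have "Z.tens (rsmult (rst \<alpha> id (regular_bimodule A)) \<one>\<^bsub>A\<^esub> a) p = Z.tens \<one>\<^bsub>A\<^esub> (a \<odot>\<^bsub>P\<^esub> p)"
      by (rule Z.tens_bal) (use ap in simp_all)
    then show ?case unfolding f(2)[OF ap] r by (rule sym)
  next
    case (add s t)
    have "f s \<in> carrier P" "f t \<in> carrier P" using f.closed add by auto
    moreover have "f (s \<oplus>\<^bsub>Z.MN\<^esub> t) = f s \<oplus>\<^bsub>P\<^esub> f t" using f.add add by simp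
    moreover have "Z.tens \<one>\<^bsub>A\<^esub> (f s \<oplus>\<^bsub>P\<^esub> f t) = Z.tens \<one>\<^bsub>A\<^esub> (f s) \<oplus>\<^bsub>Z.MN\<^esub> Z.tens \<one>\<^bsub>A\<^esub> (f t)"
      by (rule Z.tens_add2) (use calculation in simp_all)
    ultimately show ?case using add by (simp only:)
  qed
  then show ?thesis
    by (intro bimod_isoI[OF f(1), of "\<lambda>p. Z.tens \<one>\<^bsub>A\<^esub> p"]) (auto simp: f(2))
qed

lemma pbim_right_restrict:
  assumes "pbim P K A B" shows "pbim (right_restrict A P) K (base_algebra K) B"
proof -
  interpret P: pbim P K A B by fact
  interpret A: fd_algebra K A by (rule P.fdA)
  let ?k = "base_algebra K"
  have k: "fd_algebra K ?k" by (rule fd_base[OF A.field_K])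
  have W: "fbim (right_restrict A (regular_bimodule A)) K ?k A"
    by (rule fbim_rst[OF A.fbim_regular alg_hom_scal[OF P.fdA] alg_hom_id k P.fdA])
  have "fbim (left_restrict A (right_restrict A (regular_bimodule A))) K ?k ?k"
    by (rule fbim_rst[OF W alg_hom_id alg_hom_scal[OF P.fdA] k k])
  then have "pbim (left_restrict A (right_restrict A (regular_bimodule A))) K ?k ?k" by (rule pbim_base)
  then have "pbim (tensor A (right_restrict A (regular_bimodule A)) P) K ?k B"
    by (rule pbim_tensor[OF W _ assms])
  then show ?thesis using pbim_iso tensor_unit_left[OF P.bim_axioms alg_hom_scal[OF P.fdA] k] P.bim_right_restrict by blast
qed

lemma projective_cover:
  fixes X :: "('a, 'b, 'm) bimodule" and A :: "('k, 'a) module" and B :: "('k, 'b) module"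
  assumes "fbim X K A B"
  shows "\<exists>(P :: ('a, 'b, 'k vec) bimodule) f. pbim P K A B \<and> f \<in> bimod_hom A B P X \<and> f ` carrier P = carrier X"
proof -
  interpret X: fbim X K A B by fact
  interpret A: fd_algebra K A by (rule X.fdA)
  interpret B: fd_algebra K B by (rule X.fdB)
  let ?k = "base_algebra K"
  have k: "fd_algebra K ?k" by (rule fd_base[OF A.field_K])
  let ?L = "left_restrict A (regular_bimodule A)" and ?R = "right_restrict B (regular_bimodule B)"
  have L: "pbim ?L K A ?k" by (rule pbim_regular_left[OF X.fdA])
  have R: "pbim ?R K ?k B" by (rule pbim_regular_right[OF X.fdB])
  have bL: "bim ?L K A ?k" and bR: "bim ?R K ?k B" using L R pbim_bim by blast+
  interpret Z: tensor_pair K A ?k B ?L ?R by (rule tensor_pairI[OF bL bR])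
  have L': "pbim (left_restrict ?k ?L) K A ?k"
    using pbim_iso'[OF L bim.bim_left_restrict[OF bL] left_restrict_base_iso[OF bL]] .
  have T: "pbim Z.MN K A B" by (rule pbim_tensor[OF pbim_fbim[OF L] L' R])
  interpret T: pbim Z.MN K A B by (rule T)
  let ?E = "enc A Z.MN"
  have E: "pbim ?E K A B" using pbim_iso[OF T fbim_bim[OF T.enc_fbim] T.enc_iso] .
  obtain e i where e: "e \<in> bimod_hom A B Z.MN ?E" "i \<in> bimod_hom A B ?E Z.MN"
    "\<And>x. x \<in> carrier Z.MN \<Longrightarrow> i (e x) = x" "\<And>y. y \<in> carrier ?E \<Longrightarrow> e (i y) = y" using T.encE by blast
  have ev: "\<exists>f\<in>bimod_hom A B ?E X. w \<in> f ` carrier ?E" if w: "w \<in> carrier X" for w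
  proof -
    have "\<exists>f\<in>bimod_hom A B Z.MN X. \<forall>a\<in>carrier ?L. \<forall>b\<in>carrier ?R. f (Z.tens a b) = rsmult X (a \<odot>\<^bsub>X\<^esub> w) b"
    proof (rule Z.tensor_hom_ex[OF X.bim_axioms, of "\<lambda>a b. rsmult X (a \<odot>\<^bsub>X\<^esub> w) b"])
      fix a c b assume "a \<in> carrier ?L" "c \<in> carrier ?k" "b \<in> carrier ?R"
      then show "rsmult X (rsmult ?L a c \<odot>\<^bsub>X\<^esub> w) b = rsmult X (a \<odot>\<^bsub>X\<^esub> w) (c \<odot>\<^bsub>?R\<^esub> b)"
        using w X.central[of c w] by (simp add: X.l_assoc X.r_assoc X.lr_assoc)
    qed (use w in \<open>auto simp: X.l_add1 X.r_add1 X.r_add2 X.l_assoc X.r_assoc X.lr_assoc\<close>)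
    then obtain f where f: "f \<in> bimod_hom A B Z.MN X"
      "\<And>a b. \<lbrakk>a \<in> carrier ?L; b \<in> carrier ?R\<rbrakk> \<Longrightarrow> f (Z.tens a b) = rsmult X (a \<odot>\<^bsub>X\<^esub> w) b" by auto
    have "(f \<circ> i) (e (Z.tens \<one>\<^bsub>A\<^esub> \<one>\<^bsub>B\<^esub>)) = w" using f(2)[of "\<one>\<^bsub>A\<^esub>" "\<one>\<^bsub>B\<^esub>"] e(3) w by simp
    moreover have "e (Z.tens \<one>\<^bsub>A\<^esub> \<one>\<^bsub>B\<^esub>) \<in> carrier ?E" using bimod_hom_closed[OF e(1)] by simp
    ultimately have "w \<in> (f \<circ> i) ` carrier ?E" by (metis imageI)
    then show ?thesis using bimod_hom_comp[OF e(2) f(1)] by blast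
  qed
  show ?thesis
    by (rule generated_cover_surj[OF assms, of "\<lambda>F. pbim F K A B" ?E])
       (use E pbim_bim pbim_dsum pbim_zbim[OF X.fdA X.fdB] ev in auto)
qed

lemma right_functional_rst [simp]: "right_functional R (rst \<alpha> id W) f = right_functional R W f"
  by (simp add: right_functional_def)

lemma expand_rst [simp]: "expand (rst \<alpha> id W) ps x = expand W ps x"
  by (induction ps) simp_all

lemma dual_basis_rst [simp]: "dual_basis R (rst \<alpha> id W) ps = dual_basis R W ps"
  by (simp add: dual_basis_def)

lemma dual_basis_retract:
  assumes "bim F K S R" "bim W K S R" "r \<in> bimod_hom S R F W" "s \<in> bimod_hom S R W F" "\<And>x. x \<in> carrier W \<Longrightarrow> r (s x) = x"
    "dual_basis R F ps"
  shows "\<exists>qs. dual_basis R W qs"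
proof -
  interpret r: bhom K S R F W r using assms by (intro bhomI)
  interpret s: bhom K S R W F s using assms by (intro bhomI)
  let ?q = "\<lambda>p. (r (fst p), snd p \<circ> s)"
  have ps: "\<And>p. p \<in> set ps \<Longrightarrow> fst p \<in> carrier F" "\<And>p. p \<in> set ps \<Longrightarrow> right_functional R F (snd p)"
    "\<And>x. x \<in> carrier F \<Longrightarrow> expand F ps x = x" using assms(6) by (auto simp: dual_basis_def)
  have "expand W (map ?q qs) x = r (expand F qs (s x)) \<and> expand F qs (s x) \<in> carrier F"
    if "set qs \<subseteq> set ps" "x \<in> carrier W" for qs x
    using that(1)
  proof (induction qs)
    case (Cons p qs)
    then have p: "fst p \<in> carrier F" "right_functional R F (snd p)" using ps by auto
    then have "snd p (s x) \<in> carrier R" using that by (auto simp: right_functional_def)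
    then show ?case using Cons p that by simp
  qed simp
  moreover have "right_functional R W (snd p \<circ> s)" if "p \<in> set ps" for p
    using ps(2)[OF that] by (auto simp: right_functional_def)
  ultimately have "dual_basis R W (map ?q ps)"
    unfolding dual_basis_def using ps assms(5) by auto
  then show ?thesis by blast
qed

lemma dual_basis_dsum:
  assumes "bim X K S R" "bim Y K S R" "dual_basis R X ps" "dual_basis R Y qs"
  shows "\<exists>rs. dual_basis R (dsum X Y) rs"
proof -
  interpret X: bim X K S R by fact
  interpret Y: bim Y K S R by fact
  let ?p = "\<lambda>p. (vpair (fst p) \<zero>\<^bsub>Y\<^esub>, snd p \<circ> vfst)" and ?q = "\<lambda>p. (vpair \<zero>\<^bsub>X\<^esub> (fst p), snd p \<circ> vsnd)"
  have ps: "\<And>p. p \<in> set ps \<Longrightarrow> fst p \<in> carrier X" "\<And>p. p \<in> set ps \<Longrightarrow> right_functional R X (snd p)"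
    "\<And>x. x \<in> carrier X \<Longrightarrow> expand X ps x = x" using assms(3) by (auto simp: dual_basis_def)
  have qs: "\<And>p. p \<in> set qs \<Longrightarrow> fst p \<in> carrier Y" "\<And>p. p \<in> set qs \<Longrightarrow> right_functional R Y (snd p)"
    "\<And>x. x \<in> carrier Y \<Longrightarrow> expand Y qs x = x" using assms(4) by (auto simp: dual_basis_def)
  have 1: "expand (dsum X Y) (map ?q l) u = vpair \<zero>\<^bsub>X\<^esub> (expand Y l (vsnd u)) \<and> expand Y l (vsnd u) \<in> carrier Y"
    if "set l \<subseteq> set qs" "u \<in> carrier (dsum X Y)" for l u
    using that(1)
  proof (induction l)
    case (Cons p l)
    then have p: "fst p \<in> carrier Y" "right_functional R Y (snd p)" using qs by auto
    then have "snd p (vsnd u) \<in> carrier R" using that by (auto simp: right_functional_def)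
    then show ?case using Cons p that by simp
  qed simp
  have 2: "expand (dsum X Y) (map ?p l @ map ?q qs) u = vpair (expand X l (vfst u)) (vsnd u) \<and> expand X l (vfst u) \<in> carrier X"
    if "set l \<subseteq> set ps" "u \<in> carrier (dsum X Y)" for l u
    using that(1)
  proof (induction l)
    case Nil then show ?case using 1[of qs u] qs(3) that by (simp add: comp_def)
  next
    case (Cons p l)
    then have p: "fst p \<in> carrier X" "right_functional R X (snd p)" using ps by auto
    then have "snd p (vfst u) \<in> carrier R" using that by (auto simp: right_functional_def)
    then show ?case using Cons p that by simp
  qed
  have "right_functional R (dsum X Y) (snd p \<circ> vfst)" if "p \<in> set ps" for p
    using ps(2)[OF that] by (auto simp: right_functional_def)
  moreover have "right_functional R (dsum X Y) (snd p \<circ> vsnd)" if "p \<in> set qs" for p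
    using qs(2)[OF that] by (auto simp: right_functional_def)
  ultimately have "dual_basis R (dsum X Y) (map ?p ps @ map ?q qs)"
    unfolding dual_basis_def using ps qs 2 by (auto simp: vec_eqI)
  then show ?thesis by blast
qed

lemma dual_basis_exists:
  fixes W :: "('a, 'b, 'm) bimodule" and R :: "('k, 'b) module"
  assumes "bim W K S R" "pbim (right_restrict S W) K (base_algebra K) R"
  shows "\<exists>ps. dual_basis R W ps"
proof -
  let ?k = "base_algebra K" and ?W = "right_restrict S W"
  interpret W: pbim ?W K ?k R by fact
  interpret R: fd_algebra K R by (rule W.fdB)
  let ?R = "right_restrict R (regular_bimodule R)"
  interpret RR: pbim ?R K ?k R by (rule pbim_regular_right[OF W.fdB])
  let ?E = "enc ?k ?R"
  interpret E: fbim ?E K ?k R by (rule RR.enc_fbim)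
  obtain e i where e: "e \<in> bimod_hom ?k R ?R ?E" "i \<in> bimod_hom ?k R ?E ?R"
    "\<And>x. x \<in> carrier ?R \<Longrightarrow> i (e x) = x" "\<And>y. y \<in> carrier ?E \<Longrightarrow> e (i y) = y" using RR.encE by blast
  interpret e: bhom K ?k R ?R ?E e using e by (intro bhomI) unfold_locales
  interpret i: bhom K ?k R ?E ?R i using e by (intro bhomI) unfold_locales
  let ?Q = "\<lambda>F :: ('k, 'b, 'k vec) bimodule. bim F K ?k R \<and> (\<exists>ps. dual_basis R F ps)"
  have "dual_basis R ?E [(e \<one>\<^bsub>R\<^esub>, i)]"
  proof -
    have "rsmult ?E (e \<one>\<^bsub>R\<^esub>) (i x) = x" if "x \<in> carrier ?E" for x
      using e.right[of "i x" "\<one>\<^bsub>R\<^esub>"] i.closed[OF that] e(4)[OF that] by simp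
    moreover have "e \<one>\<^bsub>R\<^esub> \<in> carrier ?E" using e.closed[of "\<one>\<^bsub>R\<^esub>"] by simp
    moreover have "right_functional R ?E i" using i.closed i.add i.right by (auto simp: right_functional_def)
    ultimately show ?thesis by (simp add: dual_basis_def)
  qed
  then have QE: "?Q ?E" using E.bim_axioms by blast
  have Qz: "?Q zbim"
  proof -
    have "pbim (zbim :: ('k, 'b, 'k vec) bimodule) K ?k R" by (rule pbim_zbim[OF W.fdA W.fdB])
    moreover have "dual_basis R (zbim :: ('k, 'b, 'k vec) bimodule) []" by (simp add: dual_basis_def zbim_def)
    ultimately show ?thesis using pbim_bim by blast
  qed
  have Qd: "?Q (dsum ?E F)" if "?Q F" for F using that QE dual_basis_dsum bim_dsum by blast
  have ev: "\<exists>f\<in>bimod_hom ?k R ?E ?W. w \<in> f ` carrier ?E" if w: "w \<in> carrier ?W" for w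
  proof -
    have "(\<lambda>r. rsmult ?W w r) \<in> bimod_hom ?k R ?R ?W"
    proof (rule bimod_homI)
      fix c a assume "c \<in> carrier ?k" "a \<in> carrier ?R"
      then show "rsmult ?W w (c \<odot>\<^bsub>?R\<^esub> a) = c \<odot>\<^bsub>?W\<^esub> rsmult ?W w a"
        using W.central[of c w, symmetric] w W.lr_assoc[of c a w] W.r_assoc[of "scal R c" a w] by (simp add: R.field_K)
    qed (use w W.r_add1 W.r_assoc W.r_closed in auto)
    then have "(\<lambda>r. rsmult ?W w r) \<circ> i \<in> bimod_hom ?k R ?E ?W" using bimod_hom_comp[OF i.hom] by blast
    moreover have "((\<lambda>r. rsmult ?W w r) \<circ> i) (e \<one>\<^bsub>R\<^esub>) = w" using e(3)[of "\<one>\<^bsub>R\<^esub>"] w W.r_one by simp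
    moreover have "e \<one>\<^bsub>R\<^esub> \<in> carrier ?E" using e.closed[of "\<one>\<^bsub>R\<^esub>"] by simp
    ultimately show ?thesis by (metis imageI)
  qed
  have "\<exists>F f. ?Q F \<and> f \<in> bimod_hom ?k R F ?W \<and> f ` carrier F = carrier ?W"
    by (rule generated_cover_surj[OF W.fbim_axioms Qz Qd _ E.bim_axioms ev]) auto
  then obtain F :: "('k, 'b, 'k vec) bimodule" and f ps where F: "bim F K ?k R" "dual_basis R F ps" "f \<in> bimod_hom ?k R F ?W" "f ` carrier F = carrier ?W" by blast
  obtain s where s: "s \<in> bimod_hom ?k R ?W F" "\<And>w. w \<in> carrier ?W \<Longrightarrow> f (s w) = id w"
    by (rule W.lift[OF F(1) W.bim_axioms F(3,4) bimod_hom_id(1)]) blast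
  then show ?thesis using dual_basis_retract[OF F(1) W.bim_axioms F(3) s(1) _ F(2)] by auto
qed

lemma tensor_flat:
  assumes "sesx R T X' X X''" "bim W K S R" "pbim (right_restrict S W) K (base_algebra K) R"
    "bim X' K R T" "bim X K R T" "bim X'' K R T"
  shows "sesx S T (tensor R W X') (tensor R W X) (tensor R W X'')"
proof -
  obtain ps where ps: "dual_basis R W ps" using dual_basis_exists[OF assms(2,3)] by blast
  obtain i p where s: "ses R T X' i X p X''" using assms(1) by (auto simp: sesx_def)
  show ?thesis
  proof (rule tensor_sesx[OF s assms(2,4,5,6)])
    fix h t assume h: "h \<in> bimod_hom S T (tensor R W X') (tensor R W X)"
        "\<And>x y. \<lbrakk>x \<in> carrier W; y \<in> carrier X'\<rbrakk> \<Longrightarrow> h (tens R W X' x y) = tens R W X x (i y)"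
        "t \<in> carrier (tensor R W X')" "h t = \<zero>\<^bsub>tensor R W X\<^esub>"
    have i: "i \<in> bimod_hom R T X' X" "inj_on i (carrier X')" using s by (auto simp: ses_def)
    show "t = \<zero>\<^bsub>tensor R W X'\<^esub>" by (rule dual_basis_flat[OF assms(2,4,5) i ps h(1) _ h(3,4)]) (rule h(2))
  qed
qed


definition bop :: "('a, 'b, 'm) bimodule \<Rightarrow> ('b, 'a, 'm) bimodule" where
  "bop X = \<lparr>carrier = carrier X, mult = mult X, one = one X, zero = zero X, add = add X,
     smult = \<lambda>b x. rsmult X x b, rsmult = \<lambda>x a. a \<odot>\<^bsub>X\<^esub> x\<rparr>"

lemma bop_simps [simp]: "carrier (bop X) = carrier X" "zero (bop X) = zero X" "add (bop X) = add X"
  "smult (bop X) b x = rsmult X x b" "rsmult (bop X) x a = a \<odot>\<^bsub>X\<^esub> x"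
  by (simp_all add: bop_def)

lemma bop_bop [simp]: "bop (bop X) = X" by (simp add: bop_def)

lemma bop_rst: "bop (rst \<alpha> \<beta> X) = rst \<beta> \<alpha> (bop X)" by (simp add: bop_def rst_def)

lemma abelian_group_bop [simp]: "abelian_group (bop X) = abelian_group X"
  by (rule abelian_group_cong) simp_all

lemma scal_opposite [simp]: "scal (opposite A) c = scal A c" by (simp add: scal_def)

lemma bim_bop: assumes "bim X K A B" shows "bim (bop X) K (opposite B) (opposite A)"
proof -
  interpret X: bim X K A B by fact
  show ?thesis unfolding bim_def bim_axioms_def
    using fd_algebra.fd_algebra_opposite[OF X.fdA] fd_algebra.fd_algebra_opposite[OF X.fdB]
    by (simp add: X.abelian_group_axioms X.l_add1 X.l_add2 X.l_assoc X.r_add1 X.r_add2 X.r_assoc X.lr_assoc X.central)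
qed

lemma bim_bop': "bim (bop X) K (opposite B) (opposite A) \<Longrightarrow> bim X K A B"
  using bim_bop[of "bop X" K "opposite B" "opposite A"] by simp

lemma hom_bop: "f \<in> bimod_hom (opposite B) (opposite A) (bop X) (bop Y) \<longleftrightarrow> f \<in> bimod_hom A B X Y"
  by (auto simp: bimod_hom_iff)

lemma iso_bop: "bimod_iso (opposite B) (opposite A) (bop X) (bop Y) \<longleftrightarrow> bimod_iso A B X Y"
proof -
  have "bimod_hom (opposite B) (opposite A) (bop X) (bop Y) = bimod_hom A B X Y" using hom_bop by blast
  then show ?thesis unfolding bimod_iso_def by simp
qed

lemma sesx_bop: "sesx (opposite B) (opposite A) (bop X) (bop Y) (bop Z) \<longleftrightarrow> sesx A B X Y Z"
  by (simp add: sesx_def ses_def hom_bop a_kernel_def kernel_def)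

lemma fbim_bop: assumes "fbim X K A B" shows "fbim (bop X) K (opposite B) (opposite A)"
proof -
  interpret X: fbim X K A B by fact
  interpret X': bim "bop X" K "opposite B" "opposite A" by (rule bim_bop) unfold_locales
  obtain S where S: "finite S" "S \<subseteq> carrier X" "\<forall>H. X.stable_set H \<and> S \<subseteq> H \<longrightarrow> H = carrier X" by (rule X.generators)
  have e: "X'.stable_set H \<longleftrightarrow> X.stable_set H" for H by (auto simp: X.stable_set_def X'.stable_set_def)
  have "fg_bimodule K (opposite B) (opposite A) (bop X)"
  proof -
    have "bimodule K (opposite B) (opposite A) (bop X)" using X'.bim_axioms bim_iff by blast
    then show ?thesis unfolding fg_bimodule_def X'.subbimodule_iff using S e by (intro conjI exI[of _ S]) auto
  qed
  then show ?thesis using X'.fdA X'.fdB by (simp add: fbim_iff_fg)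
qed

lemma pbim_bop:
  fixes P :: "('a, 'b, 'm) bimodule" and A :: "('k, 'a) module" and B :: "('k, 'b) module"
  assumes "pbim P K A B" shows "pbim (bop P) K (opposite B) (opposite A)"
proof -
  interpret P: pbim P K A B by fact
  have "\<exists>l\<in>bimod_hom (opposite B) (opposite A) (bop P) X. \<forall>p\<in>carrier (bop P). g (l p) = h p"
    if *: "bim X K (opposite B) (opposite A)" "bim Y K (opposite B) (opposite A)" "g \<in> bimod_hom (opposite B) (opposite A) X Y"
      "g ` carrier X = carrier Y" "h \<in> bimod_hom (opposite B) (opposite A) (bop P) Y" for X Y :: "('b, 'a, 'k vec) bimodule" and g h
  proof -
    have 1: "bim (bop X) K A B" "bim (bop Y) K A B" using *(1,2) bim_bop'[of "bop X"] bim_bop'[of "bop Y"] by simp_all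
    have 2: "g \<in> bimod_hom A B (bop X) (bop Y)" "h \<in> bimod_hom A B P (bop Y)"
      using *(3,5) hom_bop[of g B A "bop X" "bop Y"] hom_bop[of h B A P "bop Y"] by simp_all
    have 3: "g ` carrier (bop X) = carrier (bop Y)" using *(4) by simp
    obtain l where l: "l \<in> bimod_hom A B P (bop X)" "\<And>p. p \<in> carrier P \<Longrightarrow> g (l p) = h p"
      by (rule P.lift[OF 1 2(1) 3 2(2)]) blast
    then show ?thesis using hom_bop[of l B A P "bop X"] by (intro bexI[of _ l]) simp_all
  qed
  then show ?thesis unfolding pbim_def pbim_axioms_def using fbim_bop[OF P.fbim_axioms] by blast
qed

lemma pbim_bop': "pbim (bop X) K (opposite B) (opposite A) \<Longrightarrow> pbim X K A B"
  using pbim_bop[of "bop X" K "opposite B" "opposite A"] by simp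
lemma pbim_left_restrict:
  assumes "pbim P K A B" shows "pbim (left_restrict B P) K A (base_algebra K)"
proof -
  have K: "field K" using assms by (auto simp: pbim_iff intro: fd_algebra.field_K)
  have "scal (opposite B) = scal B" by (rule ext) simp
  then have "pbim (right_restrict B (bop P)) K (base_algebra K) (opposite A)"
    using pbim_right_restrict[OF pbim_bop[OF assms]] by simp
  then have "pbim (bop (left_restrict B P)) K (opposite (base_algebra K)) (opposite A)" using K by (simp add: bop_rst)
  then show ?thesis by (rule pbim_bop')
qed

lemma tensor_flip:
  assumes M: "bim M K S R" and N: "bim N K R T"
  shows "bimod_iso (opposite T) (opposite S) (tensor (opposite R) (bop N) (bop M)) (bop (tensor R M N))"
proof -
  interpret Z: tensor_pair K S R T M N by (rule tensor_pairI[OF M N])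
  interpret W: tensor_pair K "opposite T" "opposite R" "opposite S" "bop N" "bop M" by (rule tensor_pairI[OF bim_bop[OF N] bim_bop[OF M]])
  have ZW: "bim (bop W.MN) K S T" by (rule bim_bop') (simp add: W.MN.bim_axioms)
  have WZ: "bim (bop Z.MN) K (opposite T) (opposite S)" by (rule bim_bop[OF Z.MN.bim_axioms])
  have "\<exists>f\<in>bimod_hom S T Z.MN (bop W.MN). \<forall>x\<in>carrier M. \<forall>y\<in>carrier N. f (Z.tens x y) = W.tens y x"
    by (rule Z.tensor_hom_ex[OF ZW, of "\<lambda>x y. W.tens y x"])
      (use W.tens_closed W.tens_add1 W.tens_add2 W.tens_bal W.tens_left W.tens_right in simp_all)
  then obtain f where f: "f \<in> bimod_hom S T Z.MN (bop W.MN)" "\<And>x y. \<lbrakk>x \<in> carrier M; y \<in> carrier N\<rbrakk> \<Longrightarrow> f (Z.tens x y) = W.tens y x"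
    by blast
  have "\<exists>g\<in>bimod_hom (opposite T) (opposite S) W.MN (bop Z.MN). \<forall>y\<in>carrier (bop N). \<forall>x\<in>carrier (bop M). g (W.tens y x) = Z.tens x y"
    by (rule W.tensor_hom_ex[OF WZ, of "\<lambda>y x. Z.tens x y"])
      (use Z.tens_closed Z.tens_add1 Z.tens_add2 Z.tens_bal Z.tens_left Z.tens_right in simp_all)
  then obtain g where g: "g \<in> bimod_hom (opposite T) (opposite S) W.MN (bop Z.MN)"
    "\<And>x y. \<lbrakk>x \<in> carrier M; y \<in> carrier N\<rbrakk> \<Longrightarrow> g (W.tens y x) = Z.tens x y" by auto
  have g': "g \<in> bimod_hom S T (bop W.MN) Z.MN" using g(1) hom_bop[of g T S "bop W.MN" Z.MN] by simp
  have f': "f \<in> bimod_hom (opposite T) (opposite S) (bop Z.MN) W.MN" using f(1) hom_bop[of f T S Z.MN "bop W.MN"] by simp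
  have gf: "(g \<circ> f) t = id t" if "t \<in> carrier Z.MN" for t
    by (rule Z.tensor_hom_eq[OF Z.MN.bim_axioms bimod_hom_comp[OF f(1) g'] bimod_hom_id(1) _ that]) (simp add: f(2) g(2))
  have fg: "(f \<circ> g) t = id t" if "t \<in> carrier W.MN" for t
    by (rule W.tensor_hom_eq[OF W.MN.bim_axioms bimod_hom_comp[OF g(1) f'] bimod_hom_id(1) _ that]) (simp add: f(2) g(2))
  show ?thesis
    by (rule bimod_isoI[OF g(1), of f]) (use gf fg bimod_hom_closed[OF f(1)] in auto)
qed

lemma pbim_tensor_right:
  assumes "fbim N K R T" "pbim (right_restrict R N) K (base_algebra K) T" "pbim Q K S R"
  shows "pbim (tensor R Q N) K S T"
proof -
  have K: "field K" using assms(3) by (auto simp: pbim_iff intro: fd_algebra.field_K)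
  have e: "scal (opposite R) = scal R" by (rule ext) simp
  have bN: "bim N K R T" and bQ: "bim Q K S R" using assms(1,3) fbim_bim pbim_bim by blast+
  have "pbim (bop (right_restrict R N)) K (opposite T) (opposite (base_algebra K))" by (rule pbim_bop[OF assms(2)])
  then have "pbim (left_restrict (opposite R) (bop N)) K (opposite T) (base_algebra K)" using K e by (simp add: bop_rst)
  then have "pbim (tensor (opposite R) (bop N) (bop Q)) K (opposite T) (opposite S)"
    by (rule pbim_tensor[OF fbim_bop[OF assms(1)] _ pbim_bop[OF assms(3)]])
  moreover have "bim (tensor R Q N) K S T" using tensor_pair.bim_tensor[OF tensor_pairI[OF bQ bN]] .
  ultimately have "pbim (bop (tensor R Q N)) K (opposite T) (opposite S)"
    using pbim_iso[OF _ bim_bop tensor_flip[OF bQ bN]] by blast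
  then show ?thesis by (rule pbim_bop')
qed

lemma tensor_flat_left:
  assumes "sesx S R X' X X''" "bim W K R T" "pbim (left_restrict T W) K R (base_algebra K)"
    "bim X' K S R" "bim X K S R" "bim X'' K S R"
  shows "sesx S T (tensor R X' W) (tensor R X W) (tensor R X'' W)"
proof -
  have K: "field K" using assms(3) by (auto simp: pbim_iff intro: fd_algebra.field_K)
  have e: "scal (opposite T) = scal T" by (rule ext) simp
  have "pbim (bop (left_restrict T W)) K (opposite (base_algebra K)) (opposite R)" by (rule pbim_bop[OF assms(3)])
  then have P: "pbim (right_restrict (opposite T) (bop W)) K (base_algebra K) (opposite R)" using K e by (simp add: bop_rst)
  have "sesx (opposite R) (opposite S) (bop X') (bop X) (bop X'')" using assms(1) sesx_bop by blast
  then have 1: "sesx (opposite T) (opposite S) (tensor (opposite R) (bop W) (bop X')) (tensor (opposite R) (bop W) (bop X)) (tensor (opposite R) (bop W) (bop X''))"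
    by (rule tensor_flat[OF _ bim_bop[OF assms(2)] P assms(4-6)[THEN bim_bop]])
  have a1: "bim (tensor (opposite R) (bop W) (bop X')) K (opposite T) (opposite S)"
    by (rule tensor_pair.bim_tensor[OF tensor_pairI[OF bim_bop[OF assms(2)] bim_bop]]) fact
  have a2: "bim (bop (tensor R X' W)) K (opposite T) (opposite S)"
    by (rule bim_bop[OF tensor_pair.bim_tensor[OF tensor_pairI[OF _ assms(2)]]]) fact
  have a3: "bimod_iso (opposite T) (opposite S) (tensor (opposite R) (bop W) (bop X')) (bop (tensor R X' W))"
    by (rule tensor_flip[OF _ assms(2)]) fact
  have b1: "bim (tensor (opposite R) (bop W) (bop X)) K (opposite T) (opposite S)"
    by (rule tensor_pair.bim_tensor[OF tensor_pairI[OF bim_bop[OF assms(2)] bim_bop]]) fact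
  have b2: "bim (bop (tensor R X W)) K (opposite T) (opposite S)"
    by (rule bim_bop[OF tensor_pair.bim_tensor[OF tensor_pairI[OF _ assms(2)]]]) fact
  have b3: "bimod_iso (opposite T) (opposite S) (tensor (opposite R) (bop W) (bop X)) (bop (tensor R X W))"
    by (rule tensor_flip[OF _ assms(2)]) fact
  have c1: "bim (tensor (opposite R) (bop W) (bop X'')) K (opposite T) (opposite S)"
    by (rule tensor_pair.bim_tensor[OF tensor_pairI[OF bim_bop[OF assms(2)] bim_bop]]) fact
  have c2: "bim (bop (tensor R X'' W)) K (opposite T) (opposite S)"
    by (rule bim_bop[OF tensor_pair.bim_tensor[OF tensor_pairI[OF _ assms(2)]]]) fact
  have c3: "bimod_iso (opposite T) (opposite S) (tensor (opposite R) (bop W) (bop X'')) (bop (tensor R X'' W))"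
    by (rule tensor_flip[OF _ assms(2)]) fact
  have "sesx (opposite T) (opposite S) (bop (tensor R X' W)) (bop (tensor R X W)) (bop (tensor R X'' W))"
    by (rule sesx_iso3[OF 1 a1 b1 c1 a2 b2 c2 a3 b3 c3])
  then show ?thesis using sesx_bop by blast
qed


section \<open>Left modules and the quotient algebra\<close>

definition module_bim :: "('k, 'a) module \<Rightarrow> ('a, 'm, 'y) module_scheme \<Rightarrow> ('a, 'k, 'm) bimodule" where
  "module_bim A M = \<lparr>carrier = carrier M, mult = mult M, one = one M, zero = zero M, add = add M,
     smult = smult M, rsmult = \<lambda>x c. scal A c \<odot>\<^bsub>M\<^esub> x\<rparr>"

lemma module_bim_simps [simp]:
  "carrier (module_bim A M) = carrier M" "zero (module_bim A M) = zero M" "add (module_bim A M) = add M"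
  "smult (module_bim A M) = smult M" "rsmult (module_bim A M) x c = scal A c \<odot>\<^bsub>M\<^esub> x"
  by (simp_all add: module_bim_def)

lemma bim_module:
  assumes "fd_algebra K A" "left_module A M" shows "bim (module_bim A M) K A (base_algebra K)"
proof -
  interpret A: fd_algebra K A by fact
  interpret M: left_module A M by fact
  have ag: "abelian_group (module_bim A M)" by (subst abelian_group_cong[of _ M]) (auto simp: M.abelian_group_axioms)
  have c: "scal A d \<otimes>\<^bsub>A\<^esub> a = a \<otimes>\<^bsub>A\<^esub> scal A d" if "d \<in> carrier K" "a \<in> carrier A" for d a
    using that by (simp add: A.scal_mult_left A.scal_mult_right)
  have lr: "scal A d \<odot>\<^bsub>M\<^esub> (a \<odot>\<^bsub>M\<^esub> x) = a \<odot>\<^bsub>M\<^esub> (scal A d \<odot>\<^bsub>M\<^esub> x)" if "d \<in> carrier K" "a \<in> carrier A" "x \<in> carrier M" for d a x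
    using M.smult_assoc1[of "scal A d" a x] M.smult_assoc1[of a "scal A d" x] that c by simp
  have m: "scal A (d \<otimes>\<^bsub>K\<^esub> e) \<odot>\<^bsub>M\<^esub> x = scal A e \<odot>\<^bsub>M\<^esub> (scal A d \<odot>\<^bsub>M\<^esub> x)" if "d \<in> carrier K" "e \<in> carrier K" "x \<in> carrier M" for d e x
    using that M.smult_assoc1[of "scal A d" "scal A e" x] lr[of e "scal A d" x] by (simp add: A.scal_mult)
  show ?thesis
    unfolding bim_def bim_axioms_def module_bim_simps base_algebra_simps
    by (intro conjI allI impI ag assms(1) fd_base[OF A.field_K] M.smult_closed M.smult_l_distr M.smult_r_distr M.smult_assoc1 lr)
      (simp_all add: M.smult_closed M.smult_l_distr M.smult_r_distr M.smult_one A.scal_add A.field_K m)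
qed

lemma (in bim) left_module: "left_module A X"
  using bim_axioms by (simp add: bim_iff bimodule_def)

lemma mod_hom_iff: "f \<in> mod_hom A X Y \<longleftrightarrow> f \<in> carrier X \<rightarrow> carrier Y \<and>
     (\<forall>x\<in>carrier X. \<forall>y\<in>carrier X. f (x \<oplus>\<^bsub>X\<^esub> y) = f x \<oplus>\<^bsub>Y\<^esub> f y) \<and>
     (\<forall>a\<in>carrier A. \<forall>x\<in>carrier X. f (a \<odot>\<^bsub>X\<^esub> x) = a \<odot>\<^bsub>Y\<^esub> f x)"
  by (auto simp: mod_hom_def hom_def)

lemma (in fbim) fg_module: "fg_module A X"
proof -
  interpret A: fd_algebra K A by (rule fdA)
  interpret V: vspace "kspace A X" K by (rule vspace_kspace)
  obtain ss where ss: "set ss \<subseteq> carrier X" "spn K (kspace A X) ss = carrier X" using fdim by (auto simp: fdim_def)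
  have "H = carrier X" if H: "submodule H A X" "set ss \<subseteq> H" for H
  proof -
    have "vsub K (kspace A X) H"
      using H(1) unfolding submodule_def submodule_axioms_def subgroup_def vsub_def by auto
    then have "spn K (kspace A X) ss \<subseteq> H" using V.spn_least H(2) by blast
    moreover have "H \<subseteq> carrier X" using H(1) unfolding submodule_def subgroup_def by auto
    ultimately show ?thesis using ss(2) by blast
  qed
  then have "fin_gen A X" unfolding fin_gen_def using ss(1) by (intro exI[of _ "set ss"]) auto
  then show ?thesis using left_module by (simp add: fg_module_def)
qed

lemma fg_projective_left:
  fixes P :: "('a, 'b, 'm) bimodule" and A :: "('k, 'a) module"
  assumes "fbim P K A B" "pbim (left_restrict B P) K A (base_algebra K)"
  shows "fg_projective A P"
proof -
  interpret P: fbim P K A B by fact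
  have "\<exists>l\<in>mod_hom A P X. \<forall>p\<in>carrier P. g (l p) = h p"
    if *: "left_module A X" "left_module A Y" "g \<in> mod_hom A X Y" "g ` carrier X = carrier Y" "h \<in> mod_hom A P Y"
    for X Y :: "('a, 'k vec) module" and g h
  proof -
    interpret X: bim "module_bim A X" K A "base_algebra K" by (rule bim_module[OF P.fdA *(1)])
    interpret Y: bim "module_bim A Y" K A "base_algebra K" by (rule bim_module[OF P.fdA *(2)])
    interpret A: fd_algebra K A by (rule P.fdA)
    have g: "g \<in> bimod_hom A (base_algebra K) (module_bim A X) (module_bim A Y)"
      using *(3) by (auto simp: bimod_hom_iff mod_hom_iff)
    have h: "h \<in> bimod_hom A (base_algebra K) (left_restrict B P) (module_bim A Y)"
      using *(5) by (auto simp: bimod_hom_iff mod_hom_iff P.central[symmetric])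
    obtain l where l: "l \<in> bimod_hom A (base_algebra K) (left_restrict B P) (module_bim A X)"
      "\<And>p. p \<in> carrier (left_restrict B P) \<Longrightarrow> g (l p) = h p"
      by (rule pbim.lift[OF assms(2) X.bim_axioms Y.bim_axioms g _ h]) (use *(4) in auto)
    show ?thesis by (rule bexI[of _ l]) (use l in \<open>auto simp: bimod_hom_iff mod_hom_iff\<close>)
  qed
  then show ?thesis unfolding fg_projective_def using P.fg_module by blast
qed

lemma fg_projective_cong:
  fixes A :: "('k, 'b) module" and P :: "('b, 'm, 'y) module_scheme" and Q :: "('b, 'm, 'z) module_scheme"
  assumes "carrier P = carrier Q" "zero P = zero Q" "add P = add Q" "smult P = smult Q" "fg_projective A P"
  shows "fg_projective A Q"
proof -
  have "left_module A P \<longleftrightarrow> left_module A Q"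
    unfolding left_module_def left_module_axioms_def using abelian_group_cong[OF assms(1-3)] assms(1-4) by simp
  moreover have "submodule H A P \<longleftrightarrow> submodule H A Q" for H
    using assms(1-4) a_inv_cong[OF assms(1-3)] unfolding submodule_def submodule_axioms_def subgroup_def by (simp add: a_inv_def)
  ultimately have fg: "fg_module A P \<longleftrightarrow> fg_module A Q" unfolding fg_module_def fin_gen_def using assms(1) by simp
  have h: "mod_hom A P = (mod_hom A Q :: ('b, 'k vec) module \<Rightarrow> ('m \<Rightarrow> 'k vec) set)"
    using assms(1-4) by (intro ext) (auto simp: mod_hom_iff)
  show ?thesis using assms(5) unfolding fg_projective_def fg h assms(1) .
qed

lemma fg_projective_right:
  fixes P :: "('a, 'b, 'm) bimodule" and A :: "('k, 'a) module" and B :: "('k, 'b) module"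
  assumes "fbim P K A B" "pbim (right_restrict A P) K (base_algebra K) B"
  shows "fg_projective (opposite B) (right_module P)"
proof -
  have K: "field K" using assms(2) by (auto simp: pbim_iff intro: fd_algebra.field_K)
  have e: "scal (opposite A) = scal A" by (rule ext) simp
  have "pbim (bop (right_restrict A P)) K (opposite B) (opposite (base_algebra K))" by (rule pbim_bop[OF assms(2)])
  then have "pbim (left_restrict (opposite A) (bop P)) K (opposite B) (base_algebra K)" using K e by (simp add: bop_rst)
  then have "fg_projective (opposite B) (bop P)" by (rule fg_projective_left[OF fbim_bop[OF assms(1)]])
  then show ?thesis by (rule fg_projective_cong[rotated 4]) (auto simp: fun_eq_iff)
qed

locale algebra_ideal = fd_algebra K A + J: ideal J A
  for K :: "('k, 'z) ring_scheme" and A :: "('k, 'a) module" and J :: "'a set"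
begin

abbreviation B where "B \<equiv> quotient_algebra A J"
abbreviation proj where "proj \<equiv> a_r_coset A J"

lemma quotient_simps:
  "carrier B = proj ` carrier A" "one B = proj \<one>\<^bsub>A\<^esub>" "zero B = J"
  "add B = add (A Quot J)" "mult B = mult (A Quot J)"
  unfolding quotient_algebra_def ring.defs module.defs FactRing_def A_RCOSETS_def' by (simp_all add: UNION_singleton_eq_range)

lemma proj_ring_hom: "proj \<in> ring_hom A B"
  using J.rcos_ring_hom by (simp add: ring_hom_def quotient_simps FactRing_def A_RCOSETS_def' UNION_singleton_eq_range)

lemma proj_closed: "a \<in> carrier A \<Longrightarrow> proj a \<in> carrier B" by (simp add: quotient_simps)

lemma proj_eq_iff: "\<lbrakk>a \<in> carrier A; b \<in> carrier A\<rbrakk> \<Longrightarrow> proj a = proj b \<longleftrightarrow> a \<ominus>\<^bsub>A\<^esub> b \<in> J"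
  using A.quotient_eq_iff_same_a_r_cos[OF J.ideal_axioms] by simp

lemma ideal_smult: "\<lbrakk>c \<in> carrier K; x \<in> J\<rbrakk> \<Longrightarrow> c \<odot>\<^bsub>A\<^esub> x \<in> J"
  using J.I_l_closed[of x "scal A c"] scal_mult_left[of c x] J.Icarr by simp

lemma proj_smult: "\<lbrakk>c \<in> carrier K; a \<in> carrier A\<rbrakk> \<Longrightarrow> c \<odot>\<^bsub>B\<^esub> proj a = proj (c \<odot>\<^bsub>A\<^esub> a)"
proof -
  assume c: "c \<in> carrier K" and a: "a \<in> carrier A"
  have "proj (c \<odot>\<^bsub>A\<^esub> x) = proj (c \<odot>\<^bsub>A\<^esub> a)" if x: "x \<in> proj a" for x
  proof -
    obtain j where j: "j \<in> J" "x = j \<oplus>\<^bsub>A\<^esub> a" using x by (auto simp: a_r_coset_def')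
    then have jc: "j \<in> carrier A" using J.Icarr by simp
    have "c \<odot>\<^bsub>A\<^esub> x \<ominus>\<^bsub>A\<^esub> c \<odot>\<^bsub>A\<^esub> a = c \<odot>\<^bsub>A\<^esub> j" using j jc a c by (simp add: smult_r_distr)
    then show ?thesis using proj_eq_iff[of "c \<odot>\<^bsub>A\<^esub> x" "c \<odot>\<^bsub>A\<^esub> a"] ideal_smult[OF c j(1)] j jc a c by simp
  qed
  moreover have "a \<in> proj a" using a J.a_rcos_self by blast
  ultimately have "(\<Union>x\<in>proj a. proj (c \<odot>\<^bsub>A\<^esub> x)) = proj (c \<odot>\<^bsub>A\<^esub> a)" by blast
  then show ?thesis by (simp add: quotient_algebra_def ring.defs module.defs)
qed

lemma fd_quotient: "fd_algebra K B"
proof -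
  note hm = ring_hom_mult[OF proj_ring_hom] and ha = ring_hom_add[OF proj_ring_hom]
  have r: "ring B"
  proof -
    have ag: "abelian_group B"
      by (subst abelian_group_cong[of _ "A Quot J"]) (use ring.is_abelian_group[OF J.quotient_is_ring] in
        \<open>auto simp: quotient_algebra_def ring.defs module.defs\<close>)
    show ?thesis
      by (intro ringI ag monoidI)
        (auto simp: quotient_simps(1,2) hm[symmetric] ha[symmetric] m_assoc l_distr r_distr)
  qed
  then have ag: "abelian_group B" by (rule ring.is_abelian_group)
  have m: "module K B"
    by (rule moduleI[OF K.is_cring ag])
      (auto simp: quotient_simps(1) proj_smult ha[symmetric] smult_l_distr smult_r_distr smult_assoc1)
  have v: "vspace B K"
    unfolding vspace_def vspace_axioms_def using ag module.smult_closed[OF m] module.smult_l_distr[OF m] module.smult_r_distr[OF m]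
      module.smult_assoc1[OF m] module.smult_one[OF m] by (simp add: field_K)
  have "linear_on K A B (carrier A) proj" using proj_smult by (auto simp: linear_on_def ha proj_closed)
  then have "fdim K B" using vspace.fdim_image[OF vspace_algebra fdim_algebra _ v] by (simp add: quotient_simps)
  then have "fin_gen K B" using vspace.fdim_iff[OF v] by simp
  then show ?thesis
    unfolding fd_algebra_def fd_algebra_axioms_def using m r
    by (auto simp: field_K quotient_simps(1) proj_smult hm[symmetric] smult_mult_left smult_mult_right)
qed

lemma proj_alg_hom: "alg_hom K A B proj"
  using proj_ring_hom proj_smult[of _ "\<one>\<^bsub>A\<^esub>"] by (simp add: alg_hom_def scal_def quotient_simps)

lemma restrict_module_simps [simp]:
  "carrier (restrict_module A J M) = carrier M" "zero (restrict_module A J M) = zero M"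
  "add (restrict_module A J M) = add M" "a \<odot>\<^bsub>restrict_module A J M\<^esub> x = proj a \<odot>\<^bsub>M\<^esub> x"
  by (simp_all add: restrict_module_def)

lemma left_module_restrict: assumes "left_module B M" shows "left_module A (restrict_module A J M)"
proof -
  interpret M: left_module B M by fact
  note h = ring_hom_memE[OF proj_ring_hom]
  have ag: "abelian_group (restrict_module A J M)" by (subst abelian_group_cong[of _ M]) (auto simp: M.abelian_group_axioms)
  show ?thesis
    unfolding left_module_def left_module_axioms_def
    by (simp add: ring_A ag proj_closed h M.smult_closed M.smult_l_distr M.smult_r_distr M.smult_assoc1 M.smult_one)
qed

lemma fg_module_restrict: assumes "fg_module B M" shows "fg_module A (restrict_module A J M)"
proof -
  have "submodule H B M" if "submodule H A (restrict_module A J M)" for H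
    using that unfolding submodule_def submodule_axioms_def subgroup_def
    by (auto simp: quotient_simps(1) restrict_module_def m_inv_def)
  moreover obtain S where "finite S" "S \<subseteq> carrier M" "\<forall>H. submodule H B M \<and> S \<subseteq> H \<longrightarrow> H = carrier M"
    using assms by (auto simp: fg_module_def fin_gen_def)
  ultimately have "fin_gen A (restrict_module A J M)" unfolding fin_gen_def by (intro exI[of _ S]) auto
  moreover have "left_module A (restrict_module A J M)" using assms left_module_restrict[of M] by (simp add: fg_module_def)
  ultimately show ?thesis by (simp add: fg_module_def)
qed

lemma mod_hom_restrict: "f \<in> mod_hom B M N \<Longrightarrow> f \<in> mod_hom A (restrict_module A J M) (restrict_module A J N)"
  using proj_closed by (auto simp: mod_hom_iff)

end


lemma left_moduleD: assumes "left_module A M"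
  shows "abelian_group M" "ring A" "\<lbrakk>a \<in> carrier A; x \<in> carrier M\<rbrakk> \<Longrightarrow> a \<odot>\<^bsub>M\<^esub> x \<in> carrier M" "\<zero>\<^bsub>M\<^esub> \<in> carrier M"
    "\<lbrakk>x \<in> carrier M; y \<in> carrier M\<rbrakk> \<Longrightarrow> x \<oplus>\<^bsub>M\<^esub> y \<in> carrier M"
    "\<lbrakk>x \<in> carrier M; y \<in> carrier M\<rbrakk> \<Longrightarrow> x \<ominus>\<^bsub>M\<^esub> y \<in> carrier M"
    "\<lbrakk>a \<in> carrier A; x \<in> carrier M; y \<in> carrier M\<rbrakk> \<Longrightarrow> a \<odot>\<^bsub>M\<^esub> (x \<oplus>\<^bsub>M\<^esub> y) = a \<odot>\<^bsub>M\<^esub> x \<oplus>\<^bsub>M\<^esub> a \<odot>\<^bsub>M\<^esub> y"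
proof -
  interpret M: left_module A M by fact
  show "abelian_group M" "ring A" "\<zero>\<^bsub>M\<^esub> \<in> carrier M" by unfold_locales auto
qed (use assms in \<open>auto simp: left_module_def left_module_axioms_def abelian_group.minus_closed abelian_group.axioms(1) abelian_monoid.a_closed\<close>)

lemma left_module_smult_zero: assumes "left_module A M" "a \<in> carrier A" shows "a \<odot>\<^bsub>M\<^esub> \<zero>\<^bsub>M\<^esub> = \<zero>\<^bsub>M\<^esub>"
proof -
  interpret M: left_module A M by fact
  have "a \<odot>\<^bsub>M\<^esub> \<zero>\<^bsub>M\<^esub> \<oplus>\<^bsub>M\<^esub> a \<odot>\<^bsub>M\<^esub> \<zero>\<^bsub>M\<^esub> = a \<odot>\<^bsub>M\<^esub> \<zero>\<^bsub>M\<^esub>"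
    using M.smult_r_distr[of a "\<zero>\<^bsub>M\<^esub>" "\<zero>\<^bsub>M\<^esub>"] assms(2) by simp
  then show ?thesis using M.M.add.l_cancel_one[of "a \<odot>\<^bsub>M\<^esub> \<zero>\<^bsub>M\<^esub>" "a \<odot>\<^bsub>M\<^esub> \<zero>\<^bsub>M\<^esub>"] M.smult_closed assms(2) by simp
qed

lemma left_module_smult_diff: assumes "left_module A M" "a \<in> carrier A" "x \<in> carrier M" "y \<in> carrier M"
  shows "a \<odot>\<^bsub>M\<^esub> (x \<ominus>\<^bsub>M\<^esub> y) = a \<odot>\<^bsub>M\<^esub> x \<ominus>\<^bsub>M\<^esub> a \<odot>\<^bsub>M\<^esub> y"
proof -
  interpret M: left_module A M by fact
  have "a \<odot>\<^bsub>M\<^esub> (x \<ominus>\<^bsub>M\<^esub> y) \<oplus>\<^bsub>M\<^esub> a \<odot>\<^bsub>M\<^esub> y = a \<odot>\<^bsub>M\<^esub> x" using M.smult_r_distr[of a "x \<ominus>\<^bsub>M\<^esub> y" y] assms by simp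
  then show ?thesis using M.M.diff_eq_iff[of "a \<odot>\<^bsub>M\<^esub> x" "a \<odot>\<^bsub>M\<^esub> y" "a \<odot>\<^bsub>M\<^esub> (x \<ominus>\<^bsub>M\<^esub> y)"] M.smult_closed assms by simp
qed

lemma mod_homD:
  assumes "f \<in> mod_hom A X Y"
  shows "x \<in> carrier X \<Longrightarrow> f x \<in> carrier Y" "\<lbrakk>x \<in> carrier X; y \<in> carrier X\<rbrakk> \<Longrightarrow> f (x \<oplus>\<^bsub>X\<^esub> y) = f x \<oplus>\<^bsub>Y\<^esub> f y"
    "\<lbrakk>a \<in> carrier A; x \<in> carrier X\<rbrakk> \<Longrightarrow> f (a \<odot>\<^bsub>X\<^esub> x) = a \<odot>\<^bsub>Y\<^esub> f x"
  using assms by (auto simp: mod_hom_iff)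

lemma mod_hom_zero:
  assumes "f \<in> mod_hom A X Y" "left_module A X" "left_module A Y" shows "f \<zero>\<^bsub>X\<^esub> = \<zero>\<^bsub>Y\<^esub>"
proof -
  interpret X: left_module A X by fact
  interpret Y: left_module A Y by fact
  show ?thesis
    using mod_homD(2)[OF assms(1), of "\<zero>\<^bsub>X\<^esub>" "\<zero>\<^bsub>X\<^esub>"] Y.M.add.l_cancel_one[of "f \<zero>\<^bsub>X\<^esub>" "f \<zero>\<^bsub>X\<^esub>"] mod_homD(1)[OF assms(1)] by simp
qed

lemma mod_hom_diff:
  assumes "f \<in> mod_hom A X Y" "left_module A X" "left_module A Y" "x \<in> carrier X" "y \<in> carrier X"
  shows "f (x \<ominus>\<^bsub>X\<^esub> y) = f x \<ominus>\<^bsub>Y\<^esub> f y"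
proof -
  interpret X: left_module A X by fact
  interpret Y: left_module A Y by fact
  have "f (x \<ominus>\<^bsub>X\<^esub> y) \<oplus>\<^bsub>Y\<^esub> f y = f x" using mod_homD(2)[OF assms(1), of "x \<ominus>\<^bsub>X\<^esub> y" y] assms(4,5) by simp
  then show ?thesis using Y.M.diff_eq_iff[of "f x" "f y" "f (x \<ominus>\<^bsub>X\<^esub> y)"] mod_homD(1)[OF assms(1)] assms(4,5) by simp
qed

lemma mod_hom_comp: "\<lbrakk>f \<in> mod_hom A X Y; g \<in> mod_hom A Y Z\<rbrakk> \<Longrightarrow> (\<lambda>x. g (f x)) \<in> mod_hom A X Z"
  by (auto simp: mod_hom_iff Pi_iff)

lemma mod_hom_minus:
  assumes "f \<in> mod_hom A X Y" "g \<in> mod_hom A X Y" "left_module A Y" shows "(\<lambda>x. f x \<ominus>\<^bsub>Y\<^esub> g x) \<in> mod_hom A X Y"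
proof -
  interpret Y: left_module A Y by fact
  note f = mod_homD[OF assms(1)] and g = mod_homD[OF assms(2)]
  show ?thesis unfolding mod_hom_iff
    by (simp add: f g left_module_smult_diff[OF assms(3)] Y.M.diff_add_diff)
qed

lemma mod_hom_const_zero: "left_module A Y \<Longrightarrow> (\<lambda>_. \<zero>\<^bsub>Y\<^esub>) \<in> mod_hom A X Y"
  using left_moduleD(4)[of A Y] abelian_monoid.l_zero[OF abelian_group.axioms(1)[OF left_moduleD(1)], of A Y]
  by (auto simp: mod_hom_iff left_module_smult_zero)

definition msub :: "('r, 'x) ring_scheme \<Rightarrow> ('r, 'm, 'y) module_scheme \<Rightarrow> 'm set \<Rightarrow> bool" where
  "msub A X S \<longleftrightarrow> S \<subseteq> carrier X \<and> \<zero>\<^bsub>X\<^esub> \<in> S \<and> (\<forall>x\<in>S. \<forall>y\<in>S. x \<oplus>\<^bsub>X\<^esub> y \<in> S \<and> x \<ominus>\<^bsub>X\<^esub> y \<in> S) \<and> (\<forall>a\<in>carrier A. \<forall>x\<in>S. a \<odot>\<^bsub>X\<^esub> x \<in> S)"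

lemma msub_carrier: "left_module A X \<Longrightarrow> msub A X (carrier X)"
  by (simp add: msub_def left_moduleD)

lemma msub_image: assumes "msub A X S" "g \<in> mod_hom A X Y" "left_module A X" "left_module A Y" shows "msub A Y (g ` S)"
proof -
  note g = mod_homD[OF assms(2)] mod_hom_zero[OF assms(2-4)] mod_hom_diff[OF assms(2-4)]
  note S = assms(1)[unfolded msub_def]
  have s: "x \<in> carrier X" if "x \<in> S" for x using S that by blast
  have "\<zero>\<^bsub>Y\<^esub> \<in> g ` S" using S g(4) by force
  moreover have "g x \<oplus>\<^bsub>Y\<^esub> g y \<in> g ` S \<and> g x \<ominus>\<^bsub>Y\<^esub> g y \<in> g ` S" if "x \<in> S" "y \<in> S" for x y
    using S that g(2)[of x y, symmetric] g(5)[of x y, symmetric] s by simp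
  moreover have "a \<odot>\<^bsub>Y\<^esub> g x \<in> g ` S" if "a \<in> carrier A" "x \<in> S" for a x using S that g(3)[of a x, symmetric] s by simp
  ultimately show ?thesis unfolding msub_def using g(1) s by blast
qed

lemma msub_kernel: assumes "g \<in> mod_hom A X Y" "left_module A X" "left_module A Y" shows "msub A X {x \<in> carrier X. g x = \<zero>\<^bsub>Y\<^esub>}"
proof -
  interpret X: left_module A X by fact
  interpret Y: left_module A Y by fact
  show ?thesis
    using mod_homD[OF assms(1)] mod_hom_zero[OF assms] mod_hom_diff[OF assms]
    by (simp add: msub_def X.smult_closed left_module_smult_zero[OF assms(3)])
qed

lemma left_module_sub: assumes "left_module A X" "msub A X S" shows "left_module A (X\<lparr>carrier := S\<rparr>)"
proof -
  interpret X: left_module A X by fact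
  note S = assms(2)[unfolded msub_def]
  have s: "x \<in> carrier X" if "x \<in> S" for x using S that by blast
  have n: "\<ominus>\<^bsub>X\<^esub> x \<in> S" if "x \<in> S" for x
  proof -
    have "\<zero>\<^bsub>X\<^esub> \<ominus>\<^bsub>X\<^esub> x \<in> S" using S that by simp
    then show ?thesis using s[OF that] by (simp add: a_minus_def)
  qed
  have "abelian_group (X\<lparr>carrier := S\<rparr>)"
  proof (rule abelian_groupI)
    show "\<exists>y\<in>carrier (X\<lparr>carrier := S\<rparr>). y \<oplus>\<^bsub>X\<lparr>carrier := S\<rparr>\<^esub> x = \<zero>\<^bsub>X\<lparr>carrier := S\<rparr>\<^esub>" if "x \<in> carrier (X\<lparr>carrier := S\<rparr>)" for x
      using that n s by (intro bexI[of _ "\<ominus>\<^bsub>X\<^esub> x"]) (auto simp: X.M.l_neg)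
  qed (use S s in \<open>auto simp: X.M.a_ac\<close>)
  then show ?thesis
    unfolding left_module_def left_module_axioms_def
    using S s by (simp add: X.R.ring_axioms X.smult_l_distr X.smult_r_distr X.smult_assoc1 X.smult_one)
qed

lemma proj_lift:
  fixes X Y :: "('a, 'k vec) module" and A :: "('k, 'a) module"
  assumes "fg_projective A Q" "left_module A X" "left_module A Y" "msub A X S" "g \<in> mod_hom A X Y" "h \<in> mod_hom A Q Y"
    "\<And>q. q \<in> carrier Q \<Longrightarrow> h q \<in> g ` S"
  shows "\<exists>l\<in>mod_hom A Q X. \<forall>q\<in>carrier Q. l q \<in> S \<and> g (l q) = h q"
proof -
  let ?X = "X\<lparr>carrier := S\<rparr>" and ?Y = "Y\<lparr>carrier := g ` S\<rparr>"
  have m: "left_module A ?X" "left_module A ?Y"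
    using left_module_sub[OF assms(2,4)] left_module_sub[OF assms(3) msub_image[OF assms(4,5,2,3)]] by auto
  have S: "S \<subseteq> carrier X" using assms(4) by (simp add: msub_def)
  have g: "g \<in> mod_hom A ?X ?Y" "g ` carrier ?X = carrier ?Y" using assms(5) S by (auto simp: mod_hom_iff subset_iff)
  have h: "h \<in> mod_hom A Q ?Y" using assms(6,7) by (auto simp: mod_hom_iff)
  have L: "\<forall>(X :: ('a, 'k vec) module) (Y :: ('a, 'k vec) module) g h.
        left_module A X \<and> left_module A Y \<and> g \<in> mod_hom A X Y \<and> g ` carrier X = carrier Y \<and> h \<in> mod_hom A Q Y
        \<longrightarrow> (\<exists>l\<in>mod_hom A Q X. \<forall>p\<in>carrier Q. g (l p) = h p)"
    using assms(1) unfolding fg_projective_def by (rule conjunct2)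
  obtain l where l: "l \<in> mod_hom A Q ?X" "\<forall>p\<in>carrier Q. g (l p) = h p"
    using L[rule_format, of ?X ?Y g h] m g h by blast
  show ?thesis by (rule bexI[of _ l]) (use l S in \<open>auto simp: mod_hom_iff Pi_iff subset_iff\<close>)
qed


section \<open>Complexes and quasi-isomorphisms\<close>

lemma coset_eq:
  assumes "abelian_group G" "subgroup H (add_monoid G)" "x \<in> carrier G" "y \<in> carrier G"
  shows "H +>\<^bsub>G\<^esub> x = H +>\<^bsub>G\<^esub> y \<longleftrightarrow> (\<exists>h\<in>H. x = h \<oplus>\<^bsub>G\<^esub> y)"
proof -
  interpret G: abelian_group G by fact
  have 1: "\<zero>\<^bsub>G\<^esub> \<in> H" using subgroup.one_closed[OF assms(2)] by simp
  show ?thesis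
  proof
    assume "H +>\<^bsub>G\<^esub> x = H +>\<^bsub>G\<^esub> y"
    moreover have "x \<in> H +>\<^bsub>G\<^esub> x" using 1 assms(3) by (auto simp: a_r_coset_def' intro!: exI[of _ "\<zero>\<^bsub>G\<^esub>"] bexI[of _ "\<zero>\<^bsub>G\<^esub>"])
    ultimately show "\<exists>h\<in>H. x = h \<oplus>\<^bsub>G\<^esub> y" by (auto simp: a_r_coset_def')
  next
    assume "\<exists>h\<in>H. x = h \<oplus>\<^bsub>G\<^esub> y"
    then have "x \<in> H +>\<^bsub>G\<^esub> y" by (auto simp: a_r_coset_def')
    then show "H +>\<^bsub>G\<^esub> x = H +>\<^bsub>G\<^esub> y" using G.a_repr_independence[OF _ assms(4,2)] by simp
  qed
qed

lemma msub_subgroup: assumes "left_module A X" "msub A X S" shows "subgroup S (add_monoid X)"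
proof -
  interpret S: left_module A "X\<lparr>carrier := S\<rparr>" by (rule left_module_sub[OF assms])
  interpret X: left_module A X by fact
  note D = assms(2)[unfolded msub_def]
  show ?thesis
  proof (rule X.M.add.subgroupI)
    show "S \<noteq> {}" "S \<subseteq> carrier X" using D by auto
    show "\<ominus>\<^bsub>X\<^esub> a \<in> S" if "a \<in> S" for a
    proof -
      have "\<zero>\<^bsub>X\<^esub> \<ominus>\<^bsub>X\<^esub> a \<in> S" "a \<in> carrier X" using D that by auto
      then show ?thesis by (simp add: a_minus_def)
    qed
  qed (use D in auto)
qed

locale cpx = fixes A :: "('k, 'a) module" and X :: "('a, 'm) cplx"
  assumes bounded: "bounded_complex A X"
begin

lemma lm [simp, intro]: "left_module A (ob X i)"
  using bounded by (simp add: bounded_complex_def fg_module_def)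
lemma df_hom: "df X i \<in> mod_hom A (ob X i) (ob X (i + 1))"
  using bounded by (simp add: bounded_complex_def)
lemma df_df: "x \<in> carrier (ob X i) \<Longrightarrow> df X (i + 1) (df X i x) = \<zero>\<^bsub>ob X (i + 1 + 1)\<^esub>"
  using bounded by (simp add: bounded_complex_def)
lemma df_hom': "df X (i - 1) \<in> mod_hom A (ob X (i - 1)) (ob X i)"
  using df_hom[of "i - 1"] by simp
lemma df_df': "x \<in> carrier (ob X (i - 1)) \<Longrightarrow> df X i (df X (i - 1) x) = \<zero>\<^bsub>ob X (i + 1)\<^esub>"
  using df_df[of x "i - 1"] by simp
lemma mem_cocycles: "x \<in> cocycles X i \<longleftrightarrow> x \<in> carrier (ob X i) \<and> df X i x = \<zero>\<^bsub>ob X (i + 1)\<^esub>"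
  by (auto simp: cocycles_def a_kernel_def kernel_def)
lemma msub_coboundaries: "msub A (ob X i) (coboundaries X i)"
  unfolding coboundaries_def by (rule msub_image[OF msub_carrier df_hom']) auto
lemma cobs: "subgroup (coboundaries X i) (add_monoid (ob X i))"
  by (rule msub_subgroup[OF lm msub_coboundaries])
lemma cob_closed: "x \<in> coboundaries X i \<Longrightarrow> x \<in> carrier (ob X i)"
  using msub_coboundaries[of i] by (auto simp: msub_def)
lemma cob_zero: "\<zero>\<^bsub>ob X i\<^esub> \<in> coboundaries X i"
  using msub_coboundaries[of i] by (auto simp: msub_def)
lemma cob_cocycle: "x \<in> coboundaries X i \<Longrightarrow> x \<in> cocycles X i"
  using mod_homD(1)[OF df_hom'] by (auto simp: coboundaries_def mem_cocycles df_df')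
lemma ag: "abelian_group (ob X i)" by (rule left_moduleD(1)[OF lm])

definition pos where "pos j = ob X (- int j)"
definition bd where "bd j = df X (- int (Suc j))"

lemma neg_Suc: "- int (Suc j) + 1 = - int j" "- int j - 1 = - int (Suc j)" by simp_all

lemma pos_lm [simp, intro]: "left_module A (pos j)" by (simp add: pos_def)
lemma bd_hom: "bd j \<in> mod_hom A (pos (Suc j)) (pos j)"
  using df_hom[of "- int (Suc j)"] by (simp only: pos_def bd_def neg_Suc)
lemma coboundaries_pos: "coboundaries X (- int j) = bd j ` carrier (pos (Suc j))"
  by (simp only: coboundaries_def pos_def bd_def neg_Suc)
lemma cocycles_pos: "x \<in> cocycles X (- int (Suc j)) \<longleftrightarrow> x \<in> carrier (pos (Suc j)) \<and> bd j x = \<zero>\<^bsub>pos j\<^esub>"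
  by (simp only: mem_cocycles pos_def bd_def neg_Suc)
lemma cocycles_0: "x \<in> cocycles X 0 \<longleftrightarrow> x \<in> carrier (pos 0) \<and> df X 0 x = \<zero>\<^bsub>ob X 1\<^esub>"
  by (simp add: mem_cocycles pos_def)

end

lemma chain_mapD:
  assumes "chain_map A X Y f"
  shows "f i \<in> mod_hom A (ob X i) (ob Y i)" "x \<in> carrier (ob X i) \<Longrightarrow> f (i + 1) (df X i x) = df Y i (f i x)"
    "f i ` coboundaries X i \<subseteq> coboundaries Y i"
proof -
  show 1: "f i \<in> mod_hom A (ob X i) (ob Y i)" for i using assms by (auto simp: chain_map_def)
  show 2: "x \<in> carrier (ob X i) \<Longrightarrow> f (i + 1) (df X i x) = df Y i (f i x)" for i x
    using assms by (auto simp: chain_map_def)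
  show "f i ` coboundaries X i \<subseteq> coboundaries Y i"
    using 2[of _ "i - 1"] mod_homD(1)[OF 1[of "i - 1"]] by (auto simp: coboundaries_def)
qed

lemma cohomology_map_coset:
  assumes "bounded_complex A X" "bounded_complex A Y" "chain_map A X Y f" "x \<in> carrier (ob X i)"
  shows "cohomology_map Y f i (coboundaries X i +>\<^bsub>ob X i\<^esub> x) = coboundaries Y i +>\<^bsub>ob Y i\<^esub> f i x"
proof -
  interpret X: cpx A X by unfold_locales fact
  interpret Y: cpx A Y by unfold_locales fact
  interpret G: abelian_group "ob Y i" by (rule Y.ag)
  note f = mod_homD[OF chain_mapD(1)[OF assms(3)]]
  have BY: "b \<oplus>\<^bsub>ob Y i\<^esub> b' \<in> coboundaries Y i" if "b \<in> coboundaries Y i" "b' \<in> coboundaries Y i" for b b'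
    using Y.msub_coboundaries that by (auto simp: msub_def)
  show ?thesis
  proof (intro equalityI subsetI)
    fix y assume "y \<in> cohomology_map Y f i (coboundaries X i +>\<^bsub>ob X i\<^esub> x)"
    then obtain b b' where b: "b \<in> coboundaries Y i" "b' \<in> coboundaries X i" "y = b \<oplus>\<^bsub>ob Y i\<^esub> f i (b' \<oplus>\<^bsub>ob X i\<^esub> x)"
      by (auto simp: cohomology_map_def set_add_def' a_r_coset_def')
    have b': "f i b' \<in> coboundaries Y i" using chain_mapD(3)[OF assms(3)] b(2) by auto
    have "y = (b \<oplus>\<^bsub>ob Y i\<^esub> f i b') \<oplus>\<^bsub>ob Y i\<^esub> f i x"
      using b b' assms(4) X.cob_closed Y.cob_closed by (simp add: f G.a_assoc)
    then show "y \<in> coboundaries Y i +>\<^bsub>ob Y i\<^esub> f i x" using BY[OF b(1) b'] by (auto simp: a_r_coset_def')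
  next
    fix y assume "y \<in> coboundaries Y i +>\<^bsub>ob Y i\<^esub> f i x"
    then obtain b where b: "b \<in> coboundaries Y i" "y = b \<oplus>\<^bsub>ob Y i\<^esub> f i x" by (auto simp: a_r_coset_def')
    interpret XG: abelian_group "ob X i" by (rule X.ag)
    have "x \<in> coboundaries X i +>\<^bsub>ob X i\<^esub> x"
      using X.cob_zero assms(4) by (auto simp: a_r_coset_def' intro!: bexI[of _ "\<zero>\<^bsub>ob X i\<^esub>"])
    then show "y \<in> cohomology_map Y f i (coboundaries X i +>\<^bsub>ob X i\<^esub> x)"
      using b by (auto simp: cohomology_map_def set_add_def')
  qed
qed

lemma quasi_iso_iff:
  assumes "bounded_complex A X" "bounded_complex A Y"
  shows "quasi_iso A X Y f \<longleftrightarrow> chain_map A X Y f \<and>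
    (\<forall>i. (\<forall>x\<in>cocycles X i. f i x \<in> coboundaries Y i \<longrightarrow> x \<in> coboundaries X i) \<and>
         (\<forall>y\<in>cocycles Y i. \<exists>x\<in>cocycles X i. \<exists>b\<in>coboundaries Y i. y = b \<oplus>\<^bsub>ob Y i\<^esub> f i x))"
proof (cases "chain_map A X Y f")
  case c: True
  interpret X: cpx A X by unfold_locales fact
  interpret Y: cpx A Y by unfold_locales fact
  have "bij_betw (cohomology_map Y f i) (cohomology X i) (cohomology Y i) \<longleftrightarrow>
    (\<forall>x\<in>cocycles X i. f i x \<in> coboundaries Y i \<longrightarrow> x \<in> coboundaries X i) \<and>
         (\<forall>y\<in>cocycles Y i. \<exists>x\<in>cocycles X i. \<exists>b\<in>coboundaries Y i. y = b \<oplus>\<^bsub>ob Y i\<^esub> f i x)" for i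
  proof -
    interpret XG: abelian_group "ob X i" by (rule X.ag)
    interpret YG: abelian_group "ob Y i" by (rule Y.ag)
    note f = mod_homD[OF chain_mapD(1)[OF c, of i]] mod_hom_diff[OF chain_mapD(1)[OF c, of i] X.lm Y.lm] mod_hom_zero[OF chain_mapD(1)[OF c, of i] X.lm Y.lm]
    have fc: "f i x \<in> cocycles Y i" if "x \<in> cocycles X i" for x
      using that f(1) chain_mapD(2)[OF c, of x i] mod_hom_zero[OF chain_mapD(1)[OF c, of "i + 1"] X.lm Y.lm] by (auto simp: X.mem_cocycles Y.mem_cocycles)
    have xc: "x \<in> carrier (ob X i)" if "x \<in> cocycles X i" for x using that by (simp add: X.mem_cocycles)
    have yc: "x \<in> carrier (ob Y i)" if "x \<in> cocycles Y i" for x using that by (simp add: Y.mem_cocycles)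
    have cm: "cohomology_map Y f i (coboundaries X i +>\<^bsub>ob X i\<^esub> x) = coboundaries Y i +>\<^bsub>ob Y i\<^esub> f i x" if "x \<in> cocycles X i" for x
      by (rule cohomology_map_coset[OF assms c xc[OF that]])
    have cX: "coboundaries X i +>\<^bsub>ob X i\<^esub> x = coboundaries X i +>\<^bsub>ob X i\<^esub> y \<longleftrightarrow> x \<ominus>\<^bsub>ob X i\<^esub> y \<in> coboundaries X i"
      if "x \<in> cocycles X i" "y \<in> cocycles X i" for x y
      using coset_eq[OF X.ag X.cobs xc[OF that(1)] xc[OF that(2)]] XG.diff_eq_iff[OF xc[OF that(1)] xc[OF that(2)] X.cob_closed] xc[OF that(1)] xc[OF that(2)]
      by (metis XG.diff_add_cancel)
    have cY: "coboundaries Y i +>\<^bsub>ob Y i\<^esub> x = coboundaries Y i +>\<^bsub>ob Y i\<^esub> y \<longleftrightarrow> x \<ominus>\<^bsub>ob Y i\<^esub> y \<in> coboundaries Y i"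
      if "x \<in> cocycles Y i" "y \<in> cocycles Y i" for x y
      using coset_eq[OF Y.ag Y.cobs yc[OF that(1)] yc[OF that(2)]] YG.diff_eq_iff[OF yc[OF that(1)] yc[OF that(2)] Y.cob_closed] yc[OF that(1)] yc[OF that(2)]
      by (metis YG.diff_add_cancel)
    have sub: "x \<ominus>\<^bsub>ob X i\<^esub> y \<in> cocycles X i" if "x \<in> cocycles X i" "y \<in> cocycles X i" for x y
      using msub_kernel[OF X.df_hom[of i] X.lm X.lm] that unfolding msub_def by (auto simp: X.mem_cocycles)
    have z: "\<zero>\<^bsub>ob X i\<^esub> \<in> cocycles X i" using X.cob_cocycle[OF X.cob_zero] .
    have inj: "inj_on (cohomology_map Y f i) (cohomology X i) \<longleftrightarrow> (\<forall>x\<in>cocycles X i. f i x \<in> coboundaries Y i \<longrightarrow> x \<in> coboundaries X i)"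
    proof
      assume I: "inj_on (cohomology_map Y f i) (cohomology X i)"
      show "\<forall>x\<in>cocycles X i. f i x \<in> coboundaries Y i \<longrightarrow> x \<in> coboundaries X i"
      proof (intro ballI impI)
        fix x assume x: "x \<in> cocycles X i" "f i x \<in> coboundaries Y i"
        have "coboundaries Y i +>\<^bsub>ob Y i\<^esub> f i x = coboundaries Y i +>\<^bsub>ob Y i\<^esub> f i \<zero>\<^bsub>ob X i\<^esub>"
          using cY[OF fc[OF x(1)] fc[OF z]] x yc[OF fc[OF x(1)]] by (simp add: f)
        then have "cohomology_map Y f i (coboundaries X i +>\<^bsub>ob X i\<^esub> x) = cohomology_map Y f i (coboundaries X i +>\<^bsub>ob X i\<^esub> \<zero>\<^bsub>ob X i\<^esub>)"
          by (simp add: cm x z)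
        then have "coboundaries X i +>\<^bsub>ob X i\<^esub> x = coboundaries X i +>\<^bsub>ob X i\<^esub> \<zero>\<^bsub>ob X i\<^esub>"
          using I x(1) z unfolding cohomology_def by (auto dest: inj_onD)
        then show "x \<in> coboundaries X i" using cX[OF x(1) z] xc[OF x(1)] by simp
      qed
    next
      assume I: "\<forall>x\<in>cocycles X i. f i x \<in> coboundaries Y i \<longrightarrow> x \<in> coboundaries X i"
      show "inj_on (cohomology_map Y f i) (cohomology X i)"
      proof (rule inj_onI)
        fix C D assume "C \<in> cohomology X i" "D \<in> cohomology X i" and e: "cohomology_map Y f i C = cohomology_map Y f i D"
        then obtain x y where xy: "x \<in> cocycles X i" "C = coboundaries X i +>\<^bsub>ob X i\<^esub> x" "y \<in> cocycles X i" "D = coboundaries X i +>\<^bsub>ob X i\<^esub> y"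
          by (auto simp: cohomology_def)
        then have "f i x \<ominus>\<^bsub>ob Y i\<^esub> f i y \<in> coboundaries Y i" using e cm cY[OF fc[OF xy(1)] fc[OF xy(3)]] by simp
        then have "x \<ominus>\<^bsub>ob X i\<^esub> y \<in> coboundaries X i" using I sub[OF xy(1,3)] f(4)[OF xc[OF xy(1)] xc[OF xy(3)]] by simp
        then show "C = D" using cX xy by simp
      qed
    qed
    have "cohomology_map Y f i ` cohomology X i = (\<lambda>x. coboundaries Y i +>\<^bsub>ob Y i\<^esub> f i x) ` cocycles X i"
      unfolding cohomology_def image_image by (rule image_cong) (auto simp: cm)
    then have surj: "cohomology_map Y f i ` cohomology X i = cohomology Y i \<longleftrightarrow>
      (\<forall>y\<in>cocycles Y i. \<exists>x\<in>cocycles X i. coboundaries Y i +>\<^bsub>ob Y i\<^esub> y = coboundaries Y i +>\<^bsub>ob Y i\<^esub> f i x)"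
      using fc by (auto simp: cohomology_def image_iff set_eq_iff)
    have "coboundaries Y i +>\<^bsub>ob Y i\<^esub> y = coboundaries Y i +>\<^bsub>ob Y i\<^esub> f i x \<longleftrightarrow> (\<exists>b\<in>coboundaries Y i. y = b \<oplus>\<^bsub>ob Y i\<^esub> f i x)"
      if "y \<in> cocycles Y i" "x \<in> cocycles X i" for x y
      by (rule coset_eq[OF Y.ag Y.cobs yc[OF that(1)] yc[OF fc[OF that(2)]]])
    then show ?thesis unfolding bij_betw_def inj surj by simp
  qed
  then show ?thesis using c by (simp add: quasi_iso_def)
qed (simp add: quasi_iso_def)


definition zmod :: "('a, 'k vec) module" where
  "zmod = \<lparr>carrier = {\<lambda>_. undefined}, mult = undefined, one = undefined, zero = \<lambda>_. undefined,
     add = \<lambda>_ _. (\<lambda>_. undefined), smult = \<lambda>_ _. (\<lambda>_. undefined)\<rparr>"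

lemma carrier_zmod [simp]: "carrier (zmod :: ('a, 'k vec) module) = {\<zero>\<^bsub>zmod :: ('a, 'k vec) module\<^esub>}"
  by (simp add: zmod_def)

lemma fg_module_zmod: assumes "ring A" shows "fg_module A zmod"
proof -
  have "abelian_group zmod" by (rule abelian_groupI) (auto simp: zmod_def)
  then have l: "left_module A zmod" unfolding left_module_def left_module_axioms_def using assms by (simp add: zmod_def)
  have "submodule H A zmod \<Longrightarrow> H = carrier zmod" for H
    unfolding submodule_def subgroup_def by (auto simp: zmod_def)
  then show ?thesis using l unfolding fg_module_def fin_gen_def by (intro conjI exI[of _ "{}"]) auto
qed

definition chain_cplx :: "(nat \<Rightarrow> ('a, 'k vec) module) \<Rightarrow> (nat \<Rightarrow> 'k vec \<Rightarrow> 'k vec) \<Rightarrow> ('a, 'k vec) cplx" where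
  "chain_cplx C d = \<lparr>ob = \<lambda>i. if i \<le> 0 then C (nat (- i)) else zmod,
     df = \<lambda>i. if i < 0 then d (nat (- i) - 1) else (\<lambda>_. \<zero>\<^bsub>zmod :: ('a, 'k vec) module\<^esub>)\<rparr>"

lemma chain_cplx_simps: "ob (chain_cplx C d) (- int j) = C j" "df (chain_cplx C d) (- int (Suc j)) = d j"
    "0 < i \<Longrightarrow> ob (chain_cplx C d) i = zmod" "0 \<le> i \<Longrightarrow> df (chain_cplx C d) i x = \<zero>\<^bsub>zmod :: ('a, 'k vec) module\<^esub>"
  for C :: "nat \<Rightarrow> ('a, 'k vec) module"
  by (auto simp: chain_cplx_def nat_add_distrib)

lemma int_degree_cases: obtains (pos) "0 < i" | (neg) j where "i = - int j"
  by (metis linorder_not_less nonpos_int_cases)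

lemma bounded_chain_cplx:
  fixes C :: "nat \<Rightarrow> ('a, 'k vec) module"
  assumes "ring A" "\<And>j. fg_module A (C j)" "\<And>j. d j \<in> mod_hom A (C (Suc j)) (C j)"
    "\<And>j x. x \<in> carrier (C (Suc (Suc j))) \<Longrightarrow> d j (d (Suc j) x) = \<zero>\<^bsub>C j\<^esub>"
    "\<And>j. n < j \<Longrightarrow> carrier (C j) = {\<zero>\<^bsub>C j\<^esub>}"
  shows "bounded_complex A (chain_cplx C d)"
proof -
  note z = fg_module_zmod[OF assms(1)]
  have zl: "left_module A (zmod :: ('a, 'k vec) module)" by (rule conjunct1[OF z[unfolded fg_module_def]])
  have "fg_module A (ob (chain_cplx C d) i)" for i
    by (cases i rule: int_degree_cases) (simp_all add: chain_cplx_simps z assms(2))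
  moreover have "df (chain_cplx C d) i \<in> mod_hom A (ob (chain_cplx C d) i) (ob (chain_cplx C d) (i + 1))" for i
  proof (cases "0 \<le> i")
    case True
    have "df (chain_cplx C d) i = (\<lambda>_. \<zero>\<^bsub>zmod :: ('a, 'k vec) module\<^esub>)" by (rule ext) (simp add: chain_cplx_simps(4)[OF True])
    then show ?thesis using True mod_hom_const_zero[OF zl] by (simp add: chain_cplx_simps)
  next
    case False
    then obtain j where j: "i = - int (Suc j)" by (metis int_cases not_le of_nat_0_le_iff)
    have "i + 1 = - int j" using j by simp
    then show ?thesis using j assms(3)[of j] by (simp only: chain_cplx_simps)
  qed
  moreover have "df (chain_cplx C d) (i + 1) (df (chain_cplx C d) i x) = \<zero>\<^bsub>ob (chain_cplx C d) (i + 1 + 1)\<^esub>"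
    if "x \<in> carrier (ob (chain_cplx C d) i)" for i x
  proof (cases "-1 \<le> i")
    case True
    then show ?thesis by (simp add: chain_cplx_simps)
  next
    case False
    define j where "j = nat (- i) - 2"
    have j: "i = - int (Suc (Suc j))" "i + 1 = - int (Suc j)" "i + 1 + 1 = - int j" using False by (auto simp: j_def)
    have "x \<in> carrier (C (Suc (Suc j)))" using that by (simp only: j chain_cplx_simps)
    then have "d j (d (Suc j) x) = \<zero>\<^bsub>C j\<^esub>" by (rule assms(4))
    moreover have "df (chain_cplx C d) (i + 1) (df (chain_cplx C d) i x) = d j (d (Suc j) x)"
      unfolding j(2) by (simp only: j(1) chain_cplx_simps)
    moreover have "ob (chain_cplx C d) (i + 1 + 1) = C j" unfolding j(3) by (simp only: chain_cplx_simps)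
    ultimately show ?thesis by simp
  qed
  moreover have "finite {i. carrier (ob (chain_cplx C d) i) \<noteq> {\<zero>\<^bsub>ob (chain_cplx C d) i\<^esub>}}"
  proof (rule finite_subset)
    show "{i. carrier (ob (chain_cplx C d) i) \<noteq> {\<zero>\<^bsub>ob (chain_cplx C d) i\<^esub>}} \<subseteq> {- int n..0}"
    proof
      fix i assume i: "i \<in> {i. carrier (ob (chain_cplx C d) i) \<noteq> {\<zero>\<^bsub>ob (chain_cplx C d) i\<^esub>}}"
      show "i \<in> {- int n..0}"
      proof (cases i rule: int_degree_cases)
        case pos
        then show ?thesis using i by (simp add: chain_cplx_simps)
      next
        case (neg j)
        then have "\<not> n < j" using i assms(5)[of j] by (auto simp: chain_cplx_simps)
        then show ?thesis using neg by simp
      qed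
    qed
  qed simp
  ultimately show ?thesis unfolding bounded_complex_def by blast
qed

context cpx
begin

lemma exact_step:
  assumes "\<And>j. cocycles X (- int (Suc j)) \<subseteq> coboundaries X (- int (Suc j))"
    "x \<in> carrier (pos (Suc j))" "bd j x = \<zero>\<^bsub>pos j\<^esub>"
  shows "x \<in> bd (Suc j) ` carrier (pos (Suc (Suc j)))"
  using assms(1)[of j] assms(2,3) by (simp only: coboundaries_pos cocycles_pos subset_iff)

end

locale proj_cplx =
  fixes A :: "('k, 'a) module" and P :: "nat \<Rightarrow> ('a, 'k vec) module" and \<delta>
  assumes P: "\<And>j. fg_projective A (P j)" and \<delta>: "\<And>j. \<delta> j \<in> mod_hom A (P (Suc j)) (P j)"
    and \<delta>\<delta>: "\<And>j x. x \<in> carrier (P (Suc (Suc j))) \<Longrightarrow> \<delta> j (\<delta> (Suc j) x) = \<zero>\<^bsub>P j\<^esub>"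
begin

lemma P_lm [simp, intro]: "left_module A (P j)" using P[of j] by (simp add: fg_projective_def fg_module_def)

lemma comparison:
  fixes C :: "('a, 'k vec) cplx"
  assumes "bounded_complex A C" "\<And>j. cocycles C (- int (Suc j)) \<subseteq> coboundaries C (- int (Suc j))"
    "f \<in> mod_hom A (P 0) (cpx.pos C 0)" "\<And>x. x \<in> carrier (P 1) \<Longrightarrow> f (\<delta> 0 x) \<in> coboundaries C 0"
  shows "\<exists>\<phi>. \<phi> 0 = f \<and> (\<forall>j. \<phi> j \<in> mod_hom A (P j) (cpx.pos C j)) \<and>
     (\<forall>j. \<forall>x\<in>carrier (P (Suc j)). cpx.bd C j (\<phi> (Suc j) x) = \<phi> j (\<delta> j x))"
proof -
  interpret C: cpx A C by unfold_locales fact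
  let ?P = "\<lambda>j \<phi>. \<phi> \<in> mod_hom A (P j) (C.pos j) \<and> (j = 0 \<longrightarrow> \<phi> = f) \<and>
    (\<forall>x\<in>carrier (P (Suc j)). \<phi> (\<delta> j x) \<in> C.bd j ` carrier (C.pos (Suc j)))"
  have "\<exists>\<phi>. \<forall>j. ?P j (\<phi> j) \<and> (\<forall>x\<in>carrier (P (Suc j)). C.bd j (\<phi> (Suc j) x) = \<phi> j (\<delta> j x))"
  proof (rule dependent_nat_choice)
    show "\<exists>\<phi>. ?P 0 \<phi>" using assms(3,4) C.coboundaries_pos[of 0] by (intro exI[of _ f]) auto
  next
    fix \<phi> j assume \<phi>: "?P j \<phi>"
    have "\<exists>l\<in>mod_hom A (P (Suc j)) (C.pos (Suc j)). \<forall>q\<in>carrier (P (Suc j)). l q \<in> carrier (C.pos (Suc j)) \<and> C.bd j (l q) = \<phi> (\<delta> j q)"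
      by (rule proj_lift[OF P _ _ msub_carrier C.bd_hom mod_hom_comp[OF \<delta>]]) (use \<phi> in auto)
    then obtain l where l: "l \<in> mod_hom A (P (Suc j)) (C.pos (Suc j))" "\<forall>q\<in>carrier (P (Suc j)). C.bd j (l q) = \<phi> (\<delta> j q)" by blast
    have "l (\<delta> (Suc j) x) \<in> C.bd (Suc j) ` carrier (C.pos (Suc (Suc j)))" if "x \<in> carrier (P (Suc (Suc j)))" for x
    proof (rule C.exact_step[OF assms(2)])
      have d: "\<delta> (Suc j) x \<in> carrier (P (Suc j))" using mod_homD(1)[OF \<delta> that] .
      show "l (\<delta> (Suc j) x) \<in> carrier (C.pos (Suc j))" using mod_homD(1)[OF l(1) d] .
      show "C.bd j (l (\<delta> (Suc j) x)) = \<zero>\<^bsub>C.pos j\<^esub>"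
        using l(2) d \<delta>\<delta>[OF that] \<phi> mod_hom_zero[of \<phi> A "P j" "C.pos j"] by simp
    qed
    then show "\<exists>\<psi>. ?P (Suc j) \<psi> \<and> (\<forall>x\<in>carrier (P (Suc j)). C.bd j (\<psi> x) = \<phi> (\<delta> j x))"
      using l by (intro exI[of _ l]) auto
  qed
  then show ?thesis by blast
qed

lemma null_homotopy:
  fixes C :: "('a, 'k vec) cplx"
  assumes "bounded_complex A C" "\<And>j. cocycles C (- int (Suc j)) \<subseteq> coboundaries C (- int (Suc j))"
    "\<And>j. \<psi> j \<in> mod_hom A (P j) (cpx.pos C j)"
    "\<And>j x. x \<in> carrier (P (Suc j)) \<Longrightarrow> cpx.bd C j (\<psi> (Suc j) x) = \<psi> j (\<delta> j x)"
    "\<And>x. x \<in> carrier (P 0) \<Longrightarrow> \<psi> 0 x \<in> coboundaries C 0"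
  shows "\<exists>g. (\<forall>j. g j \<in> mod_hom A (P j) (cpx.pos C (Suc j))) \<and>
     (\<forall>j. \<forall>x\<in>carrier (P (Suc j)). \<psi> (Suc j) x \<ominus>\<^bsub>cpx.pos C (Suc j)\<^esub> g j (\<delta> j x) = cpx.bd C (Suc j) (g (Suc j) x))"
proof -
  interpret C: cpx A C by unfold_locales fact
  let ?P = "\<lambda>j g. g \<in> mod_hom A (P j) (C.pos (Suc j)) \<and> (\<forall>x\<in>carrier (P (Suc j)). C.bd j (g (\<delta> j x)) = \<psi> j (\<delta> j x))"
  have "\<exists>g. \<forall>j. ?P j (g j) \<and> (\<forall>x\<in>carrier (P (Suc j)). \<psi> (Suc j) x \<ominus>\<^bsub>C.pos (Suc j)\<^esub> g j (\<delta> j x) = C.bd (Suc j) (g (Suc j) x))"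
  proof (rule dependent_nat_choice)
    have "\<exists>l\<in>mod_hom A (P 0) (C.pos (Suc 0)). \<forall>q\<in>carrier (P 0). l q \<in> carrier (C.pos (Suc 0)) \<and> C.bd 0 (l q) = \<psi> 0 q"
      by (rule proj_lift[OF P _ _ msub_carrier C.bd_hom assms(3)]) (use assms(5) C.coboundaries_pos[of 0] in auto)
    then show "\<exists>g. ?P 0 g" using mod_homD(1)[OF \<delta>] by blast
  next
    fix g j assume g: "?P j g"
    have gd: "(\<lambda>x. g (\<delta> j x)) \<in> mod_hom A (P (Suc j)) (C.pos (Suc j))" using mod_hom_comp[OF \<delta>] g by blast
    let ?h = "\<lambda>x. \<psi> (Suc j) x \<ominus>\<^bsub>C.pos (Suc j)\<^esub> g (\<delta> j x)"
    have h: "?h \<in> mod_hom A (P (Suc j)) (C.pos (Suc j))" by (rule mod_hom_minus[OF assms(3) gd]) auto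
    have "?h x \<in> C.bd (Suc j) ` carrier (C.pos (Suc (Suc j)))" if x: "x \<in> carrier (P (Suc j))" for x
    proof (rule C.exact_step[OF assms(2) mod_homD(1)[OF h x]])
      have c: "C.bd j (g (\<delta> j x)) = \<psi> j (\<delta> j x)" using g x by blast
      have "C.bd j (?h x) = C.bd j (\<psi> (Suc j) x) \<ominus>\<^bsub>C.pos j\<^esub> C.bd j (g (\<delta> j x))"
        by (rule mod_hom_diff[OF C.bd_hom]) (use mod_homD(1)[OF assms(3) x] mod_homD(1)[OF gd x] in auto)
      also have "\<dots> = \<psi> j (\<delta> j x) \<ominus>\<^bsub>C.pos j\<^esub> \<psi> j (\<delta> j x)" using assms(4)[OF x] c by simp
      also have "\<dots> = \<zero>\<^bsub>C.pos j\<^esub>"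
        using abelian_group.diff_self[OF left_moduleD(1)[OF C.pos_lm[of j]]] mod_homD(1)[OF assms(3) mod_homD(1)[OF \<delta> x]] by blast
      finally show "C.bd j (?h x) = \<zero>\<^bsub>C.pos j\<^esub>" .
    qed
    then have "\<exists>l\<in>mod_hom A (P (Suc j)) (C.pos (Suc (Suc j))). \<forall>q\<in>carrier (P (Suc j)). l q \<in> carrier (C.pos (Suc (Suc j))) \<and> C.bd (Suc j) (l q) = ?h q"
      by (intro proj_lift[OF P _ _ msub_carrier C.bd_hom h]) auto
    then obtain l where l: "l \<in> mod_hom A (P (Suc j)) (C.pos (Suc (Suc j)))" "\<forall>q\<in>carrier (P (Suc j)). C.bd (Suc j) (l q) = ?h q" by blast
    have "C.bd (Suc j) (l (\<delta> (Suc j) x)) = \<psi> (Suc j) (\<delta> (Suc j) x)" if x: "x \<in> carrier (P (Suc (Suc j)))" for x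
    proof -
      have d: "\<delta> (Suc j) x \<in> carrier (P (Suc j))" using mod_homD(1)[OF \<delta> x] .
      have "g (\<delta> j (\<delta> (Suc j) x)) = \<zero>\<^bsub>C.pos (Suc j)\<^esub>" using \<delta>\<delta>[OF x] g mod_hom_zero[of g A "P j" "C.pos (Suc j)"] by simp
      then show ?thesis
        using l(2) d abelian_group.diff_zero[OF left_moduleD(1)[OF C.pos_lm[of "Suc j"]] mod_homD(1)[OF assms(3) d]] by simp
    qed
    then show "\<exists>g'. ?P (Suc j) g' \<and> (\<forall>x\<in>carrier (P (Suc j)). ?h x = C.bd (Suc j) (g' x))"
      using l by (intro exI[of _ l]) auto
  qed
  then show ?thesis by blast
qed

end

lemma homotopic_refl:
  assumes "bounded_complex A X" "bounded_complex A Y" "chain_map A X Y f" shows "homotopic A X Y f f"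
proof -
  interpret X: cpx A X by unfold_locales fact
  interpret Y: cpx A Y by unfold_locales fact
  have z: "df Y (i - 1) \<zero>\<^bsub>ob Y (i - 1)\<^esub> = \<zero>\<^bsub>ob Y i\<^esub>" for i
    by (rule mod_hom_zero[OF Y.df_hom']) auto
  show ?thesis unfolding homotopic_def
  proof (intro exI[of _ "\<lambda>i _. \<zero>\<^bsub>ob Y (i - 1)\<^esub>"] conjI allI ballI)
    fix i x assume x: "x \<in> carrier (ob X i)"
    interpret G: abelian_group "ob Y i" by (rule Y.ag)
    have "i + 1 - 1 = i" by simp
    then show "f i x \<ominus>\<^bsub>ob Y i\<^esub> f i x = df Y (i - 1) \<zero>\<^bsub>ob Y (i - 1)\<^esub> \<oplus>\<^bsub>ob Y i\<^esub> \<zero>\<^bsub>ob Y (i + 1 - 1)\<^esub>"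
      using mod_homD(1)[OF chain_mapD(1)[OF assms(3)] x] by (simp add: z)
  qed (rule mod_hom_const_zero[OF Y.lm])
qed

lemma quasi_iso_id: assumes "bounded_complex A X" shows "quasi_iso A X X (\<lambda>_. id)"
proof -
  interpret X: cpx A X by unfold_locales fact
  have "chain_map A X X (\<lambda>_. id)" by (auto simp: chain_map_def mod_hom_iff)
  moreover have "\<exists>x\<in>cocycles X i. \<exists>b\<in>coboundaries X i. y = b \<oplus>\<^bsub>ob X i\<^esub> id x" if "y \<in> cocycles X i" for i y
    using that X.cob_zero[of i] abelian_monoid.l_zero[OF abelian_group.axioms(1)[OF X.ag[of i]], of y]
    by (intro bexI[of _ y] bexI[of _ "\<zero>\<^bsub>ob X i\<^esub>"]) (auto simp: X.mem_cocycles)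
  ultimately show ?thesis unfolding quasi_iso_iff[OF assms assms] by auto
qed

lemma roof_rel_refl:
  assumes "(Z, s, f) \<in> roofs A X Y" "bounded_complex A X" "bounded_complex A Y"
  shows "((Z, s, f), (Z, s, f)) \<in> roof_rel A X Y"
proof -
  have Z: "bounded_complex A Z" "chain_map A Z X s" "chain_map A Z Y f" using assms(1) by (auto simp: roofs_def quasi_iso_def)
  have "(\<lambda>i. s i \<circ> (\<lambda>_. id) i) = s" "(\<lambda>i. f i \<circ> (\<lambda>_. id) i) = f" by (auto simp: fun_eq_iff)
  then show ?thesis
    unfolding roof_rel_def using assms(1) Z(1) quasi_iso_id[OF Z(1)] homotopic_refl[OF Z(1) assms(2) Z(2)] homotopic_refl[OF Z(1) assms(3) Z(3)]
    by (auto intro!: exI[of _ Z] exI[of _ "\<lambda>_. id"])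
qed

context algebra_ideal
begin

lemma bounded_complex_restrict: "bounded_complex B X \<Longrightarrow> bounded_complex A (restrict_cplx A J X)"
  unfolding bounded_complex_def restrict_cplx_def by (auto simp: fg_module_restrict mod_hom_restrict)

lemma roof_lift:
  fixes X Y :: "('a set, 'k vec) cplx"
  assumes "homological_ideal A J" "bounded_complex B X" "bounded_complex B Y"
    "(Z, s, f) \<in> roofs A (restrict_cplx A J X) (restrict_cplx A J Y)"
  shows "\<exists>Z' s' f'. (Z', s', f') \<in> roofs B X Y \<and>
    ((restrict_cplx A J Z', s', f'), (Z, s, f)) \<in> roof_rel A (restrict_cplx A J X) (restrict_cplx A J Y)"
proof -
  let ?R = "roof_rel A (restrict_cplx A J X) (restrict_cplx A J Y)"
  have "bij_betw (restrict_derived_hom A J X Y) (derived_hom B X Y) (derived_hom A (restrict_cplx A J X) (restrict_cplx A J Y))"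
    using assms(1-3) unfolding homological_ideal_def by blast
  then have "restrict_derived_hom A J X Y ` derived_hom B X Y = derived_hom A (restrict_cplx A J X) (restrict_cplx A J Y)"
    unfolding bij_betw_def by (rule conjunct2)
  moreover have "?R `` {(Z, s, f)} \<in> derived_hom A (restrict_cplx A J X) (restrict_cplx A J Y)"
    unfolding derived_hom_def using assms(4) by (rule quotientI)
  ultimately have "?R `` {(Z, s, f)} \<in> restrict_derived_hom A J X Y ` derived_hom B X Y" by simp
  then obtain C where C: "?R `` {(Z, s, f)} = restrict_derived_hom A J X Y C" "C \<in> derived_hom B X Y" by (rule imageE)
  have "(Z, s, f) \<in> ?R `` {(Z, s, f)}"
    using roof_rel_refl[OF assms(4)] bounded_complex_restrict assms(2,3) by blast
  then have "(Z, s, f) \<in> restrict_derived_hom A J X Y C" using C(1) by simp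
  then obtain Z' s' f' where *: "(Z', s', f') \<in> C" "((restrict_cplx A J Z', s', f'), (Z, s, f)) \<in> ?R"
    unfolding restrict_derived_hom_def by blast
  have "C \<subseteq> roofs B X Y" using C(2) unfolding derived_hom_def quotient_def roof_rel_def by auto
  then show ?thesis using * by blast
qed

end


section \<open>Extension of homomorphisms along a homological ideal\<close>

definition stalk :: "nat \<Rightarrow> ('a, 'k vec) module \<Rightarrow> ('a, 'k vec) cplx" where
  "stalk n M = chain_cplx (\<lambda>j. if j = n then M else zmod) (\<lambda>j _. \<zero>\<^bsub>if j = n then M else zmod\<^esub>)"

lemma ob_stalk: "ob (stalk n M) (- int n) = M" "i \<noteq> - int n \<Longrightarrow> ob (stalk n M) i = zmod"
proof -
  show "ob (stalk n M) (- int n) = M" unfolding stalk_def by (simp only: chain_cplx_simps) simp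
  assume "i \<noteq> - int n"
  then show "ob (stalk n M) i = zmod" by (cases i rule: int_degree_cases) (auto simp: stalk_def chain_cplx_simps)
qed

lemma df_stalk: "df (stalk n M) i x = \<zero>\<^bsub>ob (stalk n M) (i + 1)\<^esub>"
proof (cases "0 \<le> i")
  case True
  then show ?thesis by (simp add: stalk_def chain_cplx_simps)
next
  case False
  define j where "j = nat (- i) - 1"
  have j: "i = - int (Suc j)" "i + 1 = - int j" using False by (auto simp: j_def)
  show ?thesis unfolding j(2) unfolding j(1) stalk_def by (simp only: chain_cplx_simps)
qed

lemma bounded_stalk: assumes "fg_module A M" shows "bounded_complex A (stalk n M)"
proof -
  have r: "ring A" using assms by (auto simp: fg_module_def left_module_def)
  have f: "fg_module A (if j = n then M else zmod)" for j using assms by (simp add: fg_module_zmod[OF r])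
  then have l: "left_module A (if j = n then M else zmod)" for j unfolding fg_module_def by blast
  show ?thesis unfolding stalk_def
    by (rule bounded_chain_cplx[OF r f mod_hom_const_zero[OF l], where n = n]) simp_all
qed

lemma chain_map_cocycles:
  assumes "bounded_complex A X" "bounded_complex A Y" "chain_map A X Y f" "x \<in> cocycles X i" shows "f i x \<in> cocycles Y i"
proof -
  interpret X: cpx A X by unfold_locales fact
  interpret Y: cpx A Y by unfold_locales fact
  show ?thesis
    using assms(4) mod_homD(1)[OF chain_mapD(1)[OF assms(3)], of x i] chain_mapD(2)[OF assms(3), of x i]
      mod_hom_zero[OF chain_mapD(1)[OF assms(3)] X.lm Y.lm, of "i + 1"] by (auto simp: X.mem_cocycles Y.mem_cocycles)
qed

lemma chain_map_pos:
  assumes "bounded_complex A X" "bounded_complex A Y" "chain_map A X Y f"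
  shows "f (- int j) \<in> mod_hom A (cpx.pos X j) (cpx.pos Y j)"
    "x \<in> carrier (cpx.pos X (Suc j)) \<Longrightarrow> f (- int j) (cpx.bd X j x) = cpx.bd Y j (f (- int (Suc j)) x)"
proof -
  interpret X: cpx A X by unfold_locales fact
  interpret Y: cpx A Y by unfold_locales fact
  show "f (- int j) \<in> mod_hom A (X.pos j) (Y.pos j)" using chain_mapD(1)[OF assms(3)] by (simp add: X.pos_def Y.pos_def)
  show "f (- int j) (X.bd j x) = Y.bd j (f (- int (Suc j)) x)" if "x \<in> carrier (X.pos (Suc j))"
    using chain_mapD(2)[OF assms(3), of x "- int (Suc j)"] that by (simp only: X.pos_def X.bd_def Y.bd_def X.neg_Suc)
qed

context algebra_ideal
begin

lemma ob_restrict [simp]: "ob (restrict_cplx A J X) i = restrict_module A J (ob X i)" "df (restrict_cplx A J X) = df X"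
  by (simp_all add: restrict_cplx_def)

lemma cocycles_restrict [simp]: "cocycles (restrict_cplx A J X) i = cocycles X i"
  by (simp add: cocycles_def a_kernel_def kernel_def)

lemma coboundaries_restrict [simp]: "coboundaries (restrict_cplx A J X) i = coboundaries X i"
  by (simp add: coboundaries_def)

end

locale relative_resolution = algebra_ideal K A J
  for K :: "('k, 'z) ring_scheme" and A :: "('k, 'a) module" and J :: "'a set" +
  fixes P L :: "nat \<Rightarrow> ('a, 'k vec) module" and e :: "nat \<Rightarrow> 'k vec \<Rightarrow> 'k vec" and X0 :: "('a set, 'k vec) module"
  assumes X0: "fg_projective B X0" and P: "\<And>j. fg_projective A (P j)" and L: "\<And>j. fg_module A (L j)"
    and e: "\<And>j. e j \<in> mod_hom A (P j) (L j)" and surj: "\<And>j. e j ` carrier (P j) = carrier (L j)"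
    and L0: "L 0 = restrict_module A J X0"
    and LSuc: "\<And>j. L (Suc j) = (P j)\<lparr>carrier := a_kernel (P j) (L j) (e j)\<rparr>"
begin

lemma Lm [simp, intro]: "left_module A (L j)" "left_module A (P j)" "left_module B X0" "left_module A (restrict_module A J X0)"
  using L[of j] P[of j] X0 left_module_restrict[of X0] by (auto simp: fg_projective_def fg_module_def)

lemma L_Suc_simps: "x \<in> carrier (L (Suc j)) \<longleftrightarrow> x \<in> carrier (P j) \<and> e j x = \<zero>\<^bsub>L j\<^esub>"
  "zero (L (Suc j)) = zero (P j)" "add (L (Suc j)) = add (P j)" "smult (L (Suc j)) = smult (P j)"
  by (auto simp: LSuc a_kernel_def kernel_def)

lemma e_closed: "x \<in> carrier (P (Suc j)) \<Longrightarrow> e (Suc j) x \<in> carrier (P j)" "x \<in> carrier (P (Suc j)) \<Longrightarrow> e j (e (Suc j) x) = \<zero>\<^bsub>L j\<^esub>"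
  using mod_homD(1)[OF e, of x "Suc j"] by (auto simp: L_Suc_simps)

sublocale proj_cplx A P "\<lambda>j. e (Suc j)"
proof
  show "e (Suc j) \<in> mod_hom A (P (Suc j)) (P j)" for j using e[of "Suc j"] by (auto simp: mod_hom_iff L_Suc_simps)
  show "e (Suc j) (e (Suc (Suc j)) x) = \<zero>\<^bsub>P j\<^esub>" if "x \<in> carrier (P (Suc (Suc j)))" for j x
    using e_closed(2)[OF that] by (simp add: L_Suc_simps)
qed (rule P)

definition ZC where "ZC m j = (if j \<le> m then P j else if j = Suc m then L (Suc m) else zmod)"
definition Zd where "Zd m j = (if j < m then e (Suc j) else if j = m then id else (\<lambda>_. \<zero>\<^bsub>ZC m j\<^esub>))"
definition Z where "Z m = chain_cplx (ZC m) (Zd m)"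

lemma fg_ZC: "fg_module A (ZC m j)"
  using P[of j] L[of "Suc m"] by (simp add: ZC_def fg_projective_def fg_module_zmod[OF ring_A])

lemma ZC_lm [simp, intro]: "left_module A (ZC m j)" using fg_ZC[of m j] by (simp add: fg_module_def)

lemma Zd_hom: "Zd m j \<in> mod_hom A (ZC m (Suc j)) (ZC m j)"
proof -
  consider "j < m" | "j = m" | "j > m" by linarith
  then show ?thesis
  proof cases
    case 1 then show ?thesis using \<delta>[of j] by (simp add: Zd_def ZC_def)
  next
    case 2 then show ?thesis by (auto simp: Zd_def ZC_def mod_hom_iff L_Suc_simps)
  next
    case 3 then show ?thesis using mod_hom_const_zero[OF ZC_lm] by (simp add: Zd_def)
  qed
qed

lemma Zd_image: "j \<le> m \<Longrightarrow> Zd m j ` carrier (ZC m (Suc j)) = carrier (L (Suc j))"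
  using surj[of "Suc j"] by (cases "j = m") (auto simp: Zd_def ZC_def)

lemma Zd_Zd: assumes "x \<in> carrier (ZC m (Suc (Suc j)))" shows "Zd m j (Zd m (Suc j) x) = \<zero>\<^bsub>ZC m j\<^esub>"
proof (cases "Suc j \<le> m")
  case True
  have "Zd m (Suc j) x \<in> carrier (L (Suc (Suc j)))" using Zd_image[OF True] assms by blast
  then show ?thesis using True by (simp add: L_Suc_simps Zd_def ZC_def)
next
  case False
  then have "Zd m (Suc j) x = \<zero>\<^bsub>ZC m (Suc j)\<^esub>" by (simp add: Zd_def)
  then show ?thesis using mod_hom_zero[OF Zd_hom[of m j]] by simp
qed

lemma bounded_Z: "bounded_complex A (Z m)"
  unfolding Z_def by (rule bounded_chain_cplx[where n = "Suc m"]) (use ring_A fg_ZC Zd_hom Zd_Zd in \<open>auto simp: ZC_def\<close>)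

sublocale Z: cpx A "Z m" for m by unfold_locales (rule bounded_Z)

lemma Z_pos [simp]: "Z.pos m j = ZC m j" "Z.bd m j = Zd m j"
  unfolding Z.pos_def Z.bd_def unfolding Z_def chain_cplx_simps by simp_all

lemma ZC_0 [simp]: "ZC m 0 = P 0" by (simp add: ZC_def)
lemma ZC_Suc [simp]: "ZC m (Suc m) = L (Suc m)" by (simp add: ZC_def)
lemma ob_Z_0 [simp]: "ob (Z m) 0 = P 0" using Z.pos_def[of m 0] by simp

lemma coboundaries_Z_0: "coboundaries (Z m) 0 = carrier (L 1)"
  using Z.coboundaries_pos[of m 0] Zd_image[of 0 m] by simp

lemma cocycles_Z_0: "cocycles (Z m) 0 = carrier (P 0)"
proof -
  have "df (Z m) 0 x = \<zero>\<^bsub>ob (Z m) 1\<^esub>" for x by (simp add: Z_def chain_cplx_simps)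
  then show ?thesis using Z.cocycles_0[of _ m] by auto
qed

lemma Z_exact: "cocycles (Z m) (- int (Suc j)) \<subseteq> coboundaries (Z m) (- int (Suc j))"
proof
  fix x assume "x \<in> cocycles (Z m) (- int (Suc j))"
  then have x: "x \<in> carrier (ZC m (Suc j))" "Zd m j x = \<zero>\<^bsub>ZC m j\<^esub>" unfolding Z.cocycles_pos by simp_all
  consider "Suc j \<le> m" | "j = m" | "m < j" by linarith
  then show "x \<in> coboundaries (Z m) (- int (Suc j))"
  proof cases
    case 1
    then have "x \<in> carrier (L (Suc (Suc j)))" using x by (simp add: L_Suc_simps Zd_def ZC_def)
    then show ?thesis unfolding Z.coboundaries_pos using Zd_image[OF 1] by simp
  next
    case 2
    then have "x = \<zero>\<^bsub>Z.pos m (Suc j)\<^esub>" using x(2) by (simp add: Zd_def ZC_def L_Suc_simps)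
    then show ?thesis using Z.cob_zero[of m "- int (Suc j)"] unfolding Z.pos_def by simp
  next
    case 3
    then have "x = \<zero>\<^bsub>Z.pos m (Suc j)\<^esub>" using x(1) by (simp add: ZC_def)
    then show ?thesis using Z.cob_zero[of m "- int (Suc j)"] unfolding Z.pos_def by simp
  qed
qed

abbreviation X where "X \<equiv> stalk 0 X0"
abbreviation rX where "rX \<equiv> restrict_cplx A J X"

lemma bounded_X: "bounded_complex B X" "bounded_complex A rX"
proof -
  show "bounded_complex B X" by (rule bounded_stalk) (use X0 in \<open>simp add: fg_projective_def\<close>)
  then show "bounded_complex A rX" by (rule bounded_complex_restrict)
qed

sublocale X: cpx B X by unfold_locales (rule bounded_X)
sublocale rX: cpx A rX by unfold_locales (rule bounded_X)

lemma ob_X_0 [simp]: "ob X 0 = X0" using ob_stalk(1)[of 0 X0] by simp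
lemma ob_X [simp]: "i \<noteq> 0 \<Longrightarrow> ob X i = zmod" using ob_stalk(2)[of i 0 X0] by simp

definition s where "s i = (if i = 0 then e 0 else (\<lambda>_. \<zero>\<^bsub>ob rX i\<^esub>))"

lemma s_0 [simp]: "s 0 = e 0" by (simp add: s_def)

lemma cob_X: "x \<in> coboundaries X i \<longleftrightarrow> x = \<zero>\<^bsub>ob X i\<^esub>"
  using X.cob_zero[of i] by (auto simp: coboundaries_def df_stalk)

lemma chain_map_s: "chain_map A (Z m) rX s"
  unfolding chain_map_def
proof (intro conjI allI ballI)
  show "s i \<in> mod_hom A (ob (Z m) i) (ob rX i)" for i
    using e[of 0] mod_hom_const_zero[OF rX.lm[of i]] L0 by (cases "i = 0") (auto simp: s_def)
  fix i x assume x: "x \<in> carrier (ob (Z m) i)"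
  have "s (i + 1) (df (Z m) i x) = \<zero>\<^bsub>ob rX (i + 1)\<^esub>"
  proof (cases "i = - 1")
    case True
    have "df (Z m) i x \<in> coboundaries (Z m) 0" using x True by (auto simp: coboundaries_def)
    then show ?thesis using True L_Suc_simps(1)[of _ 0] by (simp add: coboundaries_Z_0 L0)
  qed (simp add: s_def)
  then show "s (i + 1) (df (Z m) i x) = df rX i (s i x)" by (simp add: df_stalk)
qed

lemma quasi_iso_s: "quasi_iso A (Z m) rX s"
  unfolding quasi_iso_iff[OF bounded_Z bounded_X(2)]
proof (intro conjI allI ballI impI chain_map_s)
  fix i x assume x: "x \<in> cocycles (Z m) i" "s i x \<in> coboundaries rX i"
  show "x \<in> coboundaries (Z m) i"
  proof (cases i rule: int_degree_cases)
    case pos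
    then have "x = \<zero>\<^bsub>ob (Z m) i\<^esub>" using x(1) by (simp add: Z.mem_cocycles) (simp add: Z_def chain_cplx_simps)
    then show ?thesis using Z.cob_zero by simp
  next
    case (neg j)
    show ?thesis
    proof (cases j)
      case 0
      then show ?thesis using x neg by (simp add: cob_X coboundaries_Z_0 cocycles_Z_0 L_Suc_simps L0)
    next
      case (Suc j')
      then show ?thesis using x(1) neg Z_exact[of m j'] by blast
    qed
  qed
next
  fix i y assume y: "y \<in> cocycles rX i"
  have yc: "y \<in> carrier (ob rX i)" using y by (simp add: X.mem_cocycles)
  have "\<exists>x\<in>cocycles (Z m) i. y = s i x"
  proof (cases "i = 0")
    case True
    then have "y \<in> e 0 ` carrier (P 0)" using yc surj[of 0] L0 by simp
    then show ?thesis using True by (auto simp: cocycles_Z_0)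
  next
    case False
    then have "y = \<zero>\<^bsub>ob rX i\<^esub>" using yc by simp
    then show ?thesis using False Z.cob_cocycle[OF Z.cob_zero] by (auto simp: s_def)
  qed
  then obtain x where x: "x \<in> cocycles (Z m) i" "y = s i x" by blast
  show "\<exists>x\<in>cocycles (Z m) i. \<exists>b\<in>coboundaries rX i. y = b \<oplus>\<^bsub>ob rX i\<^esub> s i x"
    using x rX.cob_zero[of i] abelian_monoid.l_zero[OF abelian_group.axioms(1)[OF rX.ag[of i]] yc]
    by (intro bexI[of _ x] bexI[of _ "\<zero>\<^bsub>ob rX i\<^esub>"]) simp_all
qed

end


context relative_resolution
begin

definition ext_map where
  "ext_map m Y h i = (if i = - int (Suc m) then h else (\<lambda>_. \<zero>\<^bsub>ob (restrict_cplx A J (stalk (Suc m) Y)) i\<^esub>))"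

lemma chain_map_ext_map:
  assumes "fg_module B Y" "h \<in> mod_hom A (L (Suc m)) (restrict_module A J Y)"
  shows "chain_map A (Z m) (restrict_cplx A J (stalk (Suc m) Y)) (ext_map m Y h)"
proof -
  let ?Y = "restrict_cplx A J (stalk (Suc m) Y)"
  interpret Y: cpx A ?Y
    by unfold_locales (rule bounded_complex_restrict[OF bounded_stalk[OF assms(1)]])
  have oZ: "ob (Z m) (- int (Suc m)) = L (Suc m)" using Z.pos_def[of m "Suc m"] by simp
  have oY: "ob ?Y (- int (Suc m)) = restrict_module A J Y" by (simp only: ob_restrict ob_stalk)
  show ?thesis unfolding chain_map_def
  proof (intro conjI allI ballI)
    show "ext_map m Y h i \<in> mod_hom A (ob (Z m) i) (ob ?Y i)" for i
    proof (cases "i = - int (Suc m)")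
      case True
      then show ?thesis using assms(2) oZ oY by (simp add: ext_map_def del: ob_restrict)
    next
      case False
      then show ?thesis using mod_hom_const_zero[OF Y.lm[of i]] by (simp add: ext_map_def)
    qed
    fix i x assume x: "x \<in> carrier (ob (Z m) i)"
    have "ext_map m Y h (i + 1) (df (Z m) i x) = \<zero>\<^bsub>ob ?Y (i + 1)\<^esub>"
    proof (cases "i + 1 = - int (Suc m)")
      case True
      then have "i = - int (Suc (Suc m))" by simp
      then have "df (Z m) i = Z.bd m (Suc m)" unfolding Z.bd_def by simp
      then have 1: "df (Z m) i x = \<zero>\<^bsub>L (Suc m)\<^esub>" by (simp add: Zd_def)
      have "h \<zero>\<^bsub>L (Suc m)\<^esub> = \<zero>\<^bsub>restrict_module A J Y\<^esub>"
        by (rule mod_hom_zero[OF assms(2)]) (use oY Y.lm[of "- int (Suc m)"] in auto)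
      then show ?thesis unfolding True 1 oY by (simp add: ext_map_def)
    qed (simp add: ext_map_def)
    then show "ext_map m Y h (i + 1) (df (Z m) i x) = df ?Y i (ext_map m Y h i x)" by (simp add: df_stalk)
  qed
qed

text \<open>A homomorphism \<open>h\<close> from the syzygy \<open>L (m + 1)\<close> to a \<open>B\<close>-module \<open>Y\<close> is a morphism
  \<open>X0 \<rightarrow> Y[m + 1]\<close> in the derived category of \<open>A\<close>, represented by a roof whose left leg is the
  truncated resolution. By fullness this roof is equivalent to one over \<open>B\<close>, where it factors
  through a complex of which the projective \<open>X0\<close> splits off; the comparison maps from the
  resolution turn this into an extension of \<open>h\<close>.\<close>

lemma extension:
  fixes Y :: "('a set, 'k vec) module"
  assumes "homological_ideal A J" "fg_module B Y" "h \<in> mod_hom A (L (Suc m)) (restrict_module A J Y)"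
  shows "\<exists>k\<in>mod_hom A (P m) (restrict_module A J Y). \<forall>x\<in>carrier (L (Suc m)). k x = h x"
proof -
  let ?S = "stalk (Suc m) Y"
  let ?Y = "restrict_cplx A J ?S" and ?f = "ext_map m Y h" and ?n = "- int (Suc m)" and ?M = "restrict_module A J Y"
  have bS: "bounded_complex B ?S" by (rule bounded_stalk[OF assms(2)])
  have bY: "bounded_complex A ?Y" by (rule bounded_complex_restrict[OF bS])
  interpret Y: cpx A ?Y by unfold_locales (rule bY)
  have oY: "ob ?Y ?n = ?M" by (simp only: ob_restrict ob_stalk)
  have Mlm: "left_module A ?M" using oY Y.lm[of ?n] by simp
  have "(Z m, s, ?f) \<in> roofs A rX ?Y"
    using bounded_Z quasi_iso_s chain_map_ext_map[OF assms(2,3)] by (simp add: roofs_def)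
  from roof_lift[OF assms(1) bounded_X(1) bS this]
  obtain V s' f' where V: "(V, s', f') \<in> roofs B X ?S"
    and rel: "((restrict_cplx A J V, s', f'), (Z m, s, ?f)) \<in> roof_rel A rX ?Y" by (elim exE conjE)
  let ?V = "restrict_cplx A J V"
  have bV: "bounded_complex B V" "quasi_iso B V X s'" "chain_map B V X s'" "chain_map B V ?S f'"
    using V by (auto simp: roofs_def quasi_iso_def)
  have bV': "bounded_complex A ?V" by (rule bounded_complex_restrict[OF bV(1)])
  have "(?V, s', f') \<in> roofs A rX ?Y" using rel unfolding roof_rel_def by simp
  then have rV: "chain_map A ?V rX s'" "chain_map A ?V ?Y f'" by (auto simp: roofs_def quasi_iso_def)
  obtain W u v where W: "bounded_complex A W" "quasi_iso A W ?V u" "quasi_iso A W (Z m) v"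
    and hs: "homotopic A W rX (\<lambda>i. s' i \<circ> u i) (\<lambda>i. s i \<circ> v i)"
    and hf: "homotopic A W ?Y (\<lambda>i. f' i \<circ> u i) (\<lambda>i. ?f i \<circ> v i)"
    using rel unfolding roof_rel_def by auto
  interpret V: cpx B V by unfold_locales (rule bV)
  interpret R: cpx A ?V by unfold_locales (rule bV')
  interpret W: cpx A W by unfold_locales (rule W)
  have cu: "chain_map A W ?V u" and cv: "chain_map A W (Z m) v" using W(2,3) by (auto simp: quasi_iso_def)
  note u = chain_map_pos[OF W(1) bV' cu]
  note v = chain_map_pos[OF W(1) bounded_Z cv, unfolded Z_pos]
  note f' = chain_map_pos[OF bV' bY rV(2)]
  have qv: "\<lbrakk>x \<in> cocycles W i; v i x \<in> coboundaries (Z m) i\<rbrakk> \<Longrightarrow> x \<in> coboundaries W i" for i x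
    using W(3) unfolding quasi_iso_iff[OF W(1) bounded_Z] by blast
  have sv: "\<exists>x\<in>cocycles W i. \<exists>b\<in>coboundaries (Z m) i. y = b \<oplus>\<^bsub>ob (Z m) i\<^esub> v i x" if "y \<in> cocycles (Z m) i" for i y
    using W(3) that unfolding quasi_iso_iff[OF W(1) bounded_Z] by blast
  have qs: "\<lbrakk>x \<in> cocycles V i; s' i x \<in> coboundaries X i\<rbrakk> \<Longrightarrow> x \<in> coboundaries V i" for i x
    using bV(2) unfolding quasi_iso_iff[OF bV(1) bounded_X(1)] by blast
  have ss: "\<exists>x\<in>cocycles V i. \<exists>b\<in>coboundaries X i. y = b \<oplus>\<^bsub>ob X i\<^esub> s' i x" if "y \<in> cocycles X i" for i y
    using bV(2) that unfolding quasi_iso_iff[OF bV(1) bounded_X(1)] by blast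
  have exW: "cocycles W (- int (Suc j)) \<subseteq> coboundaries W (- int (Suc j))" for j
    using chain_map_cocycles[OF W(1) bounded_Z cv] Z_exact[of m j] qv by blast
  have exR: "cocycles ?V (- int (Suc j)) \<subseteq> coboundaries ?V (- int (Suc j))" for j
  proof
    fix x assume x: "x \<in> cocycles ?V (- int (Suc j))"
    have "s' (- int (Suc j)) x \<in> cocycles X (- int (Suc j))" using chain_map_cocycles[OF bV(1) bounded_X(1) bV(3)] x by simp
    then have "s' (- int (Suc j)) x \<in> coboundaries X (- int (Suc j))" by (simp add: X.mem_cocycles cob_X)
    then show "x \<in> coboundaries ?V (- int (Suc j))" using qs x by simp
  qed

  have P0: "W.pos 0 = ob W 0" "R.pos 0 = ob ?V 0" by (simp_all add: W.pos_def R.pos_def)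
  have v0: "v 0 \<in> mod_hom A (W.pos 0) (P 0)" and u0: "u 0 \<in> mod_hom A (W.pos 0) (R.pos 0)" using v(1)[of 0] u(1)[of 0] by simp_all
  have ev: "(\<lambda>w. e 0 (v 0 w)) \<in> mod_hom A (W.pos 0) (L 0)" by (rule mod_hom_comp[OF v0 e])
  interpret L0: abelian_group "L 0" by (rule left_moduleD(1)[OF Lm(1)])
  interpret P0: abelian_group "P 0" by (rule left_moduleD(1)[OF Lm(2)])
  have dW0: "df W 0 \<in> mod_hom A (W.pos 0) (ob W 1)" using W.df_hom[of 0] by (simp add: P0)
  have "\<exists>l\<in>mod_hom A (P 0) (W.pos 0). \<forall>q\<in>carrier (P 0). l q \<in> {w \<in> carrier (W.pos 0). df W 0 w = \<zero>\<^bsub>ob W 1\<^esub>} \<and> e 0 (v 0 (l q)) = e 0 q"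
  proof (rule proj_lift[OF P W.pos_lm Lm(1) msub_kernel[OF dW0 W.pos_lm W.lm] ev e])
    fix q assume q: "q \<in> carrier (P 0)"
    then obtain w b where w: "w \<in> cocycles W 0" "b \<in> carrier (L 1)" "q = b \<oplus>\<^bsub>P 0\<^esub> v 0 w"
      using sv[of q 0] unfolding cocycles_Z_0 coboundaries_Z_0 by auto
    have wc: "w \<in> carrier (W.pos 0)" "df W 0 w = \<zero>\<^bsub>ob W 1\<^esub>" using w(1) by (simp_all add: W.cocycles_0)
    have "e 0 q = e 0 (v 0 w)"
      using w(2,3) mod_homD(2)[OF e, of b 0 "v 0 w"] mod_homD(1)[OF v0 wc(1)] mod_homD(1)[OF ev wc(1)] by (simp add: L_Suc_simps)
    then show "e 0 q \<in> (\<lambda>w. e 0 (v 0 w)) ` {w \<in> carrier (W.pos 0). df W 0 w = \<zero>\<^bsub>ob W 1\<^esub>}" using wc by blast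
  qed
  then obtain \<phi>0 where \<phi>0: "\<phi>0 \<in> mod_hom A (P 0) (W.pos 0)" "\<And>q. q \<in> carrier (P 0) \<Longrightarrow> df W 0 (\<phi>0 q) = \<zero>\<^bsub>ob W 1\<^esub>"
    "\<And>q. q \<in> carrier (P 0) \<Longrightarrow> e 0 (v 0 (\<phi>0 q)) = e 0 q" by auto
  have \<phi>0c: "\<phi>0 q \<in> cocycles W 0" if "q \<in> carrier (P 0)" for q using mod_homD(1)[OF \<phi>0(1) that] \<phi>0(2)[OF that] by (simp add: W.cocycles_0)
  have "\<phi>0 (e (Suc 0) x) \<in> coboundaries W 0" if x: "x \<in> carrier (P 1)" for x
  proof -
    have x': "e (Suc 0) x \<in> carrier (P 0)" "e 0 (e (Suc 0) x) = \<zero>\<^bsub>L 0\<^esub>" using e_closed[of x 0] x by simp_all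
    have "v 0 (\<phi>0 (e (Suc 0) x)) \<in> carrier (L 1)"
      using \<phi>0(3)[OF x'(1)] x'(2) mod_homD(1)[OF v0 mod_homD(1)[OF \<phi>0(1) x'(1)]] by (simp add: L_Suc_simps)
    then show ?thesis using qv[OF \<phi>0c[OF x'(1)]] by (simp add: coboundaries_Z_0)
  qed
  from comparison[OF W(1) exW \<phi>0(1) this]
  obtain \<phi> where \<phi>: "\<phi> 0 = \<phi>0" "\<And>j. \<phi> j \<in> mod_hom A (P j) (W.pos j)"
    "\<And>j x. x \<in> carrier (P (Suc j)) \<Longrightarrow> W.bd j (\<phi> (Suc j) x) = \<phi> j (e (Suc j) x)" by auto

  define c where "c j = (if j \<le> m then id else if j = Suc m then e (Suc m) else (\<lambda>_. \<zero>\<^bsub>ZC m j\<^esub>))" for j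
  have c: "c j \<in> mod_hom A (P j) (ZC m j)" for j
  proof -
    consider "j \<le> m" | "j = Suc m" | "Suc m < j" by linarith
    then show ?thesis
    proof cases
      case 3 then show ?thesis using mod_hom_const_zero[OF ZC_lm[of m j]] by (simp add: c_def)
    qed (use e[of "Suc m"] in \<open>auto simp: c_def ZC_def mod_hom_iff\<close>)
  qed
  have dc: "Zd m j (c (Suc j) x) = c j (e (Suc j) x)" if x: "x \<in> carrier (P (Suc j))" for j x
    using e_closed(2)[OF x] by (auto simp: c_def Zd_def ZC_def)
  let ?\<psi> = "\<lambda>j x. v (- int j) (\<phi> j x) \<ominus>\<^bsub>ZC m j\<^esub> c j x"
  have v\<phi>: "(\<lambda>x. v (- int j) (\<phi> j x)) \<in> mod_hom A (P j) (ZC m j)" for j by (rule mod_hom_comp[OF \<phi>(2) v(1)])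
  have "\<exists>g. (\<forall>j. g j \<in> mod_hom A (P j) (Z.pos m (Suc j))) \<and>
     (\<forall>j. \<forall>x\<in>carrier (P (Suc j)). ?\<psi> (Suc j) x \<ominus>\<^bsub>Z.pos m (Suc j)\<^esub> g j (e (Suc j) x) = Z.bd m (Suc j) (g (Suc j) x))"
  proof (rule null_homotopy[OF bounded_Z Z_exact])
    show "?\<psi> j \<in> mod_hom A (P j) (Z.pos m j)" for j using mod_hom_minus[OF v\<phi> c ZC_lm] by simp
    show "Z.bd m j (?\<psi> (Suc j) x) = ?\<psi> j (e (Suc j) x)" if x: "x \<in> carrier (P (Suc j))" for j x
      using mod_hom_diff[OF Zd_hom[of m j] ZC_lm ZC_lm mod_homD(1)[OF v\<phi> x] mod_homD(1)[OF c x]]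
        dc[OF x] \<phi>(3)[OF x] v(2)[OF mod_homD(1)[OF \<phi>(2) x]] by simp
    show "?\<psi> 0 x \<in> coboundaries (Z m) 0" if x: "x \<in> carrier (P 0)" for x
    proof -
      have vc: "v 0 (\<phi>0 x) \<in> carrier (P 0)" using mod_homD(1)[OF v\<phi>, of x 0] x by (simp add: \<phi>(1))
      then have "e 0 (v 0 (\<phi>0 x) \<ominus>\<^bsub>P 0\<^esub> x) = \<zero>\<^bsub>L 0\<^esub>"
        using mod_hom_diff[OF e Lm(2,1) vc x] \<phi>0(3)[OF x] mod_homD(1)[OF e x] by simp
      then show ?thesis using vc x by (simp add: coboundaries_Z_0 L_Suc_simps \<phi>(1) c_def)
    qed
  qed
  then obtain g where g: "\<And>j. g j \<in> mod_hom A (P j) (ZC m (Suc j))"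
    "\<And>j x. x \<in> carrier (P (Suc j)) \<Longrightarrow> ?\<psi> (Suc j) x \<ominus>\<^bsub>ZC m (Suc j)\<^esub> g j (e (Suc j) x) = Zd m (Suc j) (g (Suc j) x)" by auto

  have "\<exists>l\<in>mod_hom B X0 (ob V 0). \<forall>q\<in>carrier X0. l q \<in> {z \<in> carrier (ob V 0). df V 0 z = \<zero>\<^bsub>ob V 1\<^esub>} \<and> s' 0 (l q) = q"
  proof (rule proj_lift[OF X0 V.lm Lm(3)])
    show "msub B (ob V 0) {z \<in> carrier (ob V 0). df V 0 z = \<zero>\<^bsub>ob V 1\<^esub>}"
      by (rule msub_kernel) (use V.df_hom[of 0] in auto)
    show s0: "s' 0 \<in> mod_hom B (ob V 0) X0" using chain_mapD(1)[OF bV(3), of 0] by simp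
    show "(\<lambda>q. q) \<in> mod_hom B X0 X0" by (auto simp: mod_hom_iff)
    fix q assume q: "q \<in> carrier X0"
    then have "q \<in> cocycles X 0" by (simp add: X.mem_cocycles df_stalk)
    from ss[OF this] obtain z where z: "z \<in> cocycles V 0" "q = \<zero>\<^bsub>X0\<^esub> \<oplus>\<^bsub>X0\<^esub> s' 0 z" by (auto simp: cob_X)
    then have "q = s' 0 z"
      using abelian_monoid.l_zero[OF abelian_group.axioms(1)[OF left_moduleD(1)[OF Lm(3)]]] mod_homD(1)[OF s0, of z] by (simp add: V.mem_cocycles)
    then show "q \<in> s' 0 ` {z \<in> carrier (ob V 0). df V 0 z = \<zero>\<^bsub>ob V 1\<^esub>}" using z(1) by (auto simp: V.mem_cocycles)
  qed
  then obtain \<tau> where \<tau>: "\<tau> \<in> mod_hom B X0 (ob V 0)" "\<And>q. q \<in> carrier X0 \<Longrightarrow> df V 0 (\<tau> q) = \<zero>\<^bsub>ob V 1\<^esub>"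
    "\<And>q. q \<in> carrier X0 \<Longrightarrow> s' 0 (\<tau> q) = q" by auto
  have \<tau>A: "\<tau> \<in> mod_hom A (L 0) (R.pos 0)" using mod_hom_restrict[OF \<tau>(1)] by (simp add: L0 P0)
  define t where "t j = (if j = 0 then (\<lambda>x. \<tau> (e 0 x)) else (\<lambda>_. \<zero>\<^bsub>R.pos j\<^esub>))" for j :: nat
  have t: "t j \<in> mod_hom A (P j) (R.pos j)" for j
    using mod_hom_comp[OF e[of 0] \<tau>A] mod_hom_const_zero[OF R.pos_lm[of j]] by (cases "j = 0") (simp_all add: t_def)
  have dt: "R.bd j (t (Suc j) x) = t j (e (Suc j) x)" if x: "x \<in> carrier (P (Suc j))" for j x
    using e_closed(2)[OF x] mod_hom_zero[OF \<tau>A Lm(1) R.pos_lm] mod_hom_zero[OF R.bd_hom R.pos_lm R.pos_lm, of j] by (cases j) (simp_all add: t_def)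
  let ?\<chi> = "\<lambda>j x. u (- int j) (\<phi> j x) \<ominus>\<^bsub>R.pos j\<^esub> t j x"
  have u\<phi>: "(\<lambda>x. u (- int j) (\<phi> j x)) \<in> mod_hom A (P j) (R.pos j)" for j by (rule mod_hom_comp[OF \<phi>(2) u(1)])
  have "\<exists>g. (\<forall>j. g j \<in> mod_hom A (P j) (R.pos (Suc j))) \<and>
     (\<forall>j. \<forall>x\<in>carrier (P (Suc j)). ?\<chi> (Suc j) x \<ominus>\<^bsub>R.pos (Suc j)\<^esub> g j (e (Suc j) x) = R.bd (Suc j) (g (Suc j) x))"
  proof (rule null_homotopy[OF bV' exR])
    show "?\<chi> j \<in> mod_hom A (P j) (R.pos j)" for j by (rule mod_hom_minus[OF u\<phi> t R.pos_lm])
    show "R.bd j (?\<chi> (Suc j) x) = ?\<chi> j (e (Suc j) x)" if x: "x \<in> carrier (P (Suc j))" for j x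
      using mod_hom_diff[OF R.bd_hom[of j] R.pos_lm R.pos_lm mod_homD(1)[OF u\<phi> x] mod_homD(1)[OF t x]]
        dt[OF x] \<phi>(3)[OF x] u(2)[OF mod_homD(1)[OF \<phi>(2) x]] by simp
    show "?\<chi> 0 x \<in> coboundaries ?V 0" if x: "x \<in> carrier (P 0)" for x
    proof -
      let ?y = "u 0 (\<phi>0 x) \<ominus>\<^bsub>ob ?V 0\<^esub> \<tau> (e 0 x)"
      have ex: "e 0 x \<in> carrier (L 0)" "e 0 x \<in> carrier X0" using mod_homD(1)[OF e x] L0 by simp_all
      have c1: "u 0 (\<phi>0 x) \<in> cocycles ?V 0" by (rule chain_map_cocycles[OF W(1) bV' cu \<phi>0c[OF x]])
      have c2: "\<tau> (e 0 x) \<in> cocycles ?V 0" using mod_homD(1)[OF \<tau>A ex(1)] \<tau>(2)[OF ex(2)] by (simp add: V.mem_cocycles P0)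
      have k1: "u 0 (\<phi>0 x) \<in> carrier (ob ?V 0)" "\<tau> (e 0 x) \<in> carrier (ob ?V 0)" using c1 c2 by (simp_all add: V.mem_cocycles)
      have "msub A (ob ?V 0) (cocycles ?V 0)"
        using msub_kernel[OF R.df_hom[of 0] R.lm R.lm] by (simp add: cocycles_def a_kernel_def kernel_def)
      then have y: "?y \<in> cocycles ?V 0" using c1 c2 unfolding msub_def by blast
      obtain H where H: "\<And>i. H i \<in> mod_hom A (ob W i) (ob rX (i - 1))" "\<And>i w. w \<in> carrier (ob W i) \<Longrightarrow>
          (s' i \<circ> u i) w \<ominus>\<^bsub>ob rX i\<^esub> (s i \<circ> v i) w = df rX (i - 1) (H i w) \<oplus>\<^bsub>ob rX i\<^esub> H (i + 1) (df W i w)"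
        using hs unfolding homotopic_def by blast
      have wc: "\<phi>0 x \<in> carrier (ob W 0)" using mod_homD(1)[OF \<phi>0(1) x] by (simp add: P0)
      have H1: "H 1 \<zero>\<^bsub>ob W 1\<^esub> = \<zero>\<^bsub>ob rX 0\<^esub>" using mod_hom_zero[OF H(1)[of 1] W.lm rX.lm] by simp
      have "s' 0 (u 0 (\<phi>0 x)) \<ominus>\<^bsub>ob rX 0\<^esub> e 0 (v 0 (\<phi>0 x)) = df rX (- 1) (H 0 (\<phi>0 x)) \<oplus>\<^bsub>ob rX 0\<^esub> \<zero>\<^bsub>ob rX 0\<^esub>"
        using H(2)[OF wc] \<phi>0(2)[OF x] H1 by (simp del: ob_restrict)
      also have "df rX (- 1) (H 0 (\<phi>0 x)) = \<zero>\<^bsub>ob rX 0\<^esub>" by (simp add: df_stalk)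
      also have "ob rX 0 = L 0" by (simp add: L0)
      finally have hh: "s' 0 (u 0 (\<phi>0 x)) \<ominus>\<^bsub>L 0\<^esub> e 0 (v 0 (\<phi>0 x)) = \<zero>\<^bsub>L 0\<^esub>" by simp
      have s0: "s' 0 \<in> mod_hom A (ob ?V 0) (L 0)" using chain_mapD(1)[OF rV(1), of 0] by (simp add: L0)
      have "s' 0 (u 0 (\<phi>0 x)) = e 0 x"
        using hh L0.diff_zero_iff[OF mod_homD(1)[OF s0 k1(1)] mod_homD(1)[OF ev, of "\<phi>0 x"]] \<phi>0(3)[OF x] wc by (simp add: P0)
      then have "s' 0 ?y = \<zero>\<^bsub>L 0\<^esub>"
        using mod_hom_diff[OF s0 R.lm Lm(1) k1] \<tau>(3)[OF ex(2)] ex(1) by simp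
      then have "s' 0 ?y \<in> coboundaries X 0" by (simp add: cob_X L0)
      then have "?y \<in> coboundaries V 0" using qs y by simp
      then show ?thesis by (simp add: \<phi>(1) t_def P0)
    qed
  qed
  then obtain g' where g': "\<And>j. g' j \<in> mod_hom A (P j) (R.pos (Suc j))"
    "\<And>j x. x \<in> carrier (P (Suc j)) \<Longrightarrow> ?\<chi> (Suc j) x \<ominus>\<^bsub>R.pos (Suc j)\<^esub> g' j (e (Suc j) x) = R.bd (Suc j) (g' (Suc j) x)" by blast

  have posY: "Y.pos (Suc m) = ?M" unfolding Y.pos_def by (rule oY)
  have f'M: "f' ?n \<in> mod_hom A (R.pos (Suc m)) ?M" using f'(1)[of "Suc m"] posY by simp
  obtain H where H: "\<And>i. H i \<in> mod_hom A (ob W i) (ob ?Y (i - 1))" "\<And>i w. w \<in> carrier (ob W i) \<Longrightarrow>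
      (f' i \<circ> u i) w \<ominus>\<^bsub>ob ?Y i\<^esub> (?f i \<circ> v i) w = df ?Y (i - 1) (H i w) \<oplus>\<^bsub>ob ?Y i\<^esub> H (i + 1) (df W i w)"
    using hf unfolding homotopic_def by blast
  let ?H = "H (- int m)"
  have HM: "?H \<in> mod_hom A (W.pos m) ?M" using H(1)[of "- int m"] unfolding W.neg_Suc oY W.pos_def .
  interpret M: abelian_group ?M by (rule left_moduleD(1)[OF Mlm])
  have gm: "g m \<in> mod_hom A (P m) (L (Suc m))" using g(1)[of m] by simp
  let ?k = "\<lambda>p. (f' ?n (g' m p) \<ominus>\<^bsub>?M\<^esub> h (g m p)) \<ominus>\<^bsub>?M\<^esub> ?H (\<phi> m p)"
  have k: "?k \<in> mod_hom A (P m) ?M"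
    by (intro mod_hom_minus[OF mod_hom_minus] mod_hom_comp[OF g'(1) f'M] mod_hom_comp[OF gm assms(3)] mod_hom_comp[OF \<phi>(2) HM] Mlm)
  have "?k y = h y" if y: "y \<in> carrier (L (Suc m))" for y
  proof -
    obtain x where x: "x \<in> carrier (P (Suc m))" "e (Suc m) x = y" using y surj[of "Suc m"] by (metis imageE)
    have yP: "y \<in> carrier (P m)" using y by (simp add: L_Suc_simps)
    interpret L1: abelian_group "L (Suc m)" by (rule left_moduleD(1)[OF Lm(1)])
    let ?w = "\<phi> (Suc m) x"
    have w: "?w \<in> carrier (W.pos (Suc m))" "?w \<in> carrier (ob W ?n)" using mod_homD(1)[OF \<phi>(2) x(1)] by (simp_all only: W.pos_def)
    have vL: "v ?n ?w \<in> carrier (L (Suc m))" using mod_homD(1)[OF v\<phi> x(1)] by simp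
    have gL: "g m y \<in> carrier (L (Suc m))" using mod_homD(1)[OF gm yP] .
    have "(v ?n ?w \<ominus>\<^bsub>L (Suc m)\<^esub> y) \<ominus>\<^bsub>L (Suc m)\<^esub> g m y = \<zero>\<^bsub>L (Suc m)\<^esub>"
      using g(2)[OF x(1)] x(2) by (simp add: c_def Zd_def)
    then have "v ?n ?w = g m y \<oplus>\<^bsub>L (Suc m)\<^esub> y"
      using L1.diff_zero_iff[of "v ?n ?w \<ominus>\<^bsub>L (Suc m)\<^esub> y" "g m y"] L1.diff_eq_iff[OF vL y gL] vL y gL by simp
    then have hv: "h (v ?n ?w) = h (g m y) \<oplus>\<^bsub>?M\<^esub> h y" using mod_homD(2)[OF assms(3) gL y] by simp
    have uR: "u ?n ?w \<in> carrier (R.pos (Suc m))" using mod_homD(1)[OF u\<phi> x(1)] .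
    have gR: "g' m y \<in> carrier (R.pos (Suc m))" using mod_homD(1)[OF g'(1) yP] .
    interpret RG: abelian_group "R.pos (Suc m)" by (rule left_moduleD(1)[OF R.pos_lm])
    have "u ?n ?w \<ominus>\<^bsub>R.pos (Suc m)\<^esub> g' m y = R.bd (Suc m) (g' (Suc m) x)"
      using g'(2)[OF x(1)] x(2) uR by (simp add: t_def)
    then have "f' ?n (u ?n ?w) \<ominus>\<^bsub>?M\<^esub> f' ?n (g' m y) = f' ?n (R.bd (Suc m) (g' (Suc m) x))"
      using mod_hom_diff[OF f'M R.pos_lm Mlm uR gR] by simp
    also have "\<dots> = Y.bd (Suc m) (f' (- int (Suc (Suc m))) (g' (Suc m) x))"
      by (rule f'(2)[OF mod_homD(1)[OF g'(1) x(1)]])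
    also have "\<dots> = \<zero>\<^bsub>?M\<^esub>"
      unfolding Y.bd_def using df_stalk[of "Suc m" Y "- int (Suc (Suc m))"] arg_cong[OF oY, of zero] by simp
    finally have fu: "f' ?n (u ?n ?w) = f' ?n (g' m y)"
      using M.diff_zero_iff[OF mod_homD(1)[OF f'M uR] mod_homD(1)[OF f'M gR]] by simp
    have bw: "df W ?n ?w = \<phi> m y" using \<phi>(3)[OF x(1)] x(2) by (simp only: W.bd_def)
    have hy: "h y \<in> carrier ?M" "h (g m y) \<in> carrier ?M" using mod_homD(1)[OF assms(3)] y gL by blast+
    have Hy: "?H (\<phi> m y) \<in> carrier ?M" using mod_homD(1)[OF mod_hom_comp[OF \<phi>(2) HM] yP] .
    have fy: "f' ?n (g' m y) \<in> carrier ?M" using mod_homD(1)[OF f'M gR] .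
    have "f' ?n (u ?n ?w) \<ominus>\<^bsub>?M\<^esub> h (v ?n ?w) = df ?Y (?n - 1) (H ?n ?w) \<oplus>\<^bsub>?M\<^esub> H (?n + 1) (df W ?n ?w)"
      using H(2)[OF w(2)] unfolding oY by (simp only: o_apply ext_map_def simp_thms if_True)
    also have "df ?Y (?n - 1) (H ?n ?w) = \<zero>\<^bsub>?M\<^esub>" using df_stalk[of "Suc m" Y "?n - 1"] arg_cong[OF oY, of zero] by simp
    also have "?n + 1 = - int m" by simp
    finally have "f' ?n (g' m y) \<ominus>\<^bsub>?M\<^esub> (h (g m y) \<oplus>\<^bsub>?M\<^esub> h y) = ?H (\<phi> m y)"
      using fu hv bw M.l_zero[OF Hy] by (simp del: restrict_module_simps)
    then have "f' ?n (g' m y) = ?H (\<phi> m y) \<oplus>\<^bsub>?M\<^esub> (h (g m y) \<oplus>\<^bsub>?M\<^esub> h y)" using M.diff_eq_iff fy hy Hy by (simp del: restrict_module_simps)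
    also have "\<dots> = ((h y \<oplus>\<^bsub>?M\<^esub> ?H (\<phi> m y)) \<oplus>\<^bsub>?M\<^esub> h (g m y))" using hy Hy by (simp add: M.a_ac del: restrict_module_simps)
    finally show ?thesis using hy Hy by (simp del: restrict_module_simps)
  qed
  then show ?thesis by (intro bexI[OF _ k] ballI)
qed

end


section \<open>Functoriality of tensor products and resolutions\<close>

lemma tensor_iso2:
  assumes "bim M K S R" "bim N K R T" "bim N' K R T" "bimod_iso R T N N'"
  shows "bimod_iso S T (tensor R M N) (tensor R M N')"
proof -
  obtain f g where f: "f \<in> bimod_hom R T N N'" "g \<in> bimod_hom R T N' N"
    "\<And>x. x \<in> carrier N \<Longrightarrow> g (f x) = x" "\<And>y. y \<in> carrier N' \<Longrightarrow> f (g y) = y"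
    by (rule bimod_isoE[OF assms(4,2)]) blast
  interpret N: tensor_pair K S R T M N by (rule tensor_pairI[OF assms(1,2)])
  interpret N': tensor_pair K S R T M N' by (rule tensor_pairI[OF assms(1,3)])
  obtain F where F: "F \<in> bimod_hom S T N.MN N'.MN" "\<And>x y. \<lbrakk>x \<in> carrier M; y \<in> carrier N\<rbrakk> \<Longrightarrow> F (N.tens x y) = N'.tens x (f y)"
    by (rule tensor_map[OF assms(1-3) f(1)]) blast
  obtain G where G: "G \<in> bimod_hom S T N'.MN N.MN" "\<And>x y. \<lbrakk>x \<in> carrier M; y \<in> carrier N'\<rbrakk> \<Longrightarrow> G (N'.tens x y) = N.tens x (g y)"
    by (rule tensor_map[OF assms(1,3,2) f(2)]) blast
  have GF: "(G \<circ> F) t = id t" if "t \<in> carrier N.MN" for t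
    by (rule N.tensor_hom_eq[OF N.MN.bim_axioms bimod_hom_comp[OF F(1) G(1)] bimod_hom_id(1) _ that])
       (simp add: F(2) G(2) f(3) bimod_hom_closed[OF f(1)])
  have FG: "(F \<circ> G) t = id t" if "t \<in> carrier N'.MN" for t
    by (rule N'.tensor_hom_eq[OF N'.MN.bim_axioms bimod_hom_comp[OF G(1) F(1)] bimod_hom_id(1) _ that])
       (simp add: F(2) G(2) f(4) bimod_hom_closed[OF f(2)])
  show ?thesis by (rule bimod_isoI[OF F(1), of G]) (use GF FG bimod_hom_closed[OF G(1)] in auto)
qed

lemma bim_tensor: "\<lbrakk>bim M K S R; bim N K R T\<rbrakk> \<Longrightarrow> bim (tensor R M N) K S T"
  by (rule tensor_pair.bim_tensor[OF tensor_pairI])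

lemma tensor_iso1:
  assumes "bim M K S R" "bim M' K S R" "bim N K R T" "bimod_iso S R M M'"
  shows "bimod_iso S T (tensor R M N) (tensor R M' N)"
proof -
  note b = assms(1-3)[THEN bim_bop] and o = bimod_iso_trans
  have "bimod_iso (opposite R) (opposite S) (bop M) (bop M')" using assms(4) iso_bop by blast
  then have 1: "bimod_iso (opposite T) (opposite S) (tensor (opposite R) (bop N) (bop M)) (tensor (opposite R) (bop N) (bop M'))"
    by (rule tensor_iso2[OF b(3,1,2)])
  have 2: "bimod_iso (opposite T) (opposite S) (bop (tensor R M N)) (tensor (opposite R) (bop N) (bop M))"
    by (rule bimod_iso_sym[OF tensor_flip[OF assms(1,3)] bim_tensor[OF b(3,1)]])
  show ?thesis using o[OF o[OF 2 1] tensor_flip[OF assms(2,3)]] iso_bop by blast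
qed

lemma tensor_unit_right:
  assumes "bim P K B A" "alg_hom K A' A \<alpha>" "fd_algebra K A'"
  shows "bimod_iso B A' (tensor A P (rst id \<alpha> (regular_bimodule A))) (rst id \<alpha> P)"
proof -
  have A: "fd_algebra K A" using assms(1) by (simp add: bim_iff)
  let ?R = "rst id \<alpha> (regular_bimodule A)"
  have R: "bim ?R K A A'" by (rule bim_rst[OF fd_algebra.bim_regular[OF A] alg_hom_id assms(2) A assms(3)])
  have h: "alg_hom K (opposite A') (opposite A) \<alpha>" using assms(2) by (auto simp: alg_hom_def ring_hom_def)
  have "bimod_iso (opposite A') (opposite B) (tensor (opposite A) (rst \<alpha> id (regular_bimodule (opposite A))) (bop P)) (rst \<alpha> id (bop P))"
    by (rule tensor_unit_left[OF bim_bop[OF assms(1)] h fd_algebra.fd_algebra_opposite[OF assms(3)]])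
  also have "tensor (opposite A) (rst \<alpha> id (regular_bimodule (opposite A))) (bop P) = tensor (opposite A) (bop ?R) (bop P)"
    by (simp add: tensor_def tensor_relations_def regular_bimodule_def rst_def bop_def opposite_def)
  finally have 1: "bimod_iso (opposite A') (opposite B) (tensor (opposite A) (bop ?R) (bop P)) (bop (rst id \<alpha> P))" by (simp only: bop_rst)
  have "bimod_iso (opposite A') (opposite B) (bop (tensor A P ?R)) (tensor (opposite A) (bop ?R) (bop P))"
    by (rule bimod_iso_sym[OF tensor_flip[OF assms(1) R] bim_tensor[OF bim_bop[OF R] bim_bop[OF assms(1)]]])
  then show ?thesis using bimod_iso_trans[OF _ 1] iso_bop by blast
qed

lemma tensor_epi:
  assumes "bim X K B T" "alg_hom K A B \<pi>" "fd_algebra K A" "\<pi> ` carrier A = carrier B"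
  shows "bimod_iso B T (tensor A (rst id \<pi> (regular_bimodule B)) (rst \<pi> id X)) X"
proof -
  interpret X: bim X K B T by fact
  interpret B: fd_algebra K B by (rule X.fdA)
  note h = alg_homD[OF assms(2)]
  have W: "bim (rst id \<pi> (regular_bimodule B)) K B A" by (rule bim_rst[OF B.bim_regular alg_hom_id assms(2) X.fdA assms(3)])
  have X': "bim (rst \<pi> id X) K A T" by (rule bim_rst[OF assms(1,2) alg_hom_id assms(3) X.fdB])
  interpret Z: tensor_pair K B A T "rst id \<pi> (regular_bimodule B)" "rst \<pi> id X" by (rule tensor_pairI[OF W X'])
  have "\<exists>f\<in>bimod_hom B T Z.MN X. \<forall>b\<in>carrier (rst id \<pi> (regular_bimodule B)). \<forall>x\<in>carrier (rst \<pi> id X). f (Z.tens b x) = b \<odot>\<^bsub>X\<^esub> x"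
    by (rule Z.tensor_hom_ex[OF assms(1), of "\<lambda>b x. b \<odot>\<^bsub>X\<^esub> x"])
       (auto simp: X.l_add1 X.l_add2 X.l_assoc X.lr_assoc h)
  then obtain f where f: "f \<in> bimod_hom B T Z.MN X" "\<And>b x. \<lbrakk>b \<in> carrier B; x \<in> carrier X\<rbrakk> \<Longrightarrow> f (Z.tens b x) = b \<odot>\<^bsub>X\<^esub> x" by auto
  let ?g = "\<lambda>x. Z.tens \<one>\<^bsub>B\<^esub> x"
  have bal: "Z.tens b x = ?g (b \<odot>\<^bsub>X\<^esub> x)" if "b \<in> carrier B" "x \<in> carrier X" for b x
  proof -
    have "b \<in> \<pi> ` carrier A" using that(1) assms(4) by simp
    then obtain a where a: "b = \<pi> a" "a \<in> carrier A" by (rule imageE)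
    show ?thesis using Z.tens_bal[of "\<one>\<^bsub>B\<^esub>" a x] a that by simp
  qed
  have g: "?g \<in> bimod_hom B T X Z.MN"
  proof (rule bimod_homI)
    show "?g (b \<odot>\<^bsub>X\<^esub> x) = b \<odot>\<^bsub>Z.MN\<^esub> ?g x" if "b \<in> carrier B" "x \<in> carrier X" for b x
      using that bal[OF that] by (simp add: Z.tens_left)
  qed (use Z.tens_add2[of "\<one>\<^bsub>B\<^esub>"] Z.tens_right[symmetric] in auto)
  have "(?g \<circ> f) t = id t" if "t \<in> carrier Z.MN" for t
  proof (rule Z.tensor_hom_eq[OF Z.MN.bim_axioms bimod_hom_comp[OF f(1) g] bimod_hom_id(1) _ that])
    fix b x assume "b \<in> carrier (rst id \<pi> (regular_bimodule B))" "x \<in> carrier (rst \<pi> id X)"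
    then show "(?g \<circ> f) (Z.tens b x) = id (Z.tens b x)" using bal[of b x, symmetric] by (simp add: f(2))
  qed
  then show ?thesis by (intro bimod_isoI[OF f(1), of ?g]) (auto simp: f(2))
qed

definition cover :: "('k, 'z) ring_scheme \<Rightarrow> ('k, 'a) module \<Rightarrow> ('k, 'b) module \<Rightarrow> ('a, 'b, 'k vec) bimodule
    \<Rightarrow> ('a, 'b, 'k vec) bimodule \<times> ('k vec \<Rightarrow> 'k vec)" where
  "cover K A B X = (SOME p. pbim (fst p) K A B \<and> snd p \<in> bimod_hom A B (fst p) X \<and> snd p ` carrier (fst p) = carrier X)"

definition syz :: "('k, 'z) ring_scheme \<Rightarrow> ('k, 'a) module \<Rightarrow> ('k, 'b) module \<Rightarrow> ('a, 'b, 'k vec) bimodule \<Rightarrow> ('a, 'b, 'k vec) bimodule" where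
  "syz K A B X = (fst (cover K A B X))\<lparr>carrier := a_kernel (fst (cover K A B X)) X (snd (cover K A B X))\<rparr>"

lemma cover:
  fixes X :: "('a, 'b, 'k vec) bimodule" and A :: "('k, 'a) module" and B :: "('k, 'b) module"
  assumes "fbim X K A B"
  defines "P \<equiv> fst (cover K A B X) :: ('a, 'b, 'k vec) bimodule" and "f \<equiv> snd (cover K A B X)"
  shows "pbim P K A B" "f \<in> bimod_hom A B P X" "f ` carrier P = carrier X" "fbim (syz K A B X) K A B"
    "ses A B (syz K A B X) id P f X" "omega K A B X (syz K A B X)"
proof -
  have "\<exists>p :: ('a, 'b, 'k vec) bimodule \<times> ('k vec \<Rightarrow> 'k vec). pbim (fst p) K A B \<and> snd p \<in> bimod_hom A B (fst p) X \<and> snd p ` carrier (fst p) = carrier X"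
    using projective_cover[OF assms(1)] by auto
  from someI_ex[OF this] show 1: "pbim P K A B" "f \<in> bimod_hom A B P X" "f ` carrier P = carrier X"
    unfolding cover_def P_def f_def by blast+
  interpret f: bhom K A B P X f by (rule bhomI[OF pbim_bim[OF 1(1)] fbim_bim[OF assms(1)] 1(2)])
  have s: "syz K A B X = P\<lparr>carrier := a_kernel P X f\<rparr>" by (simp add: syz_def P_def f_def)
  show "fbim (syz K A B X) K A B" unfolding s by (rule fbim.fbim_sub[OF pbim_fbim[OF 1(1)] f.stable_ker])
  show 2: "ses A B (syz K A B X) id P f X"
    unfolding s ses_def using 1 by (auto simp: bimod_hom_iff f.ker_iff)
  then show "omega K A B X (syz K A B X)" unfolding omega_def sesx_def using 1(1) by blast
qed

lemma fbim_syz: "fbim X K A B \<Longrightarrow> fbim ((syz K A B ^^ n) X) K A B"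
  by (induction n) (auto intro: cover(4))

lemma is_syzygy_syz:
  assumes "fbim X K A B" shows "is_syzygy K A B n X ((syz K A B ^^ n) X)"
proof -
  have a: "fd_algebra K A" "fd_algebra K B" using assms by (auto simp: fbim_iff_fg)
  show ?thesis
    by (induction n) (use is_syzygy_0[OF a assms] is_syzygy_SucI[OF a _ cover(6)[OF fbim_syz[OF assms]] cover(4)[OF fbim_syz[OF assms]]] in auto)
qed

lemma sesx_chain_syzygy:
  fixes F :: "nat \<Rightarrow> ('a, 'b, 'm) bimodule" and G :: "nat \<Rightarrow> ('a, 'b, 'n) bimodule" and A :: "('k, 'a) module" and B :: "('k, 'b) module"
  assumes "\<And>i. fbim (F i) K A B" "\<And>i. pbim (G i) K A B" "\<And>i. sesx A B (F (Suc i)) (G i) (F i)"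
  shows "is_syzygy K A B n (F 0) (enc A (F n))"
proof -
  have a: "fd_algebra K A" "fd_algebra K B" using assms(1)[of 0] by (auto simp: fbim_iff_fg)
  have bF: "bim (F i) K A B" and bG: "bim (G i) K A B" for i using assms fbim_bim pbim_bim by blast+
  have eF: "fbim (enc A (F i)) K A B" "bimod_iso A B (F i) (enc A (F i))" for i using fbim.enc_fbim[OF assms(1)] fbim.enc_iso[OF assms(1)] by blast+
  have eG: "fbim (enc A (G i)) K A B" "bimod_iso A B (G i) (enc A (G i))" for i using fbim.enc_fbim fbim.enc_iso pbim_fbim[OF assms(2)] by blast+
  have pG: "pbim (enc A (G i)) K A B" for i by (rule pbim_iso[OF assms(2) fbim_bim[OF eG(1)] eG(2)])
  have o: "omega K A B (enc A (F i)) (enc A (F (Suc i)))" for i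
    unfolding omega_def using pG[of i] sesx_iso3[OF assms(3) bF bG bF fbim_bim[OF eF(1)] fbim_bim[OF eG(1)] fbim_bim[OF eF(1)] eF(2) eG(2) eF(2), of i] by blast
  show ?thesis
  proof (induction n)
    case 0 then show ?case using eF[of 0] by (simp add: fbim_iff_fg)
  next
    case (Suc n) then show ?case using is_syzygy_SucI[OF a _ o eF(1)] by blast
  qed
qed

lemma is_syzygy_rst:
  fixes A :: "('k, 'a) module" and B :: "('k, 'b) module" and A' :: "('k, 'c) module" and B' :: "('k, 'd) module"
  assumes "\<And>P :: ('a, 'b, 'k vec) bimodule. pbim P K A B \<Longrightarrow> pbim (rst \<alpha> \<beta> P) K A' B'"
    "alg_hom K A' A \<alpha>" "alg_hom K B' B \<beta>" "fd_algebra K A" "fd_algebra K B" "fd_algebra K A'" "fd_algebra K B'"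
  shows "is_syzygy K A B n X Y \<Longrightarrow> is_syzygy K A' B' n (rst \<alpha> \<beta> X) (rst \<alpha> \<beta> Y)"
proof (induction n arbitrary: Y)
  case 0
  have "fbim Y K A B" using is_syzygy_fbim[OF 0 assms(4,5)] .
  then show ?case using 0 fbim_rst[OF _ assms(2,3,6,7)] iso_rst[OF _ assms(2,3)] by (auto simp: fbim_iff_fg)
next
  case (Suc n)
  then obtain Z where Z: "is_syzygy K A B n X Z" "omega K A B Z Y" "fbim Y K A B" using is_syzygy_Suc[OF assms(4,5)] by blast
  have "omega K A' B' (rst \<alpha> \<beta> Z) (rst \<alpha> \<beta> Y)" using Z(2) assms(1) sesx_rst[OF _ assms(2,3)] unfolding omega_def by blast
  then show ?case unfolding is_syzygy_Suc[OF assms(6,7)] using Suc.IH[OF Z(1)] fbim_rst[OF Z(3) assms(2,3,6,7)] by blast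
qed

lemma (in bim) stable_carrier: "stable_set (carrier X)" by (auto simp: stable_set_def)

lemma finite_proj_dim_syzygy:
  fixes X :: "('a, 'b, 'm) bimodule" and A :: "('k, 'a) module" and B :: "('k, 'b) module"
  assumes "finite_proj_dim_bimodule K A B X" "fbim X K A B"
  shows "\<exists>n (Y :: ('a, 'b, 'k vec) bimodule). is_syzygy K A B n X Y \<and> pbim Y K A B"
proof -
  have a: "fd_algebra K A" "fd_algebra K B" using assms(2) by (auto simp: fbim_iff_fg)
  obtain n and P :: "nat \<Rightarrow> ('a, 'b, 'k vec) bimodule" and d e where P: "\<forall>i. fg_projective_bimodule K A B (P i)"
    "\<forall>i>n. carrier (P i) = {\<zero>\<^bsub>P i\<^esub>}" "e \<in> bimod_hom A B (P 0) X" "e ` carrier (P 0) = carrier X"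
    "\<forall>i. d i \<in> bimod_hom A B (P (Suc i)) (P i)" "a_kernel (P 0) X e = d 0 ` carrier (P 1)"
    "\<forall>i. a_kernel (P (Suc i)) (P i) (d i) = d (Suc i) ` carrier (P (Suc (Suc i)))"
    using assms(1) unfolding finite_proj_dim_bimodule_def by (elim exE conjE)
  have pP: "pbim (P i) K A B" for i using P(1) a by (simp add: pbim_iff)
  have d: "bhom K A B (P (Suc i)) (P i) (d i)" for i using bhomI[OF pbim_bim[OF pP] pbim_bim[OF pP]] P(5) by blast
  define Z where "Z i = (P i)\<lparr>carrier := d i ` carrier (P (Suc i))\<rparr>" for i
  have st: "bim.stable_set (P (Suc i)) A B (carrier (P (Suc i)))" for i
    by (rule bim.stable_carrier[OF pbim_bim[OF pP]])
  have fZ: "fbim (Z i) K A B" for i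
    unfolding Z_def by (rule fbim.fbim_sub[OF pbim_fbim[OF pP] bhom.stable_image[OF d st]])
  have syz: "is_syzygy K A B (Suc i) X (Z i)" for i
  proof (induction i)
    case 0
    interpret X: fbim X K A B by fact
    obtain f g where f: "f \<in> bimod_hom A B X (enc A X)" "g \<in> bimod_hom A B (enc A X) X"
      "\<And>x. x \<in> carrier X \<Longrightarrow> g (f x) = x" "\<And>y. y \<in> carrier (enc A X) \<Longrightarrow> f (g y) = y" by (rule X.encE) blast
    interpret f: bhom K A B X "enc A X" f by (rule bhomI[OF X.bim_axioms fbim_bim[OF X.enc_fbim] f(1)])
    interpret e: bhom K A B "P 0" X e by (rule bhomI[OF pbim_bim[OF pP] X.bim_axioms P(3)])
    have fz: "f x = \<zero>\<^bsub>enc A X\<^esub> \<longleftrightarrow> x = \<zero>\<^bsub>X\<^esub>" if "x \<in> carrier X" for x using f(3)[of x] f(3)[of "\<zero>\<^bsub>X\<^esub>"] that f.zero by auto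
    have fe: "f \<circ> e \<in> bimod_hom A B (P 0) (enc A X)" by (rule bimod_hom_comp[OF P(3) f(1)])
    have s: "(f \<circ> e) ` carrier (P 0) = carrier (enc A X)"
      unfolding image_comp[symmetric] P(4) using f(4) bimod_hom_closed[OF f(2)] by force
    have "a_kernel (P 0) (enc A X) (f \<circ> e) = a_kernel (P 0) X e" using fz by (auto simp: a_kernel_def kernel_def)
    then have k: "(P 0)\<lparr>carrier := a_kernel (P 0) (enc A X) (f \<circ> e)\<rparr> = Z 0" using P(6) by (simp add: Z_def)
    have "is_syzygy K A B 0 X (enc A X)" using X.enc_fbim X.enc_iso by (simp add: fbim_iff_fg)
    then show ?case using fZ[of 0] fe s k bimod_iso_refl[of A B "Z 0"] P(1) unfolding is_syzygy.simps(2) fbim_iff_fg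
      by (metis k)
  next
    case (Suc i)
    have "d i \<in> bimod_hom A B (P (Suc i)) (Z i)" using P(5) by (auto simp: bimod_hom_iff Z_def)
    moreover have "d i ` carrier (P (Suc i)) = carrier (Z i)" by (simp add: Z_def)
    moreover have "a_kernel (P (Suc i)) (Z i) (d i) = a_kernel (P (Suc i)) (P i) (d i)" by (simp add: Z_def a_kernel_def kernel_def)
    then have "(P (Suc i))\<lparr>carrier := a_kernel (P (Suc i)) (Z i) (d i)\<rparr> = Z (Suc i)" using P(7) by (simp add: Z_def)
    ultimately show ?case using fZ[of "Suc i"] bimod_iso_refl[of A B "Z (Suc i)"] P(1) Suc unfolding is_syzygy.simps(2)[of K A B "Suc i"] fbim_iff_fg
      by metis
  qed
  have "carrier (Z n) = {\<zero>\<^bsub>Z n\<^esub>}" using P(2) bhom.zero[OF d[of n]] by (simp add: Z_def)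
  moreover have zb: "bim (zbim :: ('a, 'b, 'k vec) bimodule) K A B" by (rule pbim_bim[OF pbim_zbim[OF a]])
  interpret zb: bim "zbim :: ('a, 'b, 'k vec) bimodule" K A B by (rule zb)
  interpret Zn: bim "Z n" K A B by (rule fbim_bim[OF fZ])
  have cz: "carrier (zbim :: ('a, 'b, 'k vec) bimodule) = {\<zero>\<^bsub>zbim :: ('a, 'b, 'k vec) bimodule\<^esub>}" by (simp add: zbim_def)
  have "bimod_iso A B (zbim :: ('a, 'b, 'k vec) bimodule) (Z n)"
  proof (rule bimod_isoI[of "\<lambda>_. \<zero>\<^bsub>Z n\<^esub>" _ _ _ _ "\<lambda>_. \<zero>\<^bsub>zbim :: ('a, 'b, 'k vec) bimodule\<^esub>"])
    have "a \<odot>\<^bsub>Z n\<^esub> \<zero>\<^bsub>Z n\<^esub> = \<zero>\<^bsub>Z n\<^esub>" if "a \<in> carrier A" for a using Zn.l_closed[OF that Zn.zero_closed] calculation by simp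
    moreover have "rsmult (Z n) \<zero>\<^bsub>Z n\<^esub> a = \<zero>\<^bsub>Z n\<^esub>" if "a \<in> carrier B" for a
      using Zn.r_closed[OF that Zn.zero_closed] \<open>carrier (Z n) = {\<zero>\<^bsub>Z n\<^esub>}\<close> by simp
    ultimately show "(\<lambda>_. \<zero>\<^bsub>Z n\<^esub>) \<in> bimod_hom A B zbim (Z n)" by (auto simp: bimod_hom_iff)
  qed (use cz \<open>carrier (Z n) = {\<zero>\<^bsub>Z n\<^esub>}\<close> in auto)
  then have "pbim (Z n) K A B" by (rule pbim_iso[OF pbim_zbim[OF a] Zn.bim_axioms])
  then show ?thesis using syz by blast
qed


section \<open>The equivalence\<close>

lemma rst_rst [simp]: "rst \<alpha> \<beta> (rst \<gamma> \<delta> X) = rst (\<lambda>a. \<gamma> (\<alpha> a)) (\<lambda>b. \<delta> (\<beta> b)) X"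
  by (simp add: rst_def)

lemma rst_cong_iso:
  "\<lbrakk>\<And>a. a \<in> carrier A \<Longrightarrow> \<alpha> a = \<alpha>' a; \<And>b. b \<in> carrier B \<Longrightarrow> \<beta> b = \<beta>' b\<rbrakk> \<Longrightarrow> bimod_iso A B (rst \<alpha> \<beta> X) (rst \<alpha>' \<beta>' X)"
  by (rule bimod_isoI[of id _ _ _ _ id]) (auto simp: bimod_hom_iff)

context algebra_ideal
begin

abbreviation k where "k \<equiv> base_algebra K"

lemma fd_algebras: "fd_algebra K A" "fd_algebra K B" "fd_algebra K k" "field K"
  by (rule fd_algebra_axioms, rule fd_quotient, rule fd_base[OF field_K], rule field_K)

lemma alg_homs: "alg_hom K A A id" "alg_hom K B B id" "alg_hom K k k id" "alg_hom K A B proj" "alg_hom K k A (scal A)" "alg_hom K k B (scal B)"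
  by (rule alg_hom_id alg_hom_scal fd_algebras proj_alg_hom)+

definition E :: "('a set, 'a set, 'k vec) bimodule" where "E = enc B (regular_bimodule B)"

lemma E: "fbim E K B B" "bimod_iso B B (regular_bimodule B) E" "bim E K B B"
  using fbim.enc_fbim[OF fd_algebra.fbim_regular[OF fd_algebras(2)]] fbim.enc_iso[OF fd_algebra.fbim_regular[OF fd_algebras(2)]] fbim_bim by (auto simp: E_def)

definition L where "L i = (syz K A B ^^ i) (rst proj id E)"
definition P where "P i = fst (cover K A B (L i))"
definition eps where "eps i = snd (cover K A B (L i))"
definition L' where "L' i = (syz K B A ^^ i) (rst id proj E)"
definition P' where "P' i = fst (cover K B A (L' i))"

lemma L: "fbim (L i) K A B" "pbim (P i) K A B" "ses A B (L (Suc i)) id (P i) (eps i) (L i)" "is_syzygy K A B n (L 0) (L n)"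
  "L (Suc i) = (P i)\<lparr>carrier := a_kernel (P i) (L i) (eps i)\<rparr>" "L 0 = rst proj id E"
proof -
  have 0: "fbim (rst proj id E) K A B" by (rule fbim_rst[OF E(1) alg_homs(4,2) fd_algebras(1,2)])
  show 1: "fbim (L i) K A B" for i unfolding L_def by (rule fbim_syz[OF 0])
  have 2: "L (Suc i) = syz K A B (L i)" by (simp add: L_def)
  show "pbim (P i) K A B" "ses A B (L (Suc i)) id (P i) (eps i) (L i)"
    unfolding 2 P_def eps_def by (rule cover[OF 1])+
  show "is_syzygy K A B n (L 0) (L n)" using is_syzygy_syz[OF 0] by (simp add: L_def)
  show "L (Suc i) = (P i)\<lparr>carrier := a_kernel (P i) (L i) (eps i)\<rparr>" unfolding 2 by (simp add: syz_def P_def eps_def)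
  show "L 0 = rst proj id E" by (simp add: L_def)
qed

lemma L': "fbim (L' i) K B A" "pbim (P' i) K B A" "sesx B A (L' (Suc i)) (P' i) (L' i)" "is_syzygy K B A n (L' 0) (L' n)" "L' 0 = rst id proj E"
proof -
  have 0: "fbim (rst id proj E) K B A" by (rule fbim_rst[OF E(1) alg_homs(2,4) fd_algebras(2,1)])
  show 1: "fbim (L' i) K B A" for i unfolding L'_def by (rule fbim_syz[OF 0])
  have 2: "L' (Suc i) = syz K B A (L' i)" by (simp add: L'_def)
  show "pbim (P' i) K B A" unfolding P'_def by (rule cover(1)[OF 1])
  show "sesx B A (L' (Suc i)) (P' i) (L' i)" unfolding sesx_def 2 P'_def using cover(5)[OF 1] by blast
  show "is_syzygy K B A n (L' 0) (L' n)" using is_syzygy_syz[OF 0] by (simp add: L'_def)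
  show "L' 0 = rst id proj E" by (simp add: L'_def)
qed

lemma L_sesx: "sesx A B (L (Suc i)) (P i) (L i)" using L(3) unfolding sesx_def by blast

lemmas bL = L(1)[THEN fbim_bim] and bP = L(2)[THEN pbim_bim] and bL' = L'(1)[THEN fbim_bim] and bP' = L'(2)[THEN pbim_bim]

abbreviation I where "I \<equiv> enc A (ideal_bimodule A J)"
abbreviation R where "R \<equiv> enc A (regular_bimodule A)"
abbreviation V where "V \<equiv> rst proj proj E"

lemma fbim_ideal: "fbim (ideal_bimodule A J) K A A"
proof -
  interpret RA: fbim "regular_bimodule A" K A A by (rule fbim_regular)
  have "RA.stable_set J"
    using J.Icarr J.a_closed J.I_l_closed J.I_r_closed J.zero_closed unfolding RA.stable_set_def by (auto simp: regular_bimodule_def)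
  then show ?thesis unfolding ideal_bimodule_def by (rule RA.fbim_sub)
qed

lemma fbim_base: "fbim I K A A" "fbim R K A A" "fbim V K A A"
  by (rule fbim.enc_fbim[OF fbim_ideal], rule fbim.enc_fbim[OF fbim_regular], rule fbim_rst[OF E(1) alg_homs(4,4) fd_algebras(1,1)])

lemma base_sesx: "sesx A A I R V"
proof -
  let ?Q = "rst proj proj (regular_bimodule B)"
  have bQ: "bim ?Q K A A" by (rule bim_rst[OF fd_algebra.bim_regular[OF fd_algebras(2)] alg_homs(4,4) fd_algebras(1,1)])
  note h = alg_homD[OF alg_homs(4)]
  have J0: "proj x = J \<longleftrightarrow> x \<in> J" if "x \<in> carrier A" for x
    using proj_eq_iff[OF that ring.ring_simprules(2)[OF ring_A]] A.a_rcos_zero[OF J.ideal_axioms J.zero_closed] that by simp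
  have "ses A A (ideal_bimodule A J) id (regular_bimodule A) proj ?Q"
    unfolding ses_def
  proof (intro conjI)
    show "id \<in> bimod_hom A A (ideal_bimodule A J) (regular_bimodule A)"
      using J.Icarr by (auto simp: bimod_hom_iff ideal_bimodule_def)
    show "proj \<in> bimod_hom A A (regular_bimodule A) ?Q"
      using h by (auto simp: bimod_hom_iff regular_bimodule_def)
    show "proj ` carrier (regular_bimodule A) = carrier ?Q" by (simp add: quotient_simps)
    show "id ` carrier (ideal_bimodule A J) = a_kernel (regular_bimodule A) ?Q proj"
    proof -
      have "a_kernel (regular_bimodule A) ?Q proj = {x \<in> carrier A. proj x = J}" by (simp add: a_kernel_def kernel_def quotient_simps)
      also have "\<dots> = {x \<in> carrier A. x \<in> J}" using J0 by (simp cong: conj_cong)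
      also have "\<dots> = J" using J.Icarr by blast
      finally show ?thesis by (simp add: ideal_bimodule_def)
    qed
  qed simp
  then have "sesx A A (ideal_bimodule A J) (regular_bimodule A) ?Q" unfolding sesx_def by blast
  then show ?thesis
    by (rule sesx_iso3[OF _ fbim_bim[OF fbim_ideal] bim_regular bQ fbim_base[THEN fbim_bim] fbim.enc_iso[OF fbim_ideal] fbim.enc_iso[OF fbim_regular]
          iso_rst[OF E(2) alg_homs(4,4)]])
qed

lemma tensor_epi_E:
  assumes "bim X K B T"
  shows "bimod_iso B T (tensor A (rst id proj (regular_bimodule B)) (rst proj id X)) X"
  by (rule tensor_epi[OF assms alg_homs(4) fd_algebras(1)]) (simp add: quotient_simps)

lemma truncate_simps [simp]:
  "carrier (module.truncate X) = carrier X" "zero (module.truncate X) = zero X" "add (module.truncate X) = add X"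
  "smult (module.truncate X) = smult X"
  by (simp_all add: module.truncate_def)

lemma mod_hom_truncate [simp]: "mod_hom S (module.truncate X) (module.truncate Y) = mod_hom S X Y"
  by (auto simp: mod_hom_iff)

lemma fg_module_truncate: "fg_module S X \<Longrightarrow> fg_module S (module.truncate X)"
proof -
  assume X: "fg_module S X"
  have "left_module S (module.truncate X) \<longleftrightarrow> left_module S X"
    unfolding left_module_def left_module_axioms_def using abelian_group_cong[of "module.truncate X" X] by simp
  moreover have "submodule H S (module.truncate X) \<longleftrightarrow> submodule H S X" for H
    using a_inv_cong[of "module.truncate X" X] unfolding submodule_def submodule_axioms_def subgroup_def by (simp add: a_inv_def)
  ultimately show ?thesis using X unfolding fg_module_def fin_gen_def by simp
qed

lemma relative_resolution:
  "relative_resolution K A J (\<lambda>i. module.truncate (P i)) (\<lambda>i. module.truncate (L i)) eps (module.truncate E)"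
proof
  have c: "fg_projective S P \<Longrightarrow> fg_projective S (module.truncate P)" for S :: "('k, 'x) module" and P :: "('x, 'y, 'm) bimodule"
    by (rule fg_projective_cong[of P]) simp_all
  have "pbim (left_restrict B E) K B k"
    by (rule pbim_iso[OF pbim_regular_left[OF fd_algebras(2)] bim_rst[OF E(3) alg_homs(2,6) fd_algebras(2,3)] iso_rst[OF E(2) alg_homs(2,6)]])
  then show "fg_projective B (module.truncate E)" by (intro c fg_projective_left[OF E(1)])
  show "fg_projective A (module.truncate (P j))" for j
    by (intro c fg_projective_left[OF pbim_fbim[OF L(2)]] pbim_left_restrict[OF L(2)])
  show "fg_module A (module.truncate (L j))" for j by (rule fg_module_truncate[OF fbim.fg_module[OF L(1)]])
  show "eps j \<in> mod_hom A (module.truncate (P j)) (module.truncate (L j))" for j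
    using L(3)[of j] by (auto simp: ses_def bimod_hom_def)
  show "eps j ` carrier (module.truncate (P j)) = carrier (module.truncate (L j))" for j using L(3)[of j] by (simp add: ses_def)
  show "module.truncate (L 0) = restrict_module A J (module.truncate E)"
    by (simp add: L(6) module.truncate_def rst_def restrict_module_def)
  show "module.truncate (L (Suc j)) = (module.truncate (P j))\<lparr>carrier := a_kernel (module.truncate (P j)) (module.truncate (L j)) (eps j)\<rparr>" for j
    by (simp add: L(5) module.truncate_def a_kernel_def kernel_def)
qed

text \<open>Base change of the resolution of \<open>B\<close> along \<open>A \<rightarrow> B\<close> stays exact, because the homomorphism
  \<open>x \<mapsto> 1 \<otimes> x\<close> to a \<open>B\<close>-module extends from each syzygy to the projective containing it.\<close>

lemma base_change_sesx:
  assumes "homological_ideal A J"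
  defines "W \<equiv> rst id proj (regular_bimodule B)"
  shows "sesx B B (tensor A W (L (Suc i))) (tensor A W (P i)) (tensor A W (L i))"
proof -
  interpret RR: relative_resolution K A J "\<lambda>i. module.truncate (P i)" "\<lambda>i. module.truncate (L i)" eps "module.truncate E"
    by (rule relative_resolution)
  have fW: "fbim W K B A" unfolding W_def by (rule fbim_rst[OF fd_algebra.fbim_regular[OF fd_algebras(2)] alg_homs(2,4) fd_algebras(2,1)])
  note bW = fbim_bim[OF fW]
  show ?thesis
  proof (rule tensor_sesx[OF L(3) bW bL bP bL])
    fix h t
    assume h: "h \<in> bimod_hom B B (tensor A W (L (Suc i))) (tensor A W (P i))"
      and ht: "\<And>x y. \<lbrakk>x \<in> carrier W; y \<in> carrier (L (Suc i))\<rbrakk> \<Longrightarrow> h (tens A W (L (Suc i)) x y) = tens A W (P i) x (id y)"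
      and t: "t \<in> carrier (tensor A W (L (Suc i)))" "h t = \<zero>\<^bsub>tensor A W (P i)\<^esub>"
    interpret Z: tensor_pair K B A B W "L (Suc i)" by (rule tensor_pairI[OF bW bL])
    interpret Q: tensor_pair K B A B W "P i" by (rule tensor_pairI[OF bW bP])
    interpret h: bhom K B B Z.MN Q.MN h by (rule bhomI[OF Z.MN.bim_axioms Q.MN.bim_axioms h])
    interpret ZZ: fbim Z.MN K B B by (rule fbim_tensor[OF fW L(1)])
    obtain en de where en: "en \<in> bimod_hom B B Z.MN (enc B Z.MN)" "de \<in> bimod_hom B B (enc B Z.MN) Z.MN"
      "\<And>x. x \<in> carrier Z.MN \<Longrightarrow> de (en x) = x" by (rule ZZ.encE) blast
    let ?Y = "enc B Z.MN"
    interpret Y: fbim ?Y K B B by (rule ZZ.enc_fbim)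
    interpret en: bhom K B B Z.MN ?Y en by (rule bhomI[OF Z.MN.bim_axioms Y.bim_axioms en(1)])
    have cW: "carrier W = carrier B" by (simp add: W_def)
    have one: "\<one>\<^bsub>B\<^esub> \<in> carrier W" using fd_algebra.ring_A[OF fd_algebras(2)] by (simp add: cW ring.ring_simprules(6))
    have W: "b \<odot>\<^bsub>W\<^esub> b' = b \<otimes>\<^bsub>B\<^esub> b'" "rsmult W b a = b \<otimes>\<^bsub>B\<^esub> proj a" "b \<oplus>\<^bsub>W\<^esub> b' = b \<oplus>\<^bsub>B\<^esub> b'" for b b' a by (simp_all add: W_def)
    note Br = fd_algebra.ring_A[OF fd_algebras(2)]
    have bal: "Z.tens (b \<otimes>\<^bsub>B\<^esub> proj a) y = Z.tens b (a \<odot>\<^bsub>L (Suc i)\<^esub> y)" if "b \<in> carrier B" "a \<in> carrier A" "y \<in> carrier (L (Suc i))" for b a y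
      using Z.tens_bal[of b a y] that by (simp add: cW W)
    let ?h = "\<lambda>x. en (Z.tens \<one>\<^bsub>B\<^esub> x)"
    have hh: "?h \<in> mod_hom A (module.truncate (L (Suc i))) (restrict_module A J (module.truncate ?Y))"
      unfolding mod_hom_iff
    proof (intro conjI ballI)
      fix a x assume a: "a \<in> carrier A" and x: "x \<in> carrier (module.truncate (L (Suc i)))"
      have pa: "proj a \<in> carrier B" by (rule proj_closed[OF a])
      have "Z.tens \<one>\<^bsub>B\<^esub> (a \<odot>\<^bsub>L (Suc i)\<^esub> x) = Z.tens (\<one>\<^bsub>B\<^esub> \<otimes>\<^bsub>B\<^esub> proj a) x" using bal[of "\<one>\<^bsub>B\<^esub>" a x] a x one cW by simp
      also have "\<dots> = Z.tens (proj a \<odot>\<^bsub>W\<^esub> \<one>\<^bsub>B\<^esub>) x" using pa monoid.l_one[OF ring.is_monoid[OF Br] pa] monoid.r_one[OF ring.is_monoid[OF Br] pa] by (simp add: W)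
      also have "\<dots> = proj a \<odot>\<^bsub>Z.MN\<^esub> Z.tens \<one>\<^bsub>B\<^esub> x" using Z.tens_left[OF pa] by simp
      finally show "?h (a \<odot>\<^bsub>module.truncate (L (Suc i))\<^esub> x) = a \<odot>\<^bsub>restrict_module A J (module.truncate ?Y)\<^esub> ?h x"
        using pa x one by simp
    qed (use one in \<open>auto simp: Z.tens_add2\<close>)
    have fgY: "fg_module B (module.truncate ?Y)" by (rule fg_module_truncate[OF Y.fg_module])
    obtain \<theta> where \<theta>: "\<theta> \<in> mod_hom A (module.truncate (P i)) (restrict_module A J (module.truncate ?Y))"
      "\<And>x. x \<in> carrier (L (Suc i)) \<Longrightarrow> \<theta> x = ?h x" using RR.extension[OF assms(1) fgY hh] by auto
    have \<theta>c: "\<And>x. x \<in> carrier (P i) \<Longrightarrow> \<theta> x \<in> carrier ?Y"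
      "\<And>x y. \<lbrakk>x \<in> carrier (P i); y \<in> carrier (P i)\<rbrakk> \<Longrightarrow> \<theta> (x \<oplus>\<^bsub>P i\<^esub> y) = \<theta> x \<oplus>\<^bsub>?Y\<^esub> \<theta> y"
      "\<And>a x. \<lbrakk>a \<in> carrier A; x \<in> carrier (P i)\<rbrakk> \<Longrightarrow> \<theta> (a \<odot>\<^bsub>P i\<^esub> x) = proj a \<odot>\<^bsub>?Y\<^esub> \<theta> x"
      using mod_homD[OF \<theta>(1)] by auto
    have G: "comm_group (add_monoid ?Y)" by (rule Y.a_comm_group)
    have "\<exists>\<rho>. (\<forall>t\<in>carrier Q.MN. \<rho> t \<in> carrier (add_monoid ?Y)) \<and>
      (\<forall>s\<in>carrier Q.MN. \<forall>t\<in>carrier Q.MN. \<rho> (s \<oplus>\<^bsub>Q.MN\<^esub> t) = \<rho> s \<otimes>\<^bsub>add_monoid ?Y\<^esub> \<rho> t) \<and>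
      (\<forall>x\<in>carrier W. \<forall>y\<in>carrier (P i). \<rho> (Q.tens x y) = x \<odot>\<^bsub>?Y\<^esub> \<theta> y)"
      by (rule Q.tensor_universal[OF G]) (auto simp: cW W \<theta>c Y.l_add2 Y.l_assoc proj_closed Y.l_add1)
    then obtain \<rho> where "\<forall>t\<in>carrier Q.MN. \<rho> t \<in> carrier ?Y"
      "\<forall>s\<in>carrier Q.MN. \<forall>t\<in>carrier Q.MN. \<rho> (s \<oplus>\<^bsub>Q.MN\<^esub> t) = \<rho> s \<oplus>\<^bsub>?Y\<^esub> \<rho> t"
      "\<forall>x\<in>carrier W. \<forall>y\<in>carrier (P i). \<rho> (Q.tens x y) = x \<odot>\<^bsub>?Y\<^esub> \<theta> y" by auto
    then have \<rho>: "\<And>t. t \<in> carrier Q.MN \<Longrightarrow> \<rho> t \<in> carrier ?Y"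
      "\<And>s t. \<lbrakk>s \<in> carrier Q.MN; t \<in> carrier Q.MN\<rbrakk> \<Longrightarrow> \<rho> (s \<oplus>\<^bsub>Q.MN\<^esub> t) = \<rho> s \<oplus>\<^bsub>?Y\<^esub> \<rho> t"
      "\<And>x y. \<lbrakk>x \<in> carrier W; y \<in> carrier (P i)\<rbrakk> \<Longrightarrow> \<rho> (Q.tens x y) = x \<odot>\<^bsub>?Y\<^esub> \<theta> y" by blast+
    have \<rho>0: "\<rho> \<zero>\<^bsub>Q.MN\<^esub> = \<zero>\<^bsub>?Y\<^esub>"
      using \<rho>(2)[of "\<zero>\<^bsub>Q.MN\<^esub>" "\<zero>\<^bsub>Q.MN\<^esub>"] \<rho>(1)[of "\<zero>\<^bsub>Q.MN\<^esub>"] Y.add.l_cancel_one[of "\<rho> \<zero>\<^bsub>Q.MN\<^esub>" "\<rho> \<zero>\<^bsub>Q.MN\<^esub>"] by simp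
    have LP: "y \<in> carrier (P i)" if "y \<in> carrier (L (Suc i))" for y using that by (simp add: L(5) a_kernel_def kernel_def)
    have "\<rho> (h s) = en s" if "s \<in> carrier Z.MN" for s
      using that
    proof (induction s rule: Z.tensor_induct)
      case zero show ?case by (simp only: h.zero en.zero \<rho>0)
    next
      case (tens b y)
      have b: "b \<in> carrier B" using tens cW by simp
      have "\<rho> (h (Z.tens b y)) = b \<odot>\<^bsub>?Y\<^esub> en (Z.tens \<one>\<^bsub>B\<^esub> y)" using ht[OF tens] \<rho>(3)[OF tens(1) LP[OF tens(2)]] \<theta>(2)[OF tens(2)] by simp
      also have "\<dots> = en (b \<odot>\<^bsub>Z.MN\<^esub> Z.tens \<one>\<^bsub>B\<^esub> y)" using b one tens by simp
      also have "b \<odot>\<^bsub>Z.MN\<^esub> Z.tens \<one>\<^bsub>B\<^esub> y = Z.tens (b \<odot>\<^bsub>W\<^esub> \<one>\<^bsub>B\<^esub>) y" by (rule Z.tens_left[OF b])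
      also have "b \<odot>\<^bsub>W\<^esub> \<one>\<^bsub>B\<^esub> = b" using monoid.r_one[OF ring.is_monoid[OF Br] b] by (simp add: W)
      finally show ?case .
    next
      case (add s t) then show ?case using \<rho>(2) by simp
    qed
    then have "en t = \<zero>\<^bsub>?Y\<^esub>" using t \<rho>0 by metis
    then have "de (en t) = de (en \<zero>\<^bsub>Z.MN\<^esub>)" by simp
    then show "t = \<zero>\<^bsub>tensor A W (L (Suc i))\<^esub>" using en(3)[OF t(1)] en(3)[OF Z.MN.zero_closed] by simp
  qed
qed

end


context algebra_ideal
begin

lemma L_right_projective: "pbim (right_restrict A (L i)) K k B"
proof (induction i)
  case 0
  have "pbim (right_restrict B E) K k B"
    by (rule pbim_iso[OF pbim_regular_right[OF fd_algebras(2)] bim_rst[OF E(3) alg_homs(6,2) fd_algebras(3,2)] iso_rst[OF E(2) alg_homs(6,2)]])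
  moreover have "bimod_iso k B (right_restrict B E) (right_restrict A (L 0))"
    unfolding L(6) rst_rst by (rule rst_cong_iso) (simp_all add: alg_homD[OF alg_homs(4)])
  ultimately show ?case by (rule pbim_iso[OF _ bim.bim_right_restrict[OF bL]])
next
  case (Suc i)
  show ?case
    by (rule sesx_kernel_proj[OF fd_algebras(3,2) sesx_rst[OF L_sesx alg_homs(5,2)] pbim_right_restrict[OF L(2)] Suc bim.bim_right_restrict[OF bL]])
qed

lemma L'_left_projective: "pbim (left_restrict A (L' i)) K B k"
proof (induction i)
  case 0
  have "pbim (left_restrict B E) K B k"
    by (rule pbim_iso[OF pbim_regular_left[OF fd_algebras(2)] bim_rst[OF E(3) alg_homs(2,6) fd_algebras(2,3)] iso_rst[OF E(2) alg_homs(2,6)]])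
  moreover have "bimod_iso B k (left_restrict B E) (left_restrict A (L' 0))"
    unfolding L'(5) rst_rst by (rule rst_cong_iso) (simp_all add: alg_homD[OF alg_homs(4)])
  ultimately show ?case by (rule pbim_iso[OF _ bim.bim_left_restrict[OF bL']])
next
  case (Suc i)
  show ?case
    by (rule sesx_kernel_proj[OF fd_algebras(2,3) sesx_rst[OF L'(3) alg_homs(2,5)] pbim_left_restrict[OF L'(2)] Suc bim.bim_left_restrict[OF bL']])
qed

lemma pbim_R_left: "pbim (left_restrict A R) K A k"
  by (rule pbim_iso[OF pbim_regular_left[OF fd_algebras(1)] bim.bim_left_restrict[OF fbim_bim[OF fbim_base(2)]] iso_rst[OF fbim.enc_iso[OF fbim_regular] alg_homs(1,5)]])

lemma pbim_R_right: "pbim (right_restrict A R) K k A"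
  by (rule pbim_iso[OF pbim_regular_right[OF fd_algebras(1)] bim.bim_right_restrict[OF fbim_bim[OF fbim_base(2)]] iso_rst[OF fbim.enc_iso[OF fbim_regular] alg_homs(5,1)]])

lemma L_left_projective:
  assumes "is_syzygy K A A p I Y" "pbim Y K A A" shows "pbim (left_restrict B (L (Suc p))) K A k"
proof -
  have f: "fbim (left_restrict A I) K A k" "fbim (left_restrict A V) K A k"
    by (rule fbim_rst[OF fbim_base(1) alg_homs(1,5) fd_algebras(1,3)], rule fbim_rst[OF fbim_base(3) alg_homs(1,5) fd_algebras(1,3)])
  have "is_syzygy K A k p (left_restrict A I) (left_restrict A Y)"
    by (rule is_syzygy_rst[OF pbim_left_restrict alg_homs(1,5) fd_algebras(1,1,1,3) assms(1)])
  moreover have "omega K A k (left_restrict A V) (left_restrict A I)"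
    unfolding omega_def using pbim_R_left sesx_rst[OF base_sesx alg_homs(1,5)] by blast
  ultimately have 1: "is_syzygy K A k (Suc p) (left_restrict A V) (left_restrict A Y)"
    using is_syzygy_Suc_left[OF fd_algebras(1,3) _ f(2,1)] by blast
  have "bimod_iso A k (left_restrict B (L 0)) (left_restrict A V)"
    unfolding L(6) rst_rst by (rule rst_cong_iso) (simp_all add: alg_homD[OF alg_homs(4)])
  then have 2: "is_syzygy K A k (Suc p) (left_restrict B (L 0)) (left_restrict A Y)"
    by (rule is_syzygy_iso_source[OF fd_algebras(1,3) _ 1])
  have 3: "is_syzygy K A k (Suc p) (left_restrict B (L 0)) (left_restrict B (L (Suc p)))"
    by (rule is_syzygy_rst[OF pbim_left_restrict alg_homs(1,6) fd_algebras(1,2,1,3) L(4)])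
  show ?thesis by (rule is_syzygy_proj[OF fd_algebras(1,3) 2 pbim_left_restrict[OF assms(2)] 3 fbim_rst[OF L(1) alg_homs(1,6) fd_algebras(1,3)]])
qed

lemma L'_right_projective:
  assumes "is_syzygy K A A p I Y" "pbim Y K A A" shows "pbim (right_restrict B (L' (Suc p))) K k A"
proof -
  have f: "fbim (right_restrict A I) K k A" "fbim (right_restrict A V) K k A"
    by (rule fbim_rst[OF fbim_base(1) alg_homs(5,1) fd_algebras(3,1)], rule fbim_rst[OF fbim_base(3) alg_homs(5,1) fd_algebras(3,1)])
  have "is_syzygy K k A p (right_restrict A I) (right_restrict A Y)"
    by (rule is_syzygy_rst[OF pbim_right_restrict alg_homs(5,1) fd_algebras(1,1,3,1) assms(1)])
  moreover have "omega K k A (right_restrict A V) (right_restrict A I)"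
    unfolding omega_def using pbim_R_right sesx_rst[OF base_sesx alg_homs(5,1)] by blast
  ultimately have 1: "is_syzygy K k A (Suc p) (right_restrict A V) (right_restrict A Y)"
    using is_syzygy_Suc_left[OF fd_algebras(3,1) _ f(2,1)] by blast
  have "bimod_iso k A (right_restrict B (L' 0)) (right_restrict A V)"
    unfolding L'(5) rst_rst by (rule rst_cong_iso) (simp_all add: alg_homD[OF alg_homs(4)])
  then have 2: "is_syzygy K k A (Suc p) (right_restrict B (L' 0)) (right_restrict A Y)"
    by (rule is_syzygy_iso_source[OF fd_algebras(3,1) _ 1])
  have 3: "is_syzygy K k A (Suc p) (right_restrict B (L' 0)) (right_restrict B (L' (Suc p)))"
    by (rule is_syzygy_rst[OF pbim_right_restrict alg_homs(6,1) fd_algebras(2,1,3,1) L'(4)])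
  show ?thesis by (rule is_syzygy_proj[OF fd_algebras(3,1) 2 pbim_right_restrict[OF assms(2)] 3 fbim_rst[OF L'(1) alg_homs(6,1) fd_algebras(3,1)]])
qed

abbreviation RA where "RA X \<equiv> rst id proj X"

lemma tensor_L'_0:
  assumes "bim X K A B" shows "bimod_iso A A (RA X) (tensor B X (L' 0))"
proof -
  have "bimod_iso B A (RA (regular_bimodule B)) (L' 0)" unfolding L'(5) by (rule iso_rst[OF E(2) alg_homs(2,4)])
  then have "bimod_iso A A (tensor B X (RA (regular_bimodule B))) (tensor B X (L' 0))"
    by (rule tensor_iso2[OF assms bim_rst[OF fd_algebra.bim_regular[OF fd_algebras(2)] alg_homs(2,4) fd_algebras(2,1)] bL'])
  then show ?thesis
    using bimod_iso_trans[OF bimod_iso_sym[OF tensor_unit_right[OF assms alg_homs(4) fd_algebras(1)]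
      bim_tensor[OF assms bim_rst[OF fd_algebra.bim_regular[OF fd_algebras(2)] alg_homs(2,4) fd_algebras(2,1)]]]] by blast
qed

lemma tensor_syzygy_left:
  assumes "fbim X K A B" "pbim (left_restrict B X) K A k" "pbim (right_restrict A X) K k B"
  shows "is_syzygy K A A n (RA X) (enc A (tensor B X (L' n)))"
proof -
  note b = fbim_bim[OF assms(1)]
  have "is_syzygy K A A n (tensor B X (L' 0)) (enc A (tensor B X (L' n)))"
    by (rule sesx_chain_syzygy[where G = "\<lambda>i. tensor B X (P' i)"])
      (rule fbim_tensor[OF assms(1) L'(1)] pbim_tensor[OF assms(1,2) L'(2)] tensor_flat[OF L'(3) b assms(3) bL' bP' bL'])+
  then show ?thesis by (rule is_syzygy_iso_source[OF fd_algebras(1,1) tensor_L'_0[OF b]])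
qed

lemma restrict_projective_syzygy:
  assumes "is_syzygy K A A p I Y" "pbim Y K A A" "pbim X K A B"
  shows "\<exists>Z. is_syzygy K A A (Suc p) (RA X) Z \<and> pbim Z K A A"
proof -
  note f = pbim_fbim[OF assms(3)]
  have T: "fbim (tensor B X (L' (Suc p))) K A A" by (rule fbim_tensor[OF f L'(1)])
  have "pbim (tensor B X (L' (Suc p))) K A A"
    by (rule pbim_tensor_right[OF L'(1) L'_right_projective[OF assms(1,2)] assms(3)])
  then have "pbim (enc A (tensor B X (L' (Suc p)))) K A A"
    by (rule pbim_iso[OF _ fbim_bim[OF fbim.enc_fbim[OF T]] fbim.enc_iso[OF T]])
  then show ?thesis using tensor_syzygy_left[OF f pbim_left_restrict[OF assms(3)] pbim_right_restrict[OF assms(3)]] by blast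
qed

lemma syzygy_shift:
  assumes "is_syzygy K A A p I Y" "pbim Y K A A"
  shows "\<lbrakk>is_syzygy K A A (Suc p) (RA (L i)) U; is_syzygy K A A (Suc p + i) (RA (L 0)) U'\<rbrakk> \<Longrightarrow> stab K A A U U'"
proof (induction i arbitrary: U U')
  case 0
  have f: "fbim (RA (L 0)) K A A" by (rule fbim_rst[OF L(1) alg_homs(1,4) fd_algebras(1,1)])
  show ?case by (rule is_syzygy_stab[OF fd_algebras(1,1) 0(1) 0(2)[unfolded add_0_right] stab_refl[OF fd_algebras(1,1) fbim_bim[OF f]] f f])
next
  case (Suc i)
  have f: "fbim (RA (L j)) K A A" for j by (rule fbim_rst[OF L(1) alg_homs(1,4) fd_algebras(1,1)])
  have fP: "fbim (RA (P i)) K A A" by (rule fbim_rst[OF pbim_fbim[OF L(2)] alg_homs(1,4) fd_algebras(1,1)])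
  obtain Z where Z: "is_syzygy K A A (Suc p) (RA (P i)) Z" "pbim Z K A A"
    using restrict_projective_syzygy[OF assms L(2)] by blast
  define V0 where "V0 = (syz K A A ^^ Suc p) (RA (L i))"
  have V0: "is_syzygy K A A (Suc p) (RA (L i)) V0" "fbim V0 K A A" unfolding V0_def by (rule is_syzygy_syz[OF f], rule fbim_syz[OF f])
  have V1: "omega K A A V0 (syz K A A V0)" "fbim (syz K A A V0) K A A" using cover(4,6)[OF V0(2)] by blast+
  have V1': "is_syzygy K A A (Suc (Suc p)) (RA (L i)) (syz K A A V0)" by (rule is_syzygy_SucI[OF fd_algebras(1,1) V0(1) V1])
  have s1: "stab K A A U (syz K A A V0)"
    by (rule ses_syzygy_shift[OF fd_algebras(1,1) sesx_rst[OF L_sesx alg_homs(1,4)] f f fP Z Suc.prems(1) V1'])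
  have "is_syzygy K A A (Suc (Suc p + i)) (RA (L 0)) U'" using Suc.prems(2) by (simp only: add_Suc_right add_Suc)
  then obtain U2 where U2: "is_syzygy K A A (Suc p + i) (RA (L 0)) U2" "omega K A A U2 U'" "fbim U' K A A"
    using is_syzygy_Suc[OF fd_algebras(1,1)] by blast
  have fU: "fbim U2 K A A" "fbim U K A A" using is_syzygy_fbim[OF U2(1) fd_algebras(1,1)] is_syzygy_fbim[OF Suc.prems(1) fd_algebras(1,1)] .
  have "stab K A A V0 U2" by (rule Suc.IH[OF V0(1) U2(1)])
  then have "stab K A A (syz K A A V0) U'"
    by (rule schanuel[OF fd_algebras(1,1) V1(1) U2(2) _ V0(2)[THEN fbim_bim] fU(1)[THEN fbim_bim] V1(2)[THEN fbim_bim] U2(3)[THEN fbim_bim]])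
  then show ?case by (rule stab_trans[OF s1 _ fU(2)[THEN fbim_bim] V1(2)[THEN fbim_bim] U2(3)[THEN fbim_bim]])
qed

lemma bimodule_side_A:
  assumes "is_syzygy K A A p I Y" "pbim Y K A A"
  defines "m \<equiv> Suc p"
  shows "\<exists>Z. is_syzygy K A A (m + m) (regular_bimodule A) Z \<and> stably_iso K A A (tensor B (L m) (L' m)) Z"
proof -
  let ?T = "tensor B (L m) (L' m)"
  have T: "fbim ?T K A A" by (rule fbim_tensor[OF L(1) L'(1)])
  define R1 where "R1 = (syz K A A ^^ m) R"
  define R2 where "R2 = (syz K A A ^^ m) R1"
  define V1 where "V1 = (syz K A A ^^ m) V"
  define V2 where "V2 = (syz K A A ^^ m) V1"
  note f1 = fbim_syz[OF fbim_base(2), of m, folded R1_def] fbim_syz[OF fbim_base(3), of m, folded V1_def]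
  note f2 = fbim_syz[OF f1(1), of m, folded R2_def] fbim_syz[OF f1(2), of m, folded V2_def]
  note s1 = is_syzygy_syz[OF fbim_base(2), of m, folded R1_def] is_syzygy_syz[OF fbim_base(3), of m, folded V1_def]
  note s2 = is_syzygy_syz[OF f1(1), of m, folded R2_def] is_syzygy_syz[OF f1(2), of m, folded V2_def]
  have "stab K A A R1 V1"
    using ses_syzygy_quotient[OF fd_algebras(1,1) base_sesx fbim_base(2,3,1) assms(1,2)] s1 unfolding m_def by blast
  then have st: "stab K A A R2 V2" by (rule is_syzygy_stab[OF fd_algebras(1,1) s2 _ f1])
  have RL: "RA (L 0) = V" unfolding L(6) rst_rst by (simp add: rst_def)
  have "is_syzygy K A A m (RA (L m)) (enc A ?T)"
    using tensor_syzygy_left[OF L(1) L_left_projective[OF assms(1,2)] L_right_projective] unfolding m_def .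
  moreover have "is_syzygy K A A (m + m) (RA (L 0)) V2" unfolding RL by (rule is_syzygy_trans[OF fd_algebras(1,1) s1(2) s2(2)])
  ultimately have "stab K A A (enc A ?T) V2" using syzygy_shift[OF assms(1,2)] unfolding m_def by blast
  then have "stab K A A (enc A ?T) R2"
    using stab_trans[OF _ stab_sym[OF st fbim_bim[OF f2(1)]]] fbim.enc_fbim[OF T] f2 fbim_bim by blast
  then have "stably_iso K A A ?T R2"
    by (rule stab_stably_iso[OF _ fbim.enc_iso[OF T] T fbim.enc_fbim[OF T] f2(1)])
  moreover have "is_syzygy K A A (m + m) (regular_bimodule A) R2"
    by (rule is_syzygy_iso_source[OF fd_algebras(1,1) fbim.enc_iso[OF fbim_regular] is_syzygy_trans[OF fd_algebras(1,1) s1(1) s2(1)]])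
  ultimately show ?thesis by blast
qed

lemma bimodule_side_B:
  assumes "homological_ideal A J" "is_syzygy K A A p I Y" "pbim Y K A A"
  defines "m \<equiv> Suc p"
  shows "\<exists>Z. is_syzygy K B B (m + m) (regular_bimodule B) Z \<and> stably_iso K B B (tensor A (L' m) (L m)) Z"
proof -
  let ?T = "tensor A (L' m) (L m)" and ?W = "RA (regular_bimodule B)"
  have T: "fbim ?T K B B" by (rule fbim_tensor[OF L'(1) L(1)])
  have fW: "fbim ?W K B A" by (rule fbim_rst[OF fd_algebra.fbim_regular[OF fd_algebras(2)] alg_homs(2,4) fd_algebras(2,1)])
  note bW = fbim_bim[OF fW]
  have bl: "bim (left_restrict A ?W) K B k" by (rule bim.bim_left_restrict[OF bW])
  have "bimod_iso B k (left_restrict B (regular_bimodule B)) (left_restrict A ?W)"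
    unfolding rst_rst by (rule rst_cong_iso) (simp_all add: alg_homD[OF alg_homs(4)])
  then have pW: "pbim (left_restrict A ?W) K B k" by (rule pbim_iso[OF pbim_regular_left[OF fd_algebras(2)] bl])
  have 1: "is_syzygy K B B m (tensor A ?W (L 0)) (enc B (tensor A ?W (L m)))"
    by (rule sesx_chain_syzygy[where G = "\<lambda>i. tensor A ?W (P i)"])
      (rule fbim_tensor[OF fW L(1)] pbim_tensor[OF fW pW L(2)] base_change_sesx[OF assms(1)])+
  have 2: "is_syzygy K B B m (tensor A (L' 0) (L m)) (enc B ?T)"
    by (rule sesx_chain_syzygy[where F = "\<lambda>i. tensor A (L' i) (L m)" and G = "\<lambda>i. tensor A (P' i) (L m)"])
      (unfold m_def, (rule fbim_tensor[OF L'(1) L(1)] pbim_tensor_right[OF L(1) L_right_projective L'(2)]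
        tensor_flat_left[OF L'(3) bL L_left_projective[OF assms(2,3)] bL' bP' bL'])+)
  have i0: "bimod_iso B B (regular_bimodule B) (tensor A ?W (L 0))"
    unfolding L(6) using bimod_iso_trans[OF E(2) bimod_iso_sym[OF tensor_epi_E[OF E(3)] bim_tensor[OF bW bL[of 0, unfolded L(6)]]]] .
  have Wm: "fbim (tensor A ?W (L m)) K B B" by (rule fbim_tensor[OF fW L(1)])
  have "bimod_iso B A ?W (L' 0)" unfolding L'(5) by (rule iso_rst[OF E(2) alg_homs(2,4)])
  then have "bimod_iso B B (tensor A ?W (L m)) (tensor A (L' 0) (L m))" by (rule tensor_iso1[OF bW bL' bL])
  then have i1: "bimod_iso B B (enc B (tensor A ?W (L m))) (tensor A (L' 0) (L m))"
    using bimod_iso_trans[OF bimod_iso_sym[OF fbim.enc_iso[OF Wm] fbim_bim[OF Wm]]] by blast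
  have "is_syzygy K B B (m + m) (regular_bimodule B) (enc B ?T)"
    by (rule is_syzygy_trans[OF fd_algebras(2,2) is_syzygy_iso_source[OF fd_algebras(2,2) i0 1] is_syzygy_iso_source[OF fd_algebras(2,2) i1 2]])
  moreover have "stably_iso K B B ?T (enc B ?T)"
    by (rule stab_stably_iso[OF stab_refl[OF fd_algebras(2,2) fbim_bim[OF fbim.enc_fbim[OF T]]] fbim.enc_iso[OF T] T fbim.enc_fbim[OF T] fbim.enc_fbim[OF T]])
  ultimately show ?thesis by blast
qed

end

theorem theorem3p6:
  fixes K :: "('k, 'z) ring_scheme" and A :: "('k, 'a) module" and J :: "'a set"
  assumes "field K" and "fd_algebra K A"
    and "homological_ideal A J"
    and "finite_proj_dim_bimodule K A A (ideal_bimodule A J)"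
  shows "sing_equiv_morita_level K A (quotient_algebra A J)"
proof -
  have "ideal J A" using assms(3) by (simp add: homological_ideal_def)
  then interpret algebra_ideal K A J using assms(2) by (simp add: algebra_ideal_def)
  obtain p and Y :: "('a, 'a, 'k vec) bimodule" where "is_syzygy K A A p (ideal_bimodule A J) Y" and Y: "pbim Y K A A"
    using finite_proj_dim_syzygy[OF assms(4) fbim_ideal] by blast
  then have Y': "is_syzygy K A A p I Y"
    using is_syzygy_iso_source[OF fd_algebras(1,1) bimod_iso_sym[OF fbim.enc_iso[OF fbim_ideal] fbim_bim[OF fbim_ideal]]] by blast
  let ?M = "L (Suc p)" and ?N = "L' (Suc p)"
  have "bimodule K A B ?M" "bimodule K B A ?N" using bL bL' bim_iff by blast+
  moreover have "fg_projective A ?M" by (rule fg_projective_left[OF L(1) L_left_projective[OF Y' Y]])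
  moreover have "fg_projective (opposite B) (right_module ?M)" by (rule fg_projective_right[OF L(1) L_right_projective])
  moreover have "fg_projective B ?N" by (rule fg_projective_left[OF L'(1) L'_left_projective])
  moreover have "fg_projective (opposite A) (right_module ?N)" by (rule fg_projective_right[OF L'(1) L'_right_projective[OF Y' Y]])
  ultimately show ?thesis
    unfolding sing_equiv_morita_level_def using bimodule_side_A[OF Y' Y] bimodule_side_B[OF assms(3) Y' Y] by blast
qed


end
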